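(* Let $N\ge 3$ and $\lambda\le \frac{N(N-2)}{4}$. Then the equation $$-\Delta_{\mathbb{B}^N}u-\lambda u=|u|^{2^*-2}u,\qquad u\in H^1(\mathbb{B}^N),$$ has no nontrivial (weak) solution.
   Context: $\mathbb{B}^N=\{x\in\mathbb{R}^N:|x|<1\}$ with the hyperbolic metric $g_{ij}=\left(\frac{2}{1-|x|^2}\right)^2\delta_{ij}$; hyperbolic volume $dV_{\mathbb{B}^N}=\left(\frac{2}{1-|x|^2}\right)^N dx$; hyperbolic gradient $\nabla_{\mathbb{B}^N}u=\left(\frac{1-|x|^2}{2}\right)^2\nabla u$, so that $|\nabla_{\mathbb{B}^N}u|_g^2=\left(\frac{1-|x|^2}{2}\right)^2|\nabla u|^2$; Laplace–Beltrami operator $\Delta_{\mathbb{B}^N}u=\left(\frac{1-|x|^2}{2}\right)^2\Delta u+(N-2)\frac{1-|x|^2}{2}\,x\cdot\nabla u$. $H^1(\mathbb{B}^N)$ is the completion of $C_c^\infty(\mathbb{B}^N)$ under the norm $\left(\int_{\mathbb{B}^N}(|\nabla_{\mathbb{B}^N}u|_g^2+u^2)\,dV_{\mathbb{B}^N}\right)^{1/2}$. $2^*=\frac{2N}{N-2}$. A weak solution $u\in H^1(\mathbb{B}^N)$ satisfies $\int_{\mathbb{B}^N}\langle\nabla_{\mathbb{B}^N}u,\nabla_{\mathbb{B}^N}\varphi\rangle_g\,dV_{\mathbb{B}^N}-\lambda\int_{\mathbb{B}^N}u\varphi\,dV_{\mathbb{B}^N}=\int_{\mathbb{B}^N}|u|^{2^*-2}u\varphi\,dV_{\mathbb{B}^N}$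 for all $\varphi\in C_c^\infty(\mathbb{B}^N)$. *)

theory Defs
  imports "HOL-Analysis.Analysis"
begin

fun iter_pd :: "'a::euclidean_space list \<Rightarrow> ('a \<Rightarrow> real) \<Rightarrow> 'a \<Rightarrow> real" where
  "iter_pd [] f = f"
| "iter_pd (b # bs) f = (\<lambda>x. frechet_derivative (iter_pd bs f) (at x) b)"

definition smooth_fun :: "('a::euclidean_space \<Rightarrow> real) \<Rightarrow> bool" where
  "smooth_fun f \<longleftrightarrow> (\<forall>bs. set bs \<subseteq> Basis \<longrightarrow> (\<forall>x. iter_pd bs f differentiable (at x)))"

definition test_fun :: "('a::euclidean_space \<Rightarrow> real) \<Rightarrow> bool" where
  "test_fun f \<longleftrightarrow> smooth_fun f \<and>
     (\<exists>K. compact K \<and> K \<subseteq> ball 0 1 \<and> (\<forall>x. x \<notin> K \<longrightarrow> f x = 0))"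

definition egrad :: "('a::euclidean_space \<Rightarrow> real) \<Rightarrow> 'a \<Rightarrow> 'a" where
  "egrad f x = (\<Sum>b\<in>Basis. frechet_derivative f (at x) b *\<^sub>R b)"

definition conf :: "'a::euclidean_space \<Rightarrow> real" where
  "conf x = (1 - (norm x)\<^sup>2) / 2"

definition hyp_vol :: "'a::euclidean_space measure" where
  "hyp_vol = density (restrict_space lebesgue (ball 0 1))
                     (\<lambda>x. ennreal ((2 / (1 - (norm x)\<^sup>2)) ^ DIM('a)))"

text \<open>u belongs to H^1(B^N) with (Euclidean) weak gradient G: u is the limit in the
  H^1(B^N) norm of test functions, whose Euclidean gradients converge to G.
  Note |grad_B phi - grad_B u|_g^2 = conf^2 |grad phi - G|^2.\<close>
definition H1_with_grad :: "('a::euclidean_space \<Rightarrow> real) \<Rightarrow> ('a \<Rightarrow> 'a) \<Rightarrow> bool" where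
  "H1_with_grad u G \<longleftrightarrow> u \<in> borel_measurable lebesgue \<and> G \<in> borel_measurable lebesgue \<and>
     (\<exists>\<phi> :: nat \<Rightarrow> 'a \<Rightarrow> real. (\<forall>k. test_fun (\<phi> k)) \<and>
        ((\<lambda>k. \<integral>\<^sup>+ x. ennreal ((conf x)\<^sup>2 * (norm (egrad (\<phi> k) x - G x))\<^sup>2
                                  + (\<phi> k x - u x)\<^sup>2) \<partial>hyp_vol) \<longlonglongrightarrow> 0))"

definition crit_exp :: "nat \<Rightarrow> real" where
  "crit_exp N = 2 * real N / (real N - 2)"

definition weak_solution :: "real \<Rightarrow> ('a::euclidean_space \<Rightarrow> real) \<Rightarrow> ('a \<Rightarrow> 'a) \<Rightarrow> bool" where
  "weak_solution lam u G \<longleftrightarrow> H1_with_grad u G \<and>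
     (\<forall>\<phi>. test_fun \<phi> \<longrightarrow>
        (\<integral>x. (conf x)\<^sup>2 * (G x \<bullet> egrad \<phi> x) \<partial>hyp_vol) - lam * (\<integral>x. u x * \<phi> x \<partial>hyp_vol)
        = (\<integral>x. \<bar>u x\<bar> powr (crit_exp DIM('a) - 2) * u x * \<phi> x \<partial>hyp_vol))"

end

theory Submission
  imports Defs
begin

text \<open>
  Write N for the dimension, p for the critical exponent and \<open>a = (N - 2) / 2\<close>. The function
  \<open>v = conf\<^sup>-\<^sup>a u\<close> lies in the closure of the test functions of the unit ball in the Dirichlet norm,
  has a gradient F, and solves \<open>- \<Delta>v + m conf\<^sup>-\<^sup>2 v = |v|\<^sup>p\<^sup>-\<^sup>2 v\<close> with \<open>m = N (N - 2) / 4 - \<lambda> \<ge> 0\<close>.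

  A Pohozaev argument that needs no regularity: for \<open>s \<ge> 1\<close> the dilate \<open>w(x) = s\<^sup>a v(s x)\<close> is an
  admissible test function with the Dirichlet and \<open>L\<^sup>p\<close> norms of v. Testing with \<open>v - w\<close> gives
  \<open>\<parallel>F - F\<^sub>s\<parallel>\<^sup>2 / 2 + m \<integral> conf\<^sup>-\<^sup>2 v (v - w) = \<integral> |v|\<^sup>p\<^sup>-\<^sup>2 v (v - w)\<close>, where \<open>F\<^sub>s\<close> is the gradient of w. As
  v and w have the same \<open>L\<^sup>p\<close> norm, the right-hand side is at most
  \<open>\<integral> (|v|\<^sup>p\<^sup>-\<^sup>2 v - |w|\<^sup>p\<^sup>-\<^sup>2 w) (v - w)\<close>; since \<open>|v|\<^sup>p\<^sup>-\<^sup>2 \<in> L\<^sup>N\<^sup>/\<^sup>2\<close>, this is bounded by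
  \<open>\<parallel>F - F\<^sub>s\<parallel>\<^sup>2 / 4 + C \<parallel>v - w\<parallel>\<^sup>2\<close> with \<open>\<parallel>v - w\<parallel> = O(s - 1)\<close>. The term with m is at least
  \<open>c m (s - 1) \<integral> conf\<^sup>-\<^sup>2 v\<^sup>2\<close>, so \<open>s \<rightarrow> 1\<close> forces \<open>v = 0\<close> if \<open>m > 0\<close>.

  If \<open>m = 0\<close>, the estimate becomes \<open>\<parallel>F - F\<^sub>s\<parallel> = O(s - 1)\<close>. As \<open>F\<^sub>s\<close> vanishes where \<open>|x| > 1 / s\<close>, the
  gradient is so small near the sphere that v, extended by zero, solves the equation on the whole
  space. Brezis-Kato truncation gives v all the integrability needed, and a Carleman estimate with the
  linear weight \<open>exp (\<tau> x\<cdot>e)\<close>, applied to the compactly supported v, shows \<open>v = 0\<close>.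
\<close>


subsection \<open>Square-integrable functions\<close>

text \<open>The bound on \<lambda> is a sign condition: for \<open>u = conf powr a * v\<close> the
  hyperbolic Dirichlet form becomes the Euclidean one plus N (N - 2) / 4 times the form with weight
  1 / conf^2, and subtracting \<lambda> leaves m. The obstacle is that v is only a limit of test
  functions: the classical multiplier x \<bullet> grad v is not admissible, boundary integrals have
  no meaning, and the weight is singular at the sphere. A dilate with s \<ge> 1 is admissible since
  the ball is star-shaped, and the weight grows along rays, which gives the mass term its sign. For
  m = 0 this only shows, formally, that the normal derivative vanishes at the sphere, so unique
  continuation has to finish. Since the extended v has compact support, no singular weight is
  needed: with a linear weight the conjugated operator has constant coefficients, and the decisive
  multiplier is a difference of translates. The price is a nonlinear term in L^2 and a potential
  |v|^(2 (p - 2)) in L^(N / 2), which critical growth alone does not supply.\<close>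

definition sqint :: "('a::euclidean_space \<Rightarrow> 'b::euclidean_space) \<Rightarrow> bool" where
  "sqint f \<longleftrightarrow> f \<in> borel_measurable lborel \<and> integrable lborel (\<lambda>x. (norm (f x))\<^sup>2)"

definition sqn :: "('a::euclidean_space \<Rightarrow> 'b::euclidean_space) \<Rightarrow> real" where
  "sqn f = (\<integral>x. (norm (f x))\<^sup>2 \<partial>lborel)"

lemma sqint_measurable [measurable_dest]: "sqint f \<Longrightarrow> f \<in> borel_measurable borel"
  by (simp add: sqint_def)

lemma sqint_integrable: "sqint f \<Longrightarrow> integrable lborel (\<lambda>x. (norm (f x))\<^sup>2)"
  by (simp add: sqint_def)

lemma sqn_nonneg [simp]: "0 \<le> sqn f"
  by (simp add: sqn_def)

lemma sqint_bound:
  fixes f :: "'a::euclidean_space \<Rightarrow> 'b::euclidean_space" and g :: "'a \<Rightarrow> 'c::euclidean_space"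
  assumes "sqint f" "g \<in> borel_measurable borel" "\<And>x. norm (g x) \<le> C * norm (f x)"
  shows "sqint g" "sqn g \<le> C\<^sup>2 * sqn f"
proof -
  have b: "(norm (g x))\<^sup>2 \<le> C\<^sup>2 * (norm (f x))\<^sup>2" for x
    using power_mono[OF assms(3)[of x] norm_ge_zero, of 2] by (simp add: power_mult_distrib)
  have i: "integrable lborel (\<lambda>x. C\<^sup>2 * (norm (f x))\<^sup>2)"
    using sqint_integrable[OF assms(1)] by simp
  show g: "sqint g"
    unfolding sqint_def
  proof
    show "g \<in> borel_measurable lborel" using assms(2) by simp
    show "integrable lborel (\<lambda>x. (norm (g x))\<^sup>2)"
    proof (rule Bochner_Integration.integrable_bound[OF i])
      show "(\<lambda>x. (norm (g x))\<^sup>2) \<in> borel_measurable lborel" using assms(2) by measurable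
    qed (use b in \<open>auto intro!: AE_I2 simp: abs_mult\<close>)
  qed
  show "sqn g \<le> C\<^sup>2 * sqn f"
    unfolding sqn_def using integral_mono[OF sqint_integrable[OF g] i] b by simp
qed

lemma sqint_scaleR: "sqint f \<Longrightarrow> sqint (\<lambda>x. c *\<^sub>R f x)"
  and sqn_scaleR: "sqn (\<lambda>x. c *\<^sub>R f x) = c\<^sup>2 * sqn f"
  by (auto simp: sqint_def sqn_def power_mult_distrib)

lemma sqint_cmult: "sqint f \<Longrightarrow> sqint (\<lambda>x. c * f x)"
  and sqn_cmult: "sqn (\<lambda>x. c * f x) = c\<^sup>2 * sqn (f :: _ \<Rightarrow> real)"
  by (auto simp: sqint_def sqn_def power_mult_distrib)

lemma norm_add_sq_le: "(norm (x + y :: 'b::euclidean_space))\<^sup>2 \<le> 2 * (norm x)\<^sup>2 + 2 * (norm y)\<^sup>2"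
proof -
  have "(norm (x + y))\<^sup>2 \<le> (norm x + norm y)\<^sup>2"
    by (intro power_mono norm_triangle_ineq) auto
  also have "\<dots> \<le> 2 * (norm x)\<^sup>2 + 2 * (norm y)\<^sup>2"
    using sum_squares_bound[of "norm x" "norm y"] by (simp add: power2_sum)
  finally show ?thesis .
qed

lemma sqint_add:
  assumes "sqint f" "sqint g"
  shows "sqint (\<lambda>x. f x + g x)" "sqn (\<lambda>x. f x + g x) \<le> 2 * sqn f + 2 * sqn g"
proof -
  have [measurable]: "f \<in> borel_measurable borel" "g \<in> borel_measurable borel"
    using assms by (auto simp: sqint_def)
  have i: "integrable lborel (\<lambda>x. 2 * (norm (f x))\<^sup>2 + 2 * (norm (g x))\<^sup>2)"
    using assms by (auto simp: sqint_def)
  have j: "integrable lborel (\<lambda>x. (norm (f x + g x))\<^sup>2)"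
    by (rule Bochner_Integration.integrable_bound[OF i]) (use norm_add_sq_le in \<open>auto intro!: AE_I2\<close>)
  then show "sqint (\<lambda>x. f x + g x)" by (simp add: sqint_def)
  have "sqn (\<lambda>x. f x + g x) \<le> (\<integral>x. 2 * (norm (f x))\<^sup>2 + 2 * (norm (g x))\<^sup>2 \<partial>lborel)"
    unfolding sqn_def by (rule integral_mono[OF j i]) (rule norm_add_sq_le)
  also have "\<dots> = 2 * sqn f + 2 * sqn g"
    using assms by (auto simp: sqint_def sqn_def)
  finally show "sqn (\<lambda>x. f x + g x) \<le> 2 * sqn f + 2 * sqn g" .
qed

lemma sqint_minus: "sqint f \<Longrightarrow> sqint (\<lambda>x. - f x)" and sqn_minus: "sqn (\<lambda>x. - f x) = sqn f"
  by (auto simp: sqint_def sqn_def)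

lemma sqn_commute: "sqn (\<lambda>x. f x - g x) = sqn (\<lambda>x. g x - f x)"
  by (simp add: sqn_def norm_minus_commute)

lemma sqint_diff:
  assumes "sqint f" "sqint g"
  shows "sqint (\<lambda>x. f x - g x)" "sqn (\<lambda>x. f x - g x) \<le> 2 * sqn f + 2 * sqn g"
  using sqint_add[OF assms(1) sqint_minus[OF assms(2)]] by (auto simp: sqn_minus)

lemma sqint_inner:
  assumes "sqint f" "sqint g"
  shows "integrable lborel (\<lambda>x. f x \<bullet> g x)"
proof -
  have [measurable]: "f \<in> borel_measurable borel" "g \<in> borel_measurable borel"
    using assms by (auto simp: sqint_def)
  have i: "integrable lborel (\<lambda>x. (norm (f x))\<^sup>2 + (norm (g x))\<^sup>2)"
    using assms by (auto simp: sqint_def)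
  show ?thesis
  proof (rule Bochner_Integration.integrable_bound[OF i])
    show "AE x in lborel. norm (f x \<bullet> g x) \<le> norm ((norm (f x))\<^sup>2 + (norm (g x))\<^sup>2)"
    proof (rule AE_I2)
      fix x
      have "\<bar>f x \<bullet> g x\<bar> \<le> norm (f x) * norm (g x)" by (rule Cauchy_Schwarz_ineq2)
      moreover have "2 * (norm (f x) * norm (g x)) \<le> (norm (f x))\<^sup>2 + (norm (g x))\<^sup>2"
        using sum_squares_bound[of "norm (f x)" "norm (g x)"] by simp
      moreover have "0 \<le> norm (f x) * norm (g x)" by simp
      ultimately have "\<bar>f x \<bullet> g x\<bar> \<le> (norm (f x))\<^sup>2 + (norm (g x))\<^sup>2" by linarith
      then show "norm (f x \<bullet> g x) \<le> norm ((norm (f x))\<^sup>2 + (norm (g x))\<^sup>2)" by simp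
    qed
  qed simp
qed

lemma sqint_mult:
  fixes f g :: "'a::euclidean_space \<Rightarrow> real"
  shows "sqint f \<Longrightarrow> sqint g \<Longrightarrow> integrable lborel (\<lambda>x. f x * g x)"
  using sqint_inner[of f g] by simp

lemma sqn_diff_eq:
  assumes "sqint f" "sqint g"
  shows "sqn (\<lambda>x. f x - g x) = sqn f - 2 * (\<integral>x. f x \<bullet> g x \<partial>lborel) + sqn g"
proof -
  have "sqn (\<lambda>x. f x - g x) = (\<integral>x. (norm (f x))\<^sup>2 - 2 * (f x \<bullet> g x) + (norm (g x))\<^sup>2 \<partial>lborel)"
    unfolding sqn_def
    by (rule Bochner_Integration.integral_cong) (auto simp: power2_norm_eq_inner algebra_simps inner_commute)
  also have "\<dots> = sqn f - 2 * (\<integral>x. f x \<bullet> g x \<partial>lborel) + sqn g"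
    using sqint_inner[OF assms] assms by (simp add: sqint_def sqn_def)
  finally show ?thesis .
qed

text \<open>The squared norm of \<open>f - t *\<^sub>R g\<close> is a quadratic polynomial in t that
  is never negative; the inequality is the sign of its discriminant.\<close>

lemma integral_inner_sq_le:
  assumes f: "sqint f" and g: "sqint g"
  shows "(\<integral>x. f x \<bullet> g x \<partial>lborel)\<^sup>2 \<le> sqn f * sqn g"
proof -
  define I where "I = (\<integral>x. f x \<bullet> g x \<partial>lborel)"
  have q: "0 \<le> sqn f - 2 * t * I + t\<^sup>2 * sqn g" for t
  proof -
    have "0 \<le> sqn (\<lambda>x. f x - t *\<^sub>R g x)" by simp
    also have "\<dots> = sqn f - 2 * (t * I) + t\<^sup>2 * sqn g"
      using sqn_diff_eq[OF f sqint_scaleR[OF g]] by (simp add: sqn_scaleR I_def)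
    finally show ?thesis by (simp add: algebra_simps)
  qed
  show ?thesis
  proof (cases "sqn g = 0")
    case True
    have "I = 0"
    proof (rule ccontr)
      assume "I \<noteq> 0"
      \<comment> \<open>For \<open>sqn g = 0\<close> the polynomial is affine in t; at this t it
        would take the value -1.\<close>
      with q[of "(sqn f + 1) / (2 * I)"] True show False by (simp add: field_simps)
    qed
    then show ?thesis using True by (simp add: I_def)
  next
    case False
    then have gp: "sqn g > 0" using sqn_nonneg[of g] by linarith
    have "0 \<le> sqn f - I\<^sup>2 / sqn g"
      using q[of "I / sqn g"] gp by (simp add: power2_eq_square field_simps)
    then show ?thesis using gp by (simp add: I_def field_simps)
  qed
qed

lemma integral_inner_le:
  assumes "sqint f" "sqint g"
  shows "\<bar>\<integral>x. f x \<bullet> g x \<partial>lborel\<bar> \<le> sqrt (sqn f) * sqrt (sqn g)"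
  using real_sqrt_le_mono[OF integral_inner_sq_le[OF assms]] by (simp add: real_sqrt_mult)

lemma tendsto_integral_inner:
  assumes "sqint f" "sqint g" "\<And>k. sqint (fs k)" "\<And>k. sqint (gs k)"
    and "(\<lambda>k. sqn (\<lambda>x. fs k x - f x)) \<longlonglongrightarrow> 0" "(\<lambda>k. sqn (\<lambda>x. gs k x - g x)) \<longlonglongrightarrow> 0"
  shows "(\<lambda>k. \<integral>x. fs k x \<bullet> gs k x \<partial>lborel) \<longlonglongrightarrow> (\<integral>x. f x \<bullet> g x \<partial>lborel)"
proof -
  let ?a = "\<lambda>k. sqrt (sqn (\<lambda>x. fs k x - f x))" and ?b = "\<lambda>k. sqrt (sqn (\<lambda>x. gs k x - g x))"
  have a: "?a \<longlonglongrightarrow> 0" using tendsto_real_sqrt[OF assms(5)] by simp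
  have b: "?b \<longlonglongrightarrow> 0" using tendsto_real_sqrt[OF assms(6)] by simp
  note df = sqint_diff(1)[OF assms(3) assms(1)] and dg = sqint_diff(1)[OF assms(4) assms(2)]
  have e: "(\<integral>x. fs k x \<bullet> gs k x \<partial>lborel) - (\<integral>x. f x \<bullet> g x \<partial>lborel)
     = (\<integral>x. (fs k x - f x) \<bullet> (gs k x - g x) \<partial>lborel) + (\<integral>x. f x \<bullet> (gs k x - g x) \<partial>lborel)
       + (\<integral>x. (fs k x - f x) \<bullet> g x \<partial>lborel)" for k
    using sqint_inner[OF assms(1,2)] sqint_inner[OF assms(3,4)] sqint_inner[OF assms(1,4)]
      sqint_inner[OF assms(3,2)]
    by (simp add: inner_diff_left inner_diff_right)
  have "(\<lambda>k. (\<integral>x. fs k x \<bullet> gs k x \<partial>lborel) - (\<integral>x. f x \<bullet> g x \<partial>lborel)) \<longlonglongrightarrow> 0"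
  proof (rule Lim_null_comparison)
    show "\<forall>\<^sub>F k in sequentially. norm ((\<integral>x. fs k x \<bullet> gs k x \<partial>lborel) - (\<integral>x. f x \<bullet> g x \<partial>lborel))
        \<le> ?a k * ?b k + sqrt (sqn f) * ?b k + ?a k * sqrt (sqn g)"
    proof (rule always_eventually, rule allI)
      fix k
      show "norm ((\<integral>x. fs k x \<bullet> gs k x \<partial>lborel) - (\<integral>x. f x \<bullet> g x \<partial>lborel))
        \<le> ?a k * ?b k + sqrt (sqn f) * ?b k + ?a k * sqrt (sqn g)"
        unfolding e using integral_inner_le[OF df[of k] dg[of k]] integral_inner_le[OF assms(1) dg[of k]]
          integral_inner_le[OF df[of k] assms(2)] unfolding real_norm_def by linarith
    qed
    have "(\<lambda>k. ?a k * ?b k + sqrt (sqn f) * ?b k + ?a k * sqrt (sqn g)) \<longlonglongrightarrow> 0 * 0 + sqrt (sqn f) * 0 + 0 * sqrt (sqn g)"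
      by (intro tendsto_intros a b)
    then show "(\<lambda>k. ?a k * ?b k + sqrt (sqn f) * ?b k + ?a k * sqrt (sqn g)) \<longlonglongrightarrow> 0" by simp
  qed
  then show ?thesis by (simp add: LIM_zero_iff)
qed

lemma sqn_inner: "sqn f = (\<integral>x. f x \<bullet> f x \<partial>lborel)"
  by (simp add: sqn_def power2_norm_eq_inner)

lemma tendsto_sqn:
  assumes "sqint f" "\<And>k. sqint (fs k)" "(\<lambda>k. sqn (\<lambda>x. fs k x - f x)) \<longlonglongrightarrow> 0"
  shows "(\<lambda>k. sqn (fs k)) \<longlonglongrightarrow> sqn f"
  unfolding sqn_inner[of f] sqn_inner[of "fs _"]
  using tendsto_integral_inner[OF assms(1,1,2,2,3,3)] .

lemma nn_integral_sq:
  assumes "sqint f"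
  shows "(\<integral>\<^sup>+x. ennreal ((norm (f x))\<^sup>2) \<partial>lborel) = ennreal (sqn f)"
  unfolding sqn_def using sqint_integrable[OF assms] by (intro nn_integral_eq_integral) auto

lemma sqintI_nn:
  assumes "f \<in> borel_measurable borel" "(\<integral>\<^sup>+x. ennreal ((norm (f x))\<^sup>2) \<partial>lborel) < \<infinity>"
  shows "sqint f"
  unfolding sqint_def using assms by (auto intro!: integrableI_bounded)

lemma sqn_eq_0_AE:
  assumes "sqint f" "sqn f = 0"
  shows "AE x in lborel. f x = 0"
proof -
  have "AE x in lborel. (norm (f x))\<^sup>2 = 0"
    using integral_nonneg_eq_0_iff_AE[OF sqint_integrable[OF assms(1)]] assms(2) by (simp add: sqn_def)
  then show ?thesis by simp
qed

subsection \<open>Affine changes of variables\<close>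

lemma nn_integral_affine:
  fixes f :: "'a::euclidean_space \<Rightarrow> ennreal" and t :: 'a
  assumes [measurable]: "f \<in> borel_measurable borel" and "c > 0"
  shows "(\<integral>\<^sup>+x. f (t + c *\<^sub>R x) \<partial>lborel) = ennreal (1 / c ^ DIM('a)) * (\<integral>\<^sup>+x. f x \<partial>lborel)"
proof -
  have "(\<integral>\<^sup>+x. f x \<partial>lborel) = (\<integral>\<^sup>+x. f x \<partial>(density (distr lborel borel (\<lambda>x. t + c *\<^sub>R x)) (\<lambda>_. \<bar>c\<bar> ^ DIM('a))))"
    using lborel_affine[of c t] assms(2) by simp
  also have "\<dots> = ennreal (c ^ DIM('a)) * (\<integral>\<^sup>+x. f (t + c *\<^sub>R x) \<partial>lborel)"
    using assms(2) by (subst nn_integral_density; (subst nn_integral_distr)?) (auto simp: nn_integral_cmult)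
  finally have "ennreal (1 / c ^ DIM('a)) * (\<integral>\<^sup>+x. f x \<partial>lborel)
      = ennreal (1 / c ^ DIM('a)) * ennreal (c ^ DIM('a)) * (\<integral>\<^sup>+x. f (t + c *\<^sub>R x) \<partial>lborel)"
    by (simp add: mult.assoc)
  also have "ennreal (1 / c ^ DIM('a)) * ennreal (c ^ DIM('a)) = 1"
    using assms(2) by (subst ennreal_mult[symmetric]) auto
  finally show ?thesis by simp
qed

lemma
  fixes f :: "'a::euclidean_space \<Rightarrow> real" and t :: 'a
  assumes f: "integrable lborel f" and c: "c > 0"
  shows integrable_affine: "integrable lborel (\<lambda>x. f (t + c *\<^sub>R x))"
    and integral_affine: "(\<integral>x. f (t + c *\<^sub>R x) \<partial>lborel) = (\<integral>x. f x \<partial>lborel) / c ^ DIM('a)"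
proof -
  have [measurable]: "f \<in> borel_measurable borel" using f by auto
  have eq: "lborel = density (distr lborel borel (\<lambda>x::'a. t + c *\<^sub>R x)) (\<lambda>_. ennreal (c ^ DIM('a)))"
    using lborel_affine[of c t] c by simp
  have f2: "integrable (density (distr lborel borel (\<lambda>x::'a. t + c *\<^sub>R x)) (\<lambda>_. ennreal (c ^ DIM('a)))) f"
    using f eq by metis
  then have "integrable lborel (\<lambda>x. c ^ DIM('a) *\<^sub>R f (t + c *\<^sub>R x))"
    using c by (subst (asm) integrable_density; (subst (asm) integrable_distr_eq)?) auto
  then show "integrable lborel (\<lambda>x. f (t + c *\<^sub>R x))" using c by simp
  have "(\<integral>x. f x \<partial>lborel) = (\<integral>x. f x \<partial>density (distr lborel borel (\<lambda>x::'a. t + c *\<^sub>R x)) (\<lambda>_. ennreal (c ^ DIM('a))))"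
    using eq by metis
  also have "\<dots> = c ^ DIM('a) * (\<integral>x. f (t + c *\<^sub>R x) \<partial>lborel)"
    using c by (subst integral_density; (subst integral_distr)?) auto
  finally show "(\<integral>x. f (t + c *\<^sub>R x) \<partial>lborel) = (\<integral>x. f x \<partial>lborel) / c ^ DIM('a)"
    using c by (simp add: field_simps)
qed

lemma sqint_affine:
  fixes f :: "'a::euclidean_space \<Rightarrow> 'b::euclidean_space" and t :: 'a
  assumes "sqint f" "c > 0"
  shows "sqint (\<lambda>x. f (t + c *\<^sub>R x))" "sqn (\<lambda>x. f (t + c *\<^sub>R x)) = sqn f / c ^ DIM('a)"
proof -
  have [measurable]: "f \<in> borel_measurable borel" using assms(1) by (auto simp: sqint_def)
  show "sqint (\<lambda>x. f (t + c *\<^sub>R x))"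
    using integrable_affine[OF sqint_integrable[OF assms(1)] assms(2)] by (simp add: sqint_def)
  show "sqn (\<lambda>x. f (t + c *\<^sub>R x)) = sqn f / c ^ DIM('a)"
    using integral_affine[OF sqint_integrable[OF assms(1)] assms(2)] by (simp add: sqn_def)
qed

subsection \<open>Continuously differentiable functions of compact support\<close>

text \<open>One continuous derivative is enough for everything below and keeps the class closed
  under composition with functions that are only C^1, such as \<open>step_fun\<close>. The compact
  support inside \<open>U\<close> admits factors that blow up at the boundary of
  \<open>U\<close>.\<close>

definition C1c :: "'a::euclidean_space set \<Rightarrow> ('a \<Rightarrow> real) \<Rightarrow> bool" where
  "C1c U f \<longleftrightarrow> (\<forall>x. (f has_derivative (\<lambda>h. egrad f x \<bullet> h)) (at x)) \<and> continuous_on UNIV (egrad f) \<and>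
     (\<exists>K. compact K \<and> K \<subseteq> U \<and> (\<forall>x. x \<notin> K \<longrightarrow> f x = 0))"

lemma egrad_eqI:
  assumes "(f has_derivative (\<lambda>h. g \<bullet> h)) (at x)"
  shows "egrad f x = g"
proof -
  have "frechet_derivative f (at x) = (\<lambda>h. g \<bullet> h)"
    using frechet_derivative_at[OF assms] by simp
  then show ?thesis
    by (simp add: egrad_def euclidean_representation)
qed

lemma has_derivative_egrad:
  assumes "f differentiable (at x)"
  shows "(f has_derivative (\<lambda>h. egrad f x \<bullet> h)) (at x)"
proof -
  have d: "(f has_derivative frechet_derivative f (at x)) (at x)"
    using assms frechet_derivative_works by blast
  then interpret bounded_linear "frechet_derivative f (at x)" by (rule has_derivative_bounded_linear)
  have "frechet_derivative f (at x) h = egrad f x \<bullet> h" for h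
  proof -
    have "frechet_derivative f (at x) h = frechet_derivative f (at x) (\<Sum>b\<in>Basis. (h \<bullet> b) *\<^sub>R b)"
      by (simp add: euclidean_representation)
    also have "\<dots> = egrad f x \<bullet> h"
      by (simp add: sum scaleR egrad_def inner_sum_left inner_commute[of h] mult.commute)
    finally show ?thesis .
  qed
  then have "frechet_derivative f (at x) = (\<lambda>h. egrad f x \<bullet> h)" by (rule ext)
  then show ?thesis using d by simp
qed

lemma C1cI:
  assumes "\<And>x. (f has_derivative (\<lambda>h. g x \<bullet> h)) (at x)" "continuous_on UNIV g"
    and "compact K" "K \<subseteq> U" "\<And>x. x \<notin> K \<Longrightarrow> f x = 0"
  shows "C1c U f" "egrad f x = g x"
proof -
  show e: "egrad f x = g x" for x using egrad_eqI[OF assms(1)] .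
  then have e': "egrad f = g" by auto
  show "C1c U f" unfolding C1c_def e' using assms by auto
qed

lemma C1c_mono: "C1c U f \<Longrightarrow> U \<subseteq> V \<Longrightarrow> C1c V f"
  unfolding C1c_def by blast

lemma C1c_derivative: "C1c U f \<Longrightarrow> (f has_derivative (\<lambda>h. egrad f x \<bullet> h)) (at x)"
  by (simp add: C1c_def)

lemma C1c_cont: "C1c U f \<Longrightarrow> continuous_on UNIV f"
  by (meson C1c_derivative has_derivative_continuous continuous_at_imp_continuous_on)

lemma C1c_cont_egrad: "C1c U f \<Longrightarrow> continuous_on UNIV (egrad f)"
  by (simp add: C1c_def)

lemma C1c_measurable [measurable_dest]:
  assumes "C1c U f" shows "f \<in> borel_measurable borel" "egrad f \<in> borel_measurable borel"
  using C1c_cont[OF assms] C1c_cont_egrad[OF assms] by (auto intro: borel_measurable_continuous_onI)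

lemma C1c_support:
  assumes "C1c U f"
  obtains K where "compact K" "K \<subseteq> U" "\<And>x. x \<notin> K \<Longrightarrow> f x = 0" "\<And>x. x \<notin> K \<Longrightarrow> egrad f x = 0"
proof -
  obtain K where K: "compact K" "K \<subseteq> U" "\<And>x. x \<notin> K \<Longrightarrow> f x = 0"
    using assms by (auto simp: C1c_def)
  have "egrad f x = 0" if "x \<notin> K" for x
  proof (rule egrad_eqI)
    have op: "open (- K)" using K(1) by (simp add: compact_imp_closed open_Compl)
    have "((\<lambda>x. 0) has_derivative (\<lambda>h. 0)) (at x)" by simp
    then have "(f has_derivative (\<lambda>h. 0)) (at x)"
      by (rule has_derivative_transform_within_open[OF _ op]) (use that K(3) in auto)
    then show "(f has_derivative (\<lambda>h. 0 \<bullet> h)) (at x)" by simp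
  qed
  with K that show ?thesis by blast
qed

lemma continuous_compact_support:
  fixes g :: "'a::euclidean_space \<Rightarrow> 'b::euclidean_space"
  assumes "continuous_on UNIV g" "compact K" "\<And>x. x \<notin> K \<Longrightarrow> g x = 0"
  shows "integrable lborel g" "sqint g" "\<exists>B\<ge>0. \<forall>x. norm (g x) \<le> B"
proof -
  have cg: "continuous_on K g" using assms(1) continuous_on_subset by blast
  have "integrable lborel (\<lambda>x. indicator K x *\<^sub>R g x)"
    by (rule borel_integrable_compact[OF assms(2) cg])
  also have "(\<lambda>x. indicator K x *\<^sub>R g x) = g" using assms(3) by (auto simp: indicator_def fun_eq_iff)
  finally show "integrable lborel g" .
  have "integrable lborel (\<lambda>x. indicator K x *\<^sub>R (norm (g x))\<^sup>2)"
    by (rule borel_integrable_compact[OF assms(2)]) (intro continuous_intros cg)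
  also have "(\<lambda>x. indicator K x *\<^sub>R (norm (g x))\<^sup>2) = (\<lambda>x. (norm (g x))\<^sup>2)"
    using assms(3) by (auto simp: indicator_def fun_eq_iff)
  finally show "sqint g"
    unfolding sqint_def using assms(1) by (auto intro: borel_measurable_continuous_onI)
  have "bounded (g ` K)" using compact_continuous_image[OF cg assms(2)] compact_imp_bounded by blast
  then obtain B where B: "\<And>x. x \<in> K \<Longrightarrow> norm (g x) \<le> B" by (auto simp: bounded_iff)
  have "norm (g x) \<le> max B 0" for x
    using B[of x] assms(3)[of x] by (cases "x \<in> K") auto
  then show "\<exists>B\<ge>0. \<forall>x. norm (g x) \<le> B" by (intro exI[of _ "max B 0"]) auto
qed

lemma
  assumes "C1c U f"
  shows C1c_integrable: "integrable lborel f" and C1c_sqint: "sqint f"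
    and C1c_bounded: "\<exists>B\<ge>0. \<forall>x. \<bar>f x\<bar> \<le> B"
    and C1c_sqint_egrad: "sqint (egrad f)"
    and C1c_integrable_egrad: "integrable lborel (egrad f)"
    and C1c_bounded_egrad: "\<exists>B\<ge>0. \<forall>x. norm (egrad f x) \<le> B"
proof -
  obtain K where K: "compact K" "\<And>x. x \<notin> K \<Longrightarrow> f x = 0" "\<And>x. x \<notin> K \<Longrightarrow> egrad f x = 0"
    using C1c_support[OF assms] by metis
  show "integrable lborel f" "sqint f" "\<exists>B\<ge>0. \<forall>x. \<bar>f x\<bar> \<le> B"
    using continuous_compact_support[OF C1c_cont[OF assms] K(1,2)] by auto
  show "sqint (egrad f)" "integrable lborel (egrad f)" "\<exists>B\<ge>0. \<forall>x. norm (egrad f x) \<le> B"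
    using continuous_compact_support[OF C1c_cont_egrad[OF assms] K(1,3)] by auto
qed

lemma C1c_lincomb:
  assumes "C1c U f" "C1c U g"
  shows "C1c U (\<lambda>x. r * f x + s * g x)"
    and "egrad (\<lambda>x. r * f x + s * g x) x = r *\<^sub>R egrad f x + s *\<^sub>R egrad g x"
proof -
  obtain K where K: "compact K" "K \<subseteq> U" "\<And>x. x \<notin> K \<Longrightarrow> f x = 0" using C1c_support[OF assms(1)] by metis
  obtain L where L: "compact L" "L \<subseteq> U" "\<And>x. x \<notin> L \<Longrightarrow> g x = 0" using C1c_support[OF assms(2)] by metis
  have d: "((\<lambda>x. r * f x + s * g x) has_derivative (\<lambda>h. (r *\<^sub>R egrad f x + s *\<^sub>R egrad g x) \<bullet> h)) (at x)" for x
    by (rule has_derivative_eq_rhs, (rule derivative_intros C1c_derivative[OF assms(1)] C1c_derivative[OF assms(2)])+)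
       (auto simp: inner_add_left)
  have c: "continuous_on UNIV (\<lambda>x. r *\<^sub>R egrad f x + s *\<^sub>R egrad g x)"
    by (intro continuous_intros C1c_cont_egrad[OF assms(1)] C1c_cont_egrad[OF assms(2)])
  show "C1c U (\<lambda>x. r * f x + s * g x)"
    by (rule C1cI(1)[OF d c, of "K \<union> L"]) (use K L in auto)
  show "egrad (\<lambda>x. r * f x + s * g x) x = r *\<^sub>R egrad f x + s *\<^sub>R egrad g x"
    using egrad_eqI[OF d] .
qed

lemma C1c_cmult:
  assumes "C1c U f"
  shows "C1c U (\<lambda>x. r * f x)" "egrad (\<lambda>x. r * f x) x = r *\<^sub>R egrad f x"
  using C1c_lincomb[OF assms assms, of r 0] by auto

text \<open>The factor \<open>k\<close> has to be regular only on \<open>U\<close>, because the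
  product vanishes off a compact subset of \<open>U\<close>; continuity of the gradient is glued
  from \<open>U\<close> and the complement of that compact set. This is the form needed for powers
  of \<open>conf\<close>, which are singular on the sphere.\<close>

lemma C1c_mult_local:
  assumes f: "C1c U f" and U: "open U"
    and k: "\<And>x. x \<in> U \<Longrightarrow> (k has_derivative (\<lambda>h. k' x \<bullet> h)) (at x)" and k': "continuous_on U k'"
  shows "C1c U (\<lambda>x. k x * f x)" "egrad (\<lambda>x. k x * f x) x = k x *\<^sub>R egrad f x + f x *\<^sub>R k' x"
proof -
  obtain K where K: "compact K" "K \<subseteq> U" "\<And>x. x \<notin> K \<Longrightarrow> f x = 0" "\<And>x. x \<notin> K \<Longrightarrow> egrad f x = 0"
    using C1c_support[OF f] by metis
  have op: "open (- K)" using K(1) by (simp add: compact_imp_closed open_Compl)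
  have d: "((\<lambda>x. k x * f x) has_derivative (\<lambda>h. (k x *\<^sub>R egrad f x + f x *\<^sub>R k' x) \<bullet> h)) (at x)" for x
  proof (cases "x \<in> U")
    case True
    show ?thesis
      by (rule has_derivative_eq_rhs, (rule derivative_intros C1c_derivative[OF f] k[OF True])+)
         (auto simp: inner_add_left)
  next
    case False
    then have xK: "x \<notin> K" using K(2) by auto
    have "((\<lambda>x. 0) has_derivative (\<lambda>h. 0)) (at x)" by simp
    then have "((\<lambda>x. k x * f x) has_derivative (\<lambda>h. 0)) (at x)"
      by (rule has_derivative_transform_within_open[OF _ op]) (use xK K(3) in auto)
    then show ?thesis using K(3,4)[OF xK] by simp
  qed
  have kc: "continuous_on U k"
    using k has_derivative_continuous continuous_at_imp_continuous_on by metis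
  have c1: "continuous_on U (\<lambda>x. k x *\<^sub>R egrad f x + f x *\<^sub>R k' x)"
    by (intro continuous_intros kc k' continuous_on_subset[OF C1c_cont[OF f]]
        continuous_on_subset[OF C1c_cont_egrad[OF f]]) auto
  have c2: "continuous_on (- K) (\<lambda>x. k x *\<^sub>R egrad f x + f x *\<^sub>R k' x)"
    by (rule continuous_on_eq[of _ "\<lambda>x. 0"]) (use K in auto)
  have "U \<union> - K = UNIV" using K(2) by auto
  then have c: "continuous_on UNIV (\<lambda>x. k x *\<^sub>R egrad f x + f x *\<^sub>R k' x)"
    using continuous_on_open_Un[OF U op c1 c2] by simp
  show "C1c U (\<lambda>x. k x * f x)"
    by (rule C1cI(1)[OF d c K(1,2)]) (use K in auto)
  show "egrad (\<lambda>x. k x * f x) x = k x *\<^sub>R egrad f x + f x *\<^sub>R k' x" using egrad_eqI[OF d] .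
qed

lemma C1c_mult:
  assumes "C1c U f" "C1c V g" "open U"
  shows "C1c U (\<lambda>x. f x * g x)" "egrad (\<lambda>x. f x * g x) x = f x *\<^sub>R egrad g x + g x *\<^sub>R egrad f x"
  using C1c_mult_local[OF assms(1,3) C1c_derivative[OF assms(2)]
      continuous_on_subset[OF C1c_cont_egrad[OF assms(2)]]]
  by (auto simp: mult.commute add.commute)

lemma C1c_compose:
  assumes f: "C1c U f" and H: "\<And>s. (H has_real_derivative H' s) (at s)" and H': "continuous_on UNIV H'"
    and H0: "H 0 = 0"
  shows "C1c U (\<lambda>x. H (f x))" "egrad (\<lambda>x. H (f x)) x = H' (f x) *\<^sub>R egrad f x"
proof -
  obtain K where K: "compact K" "K \<subseteq> U" "\<And>x. x \<notin> K \<Longrightarrow> f x = 0" using C1c_support[OF f] by metis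
  have d: "((\<lambda>x. H (f x)) has_derivative (\<lambda>h. (H' (f x) *\<^sub>R egrad f x) \<bullet> h)) (at x)" for x
  proof -
    have "(H has_derivative (\<lambda>h. H' (f x) * h)) (at (f x))"
      using H[of "f x"] by (simp add: has_field_derivative_def)
    from has_derivative_compose[OF C1c_derivative[OF f, of x] this] show ?thesis by simp
  qed
  have c: "continuous_on UNIV (\<lambda>x. H' (f x) *\<^sub>R egrad f x)"
    by (intro continuous_intros C1c_cont_egrad[OF f] continuous_on_compose2[OF H' C1c_cont[OF f]]) auto
  show "C1c U (\<lambda>x. H (f x))"
    by (rule C1cI(1)[OF d c K(1,2)]) (use K H0 in auto)
  show "egrad (\<lambda>x. H (f x)) x = H' (f x) *\<^sub>R egrad f x" using egrad_eqI[OF d] .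
qed

lemma C1c_affine:
  assumes f: "C1c U f" and c: "c > 0" and UV: "\<And>y. y \<in> U \<Longrightarrow> (1 / c) *\<^sub>R (y - t) \<in> V"
  shows "C1c V (\<lambda>x. f (t + c *\<^sub>R x))" "egrad (\<lambda>x. f (t + c *\<^sub>R x)) x = c *\<^sub>R egrad f (t + c *\<^sub>R x)"
proof -
  obtain K where K: "compact K" "K \<subseteq> U" "\<And>x. x \<notin> K \<Longrightarrow> f x = 0" using C1c_support[OF f] by metis
  have d: "((\<lambda>x. f (t + c *\<^sub>R x)) has_derivative (\<lambda>h. (c *\<^sub>R egrad f (t + c *\<^sub>R x)) \<bullet> h)) (at x)" for x
  proof -
    have "((\<lambda>x. t + c *\<^sub>R x) has_derivative (\<lambda>h. c *\<^sub>R h)) (at x)" by (auto intro!: derivative_eq_intros)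
    from has_derivative_compose[OF this C1c_derivative[OF f, of "t + c *\<^sub>R x"]] show ?thesis by simp
  qed
  have cc: "continuous_on UNIV (\<lambda>x. c *\<^sub>R egrad f (t + c *\<^sub>R x))"
    by (intro continuous_intros continuous_on_compose2[OF C1c_cont_egrad[OF f]]) auto
  let ?L = "(\<lambda>y. (1 / c) *\<^sub>R (y - t)) ` K"
  have L: "compact ?L" by (intro compact_continuous_image K(1) continuous_intros)
  have "f (t + c *\<^sub>R x) = 0" if "x \<notin> ?L" for x
  proof (rule K(3))
    show "t + c *\<^sub>R x \<notin> K"
    proof
      assume "t + c *\<^sub>R x \<in> K"
      then have "(1 / c) *\<^sub>R ((t + c *\<^sub>R x) - t) \<in> ?L" by blast
      then show False using that c by simp
    qed
  qed
  moreover have "?L \<subseteq> V" using UV K(2) by auto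
  ultimately show "C1c V (\<lambda>x. f (t + c *\<^sub>R x))" by (intro C1cI(1)[OF d cc L]) auto
  show "egrad (\<lambda>x. f (t + c *\<^sub>R x)) x = c *\<^sub>R egrad f (t + c *\<^sub>R x)" using egrad_eqI[OF d] .
qed

lemma C1c_Lipschitz:
  assumes f: "C1c U f" and B: "\<And>x. norm (egrad f x) \<le> B"
  shows "\<bar>f y - f x\<bar> \<le> B * norm (y - x)"
proof -
  have "norm (f y - f x) \<le> B * norm (y - x)"
  proof (rule differentiable_bound[of UNIV f "\<lambda>x h. egrad f x \<bullet> h"])
    show "onorm (\<lambda>h. egrad f x \<bullet> h) \<le> B" for x
    proof (rule onorm_le)
      fix h
      have "norm (egrad f x \<bullet> h) \<le> norm (egrad f x) * norm h" using Cauchy_Schwarz_ineq2 by simp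
      also have "\<dots> \<le> B * norm h" by (intro mult_right_mono B) simp
      finally show "norm (egrad f x \<bullet> h) \<le> B * norm h" .
    qed
  qed (use C1c_derivative[OF f] in auto)
  then show ?thesis by simp
qed

text \<open>Only lists of length at most one matter: the empty list gives differentiability, and a
  single direction gives a differentiable, hence continuous, partial derivative.\<close>

lemma test_fun_C1c:
  assumes "test_fun f"
  shows "C1c (ball 0 1) f"
proof -
  have s: "iter_pd bs f differentiable (at x)" if "set bs \<subseteq> Basis" for bs x
    using assms that unfolding test_fun_def smooth_fun_def by blast
  have d: "(f has_derivative (\<lambda>h. egrad f x \<bullet> h)) (at x)" for x
    using has_derivative_egrad[of f x] s[of "[]" x] by simp
  have c: "continuous_on UNIV (\<lambda>x. frechet_derivative f (at x) b)" if "b \<in> Basis" for b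
    using s[of "[b]"] that
    by (intro continuous_at_imp_continuous_on ballI differentiable_imp_continuous_within) auto
  have "continuous_on UNIV (egrad f)"
    unfolding egrad_def[abs_def] by (intro continuous_intros c)
  then show ?thesis using d assms unfolding C1c_def test_fun_def by auto
qed

subsection \<open>Integration by parts\<close>

text \<open>Lebesgue measure is translation invariant, so every difference quotient in direction
  \<open>b\<close> has integral zero. The quotients are dominated by the Lipschitz constant on a
  ball that contains all translates of the support by at most \<open>norm b\<close>.\<close>

lemma integral_egrad_zero:
  assumes f: "C1c U f"
  shows "(\<integral>x. egrad f x \<bullet> b \<partial>lborel) = 0"
proof -
  obtain K where K: "compact K" "\<And>x. x \<notin> K \<Longrightarrow> f x = 0" using C1c_support[OF f] by metis
  obtain B where B: "B \<ge> 0" "\<And>x. norm (egrad f x) \<le> B" using C1c_bounded_egrad[OF f] by blast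
  obtain r where r: "r > 0" "K \<subseteq> ball 0 r" using compact_imp_bounded[OF K(1)] bounded_subset_ballD by blast
  define h where "h n = 1 / real (Suc n)" for n
  have hp: "h n > 0" "h n \<le> 1" for n by (auto simp: h_def)
  have h0: "h \<longlonglongrightarrow> 0" unfolding h_def[abs_def] using LIMSEQ_Suc[OF lim_1_over_n] by simp
  define d where "d n x = (f (x + h n *\<^sub>R b) - f x) / h n" for n x
  note [measurable] = C1c_measurable[OF f]
  have [measurable]: "d n \<in> borel_measurable lborel" for n unfolding d_def by measurable
  have f1: "integrable lborel (\<lambda>x. f (x + h n *\<^sub>R b))"
    and f2: "(\<integral>x. f (x + h n *\<^sub>R b) \<partial>lborel) = (\<integral>x. f x \<partial>lborel)" for n
    using integrable_affine[OF C1c_integrable[OF f], of 1 "h n *\<^sub>R b"]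
      integral_affine[OF C1c_integrable[OF f], of 1 "h n *\<^sub>R b"] by (auto simp: add.commute)
  have d0: "(\<integral>x. d n x \<partial>lborel) = 0" for n
    unfolding d_def using f1[of n] f2[of n] C1c_integrable[OF f] by simp
  have lim: "(\<lambda>n. \<integral>x. d n x \<partial>lborel) \<longlonglongrightarrow> (\<integral>x. egrad f x \<bullet> b \<partial>lborel)"
  proof (rule integral_dominated_convergence[where w = "\<lambda>x. indicator (ball 0 (r + norm b)) x * (B * norm b)"])
    show "integrable lborel (\<lambda>x. indicator (ball 0 (r + norm b)) x * (B * norm b))"
      using integrable_indicator_iff emeasure_lborel_ball_finite[of 0 "r + norm b"] by (intro integrable_mult_left integrable_real_indicator) auto
    show "AE x in lborel. (\<lambda>n. d n x) \<longlonglongrightarrow> egrad f x \<bullet> b"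
    proof (rule AE_I2)
      fix x
      have "((\<lambda>t. x + t *\<^sub>R b) has_derivative (\<lambda>t. t *\<^sub>R b)) (at 0)" by (auto intro!: derivative_eq_intros)
      from has_derivative_compose[OF this, of f "\<lambda>h. egrad f x \<bullet> h"] C1c_derivative[OF f, of x]
      have "((\<lambda>t. f (x + t *\<^sub>R b)) has_derivative (\<lambda>t. (egrad f x \<bullet> b) * t)) (at 0)" by (simp add: mult.commute)
      then have "((\<lambda>t. f (x + t *\<^sub>R b)) has_real_derivative (egrad f x \<bullet> b)) (at 0)"
        by (simp add: has_field_derivative_def)
      then have "((\<lambda>t. (f (x + t *\<^sub>R b) - f x) / t) \<longlongrightarrow> egrad f x \<bullet> b) (at 0)"
        by (simp add: has_field_derivative_iff)
      moreover have "filterlim h (at 0) sequentially"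
        using h0 hp(1) by (auto simp: filterlim_at less_imp_neq[symmetric])
      ultimately show "(\<lambda>n. d n x) \<longlonglongrightarrow> egrad f x \<bullet> b"
        unfolding d_def by (rule filterlim_compose)
    qed
    show "AE x in lborel. norm (d n x) \<le> indicator (ball 0 (r + norm b)) x * (B * norm b)" for n
    proof (rule AE_I2)
      fix x
      show "norm (d n x) \<le> indicator (ball 0 (r + norm b)) x * (B * norm b)"
      proof (cases "x \<in> ball 0 (r + norm b)")
        case True
        have "\<bar>f (x + h n *\<^sub>R b) - f x\<bar> \<le> B * norm (h n *\<^sub>R b)"
          using C1c_Lipschitz[OF f B(2), of "x + h n *\<^sub>R b" x] by simp
        then show ?thesis using True hp(1)[of n] by (simp add: d_def field_simps)
      next
        case False
        have "norm (h n *\<^sub>R b) \<le> norm b" using hp[of n] by (simp add: mult_left_le_one_le)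
        moreover have "norm x \<le> norm (x + h n *\<^sub>R b) + norm (h n *\<^sub>R b)"
          using norm_triangle_ineq4[of "x + h n *\<^sub>R b" "h n *\<^sub>R b"] by simp
        moreover have "norm x \<ge> r + norm b" "norm b \<ge> 0" using False by auto
        ultimately have "norm (x + h n *\<^sub>R b) \<ge> r" "norm x \<ge> r" by linarith+
        then have "x + h n *\<^sub>R b \<notin> K" "x \<notin> K" using r(2) by (auto simp: subset_iff)
        then show ?thesis using K(2) False by (simp add: d_def)
      qed
    qed
  qed simp_all
  then show ?thesis unfolding d0 using LIMSEQ_unique tendsto_const by metis
qed

lemma has_derivative_inner_self_const: "((\<lambda>x. x \<bullet> b) has_derivative (\<lambda>h. b \<bullet> h)) (at x)"
  by (rule has_derivative_eq_rhs, (rule derivative_intros)+) (simp add: inner_commute)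

text \<open>The divergence of the field f(x) x is x \<bullet> grad f + N f and has integral zero;
  coordinatewise this is \<open>integral_egrad_zero\<close> for
  \<open>(x \<bullet> b) * f x\<close>, summed over the basis.\<close>

lemma integral_divergence_radial:
  fixes f :: "'a::euclidean_space \<Rightarrow> real"
  assumes f: "C1c U f" and U: "open U"
  shows "integrable lborel (\<lambda>x. x \<bullet> egrad f x)"
    and "(\<integral>x. x \<bullet> egrad f x \<partial>lborel) = - real DIM('a) * (\<integral>x. f x \<partial>lborel)"
proof -
  have g: "C1c U (\<lambda>x. (x \<bullet> b) * f x)" "egrad (\<lambda>x. (x \<bullet> b) * f x) x = (x \<bullet> b) *\<^sub>R egrad f x + f x *\<^sub>R b"
    for b x :: 'a
    using C1c_mult_local[OF f U has_derivative_inner_self_const[of b]] by auto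
  have i: "integrable lborel (\<lambda>x. ((x \<bullet> b) *\<^sub>R egrad f x + f x *\<^sub>R b) \<bullet> b)"
    and z: "(\<integral>x. ((x \<bullet> b) *\<^sub>R egrad f x + f x *\<^sub>R b) \<bullet> b \<partial>lborel) = 0" for b :: 'a
    using C1c_integrable_egrad[OF g(1)[of b]] integral_egrad_zero[OF g(1)[of b], of b] unfolding g(2) by auto
  have e: "((x \<bullet> b) *\<^sub>R egrad f x + f x *\<^sub>R b) \<bullet> b = (x \<bullet> b) * (egrad f x \<bullet> b) + f x"
    if "b \<in> Basis" for b x :: 'a
    using that by (simp add: inner_add_left inner_Basis)
  have i2: "integrable lborel (\<lambda>x. (x \<bullet> b) * (egrad f x \<bullet> b))"
    and z2: "(\<integral>x. (x \<bullet> b) * (egrad f x \<bullet> b) \<partial>lborel) = - (\<integral>x. f x \<partial>lborel)" if "b \<in> Basis" for b :: 'a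
  proof -
    have i': "integrable lborel (\<lambda>x. (x \<bullet> b) * (egrad f x \<bullet> b) + f x)" using i[of b] e[OF that] by simp
    then have "integrable lborel (\<lambda>x. ((x \<bullet> b) * (egrad f x \<bullet> b) + f x) - f x)"
      using C1c_integrable[OF f] by (rule Bochner_Integration.integrable_diff)
    then show i2: "integrable lborel (\<lambda>x. (x \<bullet> b) * (egrad f x \<bullet> b))" by simp
    have "(\<integral>x. (x \<bullet> b) * (egrad f x \<bullet> b) + f x \<partial>lborel) = 0" using z[of b] e[OF that] by simp
    then show "(\<integral>x. (x \<bullet> b) * (egrad f x \<bullet> b) \<partial>lborel) = - (\<integral>x. f x \<partial>lborel)"
      using i2 C1c_integrable[OF f] by simp
  qed
  have s: "x \<bullet> egrad f x = (\<Sum>b\<in>Basis. (x \<bullet> b) * (egrad f x \<bullet> b))" for x by (rule euclidean_inner)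
  show "integrable lborel (\<lambda>x. x \<bullet> egrad f x)" unfolding s using i2 by auto
  show "(\<integral>x. x \<bullet> egrad f x \<partial>lborel) = - real DIM('a) * (\<integral>x. f x \<partial>lborel)"
    unfolding s using i2 z2 by simp
qed

lemma sqint_inner_const:
  assumes "sqint F" shows "sqint (\<lambda>x. F x \<bullet> b)" "sqn (\<lambda>x. F x \<bullet> b) \<le> (norm b)\<^sup>2 * sqn F"
proof -
  have [measurable]: "F \<in> borel_measurable borel" using assms by (simp add: sqint_def)
  have m: "(\<lambda>x. F x \<bullet> b) \<in> borel_measurable borel" by measurable
  have b: "norm (F x \<bullet> b) \<le> norm b * norm (F x)" for x
    using Cauchy_Schwarz_ineq2[of "F x" b] by (simp add: mult.commute)
  show "sqint (\<lambda>x. F x \<bullet> b)" "sqn (\<lambda>x. F x \<bullet> b) \<le> (norm b)\<^sup>2 * sqn F"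
    using sqint_bound[OF assms m b] by auto
qed

lemma C1c_integral_by_parts:
  assumes "C1c U f" "C1c V g" "open U"
  shows "(\<integral>x. f x * (egrad g x \<bullet> b) \<partial>lborel) = - (\<integral>x. (egrad f x \<bullet> b) * g x \<partial>lborel)"
proof -
  have s: "sqint (\<lambda>x. egrad f x \<bullet> b)" "sqint (\<lambda>x. egrad g x \<bullet> b)"
    using sqint_inner_const C1c_sqint_egrad assms by blast+
  have "(\<integral>x. f x * (egrad g x \<bullet> b) + (egrad f x \<bullet> b) * g x \<partial>lborel) = 0"
    using integral_egrad_zero[OF C1c_mult(1)[OF assms], of b] unfolding C1c_mult(2)[OF assms]
    by (simp add: inner_add_left mult.commute)
  then show ?thesis
    using sqint_mult[OF C1c_sqint[OF assms(1)] s(2)] sqint_mult[OF s(1) C1c_sqint[OF assms(2)]] by simp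
qed

subsection \<open>The Sobolev inequality\<close>

lemma ball_borel [measurable]: "ball c r \<in> sets borel" by simp

text \<open>The fundamental theorem of calculus along the segment from x to x + h, followed by the
  Cauchy-Schwarz inequality against the indicator of the unit interval.\<close>

lemma C1c_segment_sq:
  assumes f: "C1c U f"
  shows "ennreal ((f (x + h) - f x)\<^sup>2)
     \<le> (\<integral>\<^sup>+t. ennreal ((norm h)\<^sup>2) * (ennreal ((norm (egrad f (x + t *\<^sub>R h)))\<^sup>2) * indicator {0..1} t) \<partial>lborel)"
proof -
  define g where "g t = egrad f (x + t *\<^sub>R h) \<bullet> h" for t :: real
  have cg: "continuous_on UNIV g"
    unfolding g_def by (intro continuous_intros continuous_on_compose2[OF C1c_cont_egrad[OF f]]) auto
  have dv: "((\<lambda>t. f (x + t *\<^sub>R h)) has_real_derivative g t) (at t)" for t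
  proof -
    have "((\<lambda>t. x + t *\<^sub>R h) has_derivative (\<lambda>t. t *\<^sub>R h)) (at t)" by (auto intro!: derivative_eq_intros)
    from has_derivative_compose[OF this C1c_derivative[OF f, of "x + t *\<^sub>R h"]]
    have "((\<lambda>t. f (x + t *\<^sub>R h)) has_derivative (\<lambda>s. g t * s)) (at t)" by (simp add: g_def mult.commute)
    then show ?thesis by (simp add: has_field_derivative_def)
  qed
  have I: "(\<integral>t. indicator {0..1} t *\<^sub>R g t \<partial>lborel) = f (x + h) - f x"
    using integral_FTC_Icc[of 0 1 "\<lambda>t. f (x + t *\<^sub>R h)" g] dv cg
    by (auto simp: has_real_derivative_iff_has_vector_derivative has_vector_derivative_at_within intro: continuous_on_subset)
  have gm: "g \<in> borel_measurable borel" using cg by (rule borel_measurable_continuous_onI)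
  have i1: "sqint (\<lambda>t. indicator {0..1::real} t *\<^sub>R g t)"
  proof -
    have "integrable lborel (\<lambda>t. indicator {0..1::real} t *\<^sub>R (norm (g t))\<^sup>2)"
      by (rule borel_integrable_compact) (auto intro!: continuous_intros continuous_on_subset[OF cg])
    also have "(\<lambda>t. indicator {0..1::real} t *\<^sub>R (norm (g t))\<^sup>2) = (\<lambda>t. (norm (indicator {0..1::real} t *\<^sub>R g t))\<^sup>2)"
      by (auto simp: indicator_def)
    finally show ?thesis unfolding sqint_def using gm by auto
  qed
  have sq1: "(\<lambda>t. (norm (indicator {0..1::real} t :: real))\<^sup>2) = indicator {0..1}" by (auto simp: indicator_def)
  have i2: "sqint (indicator {0..1::real} :: real \<Rightarrow> real)"
    unfolding sqint_def sq1 by simp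
  have s2: "sqn (indicator {0..1::real} :: real \<Rightarrow> real) = 1"
    unfolding sqn_def sq1 by simp
  have "(\<lambda>t. (indicator {0..1::real} t *\<^sub>R g t) \<bullet> indicator {0..1::real} t) = (\<lambda>t. indicator {0..1::real} t *\<^sub>R g t)"
    by (auto simp: indicator_def)
  then have "(f (x + h) - f x)\<^sup>2 \<le> sqn (\<lambda>t. indicator {0..1::real} t *\<^sub>R g t)"
    using integral_inner_sq_le[OF i1 i2] I s2 by simp
  then have "ennreal ((f (x + h) - f x)\<^sup>2) \<le> ennreal (sqn (\<lambda>t. indicator {0..1::real} t *\<^sub>R g t))"
    by (rule ennreal_leI)
  also have "\<dots> = (\<integral>\<^sup>+t. ennreal ((norm (indicator {0..1::real} t *\<^sub>R g t))\<^sup>2) \<partial>lborel)"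
    by (rule nn_integral_sq[OF i1, symmetric])
  also have "\<dots> \<le> (\<integral>\<^sup>+t. ennreal ((norm h)\<^sup>2) * (ennreal ((norm (egrad f (x + t *\<^sub>R h)))\<^sup>2) * indicator {0..1} t) \<partial>lborel)"
  proof (rule nn_integral_mono)
    fix t :: real
    have "(g t)\<^sup>2 \<le> (norm h)\<^sup>2 * (norm (egrad f (x + t *\<^sub>R h)))\<^sup>2"
      using power_mono[OF Cauchy_Schwarz_ineq2[of "egrad f (x + t *\<^sub>R h)" h] abs_ge_zero, of 2]
      by (simp add: g_def power_mult_distrib mult.commute)
    then have "ennreal ((g t)\<^sup>2) \<le> ennreal ((norm h)\<^sup>2) * ennreal ((norm (egrad f (x + t *\<^sub>R h)))\<^sup>2)"
      by (subst ennreal_mult[symmetric]) (auto intro: ennreal_leI)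
    then show "ennreal ((norm (indicator {0..1::real} t *\<^sub>R g t))\<^sup>2)
        \<le> ennreal ((norm h)\<^sup>2) * (ennreal ((norm (egrad f (x + t *\<^sub>R h)))\<^sup>2) * indicator {0..1} t)"
      by (auto simp: indicator_def)
  qed
  finally show ?thesis .
qed

text \<open>After Fubini, for each fixed t the map
  \<open>x \<mapsto> (t0 + t *\<^sub>R d) + (c + t * e) *\<^sub>R x\<close> is affine with factor at
  least \<open>c\<close>, so the change of variables costs at most 1 / c^N. One statement covers
  translations (\<open>e = 0\<close>), the comparison of balls of radius R and 2 R
  (\<open>c = e = R\<close>), and dilations about the origin.\<close>

lemma C1c_displacement_sq:
  fixes f :: "'a::euclidean_space \<Rightarrow> real"
  assumes f: "C1c U f" and c: "c > 0" "e \<ge> 0" and A [measurable]: "A \<in> sets borel"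
    and M: "\<And>x. x \<in> A \<Longrightarrow> norm (d + e *\<^sub>R x) \<le> M"
  shows "(\<integral>\<^sup>+x. ennreal ((f (t0 + c *\<^sub>R x + (d + e *\<^sub>R x)) - f (t0 + c *\<^sub>R x))\<^sup>2) * indicator A x \<partial>lborel)
     \<le> ennreal (M\<^sup>2 * sqn (egrad f) / c ^ DIM('a))"
proof -
  note [measurable] = C1c_measurable[OF f]
  define k where "k y = ennreal ((norm (egrad f y))\<^sup>2)" for y
  have [measurable]: "k \<in> borel_measurable borel" unfolding k_def by measurable
  have "(\<integral>\<^sup>+x. ennreal ((f (t0 + c *\<^sub>R x + (d + e *\<^sub>R x)) - f (t0 + c *\<^sub>R x))\<^sup>2) * indicator A x \<partial>lborel)
    \<le> (\<integral>\<^sup>+x. (\<integral>\<^sup>+t. ennreal (M\<^sup>2) * (k ((t0 + t *\<^sub>R d) + (c + t * e) *\<^sub>R x) * indicator {0..1} t) \<partial>lborel) \<partial>lborel)"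
  proof (rule nn_integral_mono)
    fix x
    show "ennreal ((f (t0 + c *\<^sub>R x + (d + e *\<^sub>R x)) - f (t0 + c *\<^sub>R x))\<^sup>2) * indicator A x
      \<le> (\<integral>\<^sup>+t. ennreal (M\<^sup>2) * (k ((t0 + t *\<^sub>R d) + (c + t * e) *\<^sub>R x) * indicator {0..1} t) \<partial>lborel)"
    proof (cases "x \<in> A")
      case True
      have "(norm (d + e *\<^sub>R x))\<^sup>2 \<le> M\<^sup>2" by (intro power_mono M True) simp
      then have m: "ennreal ((norm (d + e *\<^sub>R x))\<^sup>2) \<le> ennreal (M\<^sup>2)" by (rule ennreal_leI)
      have eq: "(t0 + t *\<^sub>R d) + (c + t * e) *\<^sub>R x = t0 + c *\<^sub>R x + t *\<^sub>R (d + e *\<^sub>R x)" for t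
        by (simp add: algebra_simps)
      have "ennreal ((f (t0 + c *\<^sub>R x + (d + e *\<^sub>R x)) - f (t0 + c *\<^sub>R x))\<^sup>2)
        \<le> (\<integral>\<^sup>+t. ennreal ((norm (d + e *\<^sub>R x))\<^sup>2) * (k (t0 + c *\<^sub>R x + t *\<^sub>R (d + e *\<^sub>R x)) * indicator {0..1} t) \<partial>lborel)"
        unfolding k_def by (rule C1c_segment_sq[OF f])
      also have "\<dots> \<le> (\<integral>\<^sup>+t. ennreal (M\<^sup>2) * (k ((t0 + t *\<^sub>R d) + (c + t * e) *\<^sub>R x) * indicator {0..1} t) \<partial>lborel)"
        unfolding eq by (intro nn_integral_mono mult_right_mono m) simp
      finally show ?thesis using True by simp
    qed simp
  qed
  also have "\<dots> = (\<integral>\<^sup>+t. (\<integral>\<^sup>+x. ennreal (M\<^sup>2) * (k ((t0 + t *\<^sub>R d) + (c + t * e) *\<^sub>R x) * indicator {0..1} t) \<partial>lborel) \<partial>(lborel :: real measure))"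
    by (rule lborel_pair.Fubini') measurable
  also have "\<dots> \<le> (\<integral>\<^sup>+t. ennreal (M\<^sup>2 * sqn (egrad f) / c ^ DIM('a)) * indicator {0..1::real} t \<partial>lborel)"
  proof (rule nn_integral_mono)
    fix t :: real
    show "(\<integral>\<^sup>+x. ennreal (M\<^sup>2) * (k ((t0 + t *\<^sub>R d) + (c + t * e) *\<^sub>R x) * indicator {0..1} t) \<partial>lborel)
      \<le> ennreal (M\<^sup>2 * sqn (egrad f) / c ^ DIM('a)) * indicator {0..1} t"
    proof (cases "t \<in> {0..1}")
      case True
      then have ct: "c \<le> c + t * e" "c + t * e > 0" using c by (auto intro: add_pos_nonneg)
      have "(\<integral>\<^sup>+x. ennreal (M\<^sup>2) * (k ((t0 + t *\<^sub>R d) + (c + t * e) *\<^sub>R x) * indicator {0..1} t) \<partial>lborel)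
         = ennreal (M\<^sup>2) * (\<integral>\<^sup>+x. k ((t0 + t *\<^sub>R d) + (c + t * e) *\<^sub>R x) \<partial>lborel)"
        using True by (subst nn_integral_cmult) auto
      also have "\<dots> = ennreal (M\<^sup>2) * (ennreal (1 / (c + t * e) ^ DIM('a)) * ennreal (sqn (egrad f)))"
        using ct by (subst nn_integral_affine) (auto simp: k_def[abs_def] nn_integral_sq[OF C1c_sqint_egrad[OF f]])
      also have "\<dots> \<le> ennreal (M\<^sup>2) * (ennreal (1 / c ^ DIM('a)) * ennreal (sqn (egrad f)))"
        using ct c by (intro mult_left_mono mult_right_mono ennreal_leI divide_left_mono power_mono) auto
      also have "\<dots> = ennreal (M\<^sup>2 * sqn (egrad f) / c ^ DIM('a))"
        using c by (simp add: ennreal_mult[symmetric])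
      finally show ?thesis using True by simp
    qed simp
  qed
  also have "\<dots> = ennreal (M\<^sup>2 * sqn (egrad f) / c ^ DIM('a))"
    by (simp add: nn_integral_cmult)
  finally show ?thesis .
qed

section \<open>Averages over balls and the weak-type Sobolev inequality\<close>

definition ball_avg :: "('a::euclidean_space \<Rightarrow> real) \<Rightarrow> real \<Rightarrow> 'a \<Rightarrow> real" where
  "ball_avg f R x = (\<integral>z. indicator (ball 0 1) z * f (x + R *\<^sub>R z) \<partial>lborel) / measure lborel (ball (0::'a) 1)"

context
  fixes f :: "'a::euclidean_space \<Rightarrow> real" and U \<omega>
  assumes f: "C1c U f"
  defines "\<omega> \<equiv> measure lborel (ball (0::'a) 1)"
begin

lemma unit_ball_measure_pos: "\<omega> > 0"
  unfolding \<omega>_def by (simp add: content_ball_pos)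

lemma sqint_unit_ball: "sqint (indicator (ball (0::'a) 1) :: 'a \<Rightarrow> real)" "sqn (indicator (ball (0::'a) 1) :: 'a \<Rightarrow> real) = \<omega>"
proof -
  have e: "(\<lambda>t. (norm (indicator (ball (0::'a) 1) t :: real))\<^sup>2) = indicator (ball 0 1)" by (auto simp: indicator_def)
  have m: "(indicator (ball (0::'a) 1) :: 'a \<Rightarrow> real) \<in> borel_measurable lborel" by measurable
  show "sqint (indicator (ball (0::'a) 1) :: 'a \<Rightarrow> real)" "sqn (indicator (ball (0::'a) 1) :: 'a \<Rightarrow> real) = \<omega>"
    unfolding sqint_def sqn_def e \<omega>_def using m emeasure_lborel_ball_finite[of "0::'a" 1] by auto
qed

lemma ball_avg_integrable: "integrable lborel (\<lambda>z::'a. indicator (ball 0 1) z * g z)"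
  if "continuous_on UNIV (g :: 'a \<Rightarrow> real)"
proof -
  have "integrable lborel (\<lambda>z::'a. indicator (cball 0 1) z *\<^sub>R g z)"
    by (rule borel_integrable_compact) (auto intro: continuous_on_subset[OF that])
  then show ?thesis
    by (rule Bochner_Integration.integrable_bound)
       (use borel_measurable_continuous_onI[OF that] in \<open>auto simp: indicator_def\<close>)
qed

lemma ball_integral_sq:
  assumes g: "continuous_on UNIV (g :: 'a \<Rightarrow> real)"
    and b: "(\<integral>\<^sup>+z. ennreal ((g z)\<^sup>2) * indicator (ball 0 1) z \<partial>lborel) \<le> ennreal B" "B \<ge> 0"
  shows "(\<integral>z. indicator (ball 0 1) z * g z \<partial>lborel)\<^sup>2 \<le> \<omega> * B"
proof -
  have e: "ennreal ((norm (indicator (ball 0 1) z * g z))\<^sup>2) = ennreal ((g z)\<^sup>2) * indicator (ball 0 1) z" for z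
    by (auto simp: indicator_def)
  have [measurable]: "g \<in> borel_measurable borel" using g by (rule borel_measurable_continuous_onI)
  have s: "sqint (\<lambda>z. indicator (ball 0 1) z * g z)"
    by (rule sqintI_nn, measurable, unfold e) (use b in \<open>auto simp: le_less_trans\<close>)
  have "ennreal (sqn (\<lambda>z. indicator (ball 0 1) z * g z)) \<le> ennreal B"
    using nn_integral_sq[OF s] b unfolding e by simp
  then have sb: "sqn (\<lambda>z. indicator (ball 0 1) z * g z) \<le> B" using b(2) by simp
  have "(\<lambda>z. indicator (ball 0 1) z \<bullet> (indicator (ball 0 1) z * g z)) = (\<lambda>z. indicator (ball 0 1) z * g z)"
    by (auto simp: indicator_def)
  then have "(\<integral>z. indicator (ball 0 1) z * g z \<partial>lborel)\<^sup>2 \<le> \<omega> * sqn (\<lambda>z. indicator (ball 0 1) z * g z)"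
    using integral_inner_sq_le[OF sqint_unit_ball(1) s] sqint_unit_ball(2) by simp
  also have "\<dots> \<le> \<omega> * B" using sb unit_ball_measure_pos by simp
  finally show ?thesis .
qed

lemma cont_shift: "continuous_on UNIV (\<lambda>z. f (x + R *\<^sub>R z))"
  by (intro continuous_on_compose2[OF C1c_cont[OF f]] continuous_intros) auto

text \<open>Over the unit ball the points x + R z and x + 2 R z differ by R z, whose length is at
  most R, so \<open>C1c_displacement_sq\<close> bounds the difference of the two averages.\<close>

lemma ball_avg_double:
  assumes R: "R > 0"
  shows "(ball_avg f R x - ball_avg f (2 * R) x)\<^sup>2 \<le> R\<^sup>2 * sqn (egrad f) / (R ^ DIM('a) * \<omega>)"
proof -
  define g where "g z = f (x + (2 * R) *\<^sub>R z) - f (x + R *\<^sub>R z)" for z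
  have cg: "continuous_on UNIV g" unfolding g_def by (intro continuous_intros cont_shift)
  have ge: "f (x + R *\<^sub>R z + (0 + R *\<^sub>R z)) - f (x + R *\<^sub>R z) = g z" for z
  proof -
    have "x + R *\<^sub>R z + (0 + R *\<^sub>R z) = x + (2 * R) *\<^sub>R z"
      by (simp only: mult_2 scaleR_left_distrib add.assoc add_0)
    then show ?thesis by (simp only: g_def)
  qed
  have "(\<integral>\<^sup>+z. ennreal ((f (x + R *\<^sub>R z + (0 + R *\<^sub>R z)) - f (x + R *\<^sub>R z))\<^sup>2) * indicator (ball 0 1) z \<partial>lborel)
     \<le> ennreal (R\<^sup>2 * sqn (egrad f) / R ^ DIM('a))"
    by (rule C1c_displacement_sq[OF f]) (use R in \<open>auto simp: mult_left_le\<close>)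
  then have b: "(\<integral>z. indicator (ball 0 1) z * g z \<partial>lborel)\<^sup>2 \<le> \<omega> * (R\<^sup>2 * sqn (egrad f) / R ^ DIM('a))"
    unfolding ge using R by (intro ball_integral_sq cg) auto
  have "ball_avg f (2 * R) x - ball_avg f R x = (\<integral>z. indicator (ball 0 1) z * g z \<partial>lborel) / \<omega>"
    unfolding ball_avg_def g_def \<omega>_def
    using ball_avg_integrable[OF cont_shift[of x R]] ball_avg_integrable[OF cont_shift[of x "2*R"]]
    by (simp add: right_diff_distrib diff_divide_distrib)
  then have "(ball_avg f R x - ball_avg f (2 * R) x)\<^sup>2 = (\<integral>z. indicator (ball 0 1) z * g z \<partial>lborel)\<^sup>2 / \<omega>\<^sup>2"
    by (subst power2_commute) (simp add: power_divide)
  also have "\<dots> \<le> (\<omega> * (R\<^sup>2 * sqn (egrad f) / R ^ DIM('a))) / \<omega>\<^sup>2"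
    by (rule divide_right_mono[OF b]) simp
  also have "\<dots> = R\<^sup>2 * sqn (egrad f) / (R ^ DIM('a) * \<omega>)"
    using unit_ball_measure_pos R by (simp add: power2_eq_square field_simps)
  finally show ?thesis .
qed

lemma ball_avg_decay:
  assumes R: "R > 0"
  shows "\<bar>ball_avg f R x\<bar> \<le> (\<integral>y. \<bar>f y\<bar> \<partial>lborel) / (R ^ DIM('a) * \<omega>)"
proof -
  have i: "integrable lborel (\<lambda>z. \<bar>f (x + R *\<^sub>R z)\<bar>)"
    using integrable_affine[OF integrable_abs[OF C1c_integrable[OF f]] R, of x] .
  have "\<bar>\<integral>z. indicator (ball 0 1) z * f (x + R *\<^sub>R z) \<partial>lborel\<bar> \<le> (\<integral>z. \<bar>indicator (ball 0 1) z * f (x + R *\<^sub>R z)\<bar> \<partial>lborel)"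
    by (rule integral_abs_bound)
  also have "\<dots> \<le> (\<integral>z. \<bar>f (x + R *\<^sub>R z)\<bar> \<partial>lborel)"
    by (rule integral_mono[OF integrable_abs[OF ball_avg_integrable[OF cont_shift]] i])
       (auto simp: indicator_def)
  also have "\<dots> = (\<integral>y. \<bar>f y\<bar> \<partial>lborel) / R ^ DIM('a)"
    using integral_affine[OF integrable_abs[OF C1c_integrable[OF f]] R, of x] .
  finally show ?thesis
    unfolding ball_avg_def \<omega>_def[symmetric] using unit_ball_measure_pos by (simp add: field_simps)
qed

text \<open>The averages telescope over the radii 2^n R: they tend to zero because \<open>f\<close>
  is integrable, and in dimension at least three the increments decay geometrically, since (2^n)^2 /
  (2^n)^N \<le> 2^(-n).\<close>

lemma ball_avg_bound:
  assumes R: "R > 0" and N: "DIM('a) \<ge> 3"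
  shows "(ball_avg f R x)\<^sup>2 \<le> 16 * (R\<^sup>2 * sqn (egrad f) / (R ^ DIM('a) * \<omega>))"
proof -
  define c where "c = sqrt (R\<^sup>2 * sqn (egrad f) / (R ^ DIM('a) * \<omega>))"
  \<comment> \<open>The decay ratio of the increments in the worst dimension, three. The crude bound
    r \<le> 3 / 4 makes the geometric sum at most 4, whence the factor 16 after squaring.\<close>
  define r where "r = sqrt (1 / 2)"
  define a where "a n = ball_avg f (2 ^ n * R) x" for n
  have c0: "c \<ge> 0" unfolding c_def using R unit_ball_measure_pos by simp
  have r0: "r > 0" "r \<le> 3 / 4" unfolding r_def by (simp, intro real_le_lsqrt) (auto simp: power2_eq_square simp del: real_sqrt_divide)
  have step: "\<bar>a n - a (Suc n)\<bar> \<le> c * r ^ n" for n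
  proof -
    have "(a n - a (Suc n))\<^sup>2 \<le> (2 ^ n * R)\<^sup>2 * sqn (egrad f) / ((2 ^ n * R) ^ DIM('a) * \<omega>)"
    proof -
      have e: "2 ^ Suc n * R = 2 * (2 ^ n * R)" and p: "2 ^ n * R > 0" using R by simp_all
      show ?thesis unfolding a_def e by (rule ball_avg_double[OF p])
    qed
    also have "\<dots> = (2 ^ n)\<^sup>2 / (2 ^ n) ^ DIM('a) * (R\<^sup>2 * sqn (egrad f) / (R ^ DIM('a) * \<omega>))"
      by (simp add: power_mult_distrib)
    also have "\<dots> \<le> (1 / 2) ^ n * (R\<^sup>2 * sqn (egrad f) / (R ^ DIM('a) * \<omega>))"
    proof (rule mult_right_mono)
      have "((2::real) ^ n) ^ 3 \<le> (2 ^ n) ^ DIM('a)" by (rule power_increasing[OF N]) simp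
      then have "(2 ^ n)\<^sup>2 / (2 ^ n) ^ DIM('a) \<le> (2 ^ n)\<^sup>2 / ((2::real) ^ n) ^ 3"
        by (intro divide_left_mono) auto
      then show "(2 ^ n)\<^sup>2 / (2 ^ n) ^ DIM('a) \<le> (1 / 2 :: real) ^ n"
        by (simp add: power2_eq_square power3_eq_cube power_one_over)
    qed (use R unit_ball_measure_pos in simp)
    also have "\<dots> = (c * r ^ n)\<^sup>2"
    proof -
      have "c\<^sup>2 = R\<^sup>2 * sqn (egrad f) / (R ^ DIM('a) * \<omega>)" using R unit_ball_measure_pos by (simp add: c_def)
      moreover have "(r ^ n)\<^sup>2 = (1 / 2) ^ n"
      proof -
        have "(r ^ n)\<^sup>2 = (r\<^sup>2) ^ n" by (simp only: power_mult[symmetric] mult.commute)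
        then show ?thesis by (simp add: r_def)
      qed
      ultimately show ?thesis by (simp add: power_mult_distrib)
    qed
    finally have "(a n - a (Suc n))\<^sup>2 \<le> (c * r ^ n)\<^sup>2" .
    moreover have "0 \<le> c * r ^ n" using c0 r0 by simp
    ultimately show ?thesis by (metis abs_le_square_iff abs_of_nonneg)
  qed
  have sum: "\<bar>a 0 - a n\<bar> \<le> c * (\<Sum>i<n. r ^ i)" for n
  proof (induction n)
    case (Suc n)
    show ?case using Suc step[of n] by (simp add: distrib_left)
  qed simp
  have b4: "\<bar>a 0\<bar> \<le> 4 * c + \<bar>a n\<bar>" for n
  proof -
    have "(\<Sum>i<n. r ^ i) = (1 - r ^ n) / (1 - r)" using r0 by (intro sum_gp_strict[THEN trans]) auto
    also have "\<dots> \<le> 1 / (1 - r)" using r0 by (intro divide_right_mono) auto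
    also have "\<dots> \<le> 4" using r0 by (simp add: field_simps)
    finally have "c * (\<Sum>i<n. r ^ i) \<le> c * 4" using c0 by (intro mult_left_mono)
    then show ?thesis using sum[of n] by linarith
  qed
  have lim: "(\<lambda>n. \<bar>a n\<bar>) \<longlonglongrightarrow> 0"
  proof (rule tendsto_sandwich[of "\<lambda>n. 0"])
    show "\<forall>\<^sub>F n in sequentially. \<bar>a n\<bar> \<le> (\<integral>y. \<bar>f y\<bar> \<partial>lborel) / (R ^ DIM('a) * \<omega>) * (1 / 2) ^ n"
    proof (rule always_eventually, rule allI)
      fix n
      have "(2::real) ^ n \<le> (2 ^ n) ^ DIM('a)" using N by (intro self_le_power) auto
      then have "(\<integral>y. \<bar>f y\<bar> \<partial>lborel) / ((2 ^ n) ^ DIM('a) * (R ^ DIM('a) * \<omega>)) \<le> (\<integral>y. \<bar>f y\<bar> \<partial>lborel) / (2 ^ n * (R ^ DIM('a) * \<omega>))"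
        using R unit_ball_measure_pos by (intro divide_left_mono mult_right_mono mult_pos_pos integral_nonneg) auto
      then show "\<bar>a n\<bar> \<le> (\<integral>y. \<bar>f y\<bar> \<partial>lborel) / (R ^ DIM('a) * \<omega>) * (1 / 2) ^ n"
        using ball_avg_decay[of "2 ^ n * R" x] R by (simp add: a_def power_mult_distrib power_one_over mult_ac)
    qed
    have "(\<lambda>n. (\<integral>y. \<bar>f y\<bar> \<partial>lborel) / (R ^ DIM('a) * \<omega>) * (1 / 2) ^ n) \<longlonglongrightarrow> (\<integral>y. \<bar>f y\<bar> \<partial>lborel) / (R ^ DIM('a) * \<omega>) * 0"
      by (intro tendsto_mult tendsto_const LIMSEQ_realpow_zero) auto
    then show "(\<lambda>n. (\<integral>y. \<bar>f y\<bar> \<partial>lborel) / (R ^ DIM('a) * \<omega>) * (1 / 2) ^ n) \<longlonglongrightarrow> 0" by simp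
  qed auto
  have "\<bar>a 0\<bar> \<le> 4 * c + 0"
    by (rule tendsto_lowerbound[OF tendsto_add[OF tendsto_const lim]]) (use b4 in auto)
  then have "(a 0)\<^sup>2 \<le> (4 * c)\<^sup>2" using c0 by (subst abs_le_square_iff[symmetric]) auto
  also have "\<dots> = 16 * (R\<^sup>2 * sqn (egrad f) / (R ^ DIM('a) * \<omega>))"
    using R unit_ball_measure_pos by (simp add: power_mult_distrib c_def)
  finally show ?thesis by (simp add: a_def)
qed

lemma ball_avg_measurable [measurable]: "ball_avg f R \<in> borel_measurable borel"
proof -
  note [measurable] = C1c_measurable[OF f]
  show ?thesis unfolding ball_avg_def[abs_def] by measurable
qed

text \<open>Cauchy-Schwarz on the unit ball bounds the squared deviation from the average by the
  average of the squared increments; after Fubini each increment is a translation by R z, controlled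
  by \<open>C1c_displacement_sq\<close>.\<close>

lemma ball_avg_approx:
  assumes R: "R > 0"
  shows "(\<integral>\<^sup>+x. ennreal ((f x - ball_avg f R x)\<^sup>2) \<partial>lborel) \<le> ennreal (R\<^sup>2 * sqn (egrad f))"
proof -
  note [measurable] = C1c_measurable[OF f]
  define k where "k x z = ennreal ((f (x + R *\<^sub>R z) - f x)\<^sup>2) * indicator (ball 0 1) z" for x z
  have pt: "ennreal ((f x - ball_avg f R x)\<^sup>2) \<le> ennreal (1 / \<omega>) * (\<integral>\<^sup>+z. k x z \<partial>lborel)" for x
  proof -
    define g where "g z = f (x + R *\<^sub>R z) - f x" for z
    have cg: "continuous_on UNIV g" unfolding g_def by (intro continuous_intros cont_shift)
    have [measurable]: "g \<in> borel_measurable borel" using cg by (rule borel_measurable_continuous_onI)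
    have "integrable lborel (\<lambda>z. indicator (ball 0 1) z * (g z)\<^sup>2)"
      by (intro ball_avg_integrable continuous_intros cg)
    then have "(\<integral>\<^sup>+z. ennreal (indicator (ball 0 1) z * (g z)\<^sup>2) \<partial>lborel) = ennreal (\<integral>z. indicator (ball 0 1) z * (g z)\<^sup>2 \<partial>lborel)"
      by (rule nn_integral_eq_integral) auto
    moreover have "ennreal (indicator (ball 0 1) z * (g z)\<^sup>2) = k x z" for z by (auto simp: k_def g_def indicator_def)
    ultimately have e: "(\<integral>\<^sup>+z. k x z \<partial>lborel) = ennreal (\<integral>z. indicator (ball 0 1) z * (g z)\<^sup>2 \<partial>lborel)" by simp
    have b: "(\<integral>z. indicator (ball 0 1) z * g z \<partial>lborel)\<^sup>2 \<le> \<omega> * (\<integral>z. indicator (ball 0 1) z * (g z)\<^sup>2 \<partial>lborel)"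
      by (rule ball_integral_sq[OF cg]) (use e in \<open>auto simp: k_def g_def intro!: integral_nonneg\<close>)
    have c1: "(\<integral>z. indicator (ball (0::'a) 1) z * f x \<partial>lborel) = \<omega> * f x"
      unfolding \<omega>_def by simp
    have "(\<integral>z. indicator (ball 0 1) z * g z \<partial>lborel) = (\<integral>z. indicator (ball 0 1) z * f (x + R *\<^sub>R z) \<partial>lborel) - \<omega> * f x"
    proof -
      have "(\<integral>z. indicator (ball 0 1) z * g z \<partial>lborel) = (\<integral>z. indicator (ball 0 1) z * f (x + R *\<^sub>R z) - indicator (ball 0 1) z * f x \<partial>lborel)"
        by (simp only: g_def right_diff_distrib)
      also have "\<dots> = (\<integral>z. indicator (ball 0 1) z * f (x + R *\<^sub>R z) \<partial>lborel) - (\<integral>z. indicator (ball (0::'a) 1) z * f x \<partial>lborel)"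
        by (rule Bochner_Integration.integral_diff[OF ball_avg_integrable[OF cont_shift[of x R]] ball_avg_integrable[OF continuous_on_const]])
      finally show ?thesis unfolding c1 .
    qed
    then have "(f x - ball_avg f R x)\<^sup>2 = (\<integral>z. indicator (ball 0 1) z * g z \<partial>lborel)\<^sup>2 / \<omega>\<^sup>2"
      unfolding ball_avg_def \<omega>_def[symmetric] using unit_ball_measure_pos
      by (simp add: power_divide[symmetric] diff_divide_distrib power2_commute)
    also have "\<dots> \<le> (\<omega> * (\<integral>z. indicator (ball 0 1) z * (g z)\<^sup>2 \<partial>lborel)) / \<omega>\<^sup>2"
      by (rule divide_right_mono[OF b]) simp
    also have "\<dots> = (1 / \<omega>) * (\<integral>z. indicator (ball 0 1) z * (g z)\<^sup>2 \<partial>lborel)"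
      using unit_ball_measure_pos by (simp add: power2_eq_square)
    finally have "(f x - ball_avg f R x)\<^sup>2 \<le> (1 / \<omega>) * (\<integral>z. indicator (ball 0 1) z * (g z)\<^sup>2 \<partial>lborel)" .
    then show ?thesis unfolding e
      by (subst ennreal_mult[symmetric]) (use unit_ball_measure_pos in \<open>auto intro!: ennreal_leI integral_nonneg\<close>)
  qed
  have zb: "(\<integral>\<^sup>+x. k x z \<partial>lborel) \<le> ennreal (R\<^sup>2 * sqn (egrad f)) * indicator (ball 0 1) z" for z
  proof (cases "z \<in> ball 0 1")
    case True
    have "(\<integral>\<^sup>+x. ennreal ((f (0 + 1 *\<^sub>R x + (R *\<^sub>R z + 0 *\<^sub>R x)) - f (0 + 1 *\<^sub>R x))\<^sup>2) * indicator UNIV x \<partial>lborel)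
       \<le> ennreal (R\<^sup>2 * sqn (egrad f) / 1 ^ DIM('a))"
      by (rule C1c_displacement_sq[OF f]) (use R True in \<open>auto simp: mult_left_le\<close>)
    then show ?thesis using True by (simp add: k_def)
  qed (simp add: k_def)
  have "(\<integral>\<^sup>+x. ennreal ((f x - ball_avg f R x)\<^sup>2) \<partial>lborel) \<le> (\<integral>\<^sup>+x. ennreal (1 / \<omega>) * (\<integral>\<^sup>+z. k x z \<partial>lborel) \<partial>lborel)"
    by (intro nn_integral_mono pt)
  also have "\<dots> = ennreal (1 / \<omega>) * (\<integral>\<^sup>+x. (\<integral>\<^sup>+z. k x z \<partial>lborel) \<partial>lborel)"
    unfolding k_def by (rule nn_integral_cmult) measurable
  also have "(\<integral>\<^sup>+x. (\<integral>\<^sup>+z. k x z \<partial>lborel) \<partial>lborel) = (\<integral>\<^sup>+z. (\<integral>\<^sup>+x. k x z \<partial>lborel) \<partial>lborel)"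
    unfolding k_def by (rule lborel_pair.Fubini') measurable
  also have "ennreal (1 / \<omega>) * \<dots> \<le> ennreal (1 / \<omega>) * (\<integral>\<^sup>+z. ennreal (R\<^sup>2 * sqn (egrad f)) * indicator (ball (0::'a) 1) z \<partial>lborel)"
    by (intro mult_left_mono nn_integral_mono zb) simp
  also have "\<dots> = ennreal (1 / \<omega>) * (ennreal (R\<^sup>2 * sqn (egrad f)) * ennreal \<omega>)"
    unfolding \<omega>_def using emeasure_lborel_ball_finite[of "0::'a" 1]
    by (subst nn_integral_cmult) (auto simp: emeasure_eq_ennreal_measure)
  also have "\<dots> = ennreal (R\<^sup>2 * sqn (egrad f))"
    using unit_ball_measure_pos by (simp add: ennreal_mult[symmetric])
  finally show ?thesis .
qed

text \<open>The constant 64 makes every average at most 1 / 2 in absolute value. Where |f| \<ge> 1,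
  the function then differs from its average by at least 1 / 2, and Chebyshev's inequality with
  \<open>ball_avg_approx\<close> gives the factor 4.\<close>

lemma level_set_measure:
  assumes R: "R > 0" and N: "DIM('a) \<ge> 3" and b: "64 * (R\<^sup>2 * sqn (egrad f) / (R ^ DIM('a) * \<omega>)) \<le> 1"
  shows "emeasure lborel {x. 1 \<le> \<bar>f x\<bar>} \<le> ennreal (4 * (R\<^sup>2 * sqn (egrad f)))"
proof -
  note [measurable] = C1c_measurable[OF f]
  have A: "\<bar>ball_avg f R x\<bar> \<le> 1 / 2" for x
  proof -
    have "(ball_avg f R x)\<^sup>2 \<le> (1 / 2)\<^sup>2" using ball_avg_bound[OF R N, of x] b by (simp add: power2_eq_square)
    then show ?thesis by (subst (asm) abs_le_square_iff[symmetric]) simp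
  qed
  have "emeasure lborel {x. 1 \<le> \<bar>f x\<bar>} = (\<integral>\<^sup>+x. indicator {x. 1 \<le> \<bar>f x\<bar>} x \<partial>lborel)"
    by simp
  also have "\<dots> \<le> (\<integral>\<^sup>+x. ennreal 4 * ennreal ((f x - ball_avg f R x)\<^sup>2) \<partial>lborel)"
  proof (rule nn_integral_mono)
    fix x
    have "1 \<le> 4 * (f x - ball_avg f R x)\<^sup>2" if "1 \<le> \<bar>f x\<bar>"
    proof -
      have "1 / 2 \<le> \<bar>f x - ball_avg f R x\<bar>" using that A[of x] by linarith
      then have "(1 / 2)\<^sup>2 \<le> (f x - ball_avg f R x)\<^sup>2" by (subst abs_le_square_iff[symmetric]) simp
      then show ?thesis by (simp add: power2_eq_square)
    qed
    then show "indicator {x. 1 \<le> \<bar>f x\<bar>} x \<le> ennreal 4 * ennreal ((f x - ball_avg f R x)\<^sup>2)"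
      by (subst ennreal_mult[symmetric]) (auto simp: indicator_def simp flip: ennreal_1 intro: ennreal_leI)
  qed
  also have "\<dots> = ennreal 4 * (\<integral>\<^sup>+x. ennreal ((f x - ball_avg f R x)\<^sup>2) \<partial>lborel)"
    by (rule nn_integral_cmult) measurable
  also have "\<dots> \<le> ennreal 4 * ennreal (R\<^sup>2 * sqn (egrad f))"
    by (intro mult_left_mono ball_avg_approx[OF R]) simp
  also have "\<dots> = ennreal (4 * (R\<^sup>2 * sqn (egrad f)))" by (simp add: ennreal_mult)
  finally show ?thesis .
qed

end

text \<open>The radius in \<open>level_set_measure\<close> is optimised. The resulting exponent is 1
  + 2 / (N - 2), which is half the critical exponent: a weak-type Sobolev inequality at level
  one.\<close>

lemma level_set_measure_powr:
  assumes N: "DIM('a::euclidean_space) \<ge> 3"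
  shows "\<exists>C\<ge>0. \<forall>f :: 'a \<Rightarrow> real. C1c UNIV f \<longrightarrow>
     emeasure lborel {x. 1 \<le> \<bar>f x\<bar>} \<le> ennreal (C * sqn (egrad f) powr (crit_exp DIM('a) / 2))"
proof -
  define \<omega> where "\<omega> = measure lborel (ball (0::'a) 1)"
  have w: "\<omega> > 0" unfolding \<omega>_def by (simp add: content_ball_pos)
  define n where "n = real DIM('a) - 2"
  have n: "n > 0" using N by (simp add: n_def)
  have P: "crit_exp DIM('a) / 2 = 2 / n + 1"
    using n by (simp add: crit_exp_def n_def field_simps)
  define C where "C = 4 * (64 / \<omega>) powr (2 / n)"
  have "emeasure lborel {x. 1 \<le> \<bar>f x\<bar>} \<le> ennreal (C * sqn (egrad f) powr (crit_exp DIM('a) / 2))"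
    if f: "C1c UNIV f" for f :: "'a \<Rightarrow> real"
  proof (cases "sqn (egrad f) = 0")
    case True
    then show ?thesis
      using level_set_measure[OF f, of 1] N by simp
  next
    case False
    then have D: "sqn (egrad f) > 0" using sqn_nonneg[of "egrad f"] by linarith
    \<comment> \<open>The smallest radius allowed by the hypothesis of
      \<open>level_set_measure\<close>, which then holds with equality.\<close>
    define R where "R = (64 * sqn (egrad f) / \<omega>) powr (1 / n)"
    have R: "R > 0" unfolding R_def using D w by simp
    have Rn: "R ^ DIM('a) = R\<^sup>2 * (64 * sqn (egrad f) / \<omega>)"
    proof -
      have "R ^ DIM('a) = R powr (2 + n)" using R by (simp add: n_def powr_realpow)
      also have "\<dots> = R\<^sup>2 * R powr n" using R by (simp add: powr_add powr_numeral)
      also have "R powr n = 64 * sqn (egrad f) / \<omega>"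
        unfolding R_def powr_powr using n D w by simp
      finally show ?thesis .
    qed
    have "64 * (R\<^sup>2 * sqn (egrad f) / (R ^ DIM('a) * \<omega>)) \<le> 1"
      unfolding Rn using R D w by (simp add: field_simps)
    then have "emeasure lborel {x. 1 \<le> \<bar>f x\<bar>} \<le> ennreal (4 * (R\<^sup>2 * sqn (egrad f)))"
      unfolding \<omega>_def by (rule level_set_measure[OF f R N])
    also have "4 * (R\<^sup>2 * sqn (egrad f)) = C * sqn (egrad f) powr (crit_exp DIM('a) / 2)"
    proof -
      have "R\<^sup>2 = R powr 2" using R by (simp add: powr_numeral)
      also have "\<dots> = (64 / \<omega> * sqn (egrad f)) powr (2 / n)" unfolding R_def powr_powr by simp
      also have "\<dots> = (64 / \<omega>) powr (2 / n) * sqn (egrad f) powr (2 / n)"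
        by (rule powr_mult)
      finally show ?thesis unfolding P C_def using D by (simp add: powr_add)
    qed
    finally show ?thesis .
  qed
  moreover have "C \<ge> 0" unfolding C_def by simp
  ultimately show ?thesis by blast
qed

section \<open>Truncation at dyadic levels and the strong Sobolev inequality\<close>

definition pospart_sq :: "real \<Rightarrow> real" where
  "pospart_sq s = (max 0 s)\<^sup>2"

lemma pospart_sq_derivative: "(pospart_sq has_real_derivative 2 * max 0 s) (at s)"
proof -
  consider "s > 0" | "s < 0" | "s = 0" by linarith
  then show ?thesis
  proof cases
    case 1
    have "((\<lambda>s. s\<^sup>2) has_real_derivative 2 * max 0 s) (at s)"
      using 1 by (auto intro!: derivative_eq_intros)
    then show ?thesis
      by (rule has_field_derivative_transform_within_open[where S = "{0<..}"]) (use 1 in \<open>auto simp: pospart_sq_def\<close>)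
  next
    case 2
    have "((\<lambda>s. 0) has_real_derivative 2 * max 0 s) (at s)"
      using 2 by (auto intro!: derivative_eq_intros)
    then show ?thesis
      by (rule has_field_derivative_transform_within_open[where S = "{..<0}"]) (use 2 in \<open>auto simp: pospart_sq_def\<close>)
  next
    case 3
    have "((\<lambda>h. pospart_sq h / h) \<longlongrightarrow> 0) (at 0)"
    proof (rule Lim_null_comparison)
      show "\<forall>\<^sub>F h in at 0. norm (pospart_sq h / h) \<le> \<bar>h\<bar>"
        by (auto simp: pospart_sq_def max_def power2_eq_square intro!: always_eventually)
      show "((\<lambda>h::real. \<bar>h\<bar>) \<longlongrightarrow> 0) (at 0)" by (rule tendsto_rabs_zero) simp
    qed
    then show ?thesis using 3 by (simp add: has_field_derivative_iff pospart_sq_def)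
  qed
qed

text \<open>A \<open>C\<^sup>1\<close> step from 0 (on \<open>s \<le> 1\<close>) to 1 (on \<open>s \<ge> 4\<close>); its derivative is a hat function.\<close>
definition step_fun :: "real \<Rightarrow> real" where
  "step_fun s = 2 / 9 * (pospart_sq (s - 1) - 2 * pospart_sq (s - 5 / 2) + pospart_sq (s - 4))"

text \<open>The hat has base from 1 to 4 and height 2 / 3 at 5 / 2, hence area one, which fixes the
  slope 4 / 9. The endpoints 1 and 4 are the squares of 1 and 2: applied to the square of a rescaled
  function, the transition takes place across exactly one dyadic level.\<close>

definition step_deriv :: "real \<Rightarrow> real" where
  "step_deriv s = 4 / 9 * (max 0 (s - 1) - 2 * max 0 (s - 5 / 2) + max 0 (s - 4))"

lemma step_fun_derivative: "(step_fun has_real_derivative step_deriv s) (at s)"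
  unfolding step_fun_def[abs_def] step_deriv_def
  by (auto intro!: derivative_eq_intros DERIV_chain2[OF pospart_sq_derivative] simp: algebra_simps)

lemma step_deriv_cont: "continuous_on UNIV step_deriv"
  unfolding step_deriv_def[abs_def] by (intro continuous_intros)

lemma step_fun_simps: "s \<le> 1 \<Longrightarrow> step_fun s = 0" "4 \<le> s \<Longrightarrow> step_fun s = 1"
  by (auto simp: step_fun_def pospart_sq_def max_def power2_eq_square algebra_simps)

lemma step_deriv_bounds: "s \<le> 1 \<Longrightarrow> step_deriv s = 0" "4 \<le> s \<Longrightarrow> step_deriv s = 0"
  "0 \<le> step_deriv s" "step_deriv s \<le> 1"
  by (auto simp: step_deriv_def max_def)

lemma step_fun_bounds: "0 \<le> step_fun s" "step_fun s \<le> 1"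
proof -
  have mono: "step_fun a \<le> step_fun b" if "a \<le> b" for a b
    by (rule DERIV_nonneg_imp_nondecreasing[OF that]) (use step_fun_derivative step_deriv_bounds in blast)
  show "0 \<le> step_fun s" using mono[of "min 1 s" s] step_fun_simps(1)[of "min 1 s"] by simp
  show "step_fun s \<le> 1" using mono[of s "max 4 s"] step_fun_simps(2)[of "max 4 s"] by simp
qed

text \<open>Maz'ya's truncation: the gradients of the dyadic truncations live on disjoint shells, so the
  level-set bounds for the truncations add up to the strong inequality.\<close>
lemma C1c_truncation:
  fixes f :: "'a::euclidean_space \<Rightarrow> real" and j :: nat
  assumes f: "C1c UNIV f"
  defines "L \<equiv> {x. 1 / 2 ^ Suc j \<le> \<bar>f x\<bar> \<and> \<bar>f x\<bar> < 1 / 2 ^ j}"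
  defines "g \<equiv> (\<lambda>x. step_fun (4 ^ Suc j * (f x)\<^sup>2))"
  shows "C1c UNIV g" "{x. 1 / 2 ^ j \<le> \<bar>f x\<bar>} \<subseteq> {x. 1 \<le> \<bar>g x\<bar>}"
    "norm (egrad g x) \<le> 8 * 2 ^ j * norm (indicator L x *\<^sub>R egrad f x)"
proof -
  have four: "(4::real) ^ k = (2 ^ k)\<^sup>2" for k by (simp add: power2_eq_square power_mult_distrib[symmetric])
  have d: "((\<lambda>s. step_fun (4 ^ Suc j * s\<^sup>2)) has_real_derivative (step_deriv (4 ^ Suc j * s\<^sup>2) * (4 ^ Suc j * (2 * s)))) (at s)" for s
    by (rule DERIV_chain2[OF step_fun_derivative]) (auto intro!: derivative_eq_intros)
  have c: "continuous_on UNIV (\<lambda>s. step_deriv (4 ^ Suc j * s\<^sup>2) * (4 ^ Suc j * (2 * s)))"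
    by (intro continuous_intros continuous_on_compose2[OF step_deriv_cont]) auto
  note g = C1c_compose[OF f d c]
  show "C1c UNIV g" unfolding g_def using g(1) by (simp add: step_fun_simps)
  have sq: "4 ^ Suc j * (f x)\<^sup>2 = (2 ^ Suc j * \<bar>f x\<bar>)\<^sup>2" for x
    unfolding four by (simp add: power_mult_distrib)
  show "{x. 1 / 2 ^ j \<le> \<bar>f x\<bar>} \<subseteq> {x. 1 \<le> \<bar>g x\<bar>}"
  proof clarify
    fix x assume "1 / 2 ^ j \<le> \<bar>f x\<bar>"
    then have "2 \<le> 2 ^ Suc j * \<bar>f x\<bar>" by (simp add: field_simps)
    then have "2\<^sup>2 \<le> (2 ^ Suc j * \<bar>f x\<bar>)\<^sup>2" by (rule power_mono) simp
    then have "g x = 1" unfolding g_def sq by (intro step_fun_simps) simp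
    then show "1 \<le> \<bar>g x\<bar>" by simp
  qed
  have e: "egrad g x = (step_deriv (4 ^ Suc j * (f x)\<^sup>2) * (4 ^ Suc j * (2 * f x))) *\<^sub>R egrad f x"
    unfolding g_def using g(2) by (simp add: step_fun_simps)
  show "norm (egrad g x) \<le> 8 * 2 ^ j * norm (indicator L x *\<^sub>R egrad f x)"
  proof (cases "x \<in> L")
    case True
    have "\<bar>step_deriv (4 ^ Suc j * (f x)\<^sup>2)\<bar> \<le> 1" using step_deriv_bounds(3,4) by (simp add: abs_le_iff)
    moreover have "\<bar>4 ^ Suc j * (2 * f x)\<bar> \<le> 8 * 2 ^ j"
    proof -
      have "\<bar>f x\<bar> * 2 ^ j \<le> 1" using True by (simp add: L_def field_simps)
      then have "8 * 2 ^ j * (\<bar>f x\<bar> * 2 ^ j) \<le> 8 * 2 ^ j * 1" by (intro mult_left_mono) auto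
      then show ?thesis by (simp add: four abs_mult power2_eq_square mult_ac)
    qed
    ultimately have "\<bar>step_deriv (4 ^ Suc j * (f x)\<^sup>2)\<bar> * \<bar>4 ^ Suc j * (2 * f x)\<bar> \<le> 1 * (8 * 2 ^ j)"
      by (intro mult_mono) auto
    then show ?thesis unfolding e using True by (simp add: abs_mult mult_right_mono)
  next
    case False
    then have "2 ^ Suc j * \<bar>f x\<bar> < 1 \<or> 2 \<le> 2 ^ Suc j * \<bar>f x\<bar>" by (auto simp: L_def field_simps)
    then have "(2 ^ Suc j * \<bar>f x\<bar>)\<^sup>2 \<le> 1\<^sup>2 \<or> 2\<^sup>2 \<le> (2 ^ Suc j * \<bar>f x\<bar>)\<^sup>2"
      by (meson abs_ge_zero less_imp_le mult_nonneg_nonneg power_mono zero_le_numeral zero_le_power)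
    then have "step_deriv (4 ^ Suc j * (f x)\<^sup>2) = 0" unfolding sq using step_deriv_bounds(1,2) by auto
    then show ?thesis unfolding e using False by simp
  qed
qed

lemma ex_dyadic_level:
  fixes s :: real assumes "0 < s" "s < 1"
  shows "\<exists>j::nat. 1 / 2 ^ Suc j \<le> s \<and> s < 1 / 2 ^ j"
proof -
  obtain n where n: "(1 / 2) ^ n < s" using real_arch_pow_inv[OF assms(1), of "1/2"] by auto
  define m where "m = (LEAST n. 1 / 2 ^ n \<le> s)"
  have ex: "1 / 2 ^ n \<le> s" using n by (simp add: power_one_over)
  have m: "1 / 2 ^ m \<le> s" unfolding m_def by (rule LeastI[of "\<lambda>n. 1 / 2 ^ n \<le> s" n, OF ex])
  obtain j where j: "m = Suc j" using m assms(2) by (cases m) auto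
  have "\<not> 1 / 2 ^ j \<le> s" unfolding m_def[symmetric] using not_less_Least[of j "\<lambda>n. 1 / 2 ^ n \<le> s"] j m_def by auto
  then show ?thesis using m j by (intro exI[of _ j]) auto
qed

text \<open>For |f| < 1 the nonzero values fall into the dyadic shells \<open>L j\<close> with
  natural j. The weak inequality for the truncation at level j bounds the measure of
  \<open>E j\<close> by the Dirichlet integral over \<open>L j\<close> alone, and these integrals
  add up because the shells are disjoint.\<close>

lemma Sobolev_small:
  assumes N: "DIM('a::euclidean_space) \<ge> 3"
  defines "p \<equiv> crit_exp DIM('a)"
  shows "\<exists>S\<ge>0. \<forall>f :: 'a \<Rightarrow> real. C1c UNIV f \<longrightarrow> (\<forall>x. \<bar>f x\<bar> < 1) \<longrightarrow>
     (\<integral>\<^sup>+x. ennreal (\<bar>f x\<bar> powr p) \<partial>lborel) \<le> ennreal (S * sqn (egrad f) powr (p / 2))"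
proof -
  obtain C where C: "C \<ge> 0" "\<And>f :: 'a \<Rightarrow> real. C1c UNIV f \<Longrightarrow>
     emeasure lborel {x. 1 \<le> \<bar>f x\<bar>} \<le> ennreal (C * sqn (egrad f) powr (p / 2))"
    using level_set_measure_powr[where 'a='a, OF N] unfolding p_def by blast
  have p2: "p > 2" using N by (simp add: p_def crit_exp_def field_simps)
  \<comment> \<open>The power of 64 is the factor 8 of the truncated gradient raised to p; the power
    of 2 pays for passing from level j to level j + 1.\<close>
  define S where "S = C * 64 powr (p / 2) * 2 powr p"
  have "(\<integral>\<^sup>+x. ennreal (\<bar>f x\<bar> powr p) \<partial>lborel) \<le> ennreal (S * sqn (egrad f) powr (p / 2))"
    if f: "C1c UNIV f" and small: "\<And>x. \<bar>f x\<bar> < 1" for f :: "'a \<Rightarrow> real"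
  proof -
    note [measurable] = C1c_measurable[OF f]
    define L where "L j = {x. 1 / 2 ^ Suc j \<le> \<bar>f x\<bar> \<and> \<bar>f x\<bar> < 1 / 2 ^ j}" for j
    have [measurable]: "L j \<in> sets borel" for j unfolding L_def by measurable
    define E where "E j = {x. 1 / 2 ^ j \<le> \<bar>f x\<bar>}" for j
    have [measurable]: "E j \<in> sets borel" for j unfolding E_def by measurable
    define D where "D = sqn (egrad f)"
    define d where "d j = sqn (\<lambda>x. indicator (L j) x *\<^sub>R egrad f x)" for j
    have sq: "sqint (\<lambda>x. indicator (L j) x *\<^sub>R egrad f x)" and dD: "d j \<le> D" for j
      using sqint_bound[OF C1c_sqint_egrad[OF f], of "\<lambda>x. indicator (L j) x *\<^sub>R egrad f x" 1]
      by (auto simp: indicator_def d_def D_def)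
    have d0: "d j \<ge> 0" for j by (simp add: d_def)
    have Ej: "emeasure lborel (E j) \<le> ennreal (C * 64 powr (p / 2) * 2 powr (real j * p) * D powr (p / 2 - 1) * d j)" for j
    proof -
      define g where "g x = step_fun (4 ^ Suc j * (f x)\<^sup>2)" for x
      note tr = C1c_truncation[OF f, of j, folded g_def[abs_def] L_def E_def]
      have g: "C1c UNIV g" using tr(1) .
      have ng: "norm (egrad g x) \<le> 8 * 2 ^ j * norm (indicator (L j) x *\<^sub>R egrad f x)" for x
        using tr(3)[of x] .
      have "sqn (egrad g) \<le> (8 * 2 ^ j)\<^sup>2 * d j"
        unfolding d_def by (rule sqint_bound(2)[OF sq C1c_measurable(2)[OF g] ng])
      then have "sqn (egrad g) powr (p / 2) \<le> ((8 * 2 ^ j)\<^sup>2 * d j) powr (p / 2)"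
        using p2 by (intro powr_mono2) auto
      also have "\<dots> = 64 powr (p / 2) * 2 powr (real j * p) * d j powr (p / 2)"
      proof -
        have e: "((8 * 2 ^ j)\<^sup>2 * d j) = 64 * 2 powr (real j * 2) * d j"
          by (simp add: power_mult_distrib power2_eq_square powr_realpow[symmetric] powr_add[symmetric] mult.commute)
        show ?thesis unfolding e using d0[of j] by (simp add: powr_mult powr_powr)
      qed
      \<comment> \<open>Since p / 2 > 1, one factor stays linear in \<open>d j\<close> and the rest
        is bounded by the total energy; linearity is what allows summation over j.\<close>
      also have "d j powr (p / 2) \<le> D powr (p / 2 - 1) * d j"
      proof (cases "d j = 0")
        case False
        then have dp: "d j > 0" using d0[of j] by linarith
        have "d j powr (p / 2) = d j powr (p / 2 - 1) * d j" using dp by (simp add: powr_diff)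
        also have "\<dots> \<le> D powr (p / 2 - 1) * d j"
          using dp dD[of j] p2 by (intro mult_right_mono powr_mono2) auto
        finally show ?thesis .
      qed simp
      finally have b: "sqn (egrad g) powr (p / 2) \<le> 64 powr (p / 2) * 2 powr (real j * p) * (D powr (p / 2 - 1) * d j)"
        by (simp add: mult_left_mono)
      have sub: "E j \<subseteq> {x. 1 \<le> \<bar>g x\<bar>}" using tr(2) by (simp add: g_def)
      have "emeasure lborel (E j) \<le> emeasure lborel {x. 1 \<le> \<bar>g x\<bar>}"
        using sub C1c_measurable(1)[OF g] by (intro emeasure_mono) auto
      also have "\<dots> \<le> ennreal (C * sqn (egrad g) powr (p / 2))" by (rule C(2)[OF g])
      also have "\<dots> \<le> ennreal (C * (64 powr (p / 2) * 2 powr (real j * p) * (D powr (p / 2 - 1) * d j)))"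
        by (intro ennreal_leI mult_left_mono b C(1))
      finally show ?thesis by (simp add: mult_ac)
    qed
    \<comment> \<open>Writing both integrands as densities turns the summation over the shells into
      countable additivity of measures.\<close>
    define \<mu> where "\<mu> = density lborel (\<lambda>x. ennreal ((norm (egrad f x))\<^sup>2))"
    define \<nu> where "\<nu> = density lborel (\<lambda>x. ennreal (\<bar>f x\<bar> powr p))"
    have muL: "emeasure \<mu> (L j) = ennreal (d j)" for j
    proof -
      have "emeasure \<mu> (L j) = (\<integral>\<^sup>+x. ennreal ((norm (egrad f x))\<^sup>2) * indicator (L j) x \<partial>lborel)"
        unfolding \<mu>_def by (rule emeasure_density) auto
      also have "\<dots> = (\<integral>\<^sup>+x. ennreal ((norm (indicator (L j) x *\<^sub>R egrad f x))\<^sup>2) \<partial>lborel)"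
        by (intro nn_integral_cong) (auto simp: indicator_def)
      finally show ?thesis using nn_integral_sq[OF sq] by (simp add: d_def)
    qed
    \<comment> \<open>The shell \<open>L j\<close> lies in the superlevel set
      \<open>E (Suc j)\<close>, whose measure is governed by the energy on \<open>L (Suc j)\<close>.
      The index shift is harmless, since those shells are disjoint too.\<close>
    have nuL: "emeasure \<nu> (L j) \<le> ennreal (S * D powr (p / 2 - 1)) * emeasure \<mu> (L (Suc j))" for j
    proof -
      have "emeasure \<nu> (L j) = (\<integral>\<^sup>+x. ennreal (\<bar>f x\<bar> powr p) * indicator (L j) x \<partial>lborel)"
        unfolding \<nu>_def by (rule emeasure_density) auto
      also have "\<dots> \<le> (\<integral>\<^sup>+x. ennreal (2 powr (- real j * p)) * indicator (E (Suc j)) x \<partial>lborel)"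
      proof (intro nn_integral_mono)
        fix x
        show "ennreal (\<bar>f x\<bar> powr p) * indicator (L j) x \<le> ennreal (2 powr (- real j * p)) * indicator (E (Suc j)) x"
        proof (cases "x \<in> L j")
          case True
          then have "\<bar>f x\<bar> \<le> 2 powr (- real j)" by (simp add: L_def powr_minus_divide powr_realpow)
          then have "\<bar>f x\<bar> powr p \<le> (2 powr (- real j)) powr p" using p2 by (intro powr_mono2) auto
          then have "ennreal (\<bar>f x\<bar> powr p) \<le> ennreal (2 powr (- real j * p))"
            by (intro ennreal_leI) (simp add: powr_powr)
          moreover have "x \<in> E (Suc j)" using True by (simp add: L_def E_def)
          ultimately show ?thesis using True by simp
        qed simp
      qed
      also have "\<dots> = ennreal (2 powr (- real j * p)) * emeasure lborel (E (Suc j))"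
        by (subst nn_integral_cmult) auto
      also have "\<dots> \<le> ennreal (2 powr (- real j * p)) * ennreal (C * 64 powr (p / 2) * 2 powr (real (Suc j) * p) * D powr (p / 2 - 1) * d (Suc j))"
        by (intro mult_left_mono Ej) simp
      also have "\<dots> = ennreal (2 powr (- real j * p) * (C * 64 powr (p / 2) * 2 powr (real (Suc j) * p) * D powr (p / 2 - 1) * d (Suc j)))"
        using C(1) d0[of "Suc j"] by (simp add: ennreal_mult)
      also have "2 powr (- real j * p) * (C * 64 powr (p / 2) * 2 powr (real (Suc j) * p) * D powr (p / 2 - 1) * d (Suc j))
        = S * D powr (p / 2 - 1) * d (Suc j)"
      proof -
        have "2 powr (- real j * p) * 2 powr (real (Suc j) * p) = 2 powr p"
          by (simp add: powr_add[symmetric] algebra_simps)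
        then show ?thesis unfolding S_def by (simp add: mult_ac)
      qed
      also have "ennreal (S * D powr (p / 2 - 1) * d (Suc j)) = ennreal (S * D powr (p / 2 - 1)) * emeasure \<mu> (L (Suc j))"
        unfolding muL using C(1) d0[of "Suc j"] by (intro ennreal_mult) (auto simp: S_def)
      finally show ?thesis .
    qed
    have dis: "disjoint_family L"
    proof (unfold disjoint_family_on_def, intro ballI impI)
      have *: "L i \<inter> L j = {}" if "i < j" for i j
      proof -
        have "(2::real) ^ Suc i \<le> 2 ^ j" using that by (intro power_increasing) auto
        then have "1 / 2 ^ j \<le> 1 / (2::real) ^ Suc i" by (intro divide_left_mono) auto
        then show ?thesis by (auto simp: L_def)
      qed
      fix i j :: nat assume "i \<noteq> j"
      then show "L i \<inter> L j = {}" using *[of i j] *[of j i] by (cases "i < j") auto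
    qed
    have dis': "disjoint_family (\<lambda>j. L (Suc j))"
      using dis by (auto simp: disjoint_family_on_def)
    have "(\<integral>\<^sup>+x. ennreal (\<bar>f x\<bar> powr p) \<partial>lborel) = (\<integral>\<^sup>+x. ennreal (\<bar>f x\<bar> powr p) * indicator (\<Union>j. L j) x \<partial>lborel)"
    proof (rule nn_integral_cong)
      fix x
      show "ennreal (\<bar>f x\<bar> powr p) = ennreal (\<bar>f x\<bar> powr p) * indicator (\<Union>j. L j) x"
      proof (cases "f x = 0")
        case False
        then have "x \<in> (\<Union>j. L j)" using ex_dyadic_level[of "\<bar>f x\<bar>"] small[of x] by (auto simp: L_def)
        then show ?thesis by simp
      qed simp
    qed
    also have "\<dots> = emeasure \<nu> (\<Union>j. L j)"
      unfolding \<nu>_def by (rule emeasure_density[symmetric]) auto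
    also have "\<dots> = (\<Sum>j. emeasure \<nu> (L j))"
      by (rule suminf_emeasure[symmetric, OF _ dis]) (auto simp: \<nu>_def)
    also have "\<dots> \<le> (\<Sum>j. ennreal (S * D powr (p / 2 - 1)) * emeasure \<mu> (L (Suc j)))"
      by (intro suminf_le nuL) auto
    also have "\<dots> = ennreal (S * D powr (p / 2 - 1)) * emeasure \<mu> (\<Union>j. L (Suc j))"
      by (subst suminf_emeasure[symmetric, OF _ dis']) (auto simp: \<mu>_def)
    also have "\<dots> \<le> ennreal (S * D powr (p / 2 - 1)) * emeasure \<mu> (space \<mu>)"
      by (intro mult_left_mono emeasure_space) simp
    also have "emeasure \<mu> (space \<mu>) = ennreal D"
      unfolding \<mu>_def by (simp add: emeasure_density nn_integral_sq[OF C1c_sqint_egrad[OF f]] D_def)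
    also have "ennreal (S * D powr (p / 2 - 1)) * ennreal D = ennreal (S * D powr (p / 2))"
    proof (cases "D = 0")
      case False
      then have "D > 0" using sqn_nonneg[of "egrad f"] by (simp add: D_def less_le)
      then show ?thesis using C(1) by (simp add: ennreal_mult[symmetric] powr_diff S_def)
    qed simp
    finally show ?thesis by (simp add: D_def)
  qed
  moreover have "S \<ge> 0" using C(1) by (simp add: S_def)
  ultimately show ?thesis by blast
qed

text \<open>Both sides are homogeneous of degree p, and \<open>f\<close> is bounded, so a small
  multiple of it falls under \<open>Sobolev_small\<close>.\<close>

lemma Sobolev_C1c:
  assumes N: "DIM('a::euclidean_space) \<ge> 3"
  defines "p \<equiv> crit_exp DIM('a)"
  shows "\<exists>S\<ge>0. \<forall>f :: 'a \<Rightarrow> real. C1c UNIV f \<longrightarrow>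
     (\<integral>\<^sup>+x. ennreal (\<bar>f x\<bar> powr p) \<partial>lborel) \<le> ennreal (S * sqn (egrad f) powr (p / 2))"
proof -
  obtain S where S: "S \<ge> 0" "\<And>f :: 'a \<Rightarrow> real. C1c UNIV f \<Longrightarrow> (\<And>x. \<bar>f x\<bar> < 1) \<Longrightarrow>
     (\<integral>\<^sup>+x. ennreal (\<bar>f x\<bar> powr p) \<partial>lborel) \<le> ennreal (S * sqn (egrad f) powr (p / 2))"
    using Sobolev_small[where 'a='a, OF N] unfolding p_def by blast
  have "(\<integral>\<^sup>+x. ennreal (\<bar>f x\<bar> powr p) \<partial>lborel) \<le> ennreal (S * sqn (egrad f) powr (p / 2))"
    if f: "C1c UNIV f" for f :: "'a \<Rightarrow> real"
  proof -
    note [measurable] = C1c_measurable[OF f]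
    obtain B where B: "B \<ge> 0" "\<And>x. \<bar>f x\<bar> \<le> B" using C1c_bounded[OF f] by auto
    define r where "r = 1 / (B + 1)"
    have r: "r > 0" using B(1) by (simp add: r_def)
    note g = C1c_cmult[OF f, of r]
    have e: "egrad (\<lambda>x. r * f x) = (\<lambda>x. r *\<^sub>R egrad f x)" using g(2) by auto
    have "\<bar>r * f x\<bar> < 1" for x using B(1) B(2)[of x] by (simp add: r_def)
    from S(2)[OF g(1) this]
    have "(\<integral>\<^sup>+x. ennreal (\<bar>r * f x\<bar> powr p) \<partial>lborel) \<le> ennreal (S * (r\<^sup>2 * sqn (egrad f)) powr (p / 2))"
      by (simp add: e sqn_scaleR)
    also have "(r\<^sup>2 * sqn (egrad f)) powr (p / 2) = r powr p * sqn (egrad f) powr (p / 2)"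
      using r by (simp add: powr_mult powr_powr flip: powr_numeral)
    finally have "(\<integral>\<^sup>+x. ennreal (r powr p) * ennreal (\<bar>f x\<bar> powr p) \<partial>lborel)
       \<le> ennreal (r powr p) * ennreal (S * sqn (egrad f) powr (p / 2))"
      using r S(1) by (simp add: abs_mult powr_mult ennreal_mult mult_ac)
    then have "ennreal (r powr p) * (\<integral>\<^sup>+x. ennreal (\<bar>f x\<bar> powr p) \<partial>lborel)
       \<le> ennreal (r powr p) * ennreal (S * sqn (egrad f) powr (p / 2))"
      by (subst (asm) nn_integral_cmult) auto
    then show ?thesis
      using r by (subst (asm) ennreal_mult_le_mult_iff) auto
  qed
  with S(1) show ?thesis by blast
qed

subsection \<open>Hoelder's inequality and absorption of critical potentials\<close>

text \<open>Young's inequality for the functions divided by their norms. If one of the norms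
  vanishes, the product is zero almost everywhere.\<close>

lemma Hoelder_integral:
  fixes f g :: "'a \<Rightarrow> real"
  assumes [measurable]: "f \<in> borel_measurable M" "g \<in> borel_measurable M"
    and pos: "\<And>x. f x \<ge> 0" "\<And>x. g x \<ge> 0"
    and P: "P > 1" "Q > 1" "1 / P + 1 / Q = 1"
    and f: "integrable M (\<lambda>x. f x powr P)" and g: "integrable M (\<lambda>x. g x powr Q)"
  shows "integrable M (\<lambda>x. f x * g x)"
    and "(\<integral>x. f x * g x \<partial>M) \<le> (\<integral>x. f x powr P \<partial>M) powr (1 / P) * (\<integral>x. g x powr Q \<partial>M) powr (1 / Q)"
proof -
  have young: "f x * g x \<le> f x powr P / P + g x powr Q / Q" for x
    by (rule Youngs_inequality[OF P pos])
  have i0: "integrable M (\<lambda>x. f x powr P / P + g x powr Q / Q)" using f g by simp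
  show i: "integrable M (\<lambda>x. f x * g x)"
    by (rule Bochner_Integration.integrable_bound[OF i0]) (use young pos in \<open>auto intro!: AE_I2 order_trans[OF young]\<close>)
  define A where "A = (\<integral>x. f x powr P \<partial>M)"
  define B where "B = (\<integral>x. g x powr Q \<partial>M)"
  have AB: "A \<ge> 0" "B \<ge> 0" by (auto simp: A_def B_def)
  show "(\<integral>x. f x * g x \<partial>M) \<le> A powr (1 / P) * B powr (1 / Q)"
  proof (cases "A = 0 \<or> B = 0")
    case True
    have "AE x in M. f x * g x = 0"
    proof (cases "A = 0")
      case True
      then have "AE x in M. f x powr P = 0"
        using integral_nonneg_eq_0_iff_AE[OF f] by (simp add: A_def)
      then show ?thesis by eventually_elim simp
    next
      case False
      with True have "B = 0" by simp
      then have "AE x in M. g x powr Q = 0"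
        using integral_nonneg_eq_0_iff_AE[OF g] by (simp add: B_def)
      then show ?thesis by eventually_elim simp
    qed
    then have "(\<integral>x. f x * g x \<partial>M) = 0" by (rule integral_eq_zero_AE)
    then show ?thesis by simp
  next
    case False
    with AB have AB: "A > 0" "B > 0" by auto
    define a where "a = A powr (1 / P)"
    define b where "b = B powr (1 / Q)"
    have ab: "a > 0" "b > 0" "a powr P = A" "b powr Q = B"
      using AB P by (auto simp: a_def b_def powr_powr)
    have y: "f x / a * (g x / b) \<le> (1 / (P * A)) * f x powr P + (1 / (Q * B)) * g x powr Q" for x
    proof -
      have "f x / a * (g x / b) \<le> (f x / a) powr P / P + (g x / b) powr Q / Q"
        using ab pos by (intro Youngs_inequality[OF P]) auto
      also have "\<dots> = (1 / (P * A)) * f x powr P + (1 / (Q * B)) * g x powr Q"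
        using ab pos[of x] by (simp add: powr_divide mult.commute)
      finally show ?thesis .
    qed
    have "(\<integral>x. f x * g x \<partial>M) / (a * b) = (\<integral>x. f x / a * (g x / b) \<partial>M)" by simp
    also have "\<dots> \<le> (\<integral>x. (1 / (P * A)) * f x powr P + (1 / (Q * B)) * g x powr Q \<partial>M)"
      by (rule integral_mono) (use i f g y in auto)
    also have "\<dots> = 1 / P + 1 / Q"
      using f g AB by (simp add: A_def[symmetric] B_def[symmetric])
    finally show ?thesis using ab P(3) by (simp add: a_def b_def field_simps)
  qed
qed

definition Lpint :: "real \<Rightarrow> ('a::euclidean_space \<Rightarrow> real) \<Rightarrow> bool" where
  "Lpint p f \<longleftrightarrow> f \<in> borel_measurable borel \<and> integrable lborel (\<lambda>x. \<bar>f x\<bar> powr p)"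

text \<open>No root is taken, just as \<open>sqn\<close> is the squared norm:
  \<open>Lpn p f powr (2 / p)\<close> is the quantity comparable with \<open>sqn\<close>.\<close>

definition Lpn :: "real \<Rightarrow> ('a::euclidean_space \<Rightarrow> real) \<Rightarrow> real" where
  "Lpn p f = (\<integral>x. \<bar>f x\<bar> powr p \<partial>lborel)"

lemma Lpn_nonneg [simp]: "0 \<le> Lpn p f" by (simp add: Lpn_def)

lemma Lpint_measurable [measurable_dest]: "Lpint p f \<Longrightarrow> f \<in> borel_measurable borel"
  by (simp add: Lpint_def)

lemma Lpint_integrable: "Lpint p f \<Longrightarrow> integrable lborel (\<lambda>x. \<bar>f x\<bar> powr p)"
  by (simp add: Lpint_def)

text \<open>The part of \<open>Q\<close> above height n is small in L^(N / 2) for large n, by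
  dominated convergence, and Hoelder's inequality with exponents N / 2 and p / 2 makes its
  contribution a small multiple of the squared L^p norm. The part below n costs n times the squared
  L^2 norm. The constant \<open>K\<close> depends on \<open>Q\<close> and \<eta> only, not on
  \<open>z\<close>.\<close>

lemma potential_absorption:
  fixes Q :: "'a::euclidean_space \<Rightarrow> real"
  assumes N: "DIM('a) \<ge> 3" and [measurable]: "Q \<in> borel_measurable borel" and Q0: "\<And>x. Q x \<ge> 0"
    and Qi: "integrable lborel (\<lambda>x. Q x powr (real DIM('a) / 2))" and \<eta>: "\<eta> > 0"
  defines "p \<equiv> crit_exp DIM('a)"
  obtains K where "K \<ge> 0" "\<And>z. sqint z \<Longrightarrow> Lpint p z \<Longrightarrow> integrable lborel (\<lambda>x. Q x * (z x)\<^sup>2)"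
    "\<And>z. sqint z \<Longrightarrow> Lpint p z \<Longrightarrow> (\<integral>x. Q x * (z x)\<^sup>2 \<partial>lborel) \<le> K * sqn z + \<eta> * Lpn p z powr (2 / p)"
proof -
  define r where "r = real DIM('a) / 2"
  define r' where "r' = p / 2"
  have n: "real DIM('a) > 2" using N by simp
  have r: "r > 1" "r' > 1" "1 / r + 1 / r' = 1"
    using n by (auto simp: r_def r'_def p_def crit_exp_def field_simps)
  have p0: "p > 0" using n by (simp add: p_def crit_exp_def)
  define h where "h n x = indicator {x. Q x > real n} x * Q x" for n x
  have [measurable]: "h n \<in> borel_measurable borel" for n unfolding h_def by measurable
  have hb: "0 \<le> h n x" "h n x \<le> Q x" for n x using Q0[of x] by (auto simp: h_def indicator_def)
  have hi: "integrable lborel (\<lambda>x. h n x powr r)" for n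
    by (rule Bochner_Integration.integrable_bound[OF Qi])
       (use hb r in \<open>auto intro!: AE_I2 powr_mono2 simp: r_def\<close>)
  have "(\<lambda>n. \<integral>x. h n x powr r \<partial>lborel) \<longlonglongrightarrow> (\<integral>x. 0 \<partial>(lborel :: 'a measure))"
  proof (rule integral_dominated_convergence[where w = "\<lambda>x. Q x powr r"])
    show "integrable lborel (\<lambda>x. Q x powr r)" using Qi by (simp add: r_def)
    show "AE x in lborel. (\<lambda>n. h n x powr r) \<longlonglongrightarrow> 0"
    proof (rule AE_I2)
      fix x
      obtain m :: nat where m: "Q x \<le> real m" using real_arch_simple by blast
      have "eventually (\<lambda>n. h n x powr r = 0) sequentially"
        using eventually_ge_at_top[of m] by eventually_elim (use m in \<open>auto simp: h_def indicator_def\<close>)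
      then show "(\<lambda>n. h n x powr r) \<longlonglongrightarrow> 0" by (rule tendsto_eventually)
    qed
    show "AE x in lborel. norm (h n x powr r) \<le> Q x powr r" for n
      using hb r by (auto intro!: AE_I2 powr_mono2)
  qed auto
  then have "(\<lambda>n. (\<integral>x. h n x powr r \<partial>lborel) powr (1 / r)) \<longlonglongrightarrow> 0 powr (1 / r)"
    using r by (intro tendsto_powr2 tendsto_const) auto
  then have "eventually (\<lambda>n. (\<integral>x. h n x powr r \<partial>lborel) powr (1 / r) < \<eta>) sequentially"
    using \<eta> by (intro order_tendstoD(2)) auto
  then obtain n where nn: "(\<integral>x. h n x powr r \<partial>lborel) powr (1 / r) < \<eta>"
    using eventually_happens by force
  have main: "integrable lborel (\<lambda>x. Q x * (z x)\<^sup>2) \<and>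
      (\<integral>x. Q x * (z x)\<^sup>2 \<partial>lborel) \<le> real n * sqn z + \<eta> * Lpn p z powr (2 / p)"
    if z: "sqint z" "Lpint p z" for z
  proof -
    have [measurable]: "z \<in> borel_measurable borel" using z by auto
    have e: "((z x)\<^sup>2) powr r' = \<bar>z x\<bar> powr p" for x
    proof -
      have "\<bar>z x\<bar> powr 2 = (z x)\<^sup>2" by (cases "z x = 0") (auto simp: powr_numeral)
      then show ?thesis using powr_powr[of "\<bar>z x\<bar>" 2 r'] by (simp add: r'_def)
    qed
    have zi: "integrable lborel (\<lambda>x. ((z x)\<^sup>2) powr r')" unfolding e using z by (simp add: Lpint_def)
    note ho = Hoelder_integral[of "h n" lborel "\<lambda>x. (z x)\<^sup>2", OF _ _ hb(1) _ r hi zi]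
    have i1: "integrable lborel (\<lambda>x. h n x * (z x)\<^sup>2)" by (rule ho(1)) auto
    have b1: "(\<integral>x. h n x * (z x)\<^sup>2 \<partial>lborel) \<le> \<eta> * Lpn p z powr (2 / p)"
    proof -
      have "(\<integral>x. h n x * (z x)\<^sup>2 \<partial>lborel) \<le> (\<integral>x. h n x powr r \<partial>lborel) powr (1 / r) * Lpn p z powr (1 / r')"
        using ho(2) unfolding e Lpn_def by simp
      also have "\<dots> \<le> \<eta> * Lpn p z powr (1 / r')" using nn by (intro mult_right_mono) auto
      finally show ?thesis by (simp add: r'_def)
    qed
    have i2: "integrable lborel (\<lambda>x. real n * (z x)\<^sup>2)" using sqint_integrable[OF z(1)] by simp
    have pt: "Q x * (z x)\<^sup>2 \<le> real n * (z x)\<^sup>2 + h n x * (z x)\<^sup>2" for x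
      by (cases "Q x > real n") (auto simp: h_def intro: mult_right_mono)
    have i3: "integrable lborel (\<lambda>x. Q x * (z x)\<^sup>2)"
      by (rule Bochner_Integration.integrable_bound[OF Bochner_Integration.integrable_add[OF i2 i1]])
         (use pt Q0 hb in \<open>auto intro!: AE_I2 order_trans[OF pt] simp: abs_mult\<close>)
    have "(\<integral>x. Q x * (z x)\<^sup>2 \<partial>lborel) \<le> (\<integral>x. real n * (z x)\<^sup>2 + h n x * (z x)\<^sup>2 \<partial>lborel)"
      by (rule integral_mono[OF i3]) (use i1 i2 pt in auto)
    also have "\<dots> = real n * sqn z + (\<integral>x. h n x * (z x)\<^sup>2 \<partial>lborel)"
      using i1 sqint_integrable[OF z(1)] by (simp add: sqn_def)
    finally show ?thesis using i3 b1 by simp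
  qed
  show ?thesis by (rule that[of "real n"]) (use main in auto)
qed

subsection \<open>The closure of the test functions in the Dirichlet norm\<close>

text \<open>The gradient is carried along as the L^2 limit of the gradients of the same
  approximating sequence, in place of a theory of weak derivatives. The pair is determined only up
  to null sets, so vanishing outside \<open>U\<close> has to be stated separately where pointwise
  values are used.\<close>

definition H10 :: "'a::euclidean_space set \<Rightarrow> ('a \<Rightarrow> real) \<Rightarrow> ('a \<Rightarrow> 'a) \<Rightarrow> bool" where
  "H10 U z Z \<longleftrightarrow> sqint z \<and> sqint Z \<and> (\<exists>f. (\<forall>k::nat. C1c U (f k)) \<and>
     (\<lambda>k. sqn (\<lambda>x. f k x - z x)) \<longlonglongrightarrow> 0 \<and> (\<lambda>k. sqn (\<lambda>x. egrad (f k) x - Z x)) \<longlonglongrightarrow> 0)"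

lemma H10D: "H10 U z Z \<Longrightarrow> sqint z" "H10 U z Z \<Longrightarrow> sqint Z"
  by (auto simp: H10_def)

lemma H10_approx:
  assumes "H10 U z Z"
  obtains f where "\<And>k::nat. C1c U (f k)" "(\<lambda>k. sqn (\<lambda>x. f k x - z x)) \<longlonglongrightarrow> 0"
    "(\<lambda>k. sqn (\<lambda>x. egrad (f k) x - Z x)) \<longlonglongrightarrow> 0"
  using assms unfolding H10_def by blast

lemma H10_mono: "H10 U z Z \<Longrightarrow> U \<subseteq> V \<Longrightarrow> H10 V z Z"
  unfolding H10_def using C1c_mono by blast

lemma H10_C1c: "C1c U f \<Longrightarrow> H10 U f (egrad f)"
  unfolding H10_def using C1c_sqint C1c_sqint_egrad
  by (auto intro!: exI[of _ "\<lambda>k. f"] simp: sqn_def)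

lemma tendsto_sqn_lincomb:
  fixes fs gs :: "nat \<Rightarrow> 'a::euclidean_space \<Rightarrow> 'b::euclidean_space"
  assumes "\<And>k. sqint (\<lambda>x. fs k x)" "\<And>k. sqint (\<lambda>x. gs k x)"
    and "(\<lambda>k. sqn (fs k)) \<longlonglongrightarrow> 0" "(\<lambda>k. sqn (gs k)) \<longlonglongrightarrow> 0"
  shows "(\<lambda>k. sqn (\<lambda>x. r *\<^sub>R fs k x + s *\<^sub>R gs k x)) \<longlonglongrightarrow> 0"
proof (rule tendsto_sandwich[of "\<lambda>k. 0"])
  show "\<forall>\<^sub>F k in sequentially. sqn (\<lambda>x. r *\<^sub>R fs k x + s *\<^sub>R gs k x) \<le> 2 * (r\<^sup>2 * sqn (fs k)) + 2 * (s\<^sup>2 * sqn (gs k))"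
    using sqint_add(2)[OF sqint_scaleR[OF assms(1)] sqint_scaleR[OF assms(2)]]
    by (intro always_eventually allI) (simp add: sqn_scaleR)
  have "(\<lambda>k. 2 * (r\<^sup>2 * sqn (fs k)) + 2 * (s\<^sup>2 * sqn (gs k))) \<longlonglongrightarrow> 2 * (r\<^sup>2 * 0) + 2 * (s\<^sup>2 * 0)"
    by (intro tendsto_intros assms)
  then show "(\<lambda>k. 2 * (r\<^sup>2 * sqn (fs k)) + 2 * (s\<^sup>2 * sqn (gs k))) \<longlonglongrightarrow> 0" by simp
qed auto

lemma H10_lincomb:
  assumes f: "H10 U f F" and g: "H10 U g G"
  shows "H10 U (\<lambda>x. r * f x + s * g x) (\<lambda>x. r *\<^sub>R F x + s *\<^sub>R G x)"
proof -
  obtain fs where fs: "\<And>k::nat. C1c U (fs k)" "(\<lambda>k. sqn (\<lambda>x. fs k x - f x)) \<longlonglongrightarrow> 0"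
    "(\<lambda>k. sqn (\<lambda>x. egrad (fs k) x - F x)) \<longlonglongrightarrow> 0" using H10_approx[OF f] by blast
  obtain gs where gs: "\<And>k::nat. C1c U (gs k)" "(\<lambda>k. sqn (\<lambda>x. gs k x - g x)) \<longlonglongrightarrow> 0"
    "(\<lambda>k. sqn (\<lambda>x. egrad (gs k) x - G x)) \<longlonglongrightarrow> 0" using H10_approx[OF g] by blast
  note s = H10D[OF f] H10D[OF g]
  define hs where "hs k x = r * fs k x + s * gs k x" for k x
  have hs: "C1c U (hs k)" "egrad (hs k) x = r *\<^sub>R egrad (fs k) x + s *\<^sub>R egrad (gs k) x" for k x
    unfolding hs_def using C1c_lincomb[OF fs(1) gs(1)] by auto
  have "(\<lambda>k. sqn (\<lambda>x. r *\<^sub>R (fs k x - f x) + s *\<^sub>R (gs k x - g x))) \<longlonglongrightarrow> 0"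
    by (rule tendsto_sqn_lincomb) (use fs gs s in \<open>auto intro!: sqint_diff(1) intro: C1c_sqint\<close>)
  moreover have "r *\<^sub>R (fs k x - f x) + s *\<^sub>R (gs k x - g x) = hs k x - (r * f x + s * g x)" for k x
    by (simp add: hs_def algebra_simps)
  moreover have "(\<lambda>k. sqn (\<lambda>x. r *\<^sub>R (egrad (fs k) x - F x) + s *\<^sub>R (egrad (gs k) x - G x))) \<longlonglongrightarrow> 0"
    by (rule tendsto_sqn_lincomb) (use fs gs s in \<open>auto intro!: sqint_diff(1) intro: C1c_sqint_egrad\<close>)
  moreover have "r *\<^sub>R (egrad (fs k) x - F x) + s *\<^sub>R (egrad (gs k) x - G x) = egrad (hs k) x - (r *\<^sub>R F x + s *\<^sub>R G x)" for k x
    by (simp add: hs algebra_simps)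
  moreover have "sqint (\<lambda>x. r * f x + s * g x)" "sqint (\<lambda>x. r *\<^sub>R F x + s *\<^sub>R G x)"
    using s by (auto intro!: sqint_add sqint_scaleR sqint_cmult)
  ultimately show ?thesis unfolding H10_def using hs(1) by auto
qed

lemma H10_diff:
  assumes "H10 U f F" "H10 U g G"
  shows "H10 U (\<lambda>x. f x - g x) (\<lambda>x. F x - G x)"
  using H10_lincomb[OF assms, of 1 "-1"] by simp

lemma H10_cmult:
  assumes "H10 U f F"
  shows "H10 U (\<lambda>x. r * f x) (\<lambda>x. r *\<^sub>R F x)"
  using H10_lincomb[OF assms assms, of r 0] by simp

lemma H10_affine:
  assumes z: "H10 U z Z" and c: "c > 0" and UV: "\<And>y. y \<in> U \<Longrightarrow> (1 / c) *\<^sub>R (y - t) \<in> V"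
  shows "H10 V (\<lambda>x. z (t + c *\<^sub>R x)) (\<lambda>x. c *\<^sub>R Z (t + c *\<^sub>R x))"
proof -
  obtain f where f: "\<And>k::nat. C1c U (f k)" "(\<lambda>k. sqn (\<lambda>x. f k x - z x)) \<longlonglongrightarrow> 0"
    "(\<lambda>k. sqn (\<lambda>x. egrad (f k) x - Z x)) \<longlonglongrightarrow> 0" using H10_approx[OF z] by blast
  have s: "sqint (\<lambda>x. f k x - z x)" "sqint (\<lambda>x. egrad (f k) x - Z x)" for k
    using sqint_diff(1)[OF C1c_sqint[OF f(1)] H10D(1)[OF z]]
      sqint_diff(1)[OF C1c_sqint_egrad[OF f(1)] H10D(2)[OF z]] by auto
  define h where "h k x = f k (t + c *\<^sub>R x)" for k x
  have h: "C1c V (h k)" "egrad (h k) x = c *\<^sub>R egrad (f k) (t + c *\<^sub>R x)" for k x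
    unfolding h_def using C1c_affine[OF f(1) c UV] by auto
  have e1: "sqn (\<lambda>x. h k x - z (t + c *\<^sub>R x)) = sqn (\<lambda>x. f k x - z x) / c ^ DIM('a)" for k
    using sqint_affine(2)[OF s(1) c, of k t] by (simp add: h_def)
  have e2: "sqn (\<lambda>x. egrad (h k) x - c *\<^sub>R Z (t + c *\<^sub>R x)) = c\<^sup>2 * sqn (\<lambda>x. egrad (f k) x - Z x) / c ^ DIM('a)" for k
    using sqint_affine(2)[OF s(2) c, of k t] sqn_scaleR[of c "\<lambda>x. egrad (f k) (t + c *\<^sub>R x) - Z (t + c *\<^sub>R x)"]
    by (simp add: h scaleR_diff_right)
  have "(\<lambda>k. sqn (\<lambda>x. h k x - z (t + c *\<^sub>R x))) \<longlonglongrightarrow> 0"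
    unfolding e1 using tendsto_divide[OF f(2) tendsto_const[of "c ^ DIM('a)"]] c by simp
  moreover have "(\<lambda>k. sqn (\<lambda>x. egrad (h k) x - c *\<^sub>R Z (t + c *\<^sub>R x))) \<longlonglongrightarrow> 0"
    unfolding e2 using tendsto_divide[OF tendsto_mult[OF tendsto_const[of "c\<^sup>2"] f(3)] tendsto_const[of "c ^ DIM('a)"]] c by simp
  ultimately show ?thesis
    unfolding H10_def using h(1) sqint_affine(1)[OF H10D(1)[OF z] c, of t]
      sqint_scaleR[OF sqint_affine(1)[OF H10D(2)[OF z] c, of t]] by blast
qed

lemma sqn_tendsto_AE_subseq:
  fixes f :: "nat \<Rightarrow> 'a::euclidean_space \<Rightarrow> real"
  assumes "\<And>k. sqint (\<lambda>x. f k x - z x)" "(\<lambda>k. sqn (\<lambda>x. f k x - z x)) \<longlonglongrightarrow> 0"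
  obtains r :: "nat \<Rightarrow> nat" where "strict_mono r" "AE x in lborel. (\<lambda>n. f (r n) x) \<longlonglongrightarrow> z x"
proof -
  obtain r :: "nat \<Rightarrow> nat" where r: "strict_mono r" "AE x in lborel. (\<lambda>n. (norm (f (r n) x - z x))\<^sup>2) \<longlonglongrightarrow> 0"
    using tendsto_L1_AE_subseq[of lborel "\<lambda>k x. (norm (f k x - z x))\<^sup>2"] sqint_integrable[OF assms(1)] assms(2)
    unfolding sqn_def by auto
  have "AE x in lborel. (\<lambda>n. f (r n) x) \<longlonglongrightarrow> z x"
    using r(2)
  proof eventually_elim
    case (elim x)
    then have "(\<lambda>n. sqrt ((norm (f (r n) x - z x))\<^sup>2)) \<longlonglongrightarrow> sqrt 0" by (rule tendsto_real_sqrt)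
    then have "(\<lambda>n. norm (f (r n) x - z x)) \<longlonglongrightarrow> 0" by simp
    then have "(\<lambda>n. f (r n) x - z x) \<longlonglongrightarrow> 0" by (rule tendsto_norm_zero_cancel)
    then show ?case by (simp add: LIM_zero_iff)
  qed
  with r(1) show ?thesis by (rule that)
qed

text \<open>A bound by the Dirichlet norm passes from C^1 functions to the closure along an almost
  everywhere convergent subsequence. The dependence of \<Phi> on the point admits a singular weight,
  as in Hardy's inequality.\<close>

lemma H10_Fatou:
  assumes z: "H10 U z Z"
    and b: "\<And>f. C1c U f \<Longrightarrow> (\<integral>\<^sup>+x. ennreal (\<Phi> x (f x)) \<partial>lborel) \<le> ennreal (c (sqn (egrad f)))"
    and \<Phi>m: "\<And>f. f \<in> borel_measurable borel \<Longrightarrow> (\<lambda>x. \<Phi> x (f x)) \<in> borel_measurable borel"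
    and \<Phi>c: "\<And>x. continuous_on UNIV (\<Phi> x)" and c: "continuous_on {0..} c"
  shows "(\<integral>\<^sup>+x. ennreal (\<Phi> x (z x)) \<partial>lborel) \<le> ennreal (c (sqn Z))"
proof -
  obtain f where f: "\<And>k::nat. C1c U (f k)" "(\<lambda>k. sqn (\<lambda>x. f k x - z x)) \<longlonglongrightarrow> 0"
    "(\<lambda>k. sqn (\<lambda>x. egrad (f k) x - Z x)) \<longlonglongrightarrow> 0" using H10_approx[OF z] by blast
  have s: "sqint (\<lambda>x. f k x - z x)" for k
    by (rule sqint_diff(1)[OF C1c_sqint[OF f(1)] H10D(1)[OF z]])
  obtain r :: "nat \<Rightarrow> nat" where r: "strict_mono r" and ae: "AE x in lborel. (\<lambda>n. f (r n) x) \<longlonglongrightarrow> z x"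
    by (rule sqn_tendsto_AE_subseq[OF s f(2)])
  have "(\<integral>\<^sup>+x. ennreal (\<Phi> x (z x)) \<partial>lborel) = (\<integral>\<^sup>+x. liminf (\<lambda>n. ennreal (\<Phi> x (f (r n) x))) \<partial>lborel)"
  proof (rule nn_integral_cong_AE)
    show "AE x in lborel. ennreal (\<Phi> x (z x)) = liminf (\<lambda>n. ennreal (\<Phi> x (f (r n) x)))"
      using ae
    proof eventually_elim
      case (elim x)
      have "isCont (\<Phi> x) (z x)" using \<Phi>c[of x] by (simp add: continuous_on_eq_continuous_at)
      then have "(\<lambda>n. \<Phi> x (f (r n) x)) \<longlonglongrightarrow> \<Phi> x (z x)" using elim by (rule isCont_tendsto_compose)
      then have "(\<lambda>n. ennreal (\<Phi> x (f (r n) x))) \<longlonglongrightarrow> ennreal (\<Phi> x (z x))" by simp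
      then show ?case by (intro lim_imp_Liminf[symmetric]) auto
    qed
  qed
  also have "\<dots> \<le> liminf (\<lambda>n. \<integral>\<^sup>+x. ennreal (\<Phi> x (f (r n) x)) \<partial>lborel)"
    using \<Phi>m[OF C1c_measurable(1)[OF f(1)]] by (intro nn_integral_liminf) auto
  also have "\<dots> \<le> liminf (\<lambda>n. ennreal (c (sqn (egrad (f (r n))))))"
    by (intro Liminf_mono always_eventually allI b f(1))
  also have "\<dots> = ennreal (c (sqn Z))"
  proof (rule lim_imp_Liminf)
    have "(\<lambda>k. sqn (egrad (f k))) \<longlonglongrightarrow> sqn Z"
      by (rule tendsto_sqn[OF H10D(2)[OF z] C1c_sqint_egrad[OF f(1)] f(3)])
    then have "(\<lambda>n. sqn (egrad (f (r n)))) \<longlonglongrightarrow> sqn Z"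
      using LIMSEQ_subseq_LIMSEQ[OF _ r(1)] by (auto simp: o_def)
    then have "(\<lambda>n. c (sqn (egrad (f (r n))))) \<longlonglongrightarrow> c (sqn Z)"
      by (rule continuous_on_tendsto_compose[OF c]) auto
    then show "(\<lambda>n. ennreal (c (sqn (egrad (f (r n)))))) \<longlonglongrightarrow> ennreal (c (sqn Z))" by simp
  qed simp
  finally show ?thesis .
qed

lemma H10_Sobolev:
  assumes N: "DIM('a::euclidean_space) \<ge> 3"
  defines "p \<equiv> crit_exp DIM('a)"
  obtains S where "S > 0" "\<And>U (z :: 'a \<Rightarrow> real) Z. H10 U z Z \<Longrightarrow> Lpint p z"
    "\<And>U (z :: 'a \<Rightarrow> real) Z. H10 U z Z \<Longrightarrow> Lpn p z powr (2 / p) \<le> S * sqn Z"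
proof -
  obtain S where S: "S \<ge> 0" "\<And>f :: 'a \<Rightarrow> real. C1c UNIV f \<Longrightarrow>
     (\<integral>\<^sup>+x. ennreal (\<bar>f x\<bar> powr p) \<partial>lborel) \<le> ennreal (S * sqn (egrad f) powr (p / 2))"
    using Sobolev_C1c[where 'a='a, OF N] unfolding p_def by blast
  have p2: "p > 2" using N by (simp add: p_def crit_exp_def field_simps)
  \<comment> \<open>S + 1 instead of S keeps the constant positive, since later choices divide by
    it.\<close>
  define S' where "S' = (S + 1) powr (2 / p)"
  have main: "Lpint p z \<and> Lpn p z powr (2 / p) \<le> S' * sqn Z" if z: "H10 U z Z" for U and z :: "'a \<Rightarrow> real" and Z
  proof -
    have [measurable]: "z \<in> borel_measurable borel" using H10D(1)[OF z] by auto
    have b: "(\<integral>\<^sup>+x. ennreal (\<bar>z x\<bar> powr p) \<partial>lborel) \<le> ennreal ((S + 1) * sqn Z powr (p / 2))"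
    proof (rule H10_Fatou[OF z, where \<Phi> = "\<lambda>x s. \<bar>s\<bar> powr p" and c = "\<lambda>t. (S + 1) * t powr (p / 2)"])
      fix f assume "C1c U f"
      then have "C1c UNIV f" by (rule C1c_mono) simp
      from S(2)[OF this] show "(\<integral>\<^sup>+x. ennreal (\<bar>f x\<bar> powr p) \<partial>lborel) \<le> ennreal ((S + 1) * sqn (egrad f) powr (p / 2))"
        by (rule order_trans) (auto intro!: ennreal_leI mult_right_mono)
    next
      show "continuous_on UNIV (\<lambda>s::real. \<bar>s\<bar> powr p)"
        using p2 by (intro continuous_on_powr' continuous_intros) auto
      show "continuous_on {0..} (\<lambda>t. (S + 1) * t powr (p / 2))"
        using p2 by (intro continuous_intros continuous_on_powr') auto
    qed measurable
    have i: "integrable lborel (\<lambda>x. \<bar>z x\<bar> powr p)"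
      by (rule integrableI_bounded) (use b in \<open>auto simp: le_less_trans\<close>)
    have "Lpn p z \<le> (S + 1) * sqn Z powr (p / 2)"
      using b S(1) nn_integral_eq_integral[OF i] by (simp add: Lpn_def)
    then have "Lpn p z powr (2 / p) \<le> ((S + 1) * sqn Z powr (p / 2)) powr (2 / p)"
      using p2 by (intro powr_mono2) auto
    also have "\<dots> = S' * sqn Z" using S(1) p2 by (simp add: powr_mult S'_def powr_powr)
    finally show ?thesis using i by (simp add: Lpint_def)
  qed
  have "S' > 0" using S(1) by (simp add: S'_def)
  then show ?thesis using that[of S'] main by blast
qed

lemma tendsto_sqn_inner_const:
  fixes Fs :: "nat \<Rightarrow> 'a::euclidean_space \<Rightarrow> 'b::euclidean_space"
  assumes "\<And>k. sqint (Fs k)" "sqint F" "(\<lambda>k. sqn (\<lambda>x. Fs k x - F x)) \<longlonglongrightarrow> 0"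
  shows "(\<lambda>k. sqn (\<lambda>x. Fs k x \<bullet> b - F x \<bullet> b)) \<longlonglongrightarrow> 0"
proof (rule tendsto_sandwich[of "\<lambda>k. 0"])
  show "\<forall>\<^sub>F k in sequentially. sqn (\<lambda>x. Fs k x \<bullet> b - F x \<bullet> b) \<le> (norm b)\<^sup>2 * sqn (\<lambda>x. Fs k x - F x)"
    using sqint_inner_const(2)[OF sqint_diff(1)[OF assms(1,2)]]
    by (intro always_eventually allI) (simp add: inner_diff_left)
  show "(\<lambda>k. (norm b)\<^sup>2 * sqn (\<lambda>x. Fs k x - F x)) \<longlonglongrightarrow> 0"
    using tendsto_mult[OF tendsto_const assms(3)] by simp
qed auto

lemma H10_by_parts:
  assumes f: "H10 U f F" and g: "H10 V g G" and U: "open U"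
  shows "(\<integral>x. f x * (G x \<bullet> b) \<partial>lborel) = - (\<integral>x. (F x \<bullet> b) * g x \<partial>lborel)"
proof -
  obtain fs where fs: "\<And>k::nat. C1c U (fs k)" "(\<lambda>k. sqn (\<lambda>x. fs k x - f x)) \<longlonglongrightarrow> 0"
    "(\<lambda>k. sqn (\<lambda>x. egrad (fs k) x - F x)) \<longlonglongrightarrow> 0" using H10_approx[OF f] by blast
  obtain gs where gs: "\<And>k::nat. C1c V (gs k)" "(\<lambda>k. sqn (\<lambda>x. gs k x - g x)) \<longlonglongrightarrow> 0"
    "(\<lambda>k. sqn (\<lambda>x. egrad (gs k) x - G x)) \<longlonglongrightarrow> 0" using H10_approx[OF g] by blast
  note si = C1c_sqint_egrad[OF fs(1)] C1c_sqint_egrad[OF gs(1)] H10D[OF f] H10D[OF g] C1c_sqint[OF fs(1)] C1c_sqint[OF gs(1)]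
  have "(\<lambda>k. \<integral>x. fs k x \<bullet> (egrad (gs k) x \<bullet> b) \<partial>lborel) \<longlonglongrightarrow> (\<integral>x. f x \<bullet> (G x \<bullet> b) \<partial>lborel)"
    by (rule tendsto_integral_inner) (use fs gs si in \<open>auto intro!: tendsto_sqn_inner_const sqint_inner_const\<close>)
  moreover have "(\<lambda>k. \<integral>x. (egrad (fs k) x \<bullet> b) \<bullet> gs k x \<partial>lborel) \<longlonglongrightarrow> (\<integral>x. (F x \<bullet> b) \<bullet> g x \<partial>lborel)"
    by (rule tendsto_integral_inner) (use fs gs si in \<open>auto intro!: tendsto_sqn_inner_const sqint_inner_const\<close>)
  then have "(\<lambda>k. - (\<integral>x. (egrad (fs k) x \<bullet> b) \<bullet> gs k x \<partial>lborel)) \<longlonglongrightarrow> - (\<integral>x. (F x \<bullet> b) \<bullet> g x \<partial>lborel)"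
    by (rule tendsto_minus)
  ultimately show ?thesis
    using C1c_integral_by_parts[OF fs(1) gs(1) U] LIMSEQ_unique by auto
qed

subsection \<open>Mollification: \<open>C\<^sup>1\<close> functions of compact support are limits of test functions\<close>

text \<open>The powers of 1 / s make the family closed, up to linear combinations, under
  differentiation; j = 0 is the classical flat function.\<close>

definition bump_exp :: "nat \<Rightarrow> real \<Rightarrow> real" where
  "bump_exp j s = (if s > 0 then exp (- 1 / s) / s ^ j else 0)"

lemma bump_exp_tendsto_0: "((\<lambda>s. bump_exp j s) \<longlongrightarrow> 0) (at 0)"
proof (rule filterlim_split_at)
  have "((\<lambda>s::real. (inverse s) ^ j / exp (inverse s)) \<longlongrightarrow> 0) (at_right 0)"
    by (rule filterlim_compose[OF tendsto_power_div_exp_0 filterlim_inverse_at_top_right])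
  then show "(bump_exp j \<longlongrightarrow> 0) (at_right 0)"
    by (rule Lim_transform_eventually)
       (auto simp: bump_exp_def eventually_at_filter exp_minus divide_simps power_one_over)
  show "(bump_exp j \<longlongrightarrow> 0) (at_left 0)"
    by (rule tendsto_eventually) (auto simp: bump_exp_def eventually_at_filter)
qed

lemma bump_exp_derivative:
  "(bump_exp j has_real_derivative bump_exp (j + 2) s - real j * bump_exp (j + 1) s) (at s)"
proof -
  consider "s > 0" | "s < 0" | "s = 0" by linarith
  then show ?thesis
  proof cases
    case 1
    have "((\<lambda>s. exp (- 1 / s) * inverse s ^ j) has_real_derivative
        exp (- 1 / s) * (1 / s\<^sup>2) * inverse s ^ j + exp (- 1 / s) * (real j * inverse s ^ (j - 1) * (- (1 / s\<^sup>2)))) (at s)"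
      using 1 by (auto intro!: derivative_eq_intros simp: power2_eq_square field_simps) (cases j, auto)
    also have "exp (- 1 / s) * (1 / s\<^sup>2) * inverse s ^ j + exp (- 1 / s) * (real j * inverse s ^ (j - 1) * (- (1 / s\<^sup>2)))
        = bump_exp (j + 2) s - real j * bump_exp (j + 1) s"
      using 1 by (cases j) (auto simp: bump_exp_def power2_eq_square field_simps)
    finally show ?thesis
      by (rule has_field_derivative_transform_within_open[where S = "{0<..}"])
         (use 1 in \<open>auto simp: bump_exp_def field_simps\<close>)
  next
    case 2
    have "((\<lambda>s. 0) has_real_derivative bump_exp (j + 2) s - real j * bump_exp (j + 1) s) (at s)"
      using 2 by (simp add: bump_exp_def)
    then show ?thesis
      by (rule has_field_derivative_transform_within_open[where S = "{..<0}"]) (use 2 in \<open>auto simp: bump_exp_def\<close>)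
  next
    case 3
    have "((\<lambda>h. bump_exp (Suc j) h) \<longlongrightarrow> 0) (at 0)" by (rule bump_exp_tendsto_0)
    \<comment> \<open>At the origin the difference quotient of a member is again a member, with j
      raised by one, so the limit already computed is the derivative.\<close>
    moreover have "bump_exp (Suc j) h = (bump_exp j (0 + h) - bump_exp j 0) / h" for h
      by (auto simp: bump_exp_def)
    ultimately show ?thesis
      using 3 unfolding DERIV_def by (simp add: bump_exp_def)
  qed
qed

text \<open>Closed under partial derivatives, which makes all members smooth.\<close>
inductive_set bump_class :: "('a::euclidean_space \<Rightarrow> real) set" where
  base: "(\<lambda>x. bump_exp j (1 - x \<bullet> x)) \<in> bump_class"
| mult: "f \<in> bump_class \<Longrightarrow> (\<lambda>x. (x \<bullet> b) * f x) \<in> bump_class"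
| add: "f \<in> bump_class \<Longrightarrow> g \<in> bump_class \<Longrightarrow> (\<lambda>x. f x + g x) \<in> bump_class"
| scale: "f \<in> bump_class \<Longrightarrow> (\<lambda>x. c * f x) \<in> bump_class"

lemma bump_class_derivative:
  assumes "f \<in> bump_class"
  shows "\<exists>f'. (\<forall>x. (f has_derivative f' x) (at x)) \<and> (\<forall>b. (\<lambda>x. f' x b) \<in> bump_class)"
  using assms
proof induction
  case (base j)
  let ?g = "\<lambda>x::'a. bump_exp (j + 2) (1 - x \<bullet> x) - real j * bump_exp (j + 1) (1 - x \<bullet> x)"
  let ?f' = "\<lambda>(x::'a) h. ?g x * (- (2 * (x \<bullet> h)))"
  have "((\<lambda>x. bump_exp j (1 - x \<bullet> x)) has_derivative ?f' x) (at x)" for x :: 'a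
  proof -
    have d1: "((\<lambda>x. 1 - x \<bullet> x) has_derivative (\<lambda>h. - (2 * (x \<bullet> h)))) (at x)"
      by (rule has_derivative_eq_rhs, (rule derivative_intros)+) (simp add: inner_commute)
    have d2: "(bump_exp j has_derivative (\<lambda>h. ?g x * h)) (at (1 - x \<bullet> x))"
      using bump_exp_derivative[of j "1 - x \<bullet> x"] by (simp add: has_field_derivative_def)
    show ?thesis using has_derivative_compose[OF d1 d2] by simp
  qed
  moreover have "(\<lambda>x. ?f' x b) \<in> bump_class" for b
  proof -
    have "(\<lambda>x::'a. (x \<bullet> b) * (- 2 * bump_exp (j + 2) (1 - x \<bullet> x) + (2 * real j) * bump_exp (j + 1) (1 - x \<bullet> x))) \<in> bump_class"
      by (intro bump_class.mult bump_class.add bump_class.scale bump_class.base)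
    also have "(\<lambda>x::'a. (x \<bullet> b) * (- 2 * bump_exp (j + 2) (1 - x \<bullet> x) + (2 * real j) * bump_exp (j + 1) (1 - x \<bullet> x))) = (\<lambda>x. ?f' x b)"
      by (auto simp: algebra_simps)
    finally show ?thesis .
  qed
  ultimately show ?case by (intro exI[of _ ?f'] conjI allI)
next
  case (mult f c)
  then obtain f' where f': "\<And>x. (f has_derivative f' x) (at x)" "\<And>b. (\<lambda>x. f' x b) \<in> bump_class" by blast
  have "((\<lambda>x. (x \<bullet> c) * f x) has_derivative (\<lambda>h. (x \<bullet> c) * f' x h + (h \<bullet> c) * f x)) (at x)" for x
    by (rule has_derivative_eq_rhs, (rule derivative_intros f'(1))+) simp
  moreover have "(\<lambda>x. (x \<bullet> c) * f' x b + (b \<bullet> c) * f x) \<in> bump_class" for b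
    by (intro bump_class.mult bump_class.add bump_class.scale f' mult.hyps)
  ultimately show ?case by (intro exI[of _ "\<lambda>x h. (x \<bullet> c) * f' x h + (h \<bullet> c) * f x"]) auto
next
  case (add f g)
  then obtain f' g' where f': "\<And>x. (f has_derivative f' x) (at x)" "\<And>b. (\<lambda>x. f' x b) \<in> bump_class"
    and g': "\<And>x. (g has_derivative g' x) (at x)" "\<And>b. (\<lambda>x. g' x b) \<in> bump_class" by blast
  show ?case
    by (intro exI[of _ "\<lambda>x h. f' x h + g' x h"]) (auto intro!: has_derivative_add f' g' bump_class.add)
next
  case (scale f c)
  then obtain f' where f': "\<And>x. (f has_derivative f' x) (at x)" "\<And>b. (\<lambda>x. f' x b) \<in> bump_class" by blast
  show ?case
    by (intro exI[of _ "\<lambda>x h. c * f' x h"]) (auto intro!: has_derivative_mult_right f' bump_class.scale)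
qed

lemma bump_class_pd:
  assumes "f \<in> bump_class"
  shows "f differentiable (at x)" "(\<lambda>x. frechet_derivative f (at x) b) \<in> bump_class"
proof -
  obtain f' where f': "\<And>x. (f has_derivative f' x) (at x)" "\<And>b. (\<lambda>x. f' x b) \<in> bump_class"
    using bump_class_derivative[OF assms] by blast
  show "f differentiable (at x)" using f'(1) by (auto simp: differentiable_def)
  have "frechet_derivative f (at x) = f' x" for x using frechet_derivative_at[OF f'(1)] by simp
  then show "(\<lambda>x. frechet_derivative f (at x) b) \<in> bump_class" using f'(2) by simp
qed

lemma bump_class_support: "f \<in> bump_class \<Longrightarrow> x \<notin> cball 0 1 \<Longrightarrow> f x = 0"
proof (induction rule: bump_class.induct)
  case (base j)
  then have "1 \<le> norm x" by simp
  then have "1 \<le> x \<bullet> x" by (simp add: norm_eq_sqrt_inner)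
  then show ?case by (simp add: bump_exp_def)
qed auto

lemma bump_class_C1c:
  assumes "f \<in> bump_class"
  shows "C1c UNIV f"
proof -
  have d: "(f has_derivative (\<lambda>h. egrad f x \<bullet> h)) (at x)" for x
    by (rule has_derivative_egrad[OF bump_class_pd(1)[OF assms]])
  have "continuous_on UNIV (\<lambda>x. frechet_derivative f (at x) b)" for b
    using bump_class_pd(1)[OF bump_class_pd(2)[OF assms]]
    by (intro continuous_at_imp_continuous_on ballI differentiable_imp_continuous_within) auto
  then have "continuous_on UNIV (egrad f)"
    unfolding egrad_def[abs_def] by (intro continuous_intros)
  from C1cI(1)[OF d this compact_cball[of 0 1]] show ?thesis using bump_class_support[OF assms] by auto
qed

text \<open>Differentiation under the integral, with the Lipschitz constant of \<open>f\<close>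
  times |w| as majorant. The argument c x + \<tau>(z) covers both forms of a convolution: the given
  function moved by a small multiple of z (\<open>c = 1\<close>), and the bump centred at z
  (\<open>c\<close> negative).\<close>

lemma superposition_derivative:
  fixes f :: "'a::euclidean_space \<Rightarrow> real" and w :: "'a \<Rightarrow> real"
  assumes f: "C1c U f" and w: "integrable lborel w" and \<tau> [measurable]: "\<tau> \<in> borel_measurable borel"
  shows "integrable lborel (\<lambda>z. w z *\<^sub>R egrad f (c *\<^sub>R x + \<tau> z))"
    and "((\<lambda>x. \<integral>z. w z * f (c *\<^sub>R x + \<tau> z) \<partial>lborel) has_derivative
          (\<lambda>h. (c *\<^sub>R (\<integral>z. w z *\<^sub>R egrad f (c *\<^sub>R x + \<tau> z) \<partial>lborel)) \<bullet> h)) (at x)"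
proof -
  note [measurable] = C1c_measurable[OF f]
  have [measurable]: "w \<in> borel_measurable borel" using w by auto
  obtain B where B: "B \<ge> 0" "\<And>x. norm (egrad f x) \<le> B" using C1c_bounded_egrad[OF f] by blast
  obtain A where A: "A \<ge> 0" "\<And>x. \<bar>f x\<bar> \<le> A" using C1c_bounded[OF f] by blast
  have wA: "integrable lborel (\<lambda>z. A * \<bar>w z\<bar>)" and wB: "integrable lborel (\<lambda>z. B * \<bar>w z\<bar>)" using w by auto
  have i1: "integrable lborel (\<lambda>z. w z * f (c *\<^sub>R x + \<tau> z))" for x
    by (rule Bochner_Integration.integrable_bound[OF wA])
       (use A in \<open>auto intro!: AE_I2 mult_left_mono simp: abs_mult mult.commute[of A]\<close>)
  show i2: "integrable lborel (\<lambda>z. w z *\<^sub>R egrad f (c *\<^sub>R x + \<tau> z))" for x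
    by (rule Bochner_Integration.integrable_bound[OF wB])
       (use B in \<open>auto intro!: AE_I2 mult_left_mono simp: abs_mult mult.commute[of B]\<close>)
  define E where "E x = (c *\<^sub>R (\<integral>z. w z *\<^sub>R egrad f (c *\<^sub>R x + \<tau> z) \<partial>lborel))" for x
  have Eh: "E x \<bullet> h = (\<integral>z. w z * (egrad f (c *\<^sub>R x + \<tau> z) \<bullet> (c *\<^sub>R h)) \<partial>lborel)"
    and ih: "integrable lborel (\<lambda>z. w z * (egrad f (c *\<^sub>R x + \<tau> z) \<bullet> (c *\<^sub>R h)))" for h
  proof -
    have "(\<integral>z. (w z *\<^sub>R egrad f (c *\<^sub>R x + \<tau> z)) \<bullet> (c *\<^sub>R h) \<partial>lborel) = (\<integral>z. w z *\<^sub>R egrad f (c *\<^sub>R x + \<tau> z) \<partial>lborel) \<bullet> (c *\<^sub>R h)"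
      using i2 by (intro integral_inner_left) auto
    then show "E x \<bullet> h = (\<integral>z. w z * (egrad f (c *\<^sub>R x + \<tau> z) \<bullet> (c *\<^sub>R h)) \<partial>lborel)"
      by (simp only: E_def inner_scaleR_left) (simp only: inner_scaleR_right mult.left_commute)
    have "integrable lborel (\<lambda>z. (w z *\<^sub>R egrad f (c *\<^sub>R x + \<tau> z)) \<bullet> (c *\<^sub>R h))"
      using i2 by (intro integrable_inner_left) auto
    then show "integrable lborel (\<lambda>z. w z * (egrad f (c *\<^sub>R x + \<tau> z) \<bullet> (c *\<^sub>R h)))"
      by (simp only: inner_scaleR_left)
  qed
  have "((\<lambda>x. \<integral>z. w z * f (c *\<^sub>R x + \<tau> z) \<partial>lborel) has_derivative (\<lambda>h. E x \<bullet> h)) (at x)"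
    unfolding has_derivative_at
  proof (intro conjI)
    show "bounded_linear ((\<bullet>) (E x))" by (rule bounded_linear_inner_right)
    define R where "R h z = w z * (f (c *\<^sub>R (x + h) + \<tau> z) - f (c *\<^sub>R x + \<tau> z) - egrad f (c *\<^sub>R x + \<tau> z) \<bullet> (c *\<^sub>R h))" for h z
    have Ri: "(\<integral>z. w z * f (c *\<^sub>R (x + h) + \<tau> z) \<partial>lborel) - (\<integral>z. w z * f (c *\<^sub>R x + \<tau> z) \<partial>lborel) - E x \<bullet> h
        = (\<integral>z. R h z \<partial>lborel)" for h
      unfolding R_def Eh right_diff_distrib
      by (simp only: Bochner_Integration.integral_diff Bochner_Integration.integrable_diff i1 ih)
    have Rn: "norm (\<integral>z. R h z \<partial>lborel) / norm h = norm (\<integral>z. R h z / norm h \<partial>lborel)" for h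
      by simp
    have "((\<lambda>h. \<integral>z. R h z / norm h \<partial>lborel) \<longlongrightarrow> 0) (at 0)"
      unfolding tendsto_at_iff_sequentially
    proof (intro allI impI)
      fix X assume X: "\<forall>i. X i \<in> UNIV - {0::'a}" and X0: "X \<longlonglongrightarrow> 0"
      have "(\<lambda>n. \<integral>z. R (X n) z / norm (X n) \<partial>lborel) \<longlonglongrightarrow> (\<integral>z. 0 \<partial>(lborel :: 'a measure))"
      proof (rule integral_dominated_convergence[where w = "\<lambda>z. 2 * \<bar>c\<bar> * (B * \<bar>w z\<bar>)"])
        show "integrable lborel (\<lambda>z. 2 * \<bar>c\<bar> * (B * \<bar>w z\<bar>))" using wB by simp
        show "(\<lambda>z. R (X n) z / norm (X n)) \<in> borel_measurable lborel" for n unfolding R_def by measurable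
        show "AE z in lborel. (\<lambda>n. R (X n) z / norm (X n)) \<longlonglongrightarrow> 0"
        proof (rule AE_I2)
          fix z
          let ?y = "c *\<^sub>R x + \<tau> z"
          have "((\<lambda>u. c *\<^sub>R u + \<tau> z) has_derivative (\<lambda>h. c *\<^sub>R h)) (at x)" by (auto intro!: derivative_eq_intros)
          from has_derivative_compose[OF this C1c_derivative[OF f, of ?y]]
          have "((\<lambda>h. norm (f (c *\<^sub>R (x + h) + \<tau> z) - f ?y - egrad f ?y \<bullet> (c *\<^sub>R h)) / norm h) \<longlongrightarrow> 0) (at 0)"
            by (simp add: has_derivative_at)
          then have "(\<lambda>n. norm (f (c *\<^sub>R (x + X n) + \<tau> z) - f ?y - egrad f ?y \<bullet> (c *\<^sub>R X n)) / norm (X n)) \<longlonglongrightarrow> 0"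
            unfolding tendsto_at_iff_sequentially using X X0 by (auto simp: o_def)
          then have "(\<lambda>n. \<bar>w z\<bar> * (norm (f (c *\<^sub>R (x + X n) + \<tau> z) - f ?y - egrad f ?y \<bullet> (c *\<^sub>R X n)) / norm (X n))) \<longlonglongrightarrow> \<bar>w z\<bar> * 0"
            by (intro tendsto_mult tendsto_const)
          then have "(\<lambda>n. norm (R (X n) z / norm (X n))) \<longlonglongrightarrow> 0" by (simp add: R_def abs_mult)
          then show "(\<lambda>n. R (X n) z / norm (X n)) \<longlonglongrightarrow> 0" by (rule tendsto_norm_zero_cancel)
        qed
        show "AE z in lborel. norm (R (X n) z / norm (X n)) \<le> 2 * \<bar>c\<bar> * (B * \<bar>w z\<bar>)" for n
        proof (rule AE_I2)
          fix z
          let ?y = "c *\<^sub>R x + \<tau> z"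
          have Xn: "norm (X n) > 0" using X by auto
          have "\<bar>f (c *\<^sub>R (x + X n) + \<tau> z) - f ?y\<bar> \<le> B * norm (c *\<^sub>R (x + X n) + \<tau> z - ?y)"
            by (rule C1c_Lipschitz[OF f B(2)])
          also have "c *\<^sub>R (x + X n) + \<tau> z - ?y = c *\<^sub>R X n" by (simp add: algebra_simps)
          finally have a1: "\<bar>f (c *\<^sub>R (x + X n) + \<tau> z) - f ?y\<bar> \<le> B * norm (c *\<^sub>R X n)" .
          have a2: "\<bar>egrad f ?y \<bullet> (c *\<^sub>R X n)\<bar> \<le> B * norm (c *\<^sub>R X n)"
            by (rule order_trans[OF Cauchy_Schwarz_ineq2]) (intro mult_right_mono B, simp)
          have "\<bar>f (c *\<^sub>R (x + X n) + \<tau> z) - f ?y - egrad f ?y \<bullet> (c *\<^sub>R X n)\<bar> \<le> 2 * \<bar>c\<bar> * B * norm (X n)"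
          proof -
            have "2 * \<bar>c\<bar> * B * norm (X n) = B * norm (c *\<^sub>R X n) + B * norm (c *\<^sub>R X n)" by simp
            then show ?thesis using a1 a2 by linarith
          qed
          then have "\<bar>w z\<bar> * \<bar>f (c *\<^sub>R (x + X n) + \<tau> z) - f ?y - egrad f ?y \<bullet> (c *\<^sub>R X n)\<bar> \<le> \<bar>w z\<bar> * (2 * \<bar>c\<bar> * B * norm (X n))"
            by (rule mult_left_mono) simp
          then show "norm (R (X n) z / norm (X n)) \<le> 2 * \<bar>c\<bar> * (B * \<bar>w z\<bar>)"
            using Xn by (simp add: R_def abs_mult pos_divide_le_eq mult_ac)
        qed
      qed auto
      then show "((\<lambda>h. \<integral>z. R h z / norm h \<partial>lborel) \<circ> X) \<longlonglongrightarrow> 0" by (simp add: o_def)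
    qed
    then have "((\<lambda>h. norm (\<integral>z. R h z / norm h \<partial>lborel)) \<longlongrightarrow> 0) (at 0)" by (rule tendsto_norm_zero)
    then show "(\<lambda>h. norm ((\<integral>z. w z * f (c *\<^sub>R (x + h) + \<tau> z) \<partial>lborel) - (\<integral>z. w z * f (c *\<^sub>R x + \<tau> z) \<partial>lborel) - E x \<bullet> h) / norm h) \<midarrow>0\<rightarrow> 0"
      unfolding Ri Rn .
  qed
  then show "((\<lambda>x. \<integral>z. w z * f (c *\<^sub>R x + \<tau> z) \<partial>lborel) has_derivative
          (\<lambda>h. (c *\<^sub>R (\<integral>z. w z *\<^sub>R egrad f (c *\<^sub>R x + \<tau> z) \<partial>lborel)) \<bullet> h)) (at x)" by (simp add: E_def)
qed

text \<open>A partial derivative of the superposition of \<open>f\<close> is the superposition of c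
  times the partial derivative of \<open>f\<close>, which stays in \<open>bump_class\<close>.
  Induction on the list of directions therefore never leaves superpositions of bumps.\<close>

lemma smooth_fun_superposition:
  fixes f :: "'a::euclidean_space \<Rightarrow> real" and w :: "'a \<Rightarrow> real"
  assumes f: "f \<in> bump_class" and w: "integrable lborel w" and \<tau>: "\<tau> \<in> borel_measurable borel"
  shows "smooth_fun (\<lambda>x. \<integral>z. w z * f (c *\<^sub>R x + \<tau> z) \<partial>lborel)"
proof -
  define T where "T f x = (\<integral>z. w z * f (c *\<^sub>R x + \<tau> z) \<partial>lborel)" for f and x :: 'a
  have pd: "T f differentiable (at x)" "\<exists>g\<in>bump_class. (\<lambda>x. frechet_derivative (T f) (at x) b) = T g"
    if f: "f \<in> bump_class" for f x b
  proof -
    note d = superposition_derivative[OF bump_class_C1c[OF f] w \<tau>, of c]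
    have d2: "(T f has_derivative (\<lambda>h. (c *\<^sub>R (\<integral>z. w z *\<^sub>R egrad f (c *\<^sub>R x + \<tau> z) \<partial>lborel)) \<bullet> h)) (at x)" for x
      unfolding T_def[abs_def] by (rule d(2))
    then show "T f differentiable (at x)" by (auto simp: differentiable_def)
    have "frechet_derivative (T f) (at x) b = T (\<lambda>u. c * frechet_derivative f (at u) b) x" for x
    proof -
      have fd: "frechet_derivative f (at u) b = egrad f u \<bullet> b" for u
        using frechet_derivative_at[OF C1c_derivative[OF bump_class_C1c[OF f], of u]] by (metis)
      have "frechet_derivative (T f) (at x) b = (c *\<^sub>R (\<integral>z. w z *\<^sub>R egrad f (c *\<^sub>R x + \<tau> z) \<partial>lborel)) \<bullet> b"
        using frechet_derivative_at[OF d2[of x]] by metis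
      also have "\<dots> = (\<integral>z. (w z *\<^sub>R egrad f (c *\<^sub>R x + \<tau> z)) \<bullet> (c *\<^sub>R b) \<partial>lborel)"
      proof -
        have "(\<integral>z. (w z *\<^sub>R egrad f (c *\<^sub>R x + \<tau> z)) \<bullet> (c *\<^sub>R b) \<partial>lborel) = (\<integral>z. w z *\<^sub>R egrad f (c *\<^sub>R x + \<tau> z) \<partial>lborel) \<bullet> (c *\<^sub>R b)"
          using d(1)[of x] by (intro integral_inner_left) auto
        then show ?thesis by (simp only: inner_scaleR_left inner_scaleR_right)
      qed
      also have "\<dots> = T (\<lambda>u. c * frechet_derivative f (at u) b) x" unfolding T_def fd
        by (simp only: inner_scaleR_left inner_scaleR_right mult.left_commute)
      finally show ?thesis .
    qed
    then show "\<exists>g\<in>bump_class. (\<lambda>x. frechet_derivative (T f) (at x) b) = T g"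
      using bump_class.scale[OF bump_class_pd(2)[OF f]] by blast
  qed
  have "\<exists>g\<in>bump_class. iter_pd bs (T f) = T g" for bs
  proof (induction bs)
    case Nil
    then show ?case using f by auto
  next
    case (Cons b bs)
    then obtain g where g: "g \<in> bump_class" "iter_pd bs (T f) = T g" by blast
    show ?case using pd(2)[OF g(1), of b] g(2) by simp
  qed
  note iter = this
  have "iter_pd bs (T f) differentiable (at x)" for bs x
    using iter[of bs] pd(1) by auto
  then have "smooth_fun (T f)" by (simp add: smooth_fun_def)
  then show ?thesis by (simp add: T_def[abs_def])
qed

text \<open>Convolution with a normalised bump. The common compact support and the uniform bounds
  are part of the conclusion so that dominated convergence remains available after multiplication by
  powers of \<open>conf\<close>, which are bounded on that support only.\<close>

lemma C1c_approx_test_fun: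
  fixes g :: "'a::euclidean_space \<Rightarrow> real"
  assumes g: "C1c (ball 0 1) g"
  obtains gs K B where "\<And>n. test_fun (gs n)" "compact K" "K \<subseteq> ball 0 1"
    "\<And>n x. x \<notin> K \<Longrightarrow> gs n x = 0" "\<And>n x. x \<notin> K \<Longrightarrow> egrad (gs n) x = 0" "B \<ge> 0"
    "\<And>n x. \<bar>gs n x\<bar> \<le> B" "\<And>n x. norm (egrad (gs n) x) \<le> B"
    "\<And>x. (\<lambda>n. gs n x) \<longlonglongrightarrow> g x" "\<And>x. (\<lambda>n. egrad (gs n) x) \<longlonglongrightarrow> egrad g x"
proof -
  define \<rho> where "\<rho> = (\<lambda>x::'a. bump_exp 0 (1 - x \<bullet> x))"
  have \<rho>S: "\<rho> \<in> bump_class" unfolding \<rho>_def by (rule bump_class.base)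
  have \<rho>C: "C1c UNIV \<rho>" by (rule bump_class_C1c[OF \<rho>S])
  have \<rho>i: "integrable lborel \<rho>" by (rule C1c_integrable[OF \<rho>C])
  have \<rho>0: "\<rho> x \<ge> 0" for x by (simp add: \<rho>_def bump_exp_def)
  have \<rho>pos: "\<rho> x > 0" if "x \<in> ball 0 1" for x
  proof -
    have "(norm x)\<^sup>2 < 1" using that by (simp add: power_less_one_iff abs_square_less_1)
    then have "x \<bullet> x < 1" by (simp add: power2_norm_eq_inner)
    then show ?thesis by (simp add: \<rho>_def bump_exp_def)
  qed
  note [measurable] = C1c_measurable[OF \<rho>C] C1c_measurable[OF g]
  define m where "m = (\<integral>x. \<rho> x \<partial>lborel)"
  have m: "m > 0"
  proof -
    have "m \<noteq> 0"
    proof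
      assume "m = 0"
      then have "AE x in lborel. \<rho> x = 0"
        using integral_nonneg_eq_0_iff_AE[OF \<rho>i] \<rho>0 by (simp add: m_def)
      then have "AE x in lborel. x \<notin> ball (0::'a) 1" by eventually_elim (use \<rho>pos in force)
      then have "emeasure lborel (ball (0::'a) 1) = 0"
        by (subst (asm) AE_iff_measurable[of "ball 0 1"]) auto
      then have "measure lborel (ball (0::'a) 1) = 0" by (simp add: measure_def)
      then show False using content_ball_pos[of 1 "0::'a"] by simp
    qed
    moreover have "m \<ge> 0" unfolding m_def using \<rho>0 by (intro integral_nonneg_AE) auto
    ultimately show ?thesis by linarith
  qed
  obtain L where L: "compact L" "L \<subseteq> ball 0 1" "\<And>x. x \<notin> L \<Longrightarrow> g x = 0" "\<And>x. x \<notin> L \<Longrightarrow> egrad g x = 0"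
    using C1c_support[OF g] by metis
  obtain \<delta> where \<delta>: "\<delta> > 0" "(\<Union>x\<in>L. ball x \<delta>) \<subseteq> ball 0 1"
    using compact_subset_open_imp_ball_epsilon_subset[OF L(1) open_ball L(2)] by blast
  \<comment> \<open>At most half the margin \<delta>, so that every mollified function lives in the
    closed \<delta> / 2 neighbourhood of the support.\<close>
  define \<epsilon> where "\<epsilon> n = (\<delta> / 2) / real (Suc n)" for n
  have \<epsilon>: "\<epsilon> n > 0" "\<epsilon> n \<le> \<delta> / 2" for n
    using \<delta>(1) by (auto simp: \<epsilon>_def field_simps)
  have \<epsilon>0: "\<epsilon> \<longlonglongrightarrow> 0"
    unfolding \<epsilon>_def[abs_def] using tendsto_mult[OF tendsto_const[of "\<delta> / 2"] LIMSEQ_Suc[OF lim_1_over_n]] by simp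
  define K where "K = (\<Union>x\<in>L. cball x (\<delta> / 2))"
  have K: "compact K" unfolding K_def by (rule compact_minkowski_sum_cball[OF L(1)])
  have K1: "K \<subseteq> ball 0 1"
  proof -
    have "cball x (\<delta> / 2) \<subseteq> ball x \<delta>" for x :: 'a using \<delta>(1) by auto
    then show ?thesis unfolding K_def using \<delta>(2) by blast
  qed
  define \<kappa> where "\<kappa> z = \<rho> z / m" for z
  have [measurable]: "\<kappa> \<in> borel_measurable borel" unfolding \<kappa>_def by measurable
  define gs where "gs n x = (\<integral>z. \<kappa> z * g (1 *\<^sub>R x + \<epsilon> n *\<^sub>R z) \<partial>lborel)" for n x
  have wi: "integrable lborel (\<lambda>z. \<kappa> z)" using \<rho>i by (simp add: \<kappa>_def)
  have w1: "(\<integral>z. \<kappa> z \<partial>lborel) = 1" using m by (simp add: \<kappa>_def m_def)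
  have w0: "\<kappa> z \<ge> 0" for z using \<rho>0 m by (simp add: \<kappa>_def)
  have \<tau>m: "(\<lambda>z::'a. \<epsilon> n *\<^sub>R z) \<in> borel_measurable borel" for n
    by (rule borel_measurable_continuous_onI[OF continuous_on_scaleR[OF continuous_on_const continuous_on_id]])
  have d: "(gs n has_derivative (\<lambda>h. (1 *\<^sub>R (\<integral>z. \<kappa> z *\<^sub>R egrad g (1 *\<^sub>R x + \<epsilon> n *\<^sub>R z) \<partial>lborel)) \<bullet> h)) (at x)" for n x
    unfolding gs_def[abs_def] by (rule superposition_derivative(2)[OF g wi \<tau>m])
  have eg: "egrad (gs n) x = (\<integral>z. \<kappa> z *\<^sub>R egrad g (1 *\<^sub>R x + \<epsilon> n *\<^sub>R z) \<partial>lborel)" for n x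
    using egrad_eqI[OF d[of n x]] by simp
  have off: "\<rho> z = 0 \<or> 1 *\<^sub>R x + \<epsilon> n *\<^sub>R z \<notin> L" if "x \<notin> K" for x z n
  proof (cases "z \<in> cball 0 1")
    case True
    have "1 *\<^sub>R x + \<epsilon> n *\<^sub>R z \<notin> L"
    proof
      assume a: "1 *\<^sub>R x + \<epsilon> n *\<^sub>R z \<in> L"
      have "\<epsilon> n * norm z \<le> \<delta> / 2 * 1" using True \<epsilon>[of n] \<delta>(1) by (intro mult_mono) auto
      then have "dist (1 *\<^sub>R x + \<epsilon> n *\<^sub>R z) x \<le> \<delta> / 2" using \<epsilon>[of n] by (simp add: dist_norm)
      with a have "x \<in> K" unfolding K_def by (auto simp: dist_commute)
      with that show False by simp
    qed
    then show ?thesis by simp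
  next
    case False
    then show ?thesis using bump_class_support[OF \<rho>S] by blast
  qed
  have s0: "gs n x = 0" if "x \<notin> K" for n x
  proof -
    have "\<kappa> z * g (1 *\<^sub>R x + \<epsilon> n *\<^sub>R z) = 0" for z using off[OF that, of z n] L(3) by (auto simp: \<kappa>_def)
    then show ?thesis unfolding gs_def by (simp only: Bochner_Integration.integral_zero)
  qed
  have e0: "egrad (gs n) x = 0" if "x \<notin> K" for n x
  proof -
    have "\<kappa> z *\<^sub>R egrad g (1 *\<^sub>R x + \<epsilon> n *\<^sub>R z) = 0" for z using off[OF that, of z n] L(4) by (auto simp: \<kappa>_def)
    then show ?thesis unfolding eg by (simp only: Bochner_Integration.integral_zero)
  qed
  have tf: "test_fun (gs n)" for n
  proof -
    \<comment> \<open>The substitution y = x + \<epsilon> z moves the dependence on x from the C^1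
      function \<open>g\<close> to the smooth bump; this second representation gives smoothness,
      while the first gives convergence of value and gradient.\<close>
    define w where "w y = g y / (m * \<epsilon> n ^ DIM('a))" for y
    have "gs n x = (\<integral>y. w y * \<rho> ((- 1 / \<epsilon> n) *\<^sub>R x + (1 / \<epsilon> n) *\<^sub>R y) \<partial>lborel)" for x
    proof -
      define F where "F y = g y * \<rho> ((- 1 / \<epsilon> n) *\<^sub>R x + (1 / \<epsilon> n) *\<^sub>R y)" for y
      obtain A where A: "\<And>x. \<bar>\<rho> x\<bar> \<le> A" using C1c_bounded[OF \<rho>C] by blast
      have "integrable lborel (\<lambda>y. A * g y)" using C1c_integrable[OF g] by simp
      then have Fi: "integrable lborel F"
        unfolding F_def
        by (rule Bochner_Integration.integrable_bound)
           (use A in \<open>auto intro!: AE_I2 mult_left_mono order_trans[OF A abs_ge_self] simp: abs_mult mult.commute[of "\<bar>A\<bar>"]\<close>)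
      have "F (x + \<epsilon> n *\<^sub>R z) = g (1 *\<^sub>R x + \<epsilon> n *\<^sub>R z) * \<rho> z" for z
      proof -
        have "(- 1 / \<epsilon> n) *\<^sub>R x + (1 / \<epsilon> n) *\<^sub>R (x + \<epsilon> n *\<^sub>R z) = z"
        proof -
          have "(- 1 / \<epsilon> n) *\<^sub>R x = - ((1 / \<epsilon> n) *\<^sub>R x)" by (simp only: divide_minus_left scaleR_minus_left)
          moreover have "(1 / \<epsilon> n) *\<^sub>R (\<epsilon> n *\<^sub>R z) = z" using \<epsilon>(1)[of n] by simp
          ultimately show ?thesis by (simp only: scaleR_add_right) simp
        qed
        then show ?thesis by (simp add: F_def)
      qed
      then have "(\<integral>z. g (1 *\<^sub>R x + \<epsilon> n *\<^sub>R z) * \<rho> z \<partial>lborel) = (\<integral>y. F y \<partial>lborel) / \<epsilon> n ^ DIM('a)"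
        using integral_affine[OF Fi \<epsilon>(1)[of n], of x] by simp
      then have "(\<integral>z. g (1 *\<^sub>R x + \<epsilon> n *\<^sub>R z) * \<rho> z \<partial>lborel) / m = (\<integral>y. F y \<partial>lborel) / (m * \<epsilon> n ^ DIM('a))"
        by simp
      then show ?thesis unfolding gs_def w_def F_def by (simp add: \<kappa>_def mult.commute)
    qed
    then have e: "gs n = (\<lambda>x. \<integral>y. w y * \<rho> ((- 1 / \<epsilon> n) *\<^sub>R x + (1 / \<epsilon> n) *\<^sub>R y) \<partial>lborel)" by (rule ext)
    have "smooth_fun (gs n)"
      unfolding e
      by (rule smooth_fun_superposition[OF \<rho>S]) (use C1c_integrable[OF g] in \<open>auto simp: w_def\<close>)
    then show ?thesis unfolding test_fun_def using K K1 s0 by blast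
  qed
  obtain A where A: "A \<ge> 0" "\<And>x. \<bar>g x\<bar> \<le> A" using C1c_bounded[OF g] by blast
  obtain B where B: "B \<ge> 0" "\<And>x. norm (egrad g x) \<le> B" using C1c_bounded_egrad[OF g] by blast
  have nA: "norm (\<kappa> z * g y) \<le> A * \<kappa> z" for z y
  proof -
    have "norm (\<kappa> z * g y) = \<kappa> z * \<bar>g y\<bar>" by (simp only: real_norm_def abs_mult abs_of_nonneg[OF w0])
    also have "\<dots> \<le> \<kappa> z * A" by (rule mult_left_mono[OF A(2) w0])
    finally show ?thesis by (simp only: mult.commute[of A])
  qed
  have nB: "norm (\<kappa> z *\<^sub>R egrad g y) \<le> B * \<kappa> z" for z y
  proof -
    have "norm (\<kappa> z *\<^sub>R egrad g y) = \<kappa> z * norm (egrad g y)" by (simp only: norm_scaleR abs_of_nonneg[OF w0])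
    also have "\<dots> \<le> \<kappa> z * B" by (rule mult_left_mono[OF B(2) w0])
    finally show ?thesis by (simp only: mult.commute[of B])
  qed
  have bA: "\<bar>gs n x\<bar> \<le> A" for n x
  proof -
    have "norm (gs n x) \<le> (\<integral>z. A * \<kappa> z \<partial>lborel)"
      unfolding gs_def
    proof (rule Bochner_Integration.integral_norm_bound_integral)
      show "norm (\<kappa> z * g (1 *\<^sub>R x + \<epsilon> n *\<^sub>R z)) \<le> A * \<kappa> z" for z
        by (rule nA)
      show "integrable lborel (\<lambda>z. \<kappa> z * g (1 *\<^sub>R x + \<epsilon> n *\<^sub>R z))"
      proof (rule Bochner_Integration.integrable_bound[OF integrable_mult_right[OF wi, of A]])
        show "AE z in lborel. norm (\<kappa> z * g (1 *\<^sub>R x + \<epsilon> n *\<^sub>R z)) \<le> norm (A * \<kappa> z)"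
          by (rule AE_I2) (rule order_trans[OF nA], simp only: real_norm_def abs_ge_self)
      qed measurable
    qed (use wi in auto)
    then show ?thesis using w1 by simp
  qed
  have bB: "norm (egrad (gs n) x) \<le> B" for n x
  proof -
    have "norm (egrad (gs n) x) \<le> (\<integral>z. B * \<kappa> z \<partial>lborel)"
      unfolding eg
    proof (rule Bochner_Integration.integral_norm_bound_integral)
      show "norm (\<kappa> z *\<^sub>R egrad g (1 *\<^sub>R x + \<epsilon> n *\<^sub>R z)) \<le> B * \<kappa> z" for z
        by (rule nB)
    qed (use wi superposition_derivative(1)[OF g wi \<tau>m, of 1 x n] in auto)
    then show ?thesis using w1 by simp
  qed
  have cA: "(\<lambda>n. gs n x) \<longlonglongrightarrow> g x" for x
  proof -
    have "(\<lambda>n. gs n x) \<longlonglongrightarrow> (\<integral>z. \<kappa> z * g x \<partial>lborel)"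
      unfolding gs_def
    proof (rule integral_dominated_convergence[where w = "\<lambda>z. A * \<kappa> z"])
      show "AE z in lborel. (\<lambda>n. \<kappa> z * g (1 *\<^sub>R x + \<epsilon> n *\<^sub>R z)) \<longlonglongrightarrow> \<kappa> z * g x"
      proof (rule AE_I2)
        fix z
        have "(\<lambda>n. 1 *\<^sub>R x + \<epsilon> n *\<^sub>R z) \<longlonglongrightarrow> 1 *\<^sub>R x + 0 *\<^sub>R z" by (intro tendsto_intros \<epsilon>0)
        then have "(\<lambda>n. g (1 *\<^sub>R x + \<epsilon> n *\<^sub>R z)) \<longlonglongrightarrow> g x"
          by (intro continuous_on_tendsto_compose[OF C1c_cont[OF g]]) auto
        then show "(\<lambda>n. \<kappa> z * g (1 *\<^sub>R x + \<epsilon> n *\<^sub>R z)) \<longlonglongrightarrow> \<kappa> z * g x" by (intro tendsto_mult tendsto_const)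
      qed
      show "AE z in lborel. norm (\<kappa> z * g (1 *\<^sub>R x + \<epsilon> n *\<^sub>R z)) \<le> A * \<kappa> z" for n
        by (rule AE_I2) (rule nA)
    qed (use wi in auto)
    then show ?thesis using w1 by simp
  qed
  have cB: "(\<lambda>n. egrad (gs n) x) \<longlonglongrightarrow> egrad g x" for x
  proof -
    have "(\<lambda>n. egrad (gs n) x) \<longlonglongrightarrow> (\<integral>z. \<kappa> z *\<^sub>R egrad g x \<partial>lborel)"
      unfolding eg
    proof (rule integral_dominated_convergence[where w = "\<lambda>z. B * \<kappa> z"])
      show "AE z in lborel. (\<lambda>n. \<kappa> z *\<^sub>R egrad g (1 *\<^sub>R x + \<epsilon> n *\<^sub>R z)) \<longlonglongrightarrow> \<kappa> z *\<^sub>R egrad g x"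
      proof (rule AE_I2)
        fix z
        have "(\<lambda>n. 1 *\<^sub>R x + \<epsilon> n *\<^sub>R z) \<longlonglongrightarrow> 1 *\<^sub>R x + 0 *\<^sub>R z" by (intro tendsto_intros \<epsilon>0)
        then have "(\<lambda>n. egrad g (1 *\<^sub>R x + \<epsilon> n *\<^sub>R z)) \<longlonglongrightarrow> egrad g x"
          by (intro continuous_on_tendsto_compose[OF C1c_cont_egrad[OF g]]) auto
        then show "(\<lambda>n. \<kappa> z *\<^sub>R egrad g (1 *\<^sub>R x + \<epsilon> n *\<^sub>R z)) \<longlonglongrightarrow> \<kappa> z *\<^sub>R egrad g x" by (intro tendsto_scaleR tendsto_const)
      qed
      show "AE z in lborel. norm (\<kappa> z *\<^sub>R egrad g (1 *\<^sub>R x + \<epsilon> n *\<^sub>R z)) \<le> B * \<kappa> z" for n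
        by (rule AE_I2) (rule nB)
    qed (use wi in auto)
    then show ?thesis using w1 by (simp add: integral_scaleR_left wi)
  qed
  show ?thesis
    by (rule that[of gs K "max A B", OF tf K K1 s0 e0]) (use A cA cB in \<open>auto intro: max.coboundedI1[OF bA] max.coboundedI2[OF bB]\<close>)
qed

subsection \<open>Conformal weights on the unit ball\<close>

lemma conf_pos: "x \<in> ball 0 1 \<Longrightarrow> 0 < conf x"
  by (simp add: conf_def power_less_one_iff abs_square_less_1)

lemma conf_le_half: "conf x \<le> 1 / 2"
  by (simp add: conf_def)

lemma norm_sq_conf: "(norm x)\<^sup>2 = 1 - 2 * conf x"
  by (simp add: conf_def field_simps)

lemma conf_measurable [measurable]: "conf \<in> borel_measurable borel"
  unfolding conf_def[abs_def] by measurable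

lemma conf_powr_derivative:
  assumes "x \<in> ball 0 1"
  shows "((\<lambda>x. conf x powr r) has_derivative (\<lambda>h. (- (r * conf x powr (r - 1)) *\<^sub>R x) \<bullet> h)) (at x)"
proof -
  have e: "conf y = (1 - y \<bullet> y) / 2" for y :: 'a by (simp add: conf_def power2_norm_eq_inner)
  have d1: "(conf has_derivative (\<lambda>h. - (x \<bullet> h))) (at x)"
    unfolding e by (rule has_derivative_eq_rhs, (rule derivative_intros)+) (auto simp: inner_commute)
  have "((\<lambda>s. s powr r) has_real_derivative r * conf x powr (r - 1)) (at (conf x))"
    by (rule has_real_derivative_powr[OF conf_pos[OF assms]])
  then have d2: "((\<lambda>s. s powr r) has_derivative (\<lambda>h. (r * conf x powr (r - 1)) * h)) (at (conf x))"
    by (simp add: has_field_derivative_def)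
  show ?thesis using has_derivative_compose[OF d1 d2] by simp
qed

lemma C1c_conf_powr:
  assumes f: "C1c (ball 0 1) f"
  shows "C1c (ball 0 1) (\<lambda>x. conf x powr r * f x)"
    and "egrad (\<lambda>x. conf x powr r * f x) x = conf x powr r *\<^sub>R egrad f x - (r * conf x powr (r - 1) * f x) *\<^sub>R x"
proof -
  have c: "continuous_on (ball 0 1) (\<lambda>x::'a. - (r * conf x powr (r - 1)) *\<^sub>R x)"
  proof -
    have "continuous_on (ball 0 1) (\<lambda>x::'a. conf x powr (r - 1))"
      by (intro continuous_at_imp_continuous_on ballI has_derivative_continuous[OF conf_powr_derivative])
    then show ?thesis
      by (intro continuous_on_scaleR continuous_on_minus continuous_on_mult continuous_on_const continuous_on_id)
  qed
  have d: "((\<lambda>x. conf x powr r) has_derivative (\<lambda>h. (- (r * conf x powr (r - 1)) *\<^sub>R x) \<bullet> h)) (at x)"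
    if "x \<in> ball 0 1" for x :: 'a
    by (rule conf_powr_derivative[OF that])
  note m = C1c_mult_local[OF f open_ball d c]
  show "C1c (ball 0 1) (\<lambda>x. conf x powr r * f x)" by (rule m(1))
  show "egrad (\<lambda>x. conf x powr r * f x) x = conf x powr r *\<^sub>R egrad f x - (r * conf x powr (r - 1) * f x) *\<^sub>R x"
  proof -
    have "egrad (\<lambda>x. conf x powr r * f x) x = conf x powr r *\<^sub>R egrad f x + f x *\<^sub>R (- (r * conf x powr (r - 1)) *\<^sub>R x)"
      by (rule m(2))
    then show ?thesis by (simp add: mult_ac)
  qed
qed

section \<open>Hardy's inequality on the ball\<close>

lemma C1c_outside:
  assumes "C1c U f" "x \<notin> U" shows "f x = 0" "egrad f x = 0"
  using C1c_support[OF assms(1)] assms(2) by (metis subsetD)+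

text \<open>The square is the weight of the mass term. Since \<open>conf\<close> vanishes on the
  sphere and is negative beyond it, the value 0 there makes the weight nonnegative
  everywhere.\<close>

definition hyp_wt :: "'a::euclidean_space \<Rightarrow> real" where
  "hyp_wt x = (if norm x < 1 then 1 / conf x else 0)"

lemma hyp_wt_measurable [measurable]: "hyp_wt \<in> borel_measurable borel"
  unfolding hyp_wt_def[abs_def] by measurable

lemma hyp_wt_eq: "x \<in> ball 0 1 \<Longrightarrow> hyp_wt x = conf x powr (- 1)"
  using conf_pos[of x] by (simp add: hyp_wt_def powr_minus_divide)

lemma hyp_wt_ge: "x \<in> ball 0 1 \<Longrightarrow> 1 \<le> hyp_wt x"
  using conf_pos[of x] conf_le_half[of x] by (simp add: hyp_wt_def)

lemma hyp_wt_nonneg: "0 \<le> hyp_wt x"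
  using conf_pos[of x] by (auto simp: hyp_wt_def less_imp_le)

lemma hyp_wt_C1c: "C1c (ball 0 1) f \<Longrightarrow> hyp_wt x * f x = conf x powr (- 1) * f x"
  using hyp_wt_eq[of x] C1c_outside(1)[of "ball 0 1" f x] by (cases "x \<in> ball 0 1") auto

text \<open>With c = \<open>conf\<close>, \<phi> = f / c and \<psi> = f^2 / c, the divergence of
  \<psi>(x) x equals 2 \<phi> (x \<bullet> grad f) + \<phi>^2 + (N - 2) c \<phi>^2, because |x|^2 =
  1 - 2 c. It integrates to zero and the last term is nonnegative, so the squared norm of \<phi> is
  at most twice that of \<phi> paired with x \<bullet> grad f; Cauchy-Schwarz finishes.\<close>

lemma Hardy_C1c:
  fixes f :: "'a::euclidean_space \<Rightarrow> real"
  assumes f: "C1c (ball 0 1) f" and N: "DIM('a) \<ge> 2"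
  shows "sqn (\<lambda>x. hyp_wt x * f x) \<le> 4 * sqn (egrad f)"
proof -
  define \<phi> where "\<phi> x = conf x powr (- 1) * f x" for x
  have \<phi>: "C1c (ball 0 1) \<phi>" "egrad \<phi> x = conf x powr (- 1) *\<^sub>R egrad f x + (conf x powr (- 2) * f x) *\<^sub>R x" for x
    unfolding \<phi>_def using C1c_conf_powr[OF f, of "-1"] by auto
  have w: "(\<lambda>x. hyp_wt x * f x) = \<phi>" using hyp_wt_C1c[OF f] by (auto simp: \<phi>_def)
  define \<psi> where "\<psi> x = f x * \<phi> x" for x
  have \<psi>: "C1c (ball 0 1) \<psi>" "egrad \<psi> x = f x *\<^sub>R egrad \<phi> x + \<phi> x *\<^sub>R egrad f x" for x
    unfolding \<psi>_def using C1c_mult[OF f \<phi>(1) open_ball] by auto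
  note [measurable] = C1c_measurable[OF f] C1c_measurable[OF \<phi>(1)]
  have k: "sqint (\<lambda>x. x \<bullet> egrad f x)" "sqn (\<lambda>x. x \<bullet> egrad f x) \<le> 1\<^sup>2 * sqn (egrad f)"
  proof -
    have b: "norm (x \<bullet> egrad f x) \<le> 1 * norm (egrad f x)" for x
    proof (cases "x \<in> ball 0 1")
      case True
      have "\<bar>x \<bullet> egrad f x\<bar> \<le> norm x * norm (egrad f x)" by (rule Cauchy_Schwarz_ineq2)
      also have "\<dots> \<le> 1 * norm (egrad f x)" using True by (intro mult_right_mono) auto
      finally show ?thesis by simp
    qed (use C1c_outside[OF f] in simp)
    have m: "(\<lambda>x. x \<bullet> egrad f x) \<in> borel_measurable borel" by measurable
    show "sqint (\<lambda>x. x \<bullet> egrad f x)" "sqn (\<lambda>x. x \<bullet> egrad f x) \<le> 1\<^sup>2 * sqn (egrad f)"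
      using sqint_bound[OF C1c_sqint_egrad[OF f] m b] by auto
  qed
  have pt: "(norm (\<phi> x))\<^sup>2 \<le> (x \<bullet> egrad \<psi> x + real DIM('a) * \<psi> x) - 2 * (\<phi> x \<bullet> (x \<bullet> egrad f x))" for x
  proof (cases "x \<in> ball 0 1")
    case True
    define c where "c = conf x"
    have c: "c > 0" using conf_pos[OF True] by (simp add: c_def)
    have fx: "f x = c * \<phi> x" using c by (simp add: \<phi>_def c_def powr_minus)
    have cc: "c powr (- 2) = 1 / c\<^sup>2" "c powr (- 1) = 1 / c" using c by (simp_all add: powr_minus_divide powr_numeral)
    have "x \<bullet> egrad \<psi> x = 2 * (\<phi> x * (x \<bullet> egrad f x)) + (\<phi> x)\<^sup>2 * (x \<bullet> x)"
      unfolding \<psi>(2) \<phi>(2) c_def[symmetric] cc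
      using c by (simp add: inner_add_right fx field_simps power2_eq_square)
    moreover have "x \<bullet> x = 1 - 2 * c" using norm_sq_conf[of x] by (simp add: power2_norm_eq_inner c_def)
    moreover have "\<psi> x = c * (\<phi> x)\<^sup>2" by (simp add: \<psi>_def fx power2_eq_square)
    ultimately have "(x \<bullet> egrad \<psi> x + real DIM('a) * \<psi> x) - 2 * (\<phi> x * (x \<bullet> egrad f x)) - (\<phi> x)\<^sup>2
       = (real DIM('a) - 2) * (c * (\<phi> x)\<^sup>2)"
      by (simp add: algebra_simps)
    moreover have "(real DIM('a) - 2) * (c * (\<phi> x)\<^sup>2) \<ge> 0"
      using N c by (intro mult_nonneg_nonneg) auto
    ultimately show ?thesis by simp
  next
    case False
    then show ?thesis using C1c_outside[OF \<phi>(1) False] C1c_outside[OF \<psi>(1) False] by simp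
  qed
  have i1: "integrable lborel (\<lambda>x. x \<bullet> egrad \<psi> x + real DIM('a) * \<psi> x)"
    using integral_divergence_radial(1)[OF \<psi>(1) open_ball] C1c_integrable[OF \<psi>(1)] by auto
  have z: "(\<integral>x. x \<bullet> egrad \<psi> x + real DIM('a) * \<psi> x \<partial>lborel) = 0"
    using integral_divergence_radial[OF \<psi>(1) open_ball] C1c_integrable[OF \<psi>(1)] by simp
  have i2: "integrable lborel (\<lambda>x. \<phi> x \<bullet> (x \<bullet> egrad f x))"
    by (rule sqint_inner[OF C1c_sqint[OF \<phi>(1)] k(1)])
  have "sqn \<phi> \<le> (\<integral>x. (x \<bullet> egrad \<psi> x + real DIM('a) * \<psi> x) - 2 * (\<phi> x \<bullet> (x \<bullet> egrad f x)) \<partial>lborel)"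
    unfolding sqn_def
    by (rule integral_mono[OF sqint_integrable[OF C1c_sqint[OF \<phi>(1)]] _ pt])
       (intro Bochner_Integration.integrable_diff i1 integrable_mult_right i2)
  also have "\<dots> = - 2 * (\<integral>x. \<phi> x \<bullet> (x \<bullet> egrad f x) \<partial>lborel)"
    by (subst Bochner_Integration.integral_diff[OF i1 integrable_mult_right[OF i2]]) (simp add: z)
  also have "\<dots> \<le> 2 * (sqrt (sqn \<phi>) * sqrt (sqn (\<lambda>x. x \<bullet> egrad f x)))"
    using integral_inner_le[OF C1c_sqint[OF \<phi>(1)] k(1)] by linarith
  also have "\<dots> \<le> 2 * (sqrt (sqn \<phi>) * sqrt (sqn (egrad f)))"
    using k(2) by (intro mult_left_mono) auto
  finally have b: "sqn \<phi> \<le> 2 * (sqrt (sqn \<phi>) * sqrt (sqn (egrad f)))" .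
  have "sqrt (sqn \<phi>) \<le> 2 * sqrt (sqn (egrad f))"
  proof (cases "sqrt (sqn \<phi>) = 0")
    case False
    then have p: "sqrt (sqn \<phi>) > 0" using sqn_nonneg[of \<phi>] by (simp add: less_le)
    have "sqrt (sqn \<phi>) * sqrt (sqn \<phi>) \<le> sqrt (sqn \<phi>) * (2 * sqrt (sqn (egrad f)))" using b by simp
    from mult_left_le_imp_le[OF this p] show ?thesis .
  qed simp
  then have "(sqrt (sqn \<phi>))\<^sup>2 \<le> (2 * sqrt (sqn (egrad f)))\<^sup>2" by (rule power_mono) simp
  then show ?thesis unfolding w by (simp add: power_mult_distrib)
qed

lemma H10_Hardy:
  fixes z :: "'a::euclidean_space \<Rightarrow> real"
  assumes z: "H10 (ball 0 1) z Z" and N: "DIM('a) \<ge> 2"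
  shows "sqint (\<lambda>x. hyp_wt x * z x)" "sqn (\<lambda>x. hyp_wt x * z x) \<le> 4 * sqn Z"
proof -
  have [measurable]: "z \<in> borel_measurable borel" using H10D(1)[OF z] by auto
  have b: "(\<integral>\<^sup>+x. ennreal ((hyp_wt x * z x)\<^sup>2) \<partial>lborel) \<le> ennreal (4 * sqn Z)"
  proof (rule H10_Fatou[OF z, where \<Phi> = "\<lambda>x s. (hyp_wt x * s)\<^sup>2" and c = "\<lambda>t. 4 * t"])
    fix f :: "'a \<Rightarrow> real" assume f: "C1c (ball 0 1) f"
    have s: "sqint (\<lambda>x. hyp_wt x * f x)"
      unfolding hyp_wt_C1c[OF f] by (rule C1c_sqint[OF C1c_conf_powr(1)[OF f]])
    have "(\<integral>\<^sup>+x. ennreal ((hyp_wt x * f x)\<^sup>2) \<partial>lborel) = ennreal (sqn (\<lambda>x. hyp_wt x * f x))"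
      using nn_integral_sq[OF s] by simp
    also have "\<dots> \<le> ennreal (4 * sqn (egrad f))" by (intro ennreal_leI Hardy_C1c[OF f N])
    finally show "(\<integral>\<^sup>+x. ennreal ((hyp_wt x * f x)\<^sup>2) \<partial>lborel) \<le> ennreal (4 * sqn (egrad f))" .
  qed (auto intro!: continuous_intros)
  show s: "sqint (\<lambda>x. hyp_wt x * z x)"
    by (rule sqintI_nn) (use b in \<open>auto simp: le_less_trans\<close>)
  show "sqn (\<lambda>x. hyp_wt x * z x) \<le> 4 * sqn Z"
    using b nn_integral_sq[OF s] by simp
qed

text \<open>The difference splits as (1 - s^a) f plus s^a times the displacement from x to s x. The
  first factor is O(s - 1) by the mean value theorem, where a 2^a bounds the slope on the interval
  from 1 to 2; the displacement has length at most s - 1 on the ball.\<close>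

lemma C1c_dilation_diff:
  fixes f :: "'a::euclidean_space \<Rightarrow> real"
  assumes f: "C1c (ball 0 1) f" and N: "DIM('a) \<ge> 2" and s: "1 \<le> s" "s \<le> 2" and a: "a \<ge> 0"
  shows "sqn (\<lambda>x. f x - s powr a * f (s *\<^sub>R x)) \<le> (8 * (a * 2 powr a)\<^sup>2 + 2 * 4 powr a) * (s - 1)\<^sup>2 * sqn (egrad f)"
proof -
  note [measurable] = C1c_measurable[OF f]
  have fs: "C1c (ball 0 1) (\<lambda>x. f (s *\<^sub>R x))"
  proof -
    have "C1c (ball 0 1) (\<lambda>x. f (0 + s *\<^sub>R x))"
    proof (rule C1c_affine(1)[OF f])
      fix y :: 'a assume "y \<in> ball 0 1"
      then show "(1 / s) *\<^sub>R (y - 0) \<in> ball 0 1" using s by (simp add: field_simps)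
    qed (use s in simp)
    then show ?thesis by simp
  qed
  have d: "sqint (\<lambda>x. f x - f (s *\<^sub>R x))" by (rule sqint_diff(1)[OF C1c_sqint[OF f] C1c_sqint[OF fs]])
  have "ennreal (sqn (\<lambda>x. f x - f (s *\<^sub>R x))) = (\<integral>\<^sup>+x. ennreal ((norm (f x - f (s *\<^sub>R x)))\<^sup>2) \<partial>lborel)"
    by (rule nn_integral_sq[OF d, symmetric])
  also have "\<dots> = (\<integral>\<^sup>+x. ennreal ((f (0 + 1 *\<^sub>R x + (0 + (s - 1) *\<^sub>R x)) - f (0 + 1 *\<^sub>R x))\<^sup>2) * indicator (ball 0 1) x \<partial>lborel)"
  proof (rule nn_integral_cong)
    fix x :: 'a
    show "ennreal ((norm (f x - f (s *\<^sub>R x)))\<^sup>2) = ennreal ((f (0 + 1 *\<^sub>R x + (0 + (s - 1) *\<^sub>R x)) - f (0 + 1 *\<^sub>R x))\<^sup>2) * indicator (ball 0 1) x"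
    proof (cases "x \<in> ball 0 1")
      case True
      have "0 + 1 *\<^sub>R x + (0 + (s - 1) *\<^sub>R x) = s *\<^sub>R x" by (simp add: algebra_simps)
      then show ?thesis using True by (simp add: power2_commute)
    next
      case False
      then show ?thesis using C1c_outside(1)[OF f False] C1c_outside(1)[OF fs False] by simp
    qed
  qed
  also have "\<dots> \<le> ennreal ((s - 1)\<^sup>2 * sqn (egrad f) / 1 ^ DIM('a))"
    by (rule C1c_displacement_sq[OF f]) (use s in \<open>auto simp: mult_left_le\<close>)
  finally have b1: "sqn (\<lambda>x. f x - f (s *\<^sub>R x)) \<le> (s - 1)\<^sup>2 * sqn (egrad f)" by simp
  \<comment> \<open>A Poincare inequality, read off from Hardy's inequality because the weight is at
    least one on the ball.\<close>
  have sf: "sqn f \<le> 4 * sqn (egrad f)"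
  proof -
    have si: "sqint (\<lambda>x. hyp_wt x * f x)"
      unfolding hyp_wt_C1c[OF f] by (rule C1c_sqint[OF C1c_conf_powr(1)[OF f]])
    have "norm (f x) \<le> 1 * norm (hyp_wt x * f x)" for x
    proof (cases "x \<in> ball 0 1")
      case True
      have "1 * \<bar>f x\<bar> \<le> hyp_wt x * \<bar>f x\<bar>" using hyp_wt_ge[OF True] by (rule mult_right_mono) simp
      then show ?thesis using hyp_wt_nonneg[of x] by (simp add: abs_mult)
    qed (use C1c_outside[OF f] in simp)
    from sqint_bound(2)[OF si C1c_measurable(1)[OF f] this] have "sqn f \<le> sqn (\<lambda>x. hyp_wt x * f x)" by simp
    then show ?thesis using Hardy_C1c[OF f N] by linarith
  qed
  have sa: "(1 - s powr a)\<^sup>2 \<le> (a * 2 powr a * (s - 1))\<^sup>2"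
  proof -
    have "s powr a - 1 \<le> a * 2 powr a * (s - 1)"
    proof (cases "s = 1")
      case False
      then have s1: "1 < s" using s by simp
      have "((\<lambda>t. t powr a) has_real_derivative a * x powr (a - 1)) (at x)" if "1 \<le> x" "x \<le> s" for x
        using that by (intro has_real_derivative_powr) simp
      from MVT2[OF s1 this]
      obtain t where t: "1 < t" "t < s" "s powr a - 1 powr a = (s - 1) * (a * t powr (a - 1))" by blast
      have "t powr (a - 1) \<le> t powr a" using t by (intro powr_mono) auto
      also have "\<dots> \<le> 2 powr a" using t s a by (intro powr_mono2) auto
      finally have "(s - 1) * (a * t powr (a - 1)) \<le> (s - 1) * (a * 2 powr a)"
        using s a by (intro mult_left_mono) auto
      then show ?thesis using t(3) by (simp add: mult_ac)
    qed simp
    moreover have "s powr a - 1 \<ge> 0" using s a by (simp add: ge_one_powr_ge_zero)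
    ultimately have "(s powr a - 1)\<^sup>2 \<le> (a * 2 powr a * (s - 1))\<^sup>2" by (intro power_mono) auto
    then show ?thesis by (simp add: power2_commute)
  qed
  have sb: "(s powr a)\<^sup>2 \<le> 4 powr a"
  proof -
    have "s powr a \<le> 2 powr a" using s a by (intro powr_mono2) auto
    then have "(s powr a)\<^sup>2 \<le> (2 powr a)\<^sup>2" by (rule power_mono) simp
    also have "\<dots> = 4 powr a" by (simp add: power2_eq_square powr_mult[symmetric])
    finally show ?thesis .
  qed
  have e: "f x - s powr a * f (s *\<^sub>R x) = (1 - s powr a) *\<^sub>R f x + (s powr a) *\<^sub>R (f x - f (s *\<^sub>R x))" for x
    by (simp add: algebra_simps)
  have "sqn (\<lambda>x. f x - s powr a * f (s *\<^sub>R x)) \<le> 2 * ((1 - s powr a)\<^sup>2 * sqn f) + 2 * ((s powr a)\<^sup>2 * sqn (\<lambda>x. f x - f (s *\<^sub>R x)))"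
    unfolding e using sqint_add(2)[OF sqint_scaleR[OF C1c_sqint[OF f]] sqint_scaleR[OF d], of "1 - s powr a" "s powr a"]
    by (simp only: sqn_scaleR)
  also have "\<dots> \<le> 2 * ((a * 2 powr a * (s - 1))\<^sup>2 * (4 * sqn (egrad f))) + 2 * (4 powr a * ((s - 1)\<^sup>2 * sqn (egrad f)))"
    by (intro add_mono mult_left_mono mult_mono sa sb sf b1) auto
  also have "\<dots> = (8 * (a * 2 powr a)\<^sup>2 + 2 * 4 powr a) * (s - 1)\<^sup>2 * sqn (egrad f)"
    unfolding power_mult_distrib[of "a * 2 powr a" "s - 1"] by algebra
  finally show ?thesis .
qed

lemma H10_dilation:
  assumes z: "H10 (ball 0 1) z Z" and s: "1 \<le> s"
  shows "H10 (ball 0 1) (\<lambda>x. s powr a * z (s *\<^sub>R x)) (\<lambda>x. (s powr (a + 1)) *\<^sub>R Z (s *\<^sub>R x))"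
proof -
  have "H10 (ball 0 1) (\<lambda>x. z (0 + s *\<^sub>R x)) (\<lambda>x. s *\<^sub>R Z (0 + s *\<^sub>R x))"
  proof (rule H10_affine[OF z])
    fix y :: 'a assume "y \<in> ball 0 1"
    then show "(1 / s) *\<^sub>R (y - 0) \<in> ball 0 1" using s by (simp add: field_simps)
  qed (use s in simp)
  from H10_cmult[OF this, of "s powr a"] show ?thesis using s by (simp add: powr_add)
qed

lemma H10_dilation_diff:
  fixes z :: "'a::euclidean_space \<Rightarrow> real"
  assumes z: "H10 (ball 0 1) z Z" and N: "DIM('a) \<ge> 2" and s: "1 \<le> s" "s \<le> 2" and a: "a \<ge> 0"
  shows "sqn (\<lambda>x. z x - s powr a * z (s *\<^sub>R x)) \<le> (8 * (a * 2 powr a)\<^sup>2 + 2 * 4 powr a) * (s - 1)\<^sup>2 * sqn Z"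
proof -
  obtain f where f: "\<And>k::nat. C1c (ball 0 1) (f k)" "(\<lambda>k. sqn (\<lambda>x. f k x - z x)) \<longlonglongrightarrow> 0"
    "(\<lambda>k. sqn (\<lambda>x. egrad (f k) x - Z x)) \<longlonglongrightarrow> 0" using H10_approx[OF z] by blast
  define T where "T g x = g x - s powr a * g (s *\<^sub>R x)" for g :: "'a \<Rightarrow> real" and x
  have Ti: "sqint (T g)" if "sqint g" for g
    unfolding T_def[abs_def]
    using sqint_diff(1)[OF that sqint_cmult[OF sqint_affine(1)[OF that, of s 0], of "s powr a"]] s by simp
  have Tb: "sqn (T g) \<le> 2 * sqn g + 2 * ((s powr a)\<^sup>2 * sqn g / s ^ DIM('a))" if "sqint g" for g
    unfolding T_def[abs_def]
    using sqint_diff(2)[OF that sqint_cmult[OF sqint_affine(1)[OF that, of s 0], of "s powr a"]] s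
      sqint_affine(2)[OF that, of s 0] by (simp add: sqn_cmult)
  have d: "sqint (\<lambda>x. f k x - z x)" for k by (rule sqint_diff(1)[OF C1c_sqint[OF f(1)] H10D(1)[OF z]])
  have lim: "(\<lambda>k. sqn (\<lambda>x. T (f k) x - T z x)) \<longlonglongrightarrow> 0"
  proof (rule tendsto_sandwich[of "\<lambda>k. 0"])
    have "sqn (\<lambda>x. T (f k) x - T z x) = sqn (T (\<lambda>x. f k x - z x))" for k
      by (rule arg_cong[where f = sqn]) (auto simp: T_def algebra_simps)
    then show "\<forall>\<^sub>F k in sequentially. sqn (\<lambda>x. T (f k) x - T z x) \<le> 2 * sqn (\<lambda>x. f k x - z x) + 2 * ((s powr a)\<^sup>2 * sqn (\<lambda>x. f k x - z x) / s ^ DIM('a))"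
      using Tb[OF d] by simp
    have "(\<lambda>k. 2 * sqn (\<lambda>x. f k x - z x) + 2 * ((s powr a)\<^sup>2 * sqn (\<lambda>x. f k x - z x) / s ^ DIM('a))) \<longlonglongrightarrow> 2 * 0 + 2 * ((s powr a)\<^sup>2 * 0 / s ^ DIM('a))"
      using s by (intro tendsto_intros f(2)) auto
    then show "(\<lambda>k. 2 * sqn (\<lambda>x. f k x - z x) + 2 * ((s powr a)\<^sup>2 * sqn (\<lambda>x. f k x - z x) / s ^ DIM('a))) \<longlonglongrightarrow> 0" by simp
  qed auto
  have "(\<lambda>k. sqn (T (f k))) \<longlonglongrightarrow> sqn (T z)"
    by (rule tendsto_sqn[OF Ti[OF H10D(1)[OF z]] Ti[OF C1c_sqint[OF f(1)]] lim])
  moreover have "(\<lambda>k. (8 * (a * 2 powr a)\<^sup>2 + 2 * 4 powr a) * (s - 1)\<^sup>2 * sqn (egrad (f k)))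
      \<longlonglongrightarrow> (8 * (a * 2 powr a)\<^sup>2 + 2 * 4 powr a) * (s - 1)\<^sup>2 * sqn Z"
    by (intro tendsto_mult tendsto_const tendsto_sqn[OF H10D(2)[OF z] C1c_sqint_egrad[OF f(1)] f(3)])
  moreover have "sqn (T (f k)) \<le> (8 * (a * 2 powr a)\<^sup>2 + 2 * 4 powr a) * (s - 1)\<^sup>2 * sqn (egrad (f k))" for k
    unfolding T_def[abs_def] by (rule C1c_dilation_diff[OF f(1) N s a])
  ultimately have "sqn (T z) \<le> (8 * (a * 2 powr a)\<^sup>2 + 2 * 4 powr a) * (s - 1)\<^sup>2 * sqn Z"
    by (intro LIMSEQ_le) auto
  then show ?thesis by (simp add: T_def[abs_def])
qed

text \<open>The left-hand side is the hyperbolic Dirichlet form of conf^a f and conf^a g, since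
  conf^2 times the volume weight is conf^(-2 a). The scaled gradient is grad f - (a / conf) f x, and
  the cross terms combine to a times the divergence of (f g / conf) x, which integrates to zero.
  What is left over is a (a + 1) f g / conf^2, and a (a + 1) = N (N - 2) / 4.\<close>

lemma conformal_identity:
  fixes f g :: "'a::euclidean_space \<Rightarrow> real"
  assumes f: "C1c (ball 0 1) f" and g: "C1c (ball 0 1) g"
  defines "a \<equiv> (real DIM('a) - 2) / 2"
  shows "(\<integral>x. (conf x powr (- a) *\<^sub>R egrad (\<lambda>x. conf x powr a * f x) x) \<bullet> (conf x powr (- a) *\<^sub>R egrad (\<lambda>x. conf x powr a * g x) x) \<partial>lborel)
    = (\<integral>x. egrad f x \<bullet> egrad g x \<partial>lborel)
      + real DIM('a) * (real DIM('a) - 2) / 4 * (\<integral>x. (hyp_wt x * f x) * (hyp_wt x * g x) \<partial>lborel)"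
proof -
  define M where "M = real DIM('a) * (real DIM('a) - 2) / 4"
  have N: "real DIM('a) = 2 * a + 2" by (simp add: a_def field_simps)
  have M: "M = a * (a + 1)" by (simp add: M_def N)
  define \<phi> where "\<phi> x = conf x powr (- 1) * g x" for x
  have \<phi>: "C1c (ball 0 1) \<phi>" "egrad \<phi> x = conf x powr (- 1) *\<^sub>R egrad g x + (conf x powr (- 2) * g x) *\<^sub>R x" for x
    unfolding \<phi>_def using C1c_conf_powr[OF g, of "-1"] by auto
  define \<xi> where "\<xi> x = f x * \<phi> x" for x
  have \<xi>: "C1c (ball 0 1) \<xi>" "egrad \<xi> x = f x *\<^sub>R egrad \<phi> x + \<phi> x *\<^sub>R egrad f x" for x
    unfolding \<xi>_def using C1c_mult[OF f \<phi>(1) open_ball] by auto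
  have pt: "(conf x powr (- a) *\<^sub>R egrad (\<lambda>x. conf x powr a * f x) x) \<bullet> (conf x powr (- a) *\<^sub>R egrad (\<lambda>x. conf x powr a * g x) x)
     = egrad f x \<bullet> egrad g x - a * (x \<bullet> egrad \<xi> x + real DIM('a) * \<xi> x) + M * ((hyp_wt x * f x) * (hyp_wt x * g x))" for x
  proof (cases "x \<in> ball 0 1")
    case True
    define c where "c = conf x"
    have c: "c > 0" using conf_pos[OF True] by (simp add: c_def)
    have xx: "x \<bullet> x = 1 - 2 * c" using norm_sq_conf[of x] by (simp add: power2_norm_eq_inner c_def)
    have cc: "c powr (- 2) = 1 / c\<^sup>2" "c powr (- 1) = 1 / c" using c by (simp_all add: powr_minus_divide powr_numeral)
    have ca: "c powr (- a) * c powr a = 1" "c powr (- a) * c powr (a - 1) = 1 / c"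
      using c cc(2) by (simp_all add: powr_add[symmetric])
    have sc: "conf x powr (- a) *\<^sub>R egrad (\<lambda>x. conf x powr a * k x) x = egrad k x - (a / c * k x) *\<^sub>R x"
      if k: "C1c (ball 0 1) k" for k
    proof -
      have "conf x powr (- a) *\<^sub>R egrad (\<lambda>x. conf x powr a * k x) x
        = (c powr (- a) * c powr a) *\<^sub>R egrad k x - ((c powr (- a) * c powr (a - 1)) * (a * k x)) *\<^sub>R x"
        unfolding C1c_conf_powr(2)[OF k] c_def[symmetric] by (simp add: scaleR_diff_right mult_ac)
      then show ?thesis unfolding ca by simp
    qed
    have w: "hyp_wt x = 1 / c" using True by (simp add: hyp_wt_def c_def)
    have \<phi>x: "\<phi> x = g x / c" using c by (simp add: \<phi>_def c_def[symmetric] cc)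
    have \<xi>x: "\<xi> x = f x * g x / c" by (simp add: \<xi>_def \<phi>x)
    have E: "x \<bullet> egrad \<xi> x = (f x * (x \<bullet> egrad g x) + g x * (x \<bullet> egrad f x)) / c + f x * g x * (1 - 2 * c) / c\<^sup>2"
      unfolding \<xi>(2) \<phi>(2) c_def[symmetric] cc using c
      by (simp add: inner_add_right \<phi>x xx[symmetric] add_divide_distrib distrib_left)
    show ?thesis
      unfolding sc[OF f] sc[OF g] w E \<xi>x M N
      using c by (simp add: inner_diff_left inner_diff_right xx inner_commute[of "egrad f x" x] field_simps power2_eq_square)
  next
    case False
    then show ?thesis using C1c_outside[OF f False] C1c_outside[OF g False] C1c_outside[OF \<xi>(1) False]
      C1c_outside(2)[OF C1c_conf_powr(1)[OF f] False] by simp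
  qed
  have i1: "integrable lborel (\<lambda>x. egrad f x \<bullet> egrad g x)" by (rule sqint_inner[OF C1c_sqint_egrad[OF f] C1c_sqint_egrad[OF g]])
  have i2: "integrable lborel (\<lambda>x. x \<bullet> egrad \<xi> x + real DIM('a) * \<xi> x)"
    using integral_divergence_radial(1)[OF \<xi>(1) open_ball] C1c_integrable[OF \<xi>(1)] by auto
  have z: "(\<integral>x. x \<bullet> egrad \<xi> x + real DIM('a) * \<xi> x \<partial>lborel) = 0"
    using integral_divergence_radial[OF \<xi>(1) open_ball] C1c_integrable[OF \<xi>(1)] by simp
  have i3: "integrable lborel (\<lambda>x. (hyp_wt x * f x) * (hyp_wt x * g x))"
    unfolding hyp_wt_C1c[OF f] hyp_wt_C1c[OF g]
    by (rule sqint_mult[OF C1c_sqint[OF C1c_conf_powr(1)[OF f]] C1c_sqint[OF C1c_conf_powr(1)[OF g]]])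
  show ?thesis
    unfolding pt M_def[symmetric]
    by (simp only: Bochner_Integration.integral_add Bochner_Integration.integral_diff Bochner_Integration.integrable_diff
        integrable_mult_right i1 i2 i3 integral_mult_right_zero z)
qed

subsection \<open>The critical nonlinearity\<close>

lemma powr_diff_le:
  fixes a b r :: real
  assumes "0 \<le> b" "b \<le> a" "1 \<le> r"
  shows "a powr r - b powr r \<le> r * a powr (r - 1) * (a - b)"
proof -
  consider "b = a" | "b = 0" "a > 0" | "b > 0" "b < a" using assms by linarith
  then show ?thesis
  proof cases
    case 2
    have "a powr r = a powr (r - 1) * a" using 2 by (simp add: powr_diff)
    also have "\<dots> \<le> r * (a powr (r - 1) * a)" using assms(3) 2 by (simp add: mult_le_cancel_right1 mult_less_0_iff)
    finally show ?thesis using 2 by (simp add: mult_ac)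
  next
    case 3
    have "((\<lambda>t. t powr r) has_real_derivative r * x powr (r - 1)) (at x)" if "b \<le> x" "x \<le> a" for x
      using that 3 by (intro has_real_derivative_powr) simp
    from MVT2[OF 3(2) this]
    obtain t where t: "b < t" "t < a" "a powr r - b powr r = (a - b) * (r * t powr (r - 1))" by blast
    have "t powr (r - 1) \<le> a powr (r - 1)" using t 3 assms by (intro powr_mono2) auto
    then have "(a - b) * (r * t powr (r - 1)) \<le> (a - b) * (r * a powr (r - 1))"
      using 3 assms by (intro mult_left_mono) auto
    then show ?thesis using t(3) by (simp add: mult_ac)
  qed simp
qed

definition crit_nl :: "real \<Rightarrow> real \<Rightarrow> real" where
  "crit_nl p s = \<bar>s\<bar> powr (p - 2) * s"

lemma crit_nl_measurable [measurable]: "crit_nl p \<in> borel_measurable borel"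
  unfolding crit_nl_def[abs_def] by measurable

lemma abs_crit_nl: "p > 2 \<Longrightarrow> \<bar>crit_nl p s\<bar> = \<bar>s\<bar> powr (p - 1)"
  by (cases "s = 0") (auto simp: crit_nl_def abs_mult powr_diff power2_eq_square divide_simps)

lemma crit_nl_nonneg: "0 \<le> s \<Longrightarrow> p > 2 \<Longrightarrow> crit_nl p s = s powr (p - 1)"
  using abs_crit_nl[of p s] by (simp add: crit_nl_def)

lemma crit_nl_minus: "crit_nl p (- s) = - crit_nl p s"
  by (simp add: crit_nl_def)

lemma crit_nl_self: "p > 2 \<Longrightarrow> crit_nl p s * s = \<bar>s\<bar> powr p"
  by (cases "s = 0") (auto simp: crit_nl_def powr_diff power2_eq_square divide_simps abs_if)

text \<open>For values of equal sign this is the mean value bound \<open>powr_diff_le\<close>; for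
  opposite signs each term is bounded separately, as |s| and |t| are at most |s - t|. The remaining
  cases follow by oddness and by exchanging s and t.\<close>

lemma crit_nl_monotone_bound:
  assumes p: "p > 2"
  shows "(crit_nl p s - crit_nl p t) * (s - t) \<le> (p - 1) * ((\<bar>s\<bar> powr (p - 2) + \<bar>t\<bar> powr (p - 2)) * (s - t)\<^sup>2)"
proof -
  have same: "(crit_nl p s - crit_nl p t) * (s - t) \<le> (p - 1) * ((\<bar>s\<bar> powr (p - 2) + \<bar>t\<bar> powr (p - 2)) * (s - t)\<^sup>2)"
    if "0 \<le> t" "t \<le> s" for s t
  proof -
    have "(crit_nl p s - crit_nl p t) * (s - t) = (s powr (p - 1) - t powr (p - 1)) * (s - t)"
      using that p by (simp add: crit_nl_nonneg)
    also have "\<dots> \<le> ((p - 1) * s powr (p - 1 - 1) * (s - t)) * (s - t)"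
      using that p by (intro mult_right_mono powr_diff_le) auto
    also have "\<dots> = (p - 1) * (s powr (p - 2) * (s - t)\<^sup>2)" by (simp add: power2_eq_square mult_ac)
    also have "\<dots> \<le> (p - 1) * ((\<bar>s\<bar> powr (p - 2) + \<bar>t\<bar> powr (p - 2)) * (s - t)\<^sup>2)"
      using that p by (intro mult_left_mono mult_right_mono) auto
    finally show ?thesis .
  qed
  have opp: "(crit_nl p s - crit_nl p (- t)) * (s + t) \<le> (p - 1) * ((\<bar>s\<bar> powr (p - 2) + \<bar>t\<bar> powr (p - 2)) * (s + t)\<^sup>2)"
    if "0 \<le> t" "0 \<le> s" for s t
  proof -
    have "crit_nl p s - crit_nl p (- t) = s powr (p - 2) * s + t powr (p - 2) * t"
      using that by (simp add: crit_nl_def)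
    also have "\<dots> \<le> s powr (p - 2) * (s + t) + t powr (p - 2) * (s + t)"
      using that by (intro add_mono mult_left_mono) auto
    also have "\<dots> = (s powr (p - 2) + t powr (p - 2)) * (s + t)" by (simp add: distrib_right)
    finally have "(crit_nl p s - crit_nl p (- t)) * (s + t) \<le> (s powr (p - 2) + t powr (p - 2)) * (s + t) * (s + t)"
      using that by (intro mult_right_mono) auto
    also have "\<dots> \<le> (p - 1) * ((s powr (p - 2) + t powr (p - 2)) * (s + t) * (s + t))"
      using that p by (intro mult_right_mono[of 1 "p - 1", simplified]) auto
    finally show ?thesis using that by (simp add: power2_eq_square mult_ac)
  qed
  consider "0 \<le> t" "t \<le> s" | "0 \<le> s" "s \<le> t" | "t \<le> 0" "s \<le> t" | "s \<le> 0" "t \<le> s" | "t \<le> 0" "0 \<le> s" | "s \<le> 0" "0 \<le> t"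
    by linarith
  then show ?thesis
  proof cases
    case 1 then show ?thesis by (rule same)
  next
    case 2 then show ?thesis using same[of s t] by (simp add: algebra_simps power2_eq_square)
  next
    case 3 then show ?thesis using same[of "- t" "- s"] by (simp add: crit_nl_minus algebra_simps power2_eq_square)
  next
    case 4 then show ?thesis using same[of "- s" "- t"] by (simp add: crit_nl_minus algebra_simps power2_eq_square)
  next
    case 5 then show ?thesis using opp[of "- t" s] by (simp add: crit_nl_minus algebra_simps power2_eq_square)
  next
    case 6 then show ?thesis using opp[of "- s" t] by (simp add: crit_nl_minus algebra_simps power2_eq_square)
  qed
qed

lemma crit_nl_pairing:
  assumes p: "p > 2" and v: "Lpint p v" and z: "Lpint p z"
  shows "integrable lborel (\<lambda>x. crit_nl p (v x) * z x)"
    "\<bar>\<integral>x. crit_nl p (v x) * z x \<partial>lborel\<bar> \<le> Lpn p v powr (1 - 1 / p) * Lpn p z powr (1 / p)"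
proof -
  have [measurable]: "v \<in> borel_measurable borel" "z \<in> borel_measurable borel" using v z by auto
  define P where "P = p / (p - 1)"
  have P: "P > 1" "p > 1" "1 / P + 1 / p = 1" "1 / P = 1 - 1 / p" using p by (auto simp: P_def field_simps)
  have e: "\<bar>crit_nl p (v x)\<bar> powr P = \<bar>v x\<bar> powr p" for x
    using p by (simp add: abs_crit_nl powr_powr P_def)
  have fi: "integrable lborel (\<lambda>x. \<bar>crit_nl p (v x)\<bar> powr P)" unfolding e using v by (rule Lpint_integrable)
  note h = Hoelder_integral[of "\<lambda>x. \<bar>crit_nl p (v x)\<bar>" lborel "\<lambda>x. \<bar>z x\<bar>", OF _ _ abs_ge_zero abs_ge_zero P(1,2,3) fi Lpint_integrable[OF z]]
  have i: "integrable lborel (\<lambda>x. \<bar>crit_nl p (v x) * z x\<bar>)" unfolding abs_mult by (rule h(1)) auto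
  then show "integrable lborel (\<lambda>x. crit_nl p (v x) * z x)" by (subst (asm) integrable_abs_iff) auto
  have "\<bar>\<integral>x. crit_nl p (v x) * z x \<partial>lborel\<bar> \<le> (\<integral>x. \<bar>crit_nl p (v x) * z x\<bar> \<partial>lborel)"
    by (rule integral_abs_bound)
  also have "\<dots> \<le> Lpn p v powr (1 / P) * Lpn p z powr (1 / p)"
    unfolding abs_mult using h(2) unfolding e Lpn_def by simp
  finally show "\<bar>\<integral>x. crit_nl p (v x) * z x \<partial>lborel\<bar> \<le> Lpn p v powr (1 - 1 / p) * Lpn p z powr (1 / p)"
    by (simp add: P)
qed

lemma Lpint_affine:
  fixes f :: "'a::euclidean_space \<Rightarrow> real"
  assumes "Lpint p f" "c > 0"
  shows "Lpint p (\<lambda>x. f (t + c *\<^sub>R x))" "Lpn p (\<lambda>x. f (t + c *\<^sub>R x)) = Lpn p f / c ^ DIM('a)"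
proof -
  have [measurable]: "f \<in> borel_measurable borel" using assms(1) by (auto simp: Lpint_def)
  show "Lpint p (\<lambda>x. f (t + c *\<^sub>R x))"
    using integrable_affine[OF Lpint_integrable[OF assms(1)] assms(2)] by (simp add: Lpint_def)
  show "Lpn p (\<lambda>x. f (t + c *\<^sub>R x)) = Lpn p f / c ^ DIM('a)"
    using integral_affine[OF Lpint_integrable[OF assms(1)] assms(2)] by (simp add: Lpn_def)
qed

subsection \<open>The transformed equation and its behaviour under dilations\<close>

text \<open>The test pairs range over the closure and not just over test functions, because the
  equation is tested with dilates of the solution itself. The pointwise vanishing outside the ball
  is used where v and F are evaluated at s x.\<close>

definition conf_sol :: "real \<Rightarrow> ('a::euclidean_space \<Rightarrow> real) \<Rightarrow> ('a \<Rightarrow> 'a) \<Rightarrow> bool" where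
  "conf_sol m v F \<longleftrightarrow> H10 (ball 0 1) v F \<and> (\<forall>x. x \<notin> ball 0 1 \<longrightarrow> v x = 0 \<and> F x = 0) \<and>
     (\<forall>z Z. H10 (ball 0 1) z Z \<longrightarrow>
        (\<integral>x. F x \<bullet> Z x \<partial>lborel) + m * (\<integral>x. (hyp_wt x * v x) * (hyp_wt x * z x) \<partial>lborel)
        = (\<integral>x. crit_nl (crit_exp DIM('a)) (v x) * z x \<partial>lborel))"

lemma hyp_wt_mono:
  assumes "norm x \<le> norm y" "y \<in> ball 0 1"
  shows "hyp_wt x \<le> hyp_wt y"
proof -
  have "conf y \<le> conf x" unfolding conf_def using power_mono[OF assms(1), of 2] by simp
  moreover have "conf y > 0" using conf_pos[OF assms(2)] .
  ultimately show ?thesis using assms by (auto simp: hyp_wt_def intro!: divide_left_mono)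
qed

lemma dilation_estimate:
  fixes v :: "'a::euclidean_space \<Rightarrow> real"
  assumes N: "DIM('a) \<ge> 3" and sol: "conf_sol m v F" and m: "m \<ge> 0"
  defines "a \<equiv> (real DIM('a) - 2) / 2"
  shows "\<exists>C\<ge>0. \<forall>s. 1 \<le> s \<longrightarrow> s \<le> 2 \<longrightarrow>
     1 / 4 * sqn (\<lambda>x. F x - s powr (a + 1) *\<^sub>R F (s *\<^sub>R x))
       + m / 2 * ((1 - 1 / s\<^sup>2) * sqn (\<lambda>x. hyp_wt x * v x)) \<le> C * (s - 1)\<^sup>2"
proof -
  define p where "p = crit_exp DIM('a)"
  have n: "real DIM('a) > 2" using N by simp
  have p2: "p > 2" using n by (simp add: p_def crit_exp_def field_simps)
  have a0: "a > 0" using n by (simp add: a_def)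
  have Na: "real DIM('a) = 2 * a + 2" by (simp add: a_def field_simps)
  \<comment> \<open>Criticality: the first identity makes the L^p norm invariant under the dilation,
    the second makes |w|^(p - 2) scale with s^2.\<close>
  have ap: "a * p = real DIM('a)" "a * (p - 2) = 2"
    using n by (simp_all add: p_def crit_exp_def a_def field_simps)
  have vF: "H10 (ball 0 1) v F" and out: "\<And>x. x \<notin> ball 0 1 \<Longrightarrow> v x = 0" "\<And>x. x \<notin> ball 0 1 \<Longrightarrow> F x = 0"
    and eq: "\<And>z Z. H10 (ball 0 1) z Z \<Longrightarrow>
        (\<integral>x. F x \<bullet> Z x \<partial>lborel) + m * (\<integral>x. (hyp_wt x * v x) * (hyp_wt x * z x) \<partial>lborel)
        = (\<integral>x. crit_nl p (v x) * z x \<partial>lborel)"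
    using sol unfolding conf_sol_def p_def by auto
  have N2: "DIM('a) \<ge> 2" using N by simp
  obtain S where S: "S > 0" "\<And>U (z :: 'a \<Rightarrow> real) Z. H10 U z Z \<Longrightarrow> Lpint p z"
    "\<And>U (z :: 'a \<Rightarrow> real) Z. H10 U z Z \<Longrightarrow> Lpn p z powr (2 / p) \<le> S * sqn Z"
    unfolding p_def by (rule H10_Sobolev[where 'a='a, OF N]) blast
  have [measurable]: "v \<in> borel_measurable borel" using H10D(1)[OF vF] by auto
  have vp: "Lpint p v" by (rule S(2)[OF vF])
  define Q where "Q x = \<bar>v x\<bar> powr (p - 2)" for x
  have [measurable]: "Q \<in> borel_measurable borel" unfolding Q_def by measurable
  have Qi: "integrable lborel (\<lambda>x. Q x powr (real DIM('a) / 2))"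
  proof -
    have "(p - 2) * (real DIM('a) / 2) = p" using ap n by (simp add: p_def crit_exp_def field_simps)
    then show ?thesis using Lpint_integrable[OF vp] by (simp add: Q_def powr_powr)
  qed
  \<comment> \<open>The absorption is used twice, for the potentials of v and of w, each time with
    the factor (p - 1) S; together they cost 1 / 4 of the Dirichlet term.\<close>
  define \<eta> where "\<eta> = 1 / (8 * (p - 1) * S)"
  have \<eta>: "\<eta> > 0" using p2 S(1) by (simp add: \<eta>_def)
  obtain K where K: "K \<ge> 0" "\<And>z. sqint z \<Longrightarrow> Lpint p z \<Longrightarrow> integrable lborel (\<lambda>x. Q x * (z x)\<^sup>2)"
    "\<And>z. sqint z \<Longrightarrow> Lpint p z \<Longrightarrow> (\<integral>x. Q x * (z x)\<^sup>2 \<partial>lborel) \<le> K * sqn z + \<eta> * Lpn p z powr (2 / p)"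
    unfolding p_def by (rule potential_absorption[OF N _ _ Qi \<eta>]) (auto simp: Q_def)
  define C1 where "C1 = (8 * (a * 2 powr a)\<^sup>2 + 2 * 4 powr a)"
  define C where "C = (p - 1) * (5 * K) * (C1 * sqn F)"
  have C0: "C \<ge> 0" unfolding C_def C1_def using p2 K(1) by (intro mult_nonneg_nonneg) auto
  have "1 / 4 * sqn (\<lambda>x. F x - s powr (a + 1) *\<^sub>R F (s *\<^sub>R x))
       + m / 2 * ((1 - 1 / s\<^sup>2) * sqn (\<lambda>x. hyp_wt x * v x)) \<le> C * (s - 1)\<^sup>2" if s: "1 \<le> s" "s \<le> 2" for s
  proof -
    define w where "w x = s powr a * v (s *\<^sub>R x)" for x
    define W where "W x = s powr (a + 1) *\<^sub>R F (s *\<^sub>R x)" for x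
    have s0: "s > 0" using s by simp
    have sN: "s ^ DIM('a) = s powr (2 * a + 2)" using s0 by (simp add: Na[symmetric] powr_realpow)
    have wW: "H10 (ball 0 1) w W" unfolding w_def W_def by (rule H10_dilation[OF vF s(1)])
    have [measurable]: "w \<in> borel_measurable borel" using H10D(1)[OF wW] by auto
    have wp: "Lpint p w" by (rule S(2)[OF wW])
    define z where "z x = v x - w x" for x
    define Z where "Z x = F x - W x" for x
    have zZ: "H10 (ball 0 1) z Z" unfolding z_def Z_def by (rule H10_diff[OF vF wW])
    have zp: "Lpint p z" by (rule S(2)[OF zZ])
    have zs: "sqint z" by (rule H10D(1)[OF zZ])
    have WF: "sqn W = sqn F"
    proof -
      have "sqn W = (s powr (a + 1))\<^sup>2 * (sqn F / s ^ DIM('a))"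
        unfolding W_def sqn_scaleR using sqint_affine(2)[OF H10D(2)[OF vF] s0, of 0] by simp
      also have "(s powr (a + 1))\<^sup>2 = s ^ DIM('a)" unfolding sN by (simp add: power2_eq_square powr_add[symmetric])
      finally show ?thesis using s0 by simp
    qed
    have wv: "Lpn p w = Lpn p v"
    proof -
      have "Lpn p w = (\<integral>x. (s powr a) powr p * \<bar>v (0 + s *\<^sub>R x)\<bar> powr p \<partial>lborel)"
        unfolding Lpn_def w_def using s0 by (simp add: abs_mult powr_mult)
      also have "\<dots> = (s powr a) powr p * Lpn p (\<lambda>x. v (0 + s *\<^sub>R x))" unfolding Lpn_def by simp
      also have "\<dots> = s ^ DIM('a) * (Lpn p v / s ^ DIM('a))"
        using Lpint_affine(2)[OF vp s0, of 0] ap(1) s0 by (simp add: powr_powr powr_realpow)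
      finally show ?thesis using s0 by simp
    qed
    \<comment> \<open>Polarisation, with \<open>sqn W = sqn F\<close>: this is where the invariance
      of the Dirichlet norm enters.\<close>
    have FZ: "(\<integral>x. F x \<bullet> Z x \<partial>lborel) = 1 / 2 * sqn Z"
    proof -
      have "(\<integral>x. F x \<bullet> Z x \<partial>lborel) = (\<integral>x. F x \<bullet> F x \<partial>lborel) - (\<integral>x. F x \<bullet> W x \<partial>lborel)"
        unfolding Z_def inner_diff_right
        by (rule Bochner_Integration.integral_diff[OF sqint_inner[OF H10D(2)[OF vF] H10D(2)[OF vF]] sqint_inner[OF H10D(2)[OF vF] H10D(2)[OF wW]]])
      also have "\<dots> = sqn F - (\<integral>x. F x \<bullet> W x \<partial>lborel)" by (simp add: sqn_inner)
      finally show ?thesis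
        using sqn_diff_eq[OF H10D(2)[OF vF] H10D(2)[OF wW]] WF unfolding Z_def by simp
    qed
    have hv: "sqint (\<lambda>x. hyp_wt x * v x)" and hw: "sqint (\<lambda>x. hyp_wt x * w x)"
      using H10_Hardy(1)[OF vF N2] H10_Hardy(1)[OF wW N2] by auto
    \<comment> \<open>The weight at x is at most the weight at s x, and scaling leaves s^(2 a) / s^N
      = 1 / s^2. This strict loss is the source of the sign of the mass term.\<close>
    have hwv: "sqn (\<lambda>x. hyp_wt x * w x) \<le> 1 / s\<^sup>2 * sqn (\<lambda>x. hyp_wt x * v x)"
    proof -
      let ?h = "\<lambda>x. hyp_wt (0 + s *\<^sub>R x) * v (0 + s *\<^sub>R x)"
      have "norm (hyp_wt x * w x) \<le> s powr a * norm (?h x)" for x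
      proof (cases "s *\<^sub>R x \<in> ball 0 1")
        case True
        have "norm x \<le> norm (s *\<^sub>R x)" using s by (simp add: mult_le_cancel_right1)
        then have "hyp_wt x \<le> hyp_wt (s *\<^sub>R x)" using True by (rule hyp_wt_mono)
        then have "hyp_wt x * (s powr a * \<bar>v (s *\<^sub>R x)\<bar>) \<le> hyp_wt (s *\<^sub>R x) * (s powr a * \<bar>v (s *\<^sub>R x)\<bar>)"
          by (rule mult_right_mono) simp
        then show ?thesis using hyp_wt_nonneg[of x] hyp_wt_nonneg[of "s *\<^sub>R x"] by (simp add: w_def abs_mult mult_ac)
      next
        case False
        then show ?thesis using out(1)[OF False] by (simp add: w_def)
      qed
      from sqint_bound(2)[OF sqint_affine(1)[OF hv s0, of 0] _ this]
      have "sqn (\<lambda>x. hyp_wt x * w x) \<le> (s powr a)\<^sup>2 * sqn ?h" by simp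
      also have "\<dots> = (s powr a)\<^sup>2 * (sqn (\<lambda>x. hyp_wt x * v x) / s ^ DIM('a))"
        using sqint_affine(2)[OF hv s0, of 0] by simp
      also have "\<dots> = 1 / s\<^sup>2 * sqn (\<lambda>x. hyp_wt x * v x)"
      proof -
        have "s ^ DIM('a) = (s powr a)\<^sup>2 * s\<^sup>2" unfolding sN using s0
          by (simp add: power2_eq_square powr_add[symmetric]) (simp add: powr_add powr_numeral power2_eq_square)
        then show ?thesis using s0 by simp
      qed
      finally show ?thesis .
    qed
    have hz: "(\<integral>x. (hyp_wt x * v x) * (hyp_wt x * z x) \<partial>lborel) \<ge> 1 / 2 * ((1 - 1 / s\<^sup>2) * sqn (\<lambda>x. hyp_wt x * v x))"
    proof -
      let ?I = "\<integral>x. (hyp_wt x * v x) \<bullet> (hyp_wt x * w x) \<partial>lborel"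
      have "(\<integral>x. (hyp_wt x * v x) * (hyp_wt x * z x) \<partial>lborel) = (\<integral>x. (hyp_wt x * v x) \<bullet> (hyp_wt x * v x) - (hyp_wt x * v x) \<bullet> (hyp_wt x * w x) \<partial>lborel)"
        by (simp add: z_def right_diff_distrib)
      also have "\<dots> = sqn (\<lambda>x. hyp_wt x * v x) - ?I"
        unfolding sqn_inner[of "\<lambda>x. hyp_wt x * v x"]
        by (rule Bochner_Integration.integral_diff[OF sqint_inner[OF hv hv] sqint_inner[OF hv hw]])
      finally have e1: "(\<integral>x. (hyp_wt x * v x) * (hyp_wt x * z x) \<partial>lborel) = sqn (\<lambda>x. hyp_wt x * v x) - ?I" .
      have "0 \<le> sqn (\<lambda>x. hyp_wt x * v x - hyp_wt x * w x)" by simp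
      also have "\<dots> = sqn (\<lambda>x. hyp_wt x * v x) - 2 * ?I + sqn (\<lambda>x. hyp_wt x * w x)" by (rule sqn_diff_eq[OF hv hw])
      finally have "2 * ?I \<le> sqn (\<lambda>x. hyp_wt x * v x) + 1 / s\<^sup>2 * sqn (\<lambda>x. hyp_wt x * v x)" using hwv by linarith
      moreover have "(1 - 1 / s\<^sup>2) * sqn (\<lambda>x. hyp_wt x * v x) = sqn (\<lambda>x. hyp_wt x * v x) - 1 / s\<^sup>2 * sqn (\<lambda>x. hyp_wt x * v x)"
        by (simp only: left_diff_distrib mult_1)
      ultimately show ?thesis unfolding e1 by linarith
    qed
    have i1: "integrable lborel (\<lambda>x. crit_nl p (v x) * z x)" and i2: "integrable lborel (\<lambda>x. crit_nl p (w x) * z x)"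
      by (rule crit_nl_pairing(1)[OF p2 vp zp], rule crit_nl_pairing(1)[OF p2 wp zp])
    \<comment> \<open>By Hoelder's inequality and the equality of the L^p norms,
      \<open>crit_nl p (w x)\<close> paired with v is at most its pairing with w. Subtracting this
      integral only enlarges the right-hand side and produces the difference needed for
      \<open>crit_nl_monotone_bound\<close>.\<close>
    have neg: "(\<integral>x. crit_nl p (w x) * z x \<partial>lborel) \<le> 0"
    proof -
      have "(\<integral>x. crit_nl p (w x) * z x \<partial>lborel) = (\<integral>x. crit_nl p (w x) * v x \<partial>lborel) - (\<integral>x. crit_nl p (w x) * w x \<partial>lborel)"
        unfolding z_def right_diff_distrib
        by (rule Bochner_Integration.integral_diff[OF crit_nl_pairing(1)[OF p2 wp vp] crit_nl_pairing(1)[OF p2 wp wp]])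
      also have "(\<integral>x. crit_nl p (w x) * w x \<partial>lborel) = Lpn p w" using p2 by (simp add: crit_nl_self Lpn_def)
      also have "(\<integral>x. crit_nl p (w x) * v x \<partial>lborel) \<le> Lpn p w powr (1 - 1 / p) * Lpn p v powr (1 / p)"
        using crit_nl_pairing(2)[OF p2 wp vp] by linarith
      also have "\<dots> = Lpn p w"
        unfolding wv using p2 Lpn_nonneg[of p v] by (cases "Lpn p v = 0") (auto simp: powr_add[symmetric])
      finally show ?thesis by simp
    qed
    have Qz: "integrable lborel (\<lambda>x. Q x * (z x)\<^sup>2)" "(\<integral>x. Q x * (z x)\<^sup>2 \<partial>lborel) \<le> K * sqn z + \<eta> * Lpn p z powr (2 / p)"
      using K(2,3)[OF zs zp] by auto
    \<comment> \<open>The dilation is undone on z, so that the constant K belonging to the potential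
      of v serves every s; the loss is s^2 \<le> 4. With the potential of v itself this gives 5 K in
      total.\<close>
    have Qw: "integrable lborel (\<lambda>x. \<bar>w x\<bar> powr (p - 2) * (z x)\<^sup>2)"
      "(\<integral>x. \<bar>w x\<bar> powr (p - 2) * (z x)\<^sup>2 \<partial>lborel) \<le> 4 * K * sqn z + \<eta> * Lpn p z powr (2 / p)"
    proof -
      define z' where "z' y = z (0 + (1 / s) *\<^sub>R y)" for y
      have s_inv: "1 / s > 0" using s0 by simp
      have z's: "sqint z'" "sqn z' = s ^ DIM('a) * sqn z" and z'p: "Lpint p z'" "Lpn p z' = s ^ DIM('a) * Lpn p z"
        unfolding z'_def using sqint_affine[OF zs s_inv, of 0] Lpint_affine[OF zp s_inv, of 0] s0
        by (auto simp: power_one_over)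
      define h where "h y = Q y * (z' y)\<^sup>2" for y
      have hi: "integrable lborel h" and hb: "(\<integral>x. h x \<partial>lborel) \<le> K * sqn z' + \<eta> * Lpn p z' powr (2 / p)"
        unfolding h_def using K(2,3)[OF z's(1) z'p(1)] by auto
      have e: "\<bar>w x\<bar> powr (p - 2) * (z x)\<^sup>2 = s\<^sup>2 * h (0 + s *\<^sub>R x)" for x
      proof -
        have "\<bar>w x\<bar> powr (p - 2) = s powr (a * (p - 2)) * \<bar>v (s *\<^sub>R x)\<bar> powr (p - 2)"
          using s0 by (simp add: w_def abs_mult powr_mult powr_powr)
        also have "s powr (a * (p - 2)) = s\<^sup>2" unfolding ap using s0 by (simp add: powr_numeral)
        finally show ?thesis using s0 by (simp add: h_def Q_def z'_def)
      qed
      show "integrable lborel (\<lambda>x. \<bar>w x\<bar> powr (p - 2) * (z x)\<^sup>2)"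
        unfolding e by (intro integrable_mult_right integrable_affine[OF hi s0])
      have "(\<integral>x. \<bar>w x\<bar> powr (p - 2) * (z x)\<^sup>2 \<partial>lborel) = s\<^sup>2 * ((\<integral>x. h x \<partial>lborel) / s ^ DIM('a))"
        unfolding e using integral_affine[OF hi s0, of 0] by simp
      also have "\<dots> \<le> s\<^sup>2 * ((K * sqn z' + \<eta> * Lpn p z' powr (2 / p)) / s ^ DIM('a))"
        using s0 by (intro mult_left_mono divide_right_mono hb) auto
      also have "\<dots> = s\<^sup>2 * K * sqn z + \<eta> * Lpn p z powr (2 / p)"
      proof -
        have "(s ^ DIM('a)) powr (2 / p) = s powr (2 * a)"
        proof -
          have "real DIM('a) * (2 / p) = 2 * a" using ap(1) p2 by (simp add: field_simps)
          then show ?thesis using s0 by (simp add: powr_realpow[symmetric] powr_powr)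
        qed
        then have "Lpn p z' powr (2 / p) = s powr (2 * a) * Lpn p z powr (2 / p)"
          unfolding z'p using s0 by (simp add: powr_mult)
        moreover have "s ^ DIM('a) = s powr (2 * a) * s\<^sup>2" unfolding sN using s0 by (simp add: powr_add powr_numeral)
        ultimately show ?thesis unfolding z's using s0 by (simp add: field_simps)
      qed
      also have "\<dots> \<le> 4 * K * sqn z + \<eta> * Lpn p z powr (2 / p)"
      proof -
        have "s\<^sup>2 \<le> 2\<^sup>2" using s by (intro power_mono) auto
        then have "s\<^sup>2 * (K * sqn z) \<le> 4 * (K * sqn z)" using K(1) by (intro mult_right_mono) auto
        then show ?thesis by (simp add: mult_ac)
      qed
      finally show "(\<integral>x. \<bar>w x\<bar> powr (p - 2) * (z x)\<^sup>2 \<partial>lborel) \<le> 4 * K * sqn z + \<eta> * Lpn p z powr (2 / p)" .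
    qed
    have "(\<integral>x. crit_nl p (v x) * z x \<partial>lborel) \<le> (\<integral>x. crit_nl p (v x) * z x \<partial>lborel) - (\<integral>x. crit_nl p (w x) * z x \<partial>lborel)"
      using neg by simp
    also have "\<dots> = (\<integral>x. crit_nl p (v x) * z x - crit_nl p (w x) * z x \<partial>lborel)"
      by (rule Bochner_Integration.integral_diff[OF i1 i2, symmetric])
    also have "\<dots> \<le> (\<integral>x. (p - 1) * (Q x * (z x)\<^sup>2 + \<bar>w x\<bar> powr (p - 2) * (z x)\<^sup>2) \<partial>lborel)"
    proof (rule integral_mono)
      show "crit_nl p (v x) * z x - crit_nl p (w x) * z x \<le> (p - 1) * (Q x * (z x)\<^sup>2 + \<bar>w x\<bar> powr (p - 2) * (z x)\<^sup>2)" for x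
        using crit_nl_monotone_bound[OF p2, of "v x" "w x"] by (simp add: z_def Q_def left_diff_distrib distrib_right)
      show "integrable lborel (\<lambda>x. crit_nl p (v x) * z x - crit_nl p (w x) * z x)"
        by (rule Bochner_Integration.integrable_diff[OF i1 i2])
      show "integrable lborel (\<lambda>x. (p - 1) * (Q x * (z x)\<^sup>2 + \<bar>w x\<bar> powr (p - 2) * (z x)\<^sup>2))"
        by (intro integrable_mult_right Bochner_Integration.integrable_add Qz(1) Qw(1))
    qed
    also have "\<dots> = (p - 1) * ((\<integral>x. Q x * (z x)\<^sup>2 \<partial>lborel) + (\<integral>x. \<bar>w x\<bar> powr (p - 2) * (z x)\<^sup>2 \<partial>lborel))"
      by (simp only: integral_mult_right_zero Bochner_Integration.integral_add[OF Qz(1) Qw(1)])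
    also have "\<dots> \<le> (p - 1) * (5 * K * sqn z + 2 * \<eta> * Lpn p z powr (2 / p))"
      using Qz(2) Qw(2) p2 by (intro mult_left_mono) auto
    also have "\<dots> \<le> (p - 1) * (5 * K * sqn z + 2 * \<eta> * (S * sqn Z))"
      using S(3)[OF zZ] p2 \<eta> by (intro mult_left_mono add_left_mono) auto
    also have "\<dots> = (p - 1) * (5 * K) * sqn z + 1 / 4 * sqn Z"
      unfolding \<eta>_def using p2 S(1) by (simp add: field_simps)
    finally have main: "(\<integral>x. crit_nl p (v x) * z x \<partial>lborel) \<le> (p - 1) * (5 * K) * sqn z + 1 / 4 * sqn Z" .
    have "sqn z \<le> C1 * (s - 1)\<^sup>2 * sqn F"
      unfolding z_def w_def C1_def using H10_dilation_diff[OF vF N2 s] a0 by simp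
    then have "(p - 1) * (5 * K) * sqn z \<le> (p - 1) * (5 * K) * (C1 * (s - 1)\<^sup>2 * sqn F)"
      using p2 K(1) by (intro mult_left_mono) auto
    also have "\<dots> = C * (s - 1)\<^sup>2" by (simp add: C_def mult_ac)
    finally have zb: "(p - 1) * (5 * K) * sqn z \<le> C * (s - 1)\<^sup>2" .
    have "m * (1 / 2 * ((1 - 1 / s\<^sup>2) * sqn (\<lambda>x. hyp_wt x * v x))) \<le> m * (\<integral>x. (hyp_wt x * v x) * (hyp_wt x * z x) \<partial>lborel)"
      by (rule mult_left_mono[OF hz m])
    moreover have "m * (1 / 2 * ((1 - 1 / s\<^sup>2) * sqn (\<lambda>x. hyp_wt x * v x))) = m / 2 * ((1 - 1 / s\<^sup>2) * sqn (\<lambda>x. hyp_wt x * v x))"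
      by simp
    ultimately have "1 / 4 * sqn Z + m / 2 * ((1 - 1 / s\<^sup>2) * sqn (\<lambda>x. hyp_wt x * v x)) \<le> C * (s - 1)\<^sup>2"
      using eq[OF zZ] FZ main zb by linarith
    then show ?thesis unfolding Z_def[abs_def] W_def .
  qed
  with C0 show ?thesis by blast
qed

lemma conf_sol_positive_mass:
  fixes v :: "'a::euclidean_space \<Rightarrow> real"
  assumes N: "DIM('a) \<ge> 3" and sol: "conf_sol m v F" and m: "m > 0"
  shows "AE x in lborel. v x = 0"
proof -
  define D where "D = sqn (\<lambda>x. hyp_wt x * v x)"
  have vF: "H10 (ball 0 1) v F" and out: "\<And>x. x \<notin> ball 0 1 \<Longrightarrow> v x = 0"
    using sol unfolding conf_sol_def by auto
  have N2: "DIM('a) \<ge> 2" using N by simp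
  obtain C where C: "C \<ge> 0" "\<And>s. 1 \<le> s \<Longrightarrow> s \<le> 2 \<Longrightarrow>
     1 / 4 * sqn (\<lambda>x. F x - s powr ((real DIM('a) - 2) / 2 + 1) *\<^sub>R F (s *\<^sub>R x))
       + m / 2 * ((1 - 1 / s\<^sup>2) * D) \<le> C * (s - 1)\<^sup>2"
    using dilation_estimate[OF N sol] m unfolding D_def by auto
  have b: "m / 8 * D \<le> C * t" if t: "0 < t" "t \<le> 1" for t
  proof -
    have s: "1 \<le> 1 + t" "1 + t \<le> 2" using t by auto
    have "m / 2 * ((1 - 1 / (1 + t)\<^sup>2) * D) \<le> C * ((1 + t) - 1)\<^sup>2"
      using C(2)[OF s] sqn_nonneg[of "\<lambda>x. F x - (1 + t) powr ((real DIM('a) - 2) / 2 + 1) *\<^sub>R F ((1 + t) *\<^sub>R x)"] by linarith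
    \<comment> \<open>A crude linear lower bound on the unit interval; dividing by t leaves D
      bounded by a multiple of t.\<close>
    moreover have "t / 4 \<le> 1 - 1 / (1 + t)\<^sup>2"
    proof -
      have "1 \<le> (1 - t / 4) * (1 + t)\<^sup>2"
      proof -
        have "(1 - t / 4) * (1 + t)\<^sup>2 = 1 + t * (7 / 4 + t / 2 - t\<^sup>2 / 4)" by (simp add: power2_eq_square algebra_simps)
        moreover have "t\<^sup>2 \<le> 1" using t by (simp add: power_le_one)
        then have "t * (7 / 4 + t / 2 - t\<^sup>2 / 4) \<ge> 0" using t by (intro mult_nonneg_nonneg) auto
        ultimately show ?thesis by linarith
      qed
      then have "1 / (1 + t)\<^sup>2 \<le> 1 - t / 4" using t by (simp add: pos_divide_le_eq)
      then show ?thesis by simp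
    qed
    then have "m / 2 * (t / 4 * D) \<le> m / 2 * ((1 - 1 / (1 + t)\<^sup>2) * D)"
      using m by (intro mult_left_mono mult_right_mono) (auto simp: D_def)
    ultimately have "m / 2 * (t / 4 * D) \<le> C * ((1 + t) - 1)\<^sup>2" by linarith
    then have "t * (m / 8 * D) \<le> t * (C * t)" by (simp add: power2_eq_square mult_ac)
    then show ?thesis using t by (rule_tac mult_left_le_imp_le) auto
  qed
  have "m / 8 * D \<le> 0"
  proof (rule field_le_epsilon)
    fix e :: real assume e: "e > 0"
    define t where "t = min 1 (e / (C + 1))"
    have t: "0 < t" "t \<le> 1" "t \<le> e / (C + 1)" using e C(1) by (auto simp: t_def)
    have "C * t \<le> (C + 1) * t" using t by simp
    also have "\<dots> \<le> (C + 1) * (e / (C + 1))" using t C(1) by (intro mult_left_mono) auto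
    also have "\<dots> = e" using C(1) by simp
    finally show "m / 8 * D \<le> 0 + e" using b[OF t(1,2)] by simp
  qed
  then have "D = 0" using m sqn_nonneg[of "\<lambda>x. hyp_wt x * v x"] unfolding D_def by (simp add: mult_le_0_iff)
  then have "AE x in lborel. hyp_wt x * v x = 0"
    unfolding D_def by (rule sqn_eq_0_AE[OF H10_Hardy(1)[OF vF N2]])
  then show ?thesis
  proof eventually_elim
    case (elim x)
    show ?case
    proof (cases "x \<in> ball 0 1")
      case True
      then show ?thesis using elim hyp_wt_ge[OF True] by simp
    qed (use out in auto)
  qed
qed

subsection \<open>Extension by zero solves the equation on the whole space\<close>

text \<open>The argument 1 - |x|^2 is a polynomial substitute for the distance to the sphere. The
  cutoff is one where |x|^2 \<le> 1 - 4 \<epsilon> and vanishes where |x|^2 \<ge> 1 -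
  \<epsilon>.\<close>

definition ball_cutoff :: "real \<Rightarrow> 'a::euclidean_space \<Rightarrow> real" where
  "ball_cutoff \<epsilon> x = step_fun ((1 - x \<bullet> x) / \<epsilon>)"

lemma ball_cutoff:
  fixes x :: "'a::euclidean_space"
  assumes e: "\<epsilon> > 0"
  shows "C1c (ball 0 1) (ball_cutoff \<epsilon> :: 'a \<Rightarrow> real)"
    "egrad (ball_cutoff \<epsilon>) x = (- (2 * step_deriv ((1 - x \<bullet> x) / \<epsilon>) / \<epsilon>)) *\<^sub>R x"
proof -
  have d: "(ball_cutoff \<epsilon> has_derivative (\<lambda>h. ((- (2 * step_deriv ((1 - x \<bullet> x) / \<epsilon>) / \<epsilon>)) *\<^sub>R x) \<bullet> h)) (at x)" for x :: 'a
  proof -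
    have d1: "((\<lambda>x. (1 - x \<bullet> x) / \<epsilon>) has_derivative (\<lambda>h. - (2 * (x \<bullet> h)) / \<epsilon>)) (at x)"
      by (rule has_derivative_eq_rhs, (rule derivative_intros)+) (use e in \<open>auto simp: inner_commute field_simps\<close>)
    have d2: "(step_fun has_derivative (\<lambda>h. step_deriv ((1 - x \<bullet> x) / \<epsilon>) * h)) (at ((1 - x \<bullet> x) / \<epsilon>))"
      using step_fun_derivative by (simp add: has_field_derivative_def)
    from has_derivative_compose[OF d1 d2] show ?thesis
      unfolding ball_cutoff_def[abs_def] by (simp add: mult_ac)
  qed
  have c: "continuous_on UNIV (\<lambda>x::'a. (- (2 * step_deriv ((1 - x \<bullet> x) / \<epsilon>) / \<epsilon>)) *\<^sub>R x)"
    using e by (intro continuous_intros continuous_on_compose2[OF step_deriv_cont]) auto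
  let ?K = "cball (0::'a) (sqrt (max 0 (1 - \<epsilon>)))"
  have "sqrt (max 0 (1 - \<epsilon>)) < sqrt 1" using e by (intro real_sqrt_less_mono) auto
  then have r: "sqrt (max 0 (1 - \<epsilon>)) < 1" by (simp only: real_sqrt_one)
  have K: "?K \<subseteq> ball 0 1" using r by (intro subsetI) (simp only: mem_cball_0 mem_ball_0 le_less_trans)
  have z: "ball_cutoff \<epsilon> x = 0" if "x \<notin> ?K" for x :: 'a
  proof -
    have "sqrt (max 0 (1 - \<epsilon>)) < norm x" using that by simp
    then have "(sqrt (max 0 (1 - \<epsilon>)))\<^sup>2 < (norm x)\<^sup>2" by (rule power_strict_mono) auto
    then have "1 - \<epsilon> < x \<bullet> x" by (simp add: power2_norm_eq_inner)
    then have "(1 - x \<bullet> x) / \<epsilon> \<le> 1" using e by (simp add: field_simps)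
    then show ?thesis unfolding ball_cutoff_def by (rule step_fun_simps)
  qed
  show "C1c (ball 0 1) (ball_cutoff \<epsilon> :: 'a \<Rightarrow> real)" by (rule C1cI(1)[OF d c compact_cball K z])
  show "egrad (ball_cutoff \<epsilon>) x = (- (2 * step_deriv ((1 - x \<bullet> x) / \<epsilon>) / \<epsilon>)) *\<^sub>R x" by (rule egrad_eqI[OF d])
qed

text \<open>The equation on the ball is tested with g times a cutoff. The error pairs F with the
  gradient of the cutoff, which is of size 1 / (s - 1) and lives on the shell 1 / s < |x| < 1. On
  this shell s x is outside the ball, so F agrees there with the dilation difference, whose L^2 norm
  is O(s - 1). The product is thus bounded in L^2, and since the measure of the shell tends to zero,
  so does the error.\<close>

lemma conf_sol_extension:
  fixes v :: "'a::euclidean_space \<Rightarrow> real"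
  assumes N: "DIM('a) \<ge> 3" and sol: "conf_sol 0 v F" and g: "C1c UNIV g"
  shows "(\<integral>x. F x \<bullet> egrad g x \<partial>lborel) = (\<integral>x. crit_nl (crit_exp DIM('a)) (v x) * g x \<partial>lborel)"
proof -
  define p where "p = crit_exp DIM('a)"
  define a where "a = (real DIM('a) - 2) / 2"
  have p2: "p > 2" using N by (simp add: p_def crit_exp_def field_simps)
  have vF: "H10 (ball 0 1) v F" and out: "\<And>x. x \<notin> ball 0 1 \<Longrightarrow> v x = 0" "\<And>x. x \<notin> ball 0 1 \<Longrightarrow> F x = 0"
    and eq: "\<And>z Z. H10 (ball 0 1) z Z \<Longrightarrow> (\<integral>x. F x \<bullet> Z x \<partial>lborel) = (\<integral>x. crit_nl p (v x) * z x \<partial>lborel)"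
    using sol unfolding conf_sol_def p_def by auto
  note Fs = H10D(2)[OF vF]
  obtain S where S: "\<And>U (z :: 'a \<Rightarrow> real) Z. H10 U z Z \<Longrightarrow> Lpint p z"
    unfolding p_def by (rule H10_Sobolev[where 'a='a, OF N]) blast
  have [measurable]: "v \<in> borel_measurable borel" "F \<in> borel_measurable borel" using H10D(1)[OF vF] Fs by auto
  note [measurable] = C1c_measurable[OF g]
  obtain C where C: "C \<ge> 0" "\<And>s. 1 \<le> s \<Longrightarrow> s \<le> 2 \<Longrightarrow>
     1 / 4 * sqn (\<lambda>x. F x - s powr (a + 1) *\<^sub>R F (s *\<^sub>R x)) \<le> C * (s - 1)\<^sup>2"
    using dilation_estimate[OF N sol] unfolding a_def by auto
  obtain B where B: "B \<ge> 0" "\<And>x. \<bar>g x\<bar> \<le> B" using C1c_bounded[OF g] by blast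
  define s where "s n = 1 + 1 / real (Suc n)" for n
  have s: "1 < s n" "s n \<le> 2" for n by (auto simp: s_def)
  have slim: "s \<longlonglongrightarrow> 1"
    unfolding s_def[abs_def] using tendsto_add[OF tendsto_const[of 1] LIMSEQ_Suc[OF lim_1_over_n]] by simp
  \<comment> \<open>Chosen so that 1 - 4 \<epsilon> = 1 / s^2: the cutoff is one up to the radius 1
    / s, and its transition falls inside the shell \<open>L n\<close>.\<close>
  define \<epsilon> where "\<epsilon> n = (1 - 1 / (s n)\<^sup>2) / 4" for n
  have \<epsilon>: "\<epsilon> n > 0" "1 - 4 * \<epsilon> n = 1 / (s n)\<^sup>2" "(s n - 1) / 8 \<le> \<epsilon> n" for n
  proof -
    have q: "1 < (s n)\<^sup>2" "(s n)\<^sup>2 \<le> 4"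
      using s[of n] power_strict_mono[of 1 "s n" 2] power_mono[of "s n" 2 2] by auto
    have "1 / (s n)\<^sup>2 < 1" using q by (subst divide_less_eq_1_pos) auto
    then show "\<epsilon> n > 0" by (simp add: \<epsilon>_def)
    have "1 - 4 * ((1 - y) / 4) = y" for y :: real by (simp add: field_simps)
    then show "1 - 4 * \<epsilon> n = 1 / (s n)\<^sup>2" unfolding \<epsilon>_def .
    have "(s n - 1) / 2 * (s n)\<^sup>2 \<le> (s n - 1) / 2 * 4" using q s[of n] by (intro mult_left_mono) auto
    also have "\<dots> = (s n - 1) * 2" by simp
    also have "\<dots> \<le> (s n - 1) * (s n + 1)" using s[of n] by (intro mult_left_mono) auto
    finally have "(s n - 1) / 2 * (s n)\<^sup>2 \<le> (s n)\<^sup>2 - 1" by (simp add: power2_eq_square algebra_simps)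
    moreover have qp: "0 < (s n)\<^sup>2" using q by linarith
    ultimately have "(s n - 1) / 2 \<le> ((s n)\<^sup>2 - 1) / (s n)\<^sup>2" by (simp only: pos_le_divide_eq)
    then have "(s n - 1) / 2 \<le> 1 - 1 / (s n)\<^sup>2" using qp by (simp add: diff_divide_distrib)
    then show "(s n - 1) / 8 \<le> \<epsilon> n" by (simp add: \<epsilon>_def)
  qed
  define \<eta> where "\<eta> n = (ball_cutoff (\<epsilon> n) :: 'a \<Rightarrow> real)" for n
  have \<eta>: "C1c (ball 0 1) (\<eta> n)" for n unfolding \<eta>_def by (rule ball_cutoff(1)[OF \<epsilon>(1)])
  note [measurable] = C1c_measurable[OF \<eta>]
  have \<eta>b: "\<bar>\<eta> n x\<bar> \<le> 1" for n x unfolding \<eta>_def ball_cutoff_def using step_fun_bounds by (simp add: abs_le_iff)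
  define L where "L n = {x::'a. 1 / s n < norm x \<and> norm x < 1}" for n
  have [measurable]: "L n \<in> sets borel" for n unfolding L_def by measurable
  have out_L: "4 \<le> (1 - x \<bullet> x) / \<epsilon> n \<or> norm x \<ge> 1" if "x \<notin> L n" for x n
  proof (cases "norm x < 1")
    case True
    then have "norm x \<le> 1 / s n" using that by (auto simp: L_def)
    then have "(norm x)\<^sup>2 \<le> (1 / s n)\<^sup>2" by (rule power_mono) simp
    then have "x \<bullet> x \<le> 1 - 4 * \<epsilon> n" unfolding \<epsilon>(2) by (simp add: power2_norm_eq_inner power_divide)
    then show ?thesis using \<epsilon>(1)[of n] by (simp add: field_simps)
  qed simp
  have \<eta>1: "\<eta> n x = 1" if "x \<notin> L n" "norm x < 1" for n x
    using out_L[OF that(1)] that(2) unfolding \<eta>_def ball_cutoff_def by (intro step_fun_simps) auto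
  have gr: "norm (egrad (\<eta> n) x) \<le> 16 / (s n - 1) * indicator (L n) x" for n x
  proof (cases "x \<in> L n")
    case True
    then have x1: "norm x \<le> 1" by (simp add: L_def)
    have "norm (egrad (\<eta> n) x) = 2 * step_deriv ((1 - x \<bullet> x) / \<epsilon> n) / \<epsilon> n * norm x"
      unfolding \<eta>_def ball_cutoff(2)[OF \<epsilon>(1)] using step_deriv_bounds(3) \<epsilon>(1)[of n] by simp
    also have "\<dots> \<le> 2 / \<epsilon> n * 1"
      using step_deriv_bounds(3,4) \<epsilon>(1)[of n] x1 by (intro mult_mono divide_right_mono) auto
    also have "\<dots> \<le> 16 / (s n - 1)" using \<epsilon>(1,3)[of n] s(1)[of n] by (simp add: field_simps)
    finally show ?thesis using True by simp
  next
    case False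
    have "step_deriv ((1 - x \<bullet> x) / \<epsilon> n) = 0"
      using out_L[OF False]
    proof
      assume "norm x \<ge> 1"
      then have "1 \<le> x \<bullet> x" by (simp add: norm_eq_sqrt_inner)
      then have "(1 - x \<bullet> x) / \<epsilon> n \<le> 1" using \<epsilon>(1)[of n] by (simp add: field_simps)
      then show ?thesis by (rule step_deriv_bounds(1))
    qed (rule step_deriv_bounds(2))
    then show ?thesis unfolding \<eta>_def ball_cutoff(2)[OF \<epsilon>(1)] by (simp add: False)
  qed
  have ev: "eventually (\<lambda>n. x \<notin> L n) sequentially" for x
  proof (cases "norm x < 1")
    case True
    have "(\<lambda>n. 1 / s n) \<longlonglongrightarrow> 1 / 1" by (intro tendsto_intros slim) simp
    then have "eventually (\<lambda>n. norm x < 1 / s n) sequentially" using True by (intro order_tendstoD(1)) auto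
    then show ?thesis by eventually_elim (auto simp: L_def)
  qed (simp add: L_def)
  have t1: "(\<lambda>n. \<integral>x. \<eta> n x * (F x \<bullet> egrad g x) \<partial>lborel) \<longlonglongrightarrow> (\<integral>x. F x \<bullet> egrad g x \<partial>lborel)"
  proof (rule integral_dominated_convergence[where w = "\<lambda>x. \<bar>F x \<bullet> egrad g x\<bar>"])
    show "integrable lborel (\<lambda>x. \<bar>F x \<bullet> egrad g x\<bar>)" by (intro integrable_abs sqint_inner Fs C1c_sqint_egrad[OF g])
    show "AE x in lborel. (\<lambda>n. \<eta> n x * (F x \<bullet> egrad g x)) \<longlonglongrightarrow> F x \<bullet> egrad g x"
    proof (rule AE_I2)
      fix x
      show "(\<lambda>n. \<eta> n x * (F x \<bullet> egrad g x)) \<longlonglongrightarrow> F x \<bullet> egrad g x"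
      proof (rule tendsto_eventually)
        show "eventually (\<lambda>n. \<eta> n x * (F x \<bullet> egrad g x) = F x \<bullet> egrad g x) sequentially"
          using ev[of x] by eventually_elim (use \<eta>1 out(2)[of x] in \<open>cases "norm x < 1"; auto\<close>)
      qed
    qed
    show "AE x in lborel. norm (\<eta> n x * (F x \<bullet> egrad g x)) \<le> \<bar>F x \<bullet> egrad g x\<bar>" for n
      using \<eta>b by (intro AE_I2) (simp add: abs_mult mult_left_le_one_le)
  qed measurable
  have gp: "Lpint p g" by (rule S[OF H10_C1c[OF g]])
  have t2: "(\<lambda>n. \<integral>x. crit_nl p (v x) * (\<eta> n x * g x) \<partial>lborel) \<longlonglongrightarrow> (\<integral>x. crit_nl p (v x) * g x \<partial>lborel)"
  proof (rule integral_dominated_convergence[where w = "\<lambda>x. \<bar>crit_nl p (v x) * g x\<bar>"])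
    show "integrable lborel (\<lambda>x. \<bar>crit_nl p (v x) * g x\<bar>)"
      by (intro integrable_abs crit_nl_pairing(1)[OF p2 S[OF vF] gp])
    show "AE x in lborel. (\<lambda>n. crit_nl p (v x) * (\<eta> n x * g x)) \<longlonglongrightarrow> crit_nl p (v x) * g x"
    proof (rule AE_I2)
      fix x
      show "(\<lambda>n. crit_nl p (v x) * (\<eta> n x * g x)) \<longlonglongrightarrow> crit_nl p (v x) * g x"
      proof (rule tendsto_eventually)
        show "eventually (\<lambda>n. crit_nl p (v x) * (\<eta> n x * g x) = crit_nl p (v x) * g x) sequentially"
          using ev[of x] by eventually_elim (use \<eta>1 out(1)[of x] in \<open>cases "norm x < 1"; auto simp: crit_nl_def\<close>)
      qed
    qed
    show "AE x in lborel. norm (crit_nl p (v x) * (\<eta> n x * g x)) \<le> \<bar>crit_nl p (v x) * g x\<bar>" for n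
    proof (rule AE_I2)
      fix x
      have "\<bar>\<eta> n x\<bar> * \<bar>crit_nl p (v x) * g x\<bar> \<le> 1 * \<bar>crit_nl p (v x) * g x\<bar>" by (intro mult_right_mono \<eta>b) simp
      then show "norm (crit_nl p (v x) * (\<eta> n x * g x)) \<le> \<bar>crit_nl p (v x) * g x\<bar>" by (simp add: abs_mult mult_ac)
    qed
  qed measurable
  define J where "J n = (\<integral>x. g x * (F x \<bullet> egrad (\<eta> n) x) \<partial>lborel)" for n
  have sL: "sqint (indicator (L n) :: 'a \<Rightarrow> real)" "sqn (indicator (L n) :: 'a \<Rightarrow> real) = (\<integral>x. indicator (L n) x \<partial>lborel)" for n
  proof -
    have e: "(\<lambda>x. (norm (indicator (L n) x :: real))\<^sup>2) = indicator (L n)" by (auto simp: indicator_def)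
    have "emeasure lborel (L n) \<le> emeasure lborel (ball (0::'a) 1)" by (intro emeasure_mono) (auto simp: L_def)
    then have "emeasure lborel (L n) < \<infinity>" using emeasure_lborel_ball_finite[of "0::'a" 1] by (auto intro: le_less_trans)
    then show "sqint (indicator (L n) :: 'a \<Rightarrow> real)" unfolding sqint_def e by auto
    show "sqn (indicator (L n) :: 'a \<Rightarrow> real) = (\<integral>x. indicator (L n) x \<partial>lborel)" unfolding sqn_def e ..
  qed
  have hJ: "sqint (\<lambda>x. g x * (F x \<bullet> egrad (\<eta> n) x))" "sqn (\<lambda>x. g x * (F x \<bullet> egrad (\<eta> n) x)) \<le> 1024 * B\<^sup>2 * C" for n
  proof -
    define W where "W x = F x - s n powr (a + 1) *\<^sub>R F (s n *\<^sub>R x)" for x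
    have Ws: "sqint W"
      unfolding W_def using sqint_diff(1)[OF Fs sqint_scaleR[OF sqint_affine(1)[OF Fs, of "s n" 0], of "s n powr (a + 1)"]] s[of n] by simp
    have b: "norm (g x * (F x \<bullet> egrad (\<eta> n) x)) \<le> (B * (16 / (s n - 1))) * norm (W x)" for x
    proof (cases "x \<in> L n")
      case True
      then have "1 < norm (s n *\<^sub>R x)" using s[of n] by (simp add: L_def field_simps)
      then have W: "W x = F x" using out(2)[of "s n *\<^sub>R x"] by (simp add: W_def)
      have "\<bar>F x \<bullet> egrad (\<eta> n) x\<bar> \<le> norm (F x) * norm (egrad (\<eta> n) x)" by (rule Cauchy_Schwarz_ineq2)
      also have "\<dots> \<le> norm (F x) * (16 / (s n - 1))" using gr[of n x] True by (intro mult_left_mono) auto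
      finally have "\<bar>g x\<bar> * \<bar>F x \<bullet> egrad (\<eta> n) x\<bar> \<le> B * (norm (F x) * (16 / (s n - 1)))"
        using B by (intro mult_mono) auto
      then show ?thesis unfolding W by (simp add: abs_mult mult_ac)
    next
      case False
      then have "egrad (\<eta> n) x = 0" using gr[of n x] by simp
      then show ?thesis using B(1) s(1)[of n] by simp
    qed
    have m: "(\<lambda>x. g x * (F x \<bullet> egrad (\<eta> n) x)) \<in> borel_measurable borel" by measurable
    show "sqint (\<lambda>x. g x * (F x \<bullet> egrad (\<eta> n) x))" by (rule sqint_bound(1)[OF Ws m b])
    have "sqn (\<lambda>x. g x * (F x \<bullet> egrad (\<eta> n) x)) \<le> (B * (16 / (s n - 1)))\<^sup>2 * sqn W" by (rule sqint_bound(2)[OF Ws m b])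
    also have "sqn W \<le> 4 * C * (s n - 1)\<^sup>2" unfolding W_def using C(2)[of "s n"] s[of n] by simp
    \<comment> \<open>The powers of s - 1 cancel exactly: the second-order estimate on the dilation
      difference is just sufficient.\<close>
    also have "(B * (16 / (s n - 1)))\<^sup>2 * (4 * C * (s n - 1)\<^sup>2) = 1024 * B\<^sup>2 * C"
      using s(1)[of n] by (simp add: power_mult_distrib power_divide)
    finally show "sqn (\<lambda>x. g x * (F x \<bullet> egrad (\<eta> n) x)) \<le> 1024 * B\<^sup>2 * C" by (simp add: mult_left_mono)
  qed
  have t3: "J \<longlonglongrightarrow> 0"
  proof (rule Lim_null_comparison)
    show "eventually (\<lambda>n. norm (J n) \<le> sqrt (\<integral>x. indicator (L n) x \<partial>lborel) * sqrt (1024 * B\<^sup>2 * C)) sequentially"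
    proof (rule always_eventually, rule allI)
      fix n
      have "J n = (\<integral>x. indicator (L n) x \<bullet> (g x * (F x \<bullet> egrad (\<eta> n) x)) \<partial>lborel)"
        unfolding J_def
      proof (rule Bochner_Integration.integral_cong)
        fix x
        show "g x * (F x \<bullet> egrad (\<eta> n) x) = indicator (L n) x \<bullet> (g x * (F x \<bullet> egrad (\<eta> n) x))"
          using gr[of n x] by (cases "x \<in> L n") auto
      qed simp
      then have "\<bar>J n\<bar> \<le> sqrt (sqn (indicator (L n) :: 'a \<Rightarrow> real)) * sqrt (sqn (\<lambda>x. g x * (F x \<bullet> egrad (\<eta> n) x)))"
        using integral_inner_le[OF sL(1) hJ(1)] by simp
      also have "\<dots> \<le> sqrt (\<integral>x. indicator (L n) x \<partial>lborel) * sqrt (1024 * B\<^sup>2 * C)"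
        unfolding sL(2) using hJ(2) by (intro mult_left_mono) auto
      finally show "norm (J n) \<le> sqrt (\<integral>x. indicator (L n) x \<partial>lborel) * sqrt (1024 * B\<^sup>2 * C)" by simp
    qed
    have "(\<lambda>n. \<integral>x. (indicator (L n) x :: real) \<partial>lborel) \<longlonglongrightarrow> (\<integral>x. 0 \<partial>(lborel :: 'a measure))"
    proof (rule integral_dominated_convergence[where w = "indicator (ball 0 1)"])
      show "integrable lborel (indicator (ball (0::'a) 1) :: 'a \<Rightarrow> real)"
        using emeasure_lborel_ball_finite[of "0::'a" 1] by simp
      show "AE x in lborel. (\<lambda>n. indicator (L n) x :: real) \<longlonglongrightarrow> 0"
      proof (rule AE_I2)
        fix x
        show "(\<lambda>n. indicator (L n) x :: real) \<longlonglongrightarrow> 0"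
          by (rule tendsto_eventually) (use ev[of x] in \<open>eventually_elim, simp\<close>)
      qed
    qed (auto simp: L_def indicator_def)
    then have "(\<lambda>n. sqrt (\<integral>x. indicator (L n) x \<partial>lborel) * sqrt (1024 * B\<^sup>2 * C)) \<longlonglongrightarrow> sqrt 0 * sqrt (1024 * B\<^sup>2 * C)"
      by (intro tendsto_intros) simp
    then show "(\<lambda>n. sqrt (\<integral>x. indicator (L n) x \<partial>lborel) * sqrt (1024 * B\<^sup>2 * C)) \<longlonglongrightarrow> 0" by simp
  qed
  have id: "(\<integral>x. \<eta> n x * (F x \<bullet> egrad g x) \<partial>lborel) + J n = (\<integral>x. crit_nl p (v x) * (\<eta> n x * g x) \<partial>lborel)" for n
  proof -
    note m = C1c_mult[OF \<eta>[of n] g open_ball]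
    have i1: "integrable lborel (\<lambda>x. \<eta> n x * (F x \<bullet> egrad g x))"
      by (rule Bochner_Integration.integrable_bound[OF sqint_inner[OF Fs C1c_sqint_egrad[OF g]]])
         (use \<eta>b in \<open>auto intro!: AE_I2 simp: abs_mult mult_left_le_one_le\<close>)
    have i2: "integrable lborel (\<lambda>x. g x * (F x \<bullet> egrad (\<eta> n) x))"
    proof -
      obtain B' where B': "\<And>x. norm (egrad (\<eta> n) x) \<le> B'" using C1c_bounded_egrad[OF \<eta>] by blast
      have "sqint (\<lambda>x. g x *\<^sub>R egrad (\<eta> n) x)"
      proof (rule sqint_bound(1)[OF C1c_sqint[OF g], of _ B'])
        show "norm (g x *\<^sub>R egrad (\<eta> n) x) \<le> B' * norm (g x)" for x
          using mult_left_mono[OF B'[of x] abs_ge_zero[of "g x"]] by (simp add: mult.commute)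
      qed measurable
      from sqint_inner[OF Fs this] show ?thesis by simp
    qed
    have "(\<integral>x. crit_nl p (v x) * (\<eta> n x * g x) \<partial>lborel) = (\<integral>x. F x \<bullet> egrad (\<lambda>x. \<eta> n x * g x) x \<partial>lborel)"
      by (rule eq[OF H10_C1c[OF m(1)], symmetric])
    also have "\<dots> = (\<integral>x. \<eta> n x * (F x \<bullet> egrad g x) + g x * (F x \<bullet> egrad (\<eta> n) x) \<partial>lborel)"
      unfolding m(2) by (simp add: inner_add_right)
    also have "\<dots> = (\<integral>x. \<eta> n x * (F x \<bullet> egrad g x) \<partial>lborel) + J n"
      unfolding J_def by (rule Bochner_Integration.integral_add[OF i1 i2])
    finally show ?thesis by simp
  qed
  have "(\<lambda>n. \<integral>x. crit_nl p (v x) * (\<eta> n x * g x) \<partial>lborel) \<longlonglongrightarrow> (\<integral>x. F x \<bullet> egrad g x \<partial>lborel) + 0"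
    unfolding id[symmetric] by (rule tendsto_add[OF t1 t3])
  from LIMSEQ_unique[OF this t2] show ?thesis by (simp add: p_def)
qed

subsection \<open>Higher integrability (Brezis--Kato)\<close>

text \<open>A smooth substitute for truncating 1 + s^2 at height 1 / \<delta>: it lies between 1 and
  both of these bounds, and tends to 1 + s^2 as \<delta> tends to 0.\<close>

definition bk_ratio :: "real \<Rightarrow> real \<Rightarrow> real" where
  "bk_ratio \<delta> s = (1 + s\<^sup>2) / (1 + \<delta> * s\<^sup>2)"

text \<open>Lipschitz for \<open>\<delta> > 0\<close>, and \<open>s * bk_fun \<delta> (2 * \<beta>) s = (bk_fun \<delta> \<beta> s)\<^sup>2\<close>: testing with the exponent
  \<open>2 * \<beta>\<close> controls the gradient of the function with exponent \<open>\<beta>\<close>.\<close>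
definition bk_fun :: "real \<Rightarrow> real \<Rightarrow> real \<Rightarrow> real" where
  "bk_fun \<delta> \<gamma> s = s * bk_ratio \<delta> s powr \<gamma>"

definition bk_deriv :: "real \<Rightarrow> real \<Rightarrow> real \<Rightarrow> real" where
  "bk_deriv \<delta> \<gamma> s = bk_ratio \<delta> s powr \<gamma> * (1 + \<gamma> * (2 * s\<^sup>2 * (1 - \<delta>) / ((1 + \<delta> * s\<^sup>2) * (1 + s\<^sup>2))))"

lemma bk_fun_measurable [measurable]: "bk_fun \<delta> \<gamma> \<in> borel_measurable borel"
  unfolding bk_fun_def[abs_def] bk_ratio_def[abs_def] by measurable

context
  fixes \<delta> :: real
  assumes \<delta>: "0 < \<delta>" "\<delta> \<le> 1"
begin

lemma bk_den_pos: "0 < 1 + \<delta> * s\<^sup>2" "0 < 1 + s\<^sup>2"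
  using \<delta> by (auto intro: add_pos_nonneg)

lemma bk_ratio_bounds: "1 \<le> bk_ratio \<delta> s" "bk_ratio \<delta> s \<le> 1 + s\<^sup>2" "bk_ratio \<delta> s \<le> 1 / \<delta>"
proof -
  have "\<delta> * s\<^sup>2 \<le> s\<^sup>2" using \<delta> by (simp add: mult_left_le_one_le)
  then show "1 \<le> bk_ratio \<delta> s" unfolding bk_ratio_def using bk_den_pos(1)[of s] by simp
  show "bk_ratio \<delta> s \<le> 1 + s\<^sup>2"
    unfolding bk_ratio_def using bk_den_pos[of s] \<delta> by (simp add: pos_divide_le_eq mult_le_cancel_left1)
  show "bk_ratio \<delta> s \<le> 1 / \<delta>"
    unfolding bk_ratio_def using bk_den_pos(1)[of s] \<delta> by (simp add: divide_simps) (simp add: algebra_simps)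
qed

lemma bk_fun_derivative: "(bk_fun \<delta> \<gamma> has_real_derivative bk_deriv \<delta> \<gamma> s) (at s)"
proof -
  let ?q = "bk_ratio \<delta> s"
  have q: "?q > 0" using bk_ratio_bounds(1)[of s] by linarith
  have dq: "(bk_ratio \<delta> has_real_derivative (2 * s * (1 - \<delta>) / (1 + \<delta> * s\<^sup>2)\<^sup>2)) (at s)"
    unfolding bk_ratio_def[abs_def] using bk_den_pos(1)[of s]
    by (auto intro!: derivative_eq_intros simp: power2_eq_square algebra_simps)
  have dp: "((\<lambda>s. bk_ratio \<delta> s powr \<gamma>) has_real_derivative (\<gamma> * ?q powr (\<gamma> - 1) * (2 * s * (1 - \<delta>) / (1 + \<delta> * s\<^sup>2)\<^sup>2))) (at s)"
    by (rule DERIV_chain2[OF has_real_derivative_powr[OF q] dq])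
  have "(bk_fun \<delta> \<gamma> has_real_derivative (1 * ?q powr \<gamma> + (\<gamma> * ?q powr (\<gamma> - 1) * (2 * s * (1 - \<delta>) / (1 + \<delta> * s\<^sup>2)\<^sup>2)) * s)) (at s)"
    unfolding bk_fun_def[abs_def] by (rule DERIV_mult[OF DERIV_ident dp])
  also have "1 * ?q powr \<gamma> + (\<gamma> * ?q powr (\<gamma> - 1) * (2 * s * (1 - \<delta>) / (1 + \<delta> * s\<^sup>2)\<^sup>2)) * s = bk_deriv \<delta> \<gamma> s"
  proof -
    have e1: "?q powr (\<gamma> - 1) = ?q powr \<gamma> / ?q" using q by (simp add: powr_diff)
    have e2: "(2 * s * (1 - \<delta>) / (1 + \<delta> * s\<^sup>2)\<^sup>2) * s / ?q = 2 * s\<^sup>2 * (1 - \<delta>) / ((1 + \<delta> * s\<^sup>2) * (1 + s\<^sup>2))"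
      unfolding bk_ratio_def using bk_den_pos[of s] by (simp add: power2_eq_square)
    have "(\<gamma> * ?q powr (\<gamma> - 1) * (2 * s * (1 - \<delta>) / (1 + \<delta> * s\<^sup>2)\<^sup>2)) * s
        = ?q powr \<gamma> * (\<gamma> * ((2 * s * (1 - \<delta>) / (1 + \<delta> * s\<^sup>2)\<^sup>2) * s / ?q))"
      unfolding e1 by (simp add: mult_ac)
    then show ?thesis unfolding e2 bk_deriv_def by (simp only: mult_1 distrib_left mult_1_right)
  qed
  finally show ?thesis .
qed

lemma bk_deriv_cont: "continuous_on UNIV (bk_deriv \<delta> \<gamma>)"
proof -
  have n: "1 + \<delta> * s\<^sup>2 \<noteq> 0" "1 + s\<^sup>2 \<noteq> 0" "bk_ratio \<delta> s \<noteq> 0" for s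
    using bk_den_pos[of s] bk_ratio_bounds(1)[of s] by auto
  have c: "continuous_on UNIV (bk_ratio \<delta>)"
    unfolding bk_ratio_def[abs_def] by (intro continuous_intros) (use n in auto)
  show ?thesis
    unfolding bk_deriv_def[abs_def] using n by (intro continuous_intros c) auto
qed

text \<open>The logarithmic derivative of the ratio contributes a factor between 0 and 2, whatever
  \<delta> is. The first two bounds have constants free of \<delta> and carry the estimate; the
  third depends on \<delta> and serves only to keep all terms finite.\<close>

lemma bk_deriv_bounds:
  assumes "\<gamma> \<ge> 0"
  shows "bk_ratio \<delta> s powr \<gamma> \<le> bk_deriv \<delta> \<gamma> s" "bk_deriv \<delta> \<gamma> s \<le> (1 + 2 * \<gamma>) * bk_ratio \<delta> s powr \<gamma>"
    "bk_deriv \<delta> \<gamma> s \<le> (1 + 2 * \<gamma>) * (1 / \<delta>) powr \<gamma>"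
proof -
  define t where "t = 2 * s\<^sup>2 * (1 - \<delta>) / ((1 + \<delta> * s\<^sup>2) * (1 + s\<^sup>2))"
  have d: "0 < (1 + \<delta> * s\<^sup>2) * (1 + s\<^sup>2)" using bk_den_pos[of s] by simp
  have t0: "0 \<le> t" unfolding t_def using \<delta> d by (intro divide_nonneg_pos) auto
  have t2: "t \<le> 2"
  proof -
    have "s\<^sup>2 * (1 - \<delta>) \<le> s\<^sup>2 * 1" using \<delta> by (intro mult_left_mono) auto
    also have "\<dots> \<le> 1 * (1 + s\<^sup>2)" by simp
    also have "\<dots> \<le> (1 + \<delta> * s\<^sup>2) * (1 + s\<^sup>2)" using \<delta> by (intro mult_right_mono) auto
    finally have "s\<^sup>2 * (1 - \<delta>) \<le> (1 + \<delta> * s\<^sup>2) * (1 + s\<^sup>2)" .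
    then have "2 * s\<^sup>2 * (1 - \<delta>) \<le> 2 * ((1 + \<delta> * s\<^sup>2) * (1 + s\<^sup>2))"
      by (simp only: mult.assoc mult_left_mono zero_le_numeral)
    then show ?thesis unfolding t_def using d by (simp add: pos_divide_le_eq)
  qed
  have e: "bk_deriv \<delta> \<gamma> s = bk_ratio \<delta> s powr \<gamma> * (1 + \<gamma> * t)" by (simp add: bk_deriv_def t_def)
  have "bk_ratio \<delta> s powr \<gamma> * 1 \<le> bk_ratio \<delta> s powr \<gamma> * (1 + \<gamma> * t)"
    using t0 assms by (intro mult_left_mono) auto
  then show "bk_ratio \<delta> s powr \<gamma> \<le> bk_deriv \<delta> \<gamma> s" by (simp add: e)
  have "\<gamma> * t \<le> \<gamma> * 2" using t2 assms by (intro mult_left_mono)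
  then have "bk_ratio \<delta> s powr \<gamma> * (1 + \<gamma> * t) \<le> bk_ratio \<delta> s powr \<gamma> * (1 + 2 * \<gamma>)"
    by (intro mult_left_mono) auto
  then show b: "bk_deriv \<delta> \<gamma> s \<le> (1 + 2 * \<gamma>) * bk_ratio \<delta> s powr \<gamma>" by (simp add: e mult.commute)
  have "bk_ratio \<delta> s powr \<gamma> \<le> (1 / \<delta>) powr \<gamma>"
    using bk_ratio_bounds[of s] assms by (intro powr_mono2) auto
  then have "(1 + 2 * \<gamma>) * bk_ratio \<delta> s powr \<gamma> \<le> (1 + 2 * \<gamma>) * (1 / \<delta>) powr \<gamma>"
    using assms by (intro mult_left_mono) auto
  with b show "bk_deriv \<delta> \<gamma> s \<le> (1 + 2 * \<gamma>) * (1 / \<delta>) powr \<gamma>" by linarith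
qed

lemma bk_fun_Lipschitz:
  assumes "\<gamma> \<ge> 0"
  shows "\<bar>bk_fun \<delta> \<gamma> s - bk_fun \<delta> \<gamma> t\<bar> \<le> (1 + 2 * \<gamma>) * (1 / \<delta>) powr \<gamma> * \<bar>s - t\<bar>"
proof -
  have "norm (bk_fun \<delta> \<gamma> s - bk_fun \<delta> \<gamma> t) \<le> (1 + 2 * \<gamma>) * (1 / \<delta>) powr \<gamma> * norm (s - t)"
  proof (rule field_differentiable_bound[of UNIV])
    fix z
    show "(bk_fun \<delta> \<gamma> has_field_derivative bk_deriv \<delta> \<gamma> z) (at z within UNIV)" using bk_fun_derivative by simp
    have "0 \<le> bk_ratio \<delta> z powr \<gamma>" by simp
    then show "norm (bk_deriv \<delta> \<gamma> z) \<le> (1 + 2 * \<gamma>) * (1 / \<delta>) powr \<gamma>"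
      using bk_deriv_bounds(1,3)[OF assms, of z] unfolding real_norm_def by linarith
  qed auto
  then show ?thesis by simp
qed

lemma bk_fun_abs: "\<gamma> \<ge> 0 \<Longrightarrow> \<bar>bk_fun \<delta> \<gamma> s\<bar> \<le> (1 + 2 * \<gamma>) * (1 / \<delta>) powr \<gamma> * \<bar>s\<bar>"
  using bk_fun_Lipschitz[of \<gamma> s 0] by (simp add: bk_fun_def)

end

text \<open>The constant must not depend on \<delta>, which tends to 0 afterwards. With H and G the
  functions of exponents \<beta> and 2 \<beta>, testing with G(v) bounds the gradient of H(v),
  because (H')^2 \<le> D G' with D free of \<delta>. The right-hand side is the integral of |v|^(p -
  2) H(v)^2, and \<open>potential_absorption\<close> moves its critical part to the left.\<close>

lemma Brezis_Kato_estimate: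
  fixes v :: "'a::euclidean_space \<Rightarrow> real"
  assumes N: "DIM('a) \<ge> 3" and sol: "conf_sol 0 v F" and \<beta>: "\<beta> \<ge> 0"
  defines "p \<equiv> crit_exp DIM('a)"
  obtains M where "M \<ge> 0" "\<And>\<delta>. 0 < \<delta> \<Longrightarrow> \<delta> \<le> 1 \<Longrightarrow>
      Lpint p (\<lambda>x. bk_fun \<delta> \<beta> (v x)) \<and> sqint (\<lambda>x. bk_fun \<delta> \<beta> (v x)) \<and>
      Lpn p (\<lambda>x. bk_fun \<delta> \<beta> (v x)) powr (2 / p) \<le> M * sqn (\<lambda>x. bk_fun \<delta> \<beta> (v x))"
proof -
  have p2: "p > 2" using N by (simp add: p_def crit_exp_def field_simps)
  have vF: "H10 (ball 0 1) v F"
    and eq: "\<And>z Z. H10 (ball 0 1) z Z \<Longrightarrow> (\<integral>x. F x \<bullet> Z x \<partial>lborel) = (\<integral>x. crit_nl p (v x) * z x \<partial>lborel)"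
    using sol unfolding conf_sol_def p_def by auto
  note Fs = H10D(2)[OF vF] and vs = H10D(1)[OF vF]
  obtain S where S: "S > 0" "\<And>U (z :: 'a \<Rightarrow> real) Z. H10 U z Z \<Longrightarrow> Lpint p z"
    "\<And>U (z :: 'a \<Rightarrow> real) Z. H10 U z Z \<Longrightarrow> Lpn p z powr (2 / p) \<le> S * sqn Z"
    unfolding p_def by (rule H10_Sobolev[where 'a='a, OF N]) blast
  have [measurable]: "v \<in> borel_measurable borel" using vs by auto
  have vp: "Lpint p v" by (rule S(2)[OF vF])
  define Q where "Q x = \<bar>v x\<bar> powr (p - 2)" for x
  have [measurable]: "Q \<in> borel_measurable borel" unfolding Q_def by measurable
  have Qi: "integrable lborel (\<lambda>x. Q x powr (real DIM('a) / 2))"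
  proof -
    have "(p - 2) * (real DIM('a) / 2) = p" using N by (simp add: p_def crit_exp_def field_simps)
    then show ?thesis using Lpint_integrable[OF vp] by (simp add: Q_def powr_powr)
  qed
  define D where "D = (1 + 2 * \<beta>)\<^sup>2"
  have D: "D > 0" using \<beta> by (simp add: D_def)
  \<comment> \<open>After multiplication by the Sobolev constant and D, half of the left-hand side
    is absorbed.\<close>
  define \<eta> where "\<eta> = 1 / (2 * (S * D))"
  have \<eta>: "\<eta> > 0" using D S(1) by (simp add: \<eta>_def)
  obtain K where K: "K \<ge> 0" "\<And>z. sqint z \<Longrightarrow> Lpint p z \<Longrightarrow> (\<integral>x. Q x * (z x)\<^sup>2 \<partial>lborel) \<le> K * sqn z + \<eta> * Lpn p z powr (2 / p)"
    unfolding p_def by (rule potential_absorption[OF N _ _ Qi \<eta>]) (auto simp: Q_def)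
  obtain f where f: "\<And>k::nat. C1c (ball 0 1) (f k)" "(\<lambda>k. sqn (\<lambda>x. f k x - v x)) \<longlonglongrightarrow> 0"
    "(\<lambda>k. sqn (\<lambda>x. egrad (f k) x - F x)) \<longlonglongrightarrow> 0" using H10_approx[OF vF] by blast
  have fv: "H10 (ball 0 1) (\<lambda>x. f k x - v x) (\<lambda>x. egrad (f k) x - F x)" for k
    by (rule H10_diff[OF H10_C1c[OF f(1)] vF])
  obtain r :: "nat \<Rightarrow> nat" where r: "strict_mono r" "AE x in lborel. (\<lambda>n. f (r n) x) \<longlonglongrightarrow> v x"
    by (rule sqn_tendsto_AE_subseq[OF H10D(1)[OF fv] f(2)])
  have Lf: "(\<lambda>k. Lpn p (\<lambda>x. f k x - v x) powr (1 / p)) \<longlonglongrightarrow> 0"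
  proof (rule tendsto_sandwich[of "\<lambda>k. 0"])
    show "eventually (\<lambda>k. Lpn p (\<lambda>x. f k x - v x) powr (1 / p) \<le> sqrt (S * sqn (\<lambda>x. egrad (f k) x - F x))) sequentially"
    proof (rule always_eventually, rule allI)
      fix k
      have "Lpn p (\<lambda>x. f k x - v x) powr (1 / p) = sqrt (Lpn p (\<lambda>x. f k x - v x) powr (2 / p))"
        by (simp add: powr_half_sqrt[symmetric] powr_powr)
      also have "\<dots> \<le> sqrt (S * sqn (\<lambda>x. egrad (f k) x - F x))" by (intro real_sqrt_le_mono S(3)[OF fv])
      finally show "Lpn p (\<lambda>x. f k x - v x) powr (1 / p) \<le> sqrt (S * sqn (\<lambda>x. egrad (f k) x - F x))" .
    qed
    have "(\<lambda>k. sqrt (S * sqn (\<lambda>x. egrad (f k) x - F x))) \<longlonglongrightarrow> sqrt (S * 0)" by (intro tendsto_intros f(3))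
    then show "(\<lambda>k. sqrt (S * sqn (\<lambda>x. egrad (f k) x - F x))) \<longlonglongrightarrow> 0" by simp
  qed auto
  have main: "Lpint p (\<lambda>x. bk_fun \<delta> \<beta> (v x)) \<and> sqint (\<lambda>x. bk_fun \<delta> \<beta> (v x)) \<and>
      Lpn p (\<lambda>x. bk_fun \<delta> \<beta> (v x)) powr (2 / p) \<le> (2 * (S * D) * K) * sqn (\<lambda>x. bk_fun \<delta> \<beta> (v x))"
    if \<delta>: "0 < \<delta>" "\<delta> \<le> 1" for \<delta>
  proof -
    have b2: "2 * \<beta> \<ge> 0" using \<beta> by simp
    define H where "H = bk_fun \<delta> \<beta>"
    define G where "G = bk_fun \<delta> (2 * \<beta>)"
    define H' where "H' = bk_deriv \<delta> \<beta>"
    define G' where "G' = bk_deriv \<delta> (2 * \<beta>)"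
    have [measurable]: "H \<in> borel_measurable borel" "G \<in> borel_measurable borel" by (simp_all add: H_def G_def)
    define L where "L = (1 + 2 * (2 * \<beta>)) * (1 / \<delta>) powr (2 * \<beta>)"
    have L0: "L \<ge> 0" using \<beta> by (simp add: L_def)
    define LH where "LH = (1 + 2 * \<beta>) * (1 / \<delta>) powr \<beta>"
    have LH0: "LH \<ge> 0" using \<beta> by (simp add: LH_def)
    have HL: "\<bar>H s\<bar> \<le> LH * \<bar>s\<bar>" for s unfolding H_def LH_def by (rule bk_fun_abs[OF \<delta> \<beta>])
    have GL: "\<bar>G s - G t\<bar> \<le> L * \<bar>s - t\<bar>" for s t unfolding G_def L_def by (rule bk_fun_Lipschitz[OF \<delta> b2])
    have G'0: "0 \<le> G' s" for s
    proof -
      have "0 \<le> bk_ratio \<delta> s powr (2 * \<beta>)" by simp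
      also have "\<dots> \<le> G' s" unfolding G'_def by (rule bk_deriv_bounds(1)[OF \<delta> b2])
      finally show ?thesis .
    qed
    have G'L: "\<bar>G' s\<bar> \<le> L" for s
      using G'0[of s] bk_deriv_bounds(3)[OF \<delta> b2, of s] by (simp add: G'_def L_def)
    \<comment> \<open>Doubling the exponent squares the power of the ratio, so this compares the
      upper bound for H' with the lower bound for G'.\<close>
    have HG: "(H' s)\<^sup>2 \<le> D * G' s" for s
    proof -
      have h0: "0 \<le> H' s" using bk_deriv_bounds(1)[OF \<delta> \<beta>, of s] powr_ge_zero[of "bk_ratio \<delta> s" \<beta>] unfolding H'_def by linarith
      have "(H' s)\<^sup>2 \<le> ((1 + 2 * \<beta>) * bk_ratio \<delta> s powr \<beta>)\<^sup>2"
        using bk_deriv_bounds(2)[OF \<delta> \<beta>, of s] h0 unfolding H'_def by (rule power_mono)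
      also have "\<dots> = D * bk_ratio \<delta> s powr (2 * \<beta>)"
        by (simp add: D_def power_mult_distrib power2_eq_square powr_add[symmetric])
      also have "\<dots> \<le> D * G' s" unfolding G'_def using D bk_deriv_bounds(1)[OF \<delta> b2, of s] by (intro mult_left_mono) auto
      finally show ?thesis .
    qed
    have sG: "s * G s = (H s)\<^sup>2" for s
      by (simp add: G_def H_def bk_fun_def power2_eq_square powr_add[symmetric])
    have H0: "H 0 = 0" "G 0 = 0" by (simp_all add: H_def G_def bk_fun_def)
    note Hf = C1c_compose[OF f(1), of H H', OF bk_fun_derivative[OF \<delta>, of \<beta>, folded H_def H'_def] bk_deriv_cont[OF \<delta>, of \<beta>, folded H'_def] H0(1)]
    note Gf = C1c_compose[OF f(1), of G G', OF bk_fun_derivative[OF \<delta>, of "2 * \<beta>", folded G_def G'_def] bk_deriv_cont[OF \<delta>, of "2 * \<beta>", folded G'_def] H0(2)]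
    have Hs: "sqint (\<lambda>x. H (v x))"
      by (rule sqint_bound(1)[OF vs, of _ LH]) (use HL in auto)
    have Lp_lip: "Lpint p (\<lambda>x. k x)" "Lpn p (\<lambda>x. k x) \<le> c powr p * Lpn p w"
      if "Lpint p w" "k \<in> borel_measurable borel" "\<And>x. \<bar>k x\<bar> \<le> c * \<bar>w x\<bar>" "c \<ge> 0" for k w :: "'a \<Rightarrow> real" and c
    proof -
      have b: "\<bar>k x\<bar> powr p \<le> c powr p * \<bar>w x\<bar> powr p" for x
        using powr_mono2[OF _ abs_ge_zero that(3)[of x], of p] p2 that(4) by (simp add: powr_mult)
      have i: "integrable lborel (\<lambda>x. c powr p * \<bar>w x\<bar> powr p)" using Lpint_integrable[OF that(1)] by simp
      have j: "integrable lborel (\<lambda>x. \<bar>k x\<bar> powr p)"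
        by (rule Bochner_Integration.integrable_bound[OF i]) (use b that(2) in \<open>auto intro!: AE_I2\<close>)
      then show "Lpint p (\<lambda>x. k x)" using that(2) by (simp add: Lpint_def)
      have "Lpn p (\<lambda>x. k x) \<le> (\<integral>x. c powr p * \<bar>w x\<bar> powr p \<partial>lborel)"
        unfolding Lpn_def by (rule integral_mono[OF j i b])
      then show "Lpn p (\<lambda>x. k x) \<le> c powr p * Lpn p w" by (simp add: Lpn_def)
    qed
    have Hp: "Lpint p (\<lambda>x. H (v x))" by (rule Lp_lip(1)[OF vp]) (use HL LH0 in auto)
    have Gp: "Lpint p (\<lambda>x. G (v x))"
    proof (rule Lp_lip(1)[OF vp])
      show "\<bar>G (v x)\<bar> \<le> L * \<bar>v x\<bar>" for x using GL[of "v x" 0] H0 by simp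
    qed (use L0 in auto)
    define A where "A = (\<integral>x. crit_nl p (v x) * G (v x) \<partial>lborel)"
    define A' where "A' k = (\<integral>x. crit_nl p (v x) * G (f k x) \<partial>lborel)" for k
    have A'lim: "A' \<longlonglongrightarrow> A"
    proof -
      have "(\<lambda>k. A' k - A) \<longlonglongrightarrow> 0"
      proof (rule Lim_null_comparison)
        show "eventually (\<lambda>k. norm (A' k - A) \<le> Lpn p v powr (1 - 1 / p) * (L * Lpn p (\<lambda>x. f k x - v x) powr (1 / p))) sequentially"
        proof (rule always_eventually, rule allI)
          fix k
          note [measurable] = C1c_measurable[OF f(1)[of k]]
          have Gk: "Lpint p (\<lambda>x. G (f k x))" by (rule S(2)[OF H10_C1c[OF Gf(1)]])
          have d: "Lpint p (\<lambda>x. G (f k x) - G (v x))" "Lpn p (\<lambda>x. G (f k x) - G (v x)) \<le> L powr p * Lpn p (\<lambda>x. f k x - v x)"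
            using Lp_lip[OF S(2)[OF fv[of k]], of "\<lambda>x. G (f k x) - G (v x)" L] GL L0 by auto
          have "A' k - A = (\<integral>x. crit_nl p (v x) * (G (f k x) - G (v x)) \<partial>lborel)"
            unfolding A'_def A_def right_diff_distrib
            by (rule Bochner_Integration.integral_diff[OF crit_nl_pairing(1)[OF p2 vp Gk] crit_nl_pairing(1)[OF p2 vp Gp], symmetric])
          then have "\<bar>A' k - A\<bar> \<le> Lpn p v powr (1 - 1 / p) * Lpn p (\<lambda>x. G (f k x) - G (v x)) powr (1 / p)"
            using crit_nl_pairing(2)[OF p2 vp d(1)] by simp
          also have "\<dots> \<le> Lpn p v powr (1 - 1 / p) * (L powr p * Lpn p (\<lambda>x. f k x - v x)) powr (1 / p)"
            using d(2) p2 by (intro mult_left_mono powr_mono2) auto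
          also have "(L powr p * Lpn p (\<lambda>x. f k x - v x)) powr (1 / p) = L * Lpn p (\<lambda>x. f k x - v x) powr (1 / p)"
            using p2 L0 by (simp add: powr_mult powr_powr)
          finally show "norm (A' k - A) \<le> Lpn p v powr (1 - 1 / p) * (L * Lpn p (\<lambda>x. f k x - v x) powr (1 / p))" by simp
        qed
        have "(\<lambda>k. Lpn p v powr (1 - 1 / p) * (L * Lpn p (\<lambda>x. f k x - v x) powr (1 / p))) \<longlonglongrightarrow> Lpn p v powr (1 - 1 / p) * (L * 0)"
          by (intro tendsto_mult tendsto_const Lf)
        then show "(\<lambda>k. Lpn p v powr (1 - 1 / p) * (L * Lpn p (\<lambda>x. f k x - v x) powr (1 / p))) \<longlonglongrightarrow> 0" by simp
      qed
      then show ?thesis by (simp add: LIM_zero_iff)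
    qed
    \<comment> \<open>The equation is tested with G of the C^1 approximants of v, which are
      admissible by the ordinary chain rule. The second summand is the error made by exchanging F
      for the gradient of the approximant; for fixed \<delta> it tends to zero, as G' is bounded by
      L.\<close>
    define b where "b k = A' k + sqrt (sqn (\<lambda>x. egrad (f k) x - F x)) * (L * sqrt (sqn (egrad (f k))))" for k
    have blim: "b \<longlonglongrightarrow> A"
    proof -
      have "b \<longlonglongrightarrow> A + sqrt 0 * (L * sqrt (sqn F))"
        unfolding b_def by (intro tendsto_intros A'lim f(3) tendsto_sqn[OF Fs C1c_sqint_egrad[OF f(1)] f(3)])
      then show ?thesis by simp
    qed
    have Hk: "Lpn p (\<lambda>x. H (f k x)) powr (2 / p) \<le> S * (D * b k)" for k
    proof -
      define gk where "gk = egrad (f k)"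
      define Gk where "Gk x = G' (f k x) *\<^sub>R gk x" for x
      have eG: "egrad (\<lambda>x. G (f k x)) = Gk" unfolding Gk_def gk_def using Gf(2) by auto
      have sg: "sqint gk" unfolding gk_def by (rule C1c_sqint_egrad[OF f(1)])
      have sGk: "sqint Gk" unfolding eG[symmetric] by (rule C1c_sqint_egrad[OF Gf(1)])
      have sGkL: "sqn Gk \<le> L\<^sup>2 * sqn gk"
        by (rule sqint_bound(2)[OF sg]) (use sGk G'L in \<open>auto simp: Gk_def intro: mult_right_mono\<close>)
      have "sqn (egrad (\<lambda>x. H (f k x))) \<le> (\<integral>x. D * (gk x \<bullet> Gk x) \<partial>lborel)"
        unfolding sqn_def
      proof (rule integral_mono)
        show "integrable lborel (\<lambda>x. (norm (egrad (\<lambda>x. H (f k x)) x))\<^sup>2)"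
          by (rule sqint_integrable[OF C1c_sqint_egrad[OF Hf(1)]])
        show "integrable lborel (\<lambda>x. D * (gk x \<bullet> Gk x))" by (intro integrable_mult_right sqint_inner[OF sg sGk])
        fix x
        have "(norm (egrad (\<lambda>x. H (f k x)) x))\<^sup>2 = (H' (f k x))\<^sup>2 * (norm (gk x))\<^sup>2"
          unfolding Hf(2) gk_def by (simp add: power_mult_distrib)
        also have "\<dots> \<le> D * G' (f k x) * (norm (gk x))\<^sup>2" by (intro mult_right_mono HG) simp
        also have "\<dots> = D * (gk x \<bullet> Gk x)" by (simp add: Gk_def power2_norm_eq_inner)
        finally show "(norm (egrad (\<lambda>x. H (f k x)) x))\<^sup>2 \<le> D * (gk x \<bullet> Gk x)" .
      qed
      also have "\<dots> = D * (\<integral>x. gk x \<bullet> Gk x \<partial>lborel)" by simp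
      also have "(\<integral>x. gk x \<bullet> Gk x \<partial>lborel) = (\<integral>x. F x \<bullet> Gk x \<partial>lborel) + (\<integral>x. (gk x - F x) \<bullet> Gk x \<partial>lborel)"
        using sqint_inner[OF Fs sGk] sqint_inner[OF sg sGk] by (simp add: inner_diff_left)
      also have "\<dots> \<le> b k"
      proof -
        have "(\<integral>x. F x \<bullet> Gk x \<partial>lborel) = A' k"
          unfolding A'_def eG[symmetric] by (rule eq[OF H10_C1c[OF Gf(1)]])
        moreover have "(\<integral>x. (gk x - F x) \<bullet> Gk x \<partial>lborel) \<le> sqrt (sqn (\<lambda>x. gk x - F x)) * sqrt (sqn Gk)"
          using integral_inner_le[OF sqint_diff(1)[OF sg Fs] sGk] by linarith
        moreover have "sqrt (sqn Gk) \<le> L * sqrt (sqn gk)"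
          using real_sqrt_le_mono[OF sGkL] L0 by (simp add: real_sqrt_mult)
        then have "sqrt (sqn (\<lambda>x. gk x - F x)) * sqrt (sqn Gk) \<le> sqrt (sqn (\<lambda>x. gk x - F x)) * (L * sqrt (sqn gk))"
          by (rule mult_left_mono) simp
        ultimately show ?thesis unfolding b_def gk_def by linarith
      qed
      finally have "sqn (egrad (\<lambda>x. H (f k x))) \<le> D * b k" using D by (simp add: mult_left_mono)
      then have "S * sqn (egrad (\<lambda>x. H (f k x))) \<le> S * (D * b k)" using S(1) by (intro mult_left_mono) auto
      with S(3)[OF H10_C1c[OF Hf(1)], of k] show ?thesis by linarith
    qed
    have b0: "0 \<le> S * (D * b k)" for k using Hk[of k] powr_ge_zero order_trans by blast
    have "(\<integral>\<^sup>+x. ennreal (\<bar>H (v x)\<bar> powr p) \<partial>lborel) \<le> ennreal ((S * (D * A)) powr (p / 2))"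
    proof -
      have Hc: "continuous_on UNIV H"
        unfolding H_def by (meson DERIV_isCont bk_fun_derivative[OF \<delta>] continuous_at_imp_continuous_on)
      have "(\<integral>\<^sup>+x. ennreal (\<bar>H (v x)\<bar> powr p) \<partial>lborel) = (\<integral>\<^sup>+x. liminf (\<lambda>n. ennreal (\<bar>H (f (r n) x)\<bar> powr p)) \<partial>lborel)"
      proof (rule nn_integral_cong_AE)
        show "AE x in lborel. ennreal (\<bar>H (v x)\<bar> powr p) = liminf (\<lambda>n. ennreal (\<bar>H (f (r n) x)\<bar> powr p))"
          using r(2)
        proof eventually_elim
          case (elim x)
          have "(\<lambda>n. H (f (r n) x)) \<longlonglongrightarrow> H (v x)"
            by (rule continuous_on_tendsto_compose[OF Hc elim]) auto
          then have "(\<lambda>n. \<bar>H (f (r n) x)\<bar> powr p) \<longlonglongrightarrow> \<bar>H (v x)\<bar> powr p"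
            using p2 by (intro tendsto_powr2 tendsto_rabs tendsto_const) auto
          then have "(\<lambda>n. ennreal (\<bar>H (f (r n) x)\<bar> powr p)) \<longlonglongrightarrow> ennreal (\<bar>H (v x)\<bar> powr p)" by simp
          then show ?case by (intro lim_imp_Liminf[symmetric]) auto
        qed
      qed
      also have "\<dots> \<le> liminf (\<lambda>n. \<integral>\<^sup>+x. ennreal (\<bar>H (f (r n) x)\<bar> powr p) \<partial>lborel)"
        using C1c_measurable(1)[OF f(1)] by (intro nn_integral_liminf) auto
      also have "\<dots> \<le> liminf (\<lambda>n. ennreal ((S * (D * b (r n))) powr (p / 2)))"
      proof (intro Liminf_mono always_eventually allI)
        fix n
        have Lk: "Lpint p (\<lambda>x. H (f (r n) x))" by (rule S(2)[OF H10_C1c[OF Hf(1)]])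
        have "(\<integral>\<^sup>+x. ennreal (\<bar>H (f (r n) x)\<bar> powr p) \<partial>lborel) = ennreal (Lpn p (\<lambda>x. H (f (r n) x)))"
          unfolding Lpn_def using Lpint_integrable[OF Lk] by (intro nn_integral_eq_integral) auto
        also have "Lpn p (\<lambda>x. H (f (r n) x)) = (Lpn p (\<lambda>x. H (f (r n) x)) powr (2 / p)) powr (p / 2)"
          using p2 by (simp add: powr_powr)
        also have "ennreal \<dots> \<le> ennreal ((S * (D * b (r n))) powr (p / 2))"
          using p2 by (intro ennreal_leI powr_mono2 Hk) auto
        finally show "(\<integral>\<^sup>+x. ennreal (\<bar>H (f (r n) x)\<bar> powr p) \<partial>lborel) \<le> ennreal ((S * (D * b (r n))) powr (p / 2))" .
      qed
      also have "\<dots> = ennreal ((S * (D * A)) powr (p / 2))"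
      proof (rule lim_imp_Liminf)
        have "(\<lambda>n. b (r n)) \<longlonglongrightarrow> A" using LIMSEQ_subseq_LIMSEQ[OF blim r(1)] by (simp add: o_def)
        then have "(\<lambda>n. (S * (D * b (r n))) powr (p / 2)) \<longlonglongrightarrow> (S * (D * A)) powr (p / 2)"
          using b0 p2 by (intro tendsto_powr2 tendsto_mult tendsto_const) auto
        then show "(\<lambda>n. ennreal ((S * (D * b (r n))) powr (p / 2))) \<longlonglongrightarrow> ennreal ((S * (D * A)) powr (p / 2))" by simp
      qed simp
      finally show ?thesis .
    qed
    then have "Lpn p (\<lambda>x. H (v x)) \<le> (S * (D * A)) powr (p / 2)"
      using nn_integral_eq_integral[OF Lpint_integrable[OF Hp]] by (simp add: Lpn_def)
    moreover have A0: "0 \<le> S * (D * A)"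
      by (rule LIMSEQ_le_const[OF tendsto_mult[OF tendsto_const tendsto_mult[OF tendsto_const blim]]]) (use b0 in auto)
    ultimately have "Lpn p (\<lambda>x. H (v x)) powr (2 / p) \<le> ((S * (D * A)) powr (p / 2)) powr (2 / p)"
      using p2 by (intro powr_mono2) auto
    also have "\<dots> = S * (D * A)" using p2 A0 by (simp add: powr_powr)
    \<comment> \<open>The relation s G(s) = H(s)^2 turns the pairing of the nonlinearity with G(v)
      into a potential acting on H(v).\<close>
    also have "A = (\<integral>x. Q x * (H (v x))\<^sup>2 \<partial>lborel)"
      unfolding A_def Q_def crit_nl_def sG[symmetric] by (simp add: mult_ac)
    also have "S * (D * \<dots>) \<le> S * (D * (K * sqn (\<lambda>x. H (v x)) + \<eta> * Lpn p (\<lambda>x. H (v x)) powr (2 / p)))"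
      using S(1) D by (intro mult_left_mono K(2)[OF Hs Hp]) auto
    also have "\<dots> = S * D * K * sqn (\<lambda>x. H (v x)) + 1 / 2 * Lpn p (\<lambda>x. H (v x)) powr (2 / p)"
      unfolding \<eta>_def using S(1) D by (simp add: distrib_left)
    finally have "Lpn p (\<lambda>x. H (v x)) powr (2 / p) \<le> 2 * (S * D) * K * sqn (\<lambda>x. H (v x))" by (simp add: mult_ac)
    then show ?thesis using Hp Hs by (simp add: H_def)
  qed
  show ?thesis by (rule that[of "2 * (S * D) * K"]) (use main K(1) S(1) D in auto)
qed

text \<open>Fatou's lemma for \<delta> = 1 / (n + 1). The truncated functions increase the
  integrability from L^2 to L^p with a bound that only involves the untruncated integral assumed
  finite.\<close>

lemma Brezis_Kato_step:
  fixes v :: "'a::euclidean_space \<Rightarrow> real"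
  assumes N: "DIM('a) \<ge> 3" and sol: "conf_sol 0 v F" and \<beta>: "\<beta> \<ge> 0"
    and i: "integrable lborel (\<lambda>x. (v x)\<^sup>2 * (1 + (v x)\<^sup>2) powr (2 * \<beta>))"
  defines "p \<equiv> crit_exp DIM('a)"
  shows "integrable lborel (\<lambda>x. \<bar>v x\<bar> powr p * (1 + (v x)\<^sup>2) powr (\<beta> * p))"
proof -
  have p2: "p > 2" using N by (simp add: p_def crit_exp_def field_simps)
  have "sqint v" using sol H10D(1) by (auto simp: conf_sol_def)
  then have [measurable]: "v \<in> borel_measurable borel" by auto
  obtain M where M: "M \<ge> 0" "\<And>\<delta>. 0 < \<delta> \<Longrightarrow> \<delta> \<le> 1 \<Longrightarrow>
      Lpint p (\<lambda>x. bk_fun \<delta> \<beta> (v x)) \<and> sqint (\<lambda>x. bk_fun \<delta> \<beta> (v x)) \<and>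
      Lpn p (\<lambda>x. bk_fun \<delta> \<beta> (v x)) powr (2 / p) \<le> M * sqn (\<lambda>x. bk_fun \<delta> \<beta> (v x))"
    unfolding p_def by (rule Brezis_Kato_estimate[OF N sol \<beta>]) blast
  define J where "J = (\<integral>x. (v x)\<^sup>2 * (1 + (v x)\<^sup>2) powr (2 * \<beta>) \<partial>lborel)"
  define d where "d n = 1 / real (Suc n)" for n
  have d: "0 < d n" "d n \<le> 1" for n by (auto simp: d_def)
  have d0: "d \<longlonglongrightarrow> 0" unfolding d_def[abs_def] using LIMSEQ_Suc[OF lim_1_over_n] by simp
  have b: "(\<integral>\<^sup>+x. ennreal (\<bar>bk_fun (d n) \<beta> (v x)\<bar> powr p) \<partial>lborel) \<le> ennreal ((M * J) powr (p / 2))" for n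
  proof -
    define k where "k x = bk_fun (d n) \<beta> (v x)" for x
    have k: "Lpint p k" "sqint k" "Lpn p k powr (2 / p) \<le> M * sqn k"
      unfolding k_def using M(2)[OF d, of n] by auto
    have "sqn k \<le> J"
      unfolding sqn_def J_def
    proof (rule integral_mono[OF sqint_integrable[OF k(2)] i])
      fix x
      have "(norm (k x))\<^sup>2 = (v x)\<^sup>2 * bk_ratio (d n) (v x) powr (2 * \<beta>)"
        by (simp add: k_def bk_fun_def power_mult_distrib power2_eq_square powr_add[symmetric])
      also have "\<dots> \<le> (v x)\<^sup>2 * (1 + (v x)\<^sup>2) powr (2 * \<beta>)"
        using bk_ratio_bounds(1,2)[OF d, of n "v x"] \<beta> by (intro mult_left_mono powr_mono2) auto
      finally show "(norm (k x))\<^sup>2 \<le> (v x)\<^sup>2 * (1 + (v x)\<^sup>2) powr (2 * \<beta>)" .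
    qed
    then have "M * sqn k \<le> M * J" using M(1) by (rule mult_left_mono)
    then have kb: "Lpn p k powr (2 / p) \<le> M * J" using k(3) by linarith
    have "Lpn p k = (Lpn p k powr (2 / p)) powr (p / 2)" using p2 by (simp add: powr_powr)
    also have "\<dots> \<le> (M * J) powr (p / 2)" using p2 by (intro powr_mono2 kb) auto
    finally have "Lpn p k \<le> (M * J) powr (p / 2)" .
    then show ?thesis
      using nn_integral_eq_integral[OF Lpint_integrable[OF k(1)]] unfolding Lpn_def k_def by (simp add: ennreal_leI)
  qed
  have "(\<integral>\<^sup>+x. ennreal (\<bar>v x\<bar> powr p * (1 + (v x)\<^sup>2) powr (\<beta> * p)) \<partial>lborel)
     = (\<integral>\<^sup>+x. liminf (\<lambda>n. ennreal (\<bar>bk_fun (d n) \<beta> (v x)\<bar> powr p)) \<partial>lborel)"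
  proof (rule nn_integral_cong)
    fix x
    have pos: "1 + (v x)\<^sup>2 > 0" by (simp add: add_pos_nonneg)
    have "(\<lambda>n. bk_ratio (d n) (v x)) \<longlonglongrightarrow> (1 + (v x)\<^sup>2) / (1 + 0 * (v x)\<^sup>2)"
      unfolding bk_ratio_def by (intro tendsto_intros d0) simp
    then have "(\<lambda>n. \<bar>v x * bk_ratio (d n) (v x) powr \<beta>\<bar> powr p) \<longlonglongrightarrow> \<bar>v x * (1 + (v x)\<^sup>2) powr \<beta>\<bar> powr p"
      using pos p2 by (intro tendsto_powr2 tendsto_rabs tendsto_mult tendsto_const tendsto_powr) auto
    moreover have "\<bar>v x * (1 + (v x)\<^sup>2) powr \<beta>\<bar> powr p = \<bar>v x\<bar> powr p * (1 + (v x)\<^sup>2) powr (\<beta> * p)"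
      by (simp add: abs_mult powr_mult powr_powr)
    ultimately have "(\<lambda>n. ennreal (\<bar>bk_fun (d n) \<beta> (v x)\<bar> powr p)) \<longlonglongrightarrow> ennreal (\<bar>v x\<bar> powr p * (1 + (v x)\<^sup>2) powr (\<beta> * p))"
      by (simp add: bk_fun_def)
    then show "ennreal (\<bar>v x\<bar> powr p * (1 + (v x)\<^sup>2) powr (\<beta> * p)) = liminf (\<lambda>n. ennreal (\<bar>bk_fun (d n) \<beta> (v x)\<bar> powr p))"
      by (intro lim_imp_Liminf[symmetric]) auto
  qed
  also have "\<dots> \<le> liminf (\<lambda>n. \<integral>\<^sup>+x. ennreal (\<bar>bk_fun (d n) \<beta> (v x)\<bar> powr p) \<partial>lborel)"
    by (intro nn_integral_liminf) auto
  also have "\<dots> \<le> liminf (\<lambda>n::nat. ennreal ((M * J) powr (p / 2)))"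
    by (intro Liminf_mono always_eventually allI b)
  also have "\<dots> < \<infinity>" by (simp add: Liminf_const)
  finally show ?thesis by (intro integrableI_bounded) auto
qed

text \<open>Each step raises the exponent by a fixed amount, so finitely many steps exceed any
  \<gamma>.\<close>

lemma conf_sol_higher_integrability:
  fixes v :: "'a::euclidean_space \<Rightarrow> real"
  assumes N: "DIM('a) \<ge> 3" and sol: "conf_sol 0 v F"
  shows "integrable lborel (\<lambda>x. (v x)\<^sup>2 * (1 + (v x)\<^sup>2) powr \<gamma>)"
proof -
  define p where "p = crit_exp DIM('a)"
  have p2: "p > 2" using N by (simp add: p_def crit_exp_def field_simps)
  have vs: "sqint v" using sol H10D(1) by (auto simp: conf_sol_def)
  have [measurable]: "v \<in> borel_measurable borel" using vs by auto
  \<comment> \<open>For |s| \<ge> 1 the surplus |s|^(p - 2) in the L^p integrand is worth (1 +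
    s^2)^((p - 2) / 2), hence a gain of (p - 2) / 4 in \<beta>; for |s| < 1 the integrand is
    comparable with s^2.\<close>
  define e where "e = (p - 2) / 4"
  have e: "e > 0" using p2 by (simp add: e_def)
  have step: "integrable lborel (\<lambda>x. (v x)\<^sup>2 * (1 + (v x)\<^sup>2) powr (2 * (\<beta> + e)))"
    if \<beta>: "\<beta> \<ge> 0" and i: "integrable lborel (\<lambda>x. (v x)\<^sup>2 * (1 + (v x)\<^sup>2) powr (2 * \<beta>))" for \<beta>
  proof -
    note j = Brezis_Kato_step[OF N sol \<beta> i, folded p_def]
    define c1 where "c1 = 2 powr (2 * (\<beta> + e))"
    define c2 where "c2 = 2 powr ((p - 2) / 2)"
    have bd: "integrable lborel (\<lambda>x. c1 * (norm (v x))\<^sup>2 + c2 * (\<bar>v x\<bar> powr p * (1 + (v x)\<^sup>2) powr (\<beta> * p)))"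
      by (intro Bochner_Integration.integrable_add integrable_mult_right j sqint_integrable[OF vs])
    have pt: "s\<^sup>2 * (1 + s\<^sup>2) powr (2 * (\<beta> + e)) \<le> c1 * (norm s)\<^sup>2 + c2 * (\<bar>s\<bar> powr p * (1 + s\<^sup>2) powr (\<beta> * p))" for s :: real
    proof (cases "\<bar>s\<bar> < 1")
      case True
      then have "s\<^sup>2 \<le> 1" by (simp add: abs_square_le_1)
      then have "(1 + s\<^sup>2) powr (2 * (\<beta> + e)) \<le> c1" unfolding c1_def using \<beta> e by (intro powr_mono2) auto
      then have "s\<^sup>2 * (1 + s\<^sup>2) powr (2 * (\<beta> + e)) \<le> s\<^sup>2 * c1" by (rule mult_left_mono) simp
      moreover have "0 \<le> c2 * (\<bar>s\<bar> powr p * (1 + s\<^sup>2) powr (\<beta> * p))" by (simp add: c2_def)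
      moreover have "c1 * (norm s)\<^sup>2 = s\<^sup>2 * c1" by simp
      ultimately show ?thesis by linarith
    next
      case False
      then have s1: "1 \<le> \<bar>s\<bar>" by simp
      then have sq: "1 \<le> s\<^sup>2" by (metis abs_le_square_iff abs_one one_power2)
      have b1: "1 + s\<^sup>2 \<ge> 1" by simp
      have pb: "2 * \<beta> \<le> \<beta> * p" using p2 \<beta> by (simp add: mult_left_mono mult.commute)
      have "(1 + s\<^sup>2) powr (2 * (\<beta> + e)) = (1 + s\<^sup>2) powr (2 * \<beta>) * (1 + s\<^sup>2) powr ((p - 2) / 2)"
      proof -
        have "2 * (\<beta> + e) = 2 * \<beta> + (p - 2) / 2" by (simp add: e_def)
        then show ?thesis by (simp only: powr_add)
      qed
      also have "\<dots> \<le> (1 + s\<^sup>2) powr (\<beta> * p) * (2 * s\<^sup>2) powr ((p - 2) / 2)"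
        by (rule mult_mono[OF powr_mono[OF pb b1] powr_mono2]) (use sq p2 in auto)
      also have "(2 * s\<^sup>2) powr ((p - 2) / 2) = c2 * \<bar>s\<bar> powr (p - 2)"
      proof -
        have "s\<^sup>2 = \<bar>s\<bar> powr 2" using s1 by (simp add: powr_numeral)
        moreover have "2 * ((p - 2) / 2) = p - 2" by (simp add: field_simps)
        ultimately have "(s\<^sup>2) powr ((p - 2) / 2) = \<bar>s\<bar> powr (p - 2)" by (simp only: powr_powr)
        then show ?thesis by (simp add: powr_mult c2_def)
      qed
      finally have "s\<^sup>2 * (1 + s\<^sup>2) powr (2 * (\<beta> + e)) \<le> s\<^sup>2 * ((1 + s\<^sup>2) powr (\<beta> * p) * (c2 * \<bar>s\<bar> powr (p - 2)))"
        by (rule mult_left_mono) simp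
      also have "\<dots> = c2 * (\<bar>s\<bar> powr p * (1 + s\<^sup>2) powr (\<beta> * p))"
      proof -
        have "s\<^sup>2 * \<bar>s\<bar> powr (p - 2) = \<bar>s\<bar> powr p" using s1 by (simp add: powr_diff powr_numeral)
        then show ?thesis by (simp add: mult_ac)
      qed
      also have "\<dots> \<le> c1 * (norm s)\<^sup>2 + \<dots>" by (simp add: c1_def)
      finally show ?thesis .
    qed
    show ?thesis
    proof (rule Bochner_Integration.integrable_bound[OF bd])
      show "AE x in lborel. norm ((v x)\<^sup>2 * (1 + (v x)\<^sup>2) powr (2 * (\<beta> + e)))
          \<le> norm (c1 * (norm (v x))\<^sup>2 + c2 * (\<bar>v x\<bar> powr p * (1 + (v x)\<^sup>2) powr (\<beta> * p)))"
      proof (rule AE_I2)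
        fix x
        have "norm ((v x)\<^sup>2 * (1 + (v x)\<^sup>2) powr (2 * (\<beta> + e))) = (v x)\<^sup>2 * (1 + (v x)\<^sup>2) powr (2 * (\<beta> + e))"
          by simp
        also have "\<dots> \<le> norm (c1 * (norm (v x))\<^sup>2 + c2 * (\<bar>v x\<bar> powr p * (1 + (v x)\<^sup>2) powr (\<beta> * p)))"
          unfolding real_norm_def[of "_ + _"] by (rule order_trans[OF pt abs_ge_self])
        finally show "norm ((v x)\<^sup>2 * (1 + (v x)\<^sup>2) powr (2 * (\<beta> + e)))
          \<le> norm (c1 * (norm (v x))\<^sup>2 + c2 * (\<bar>v x\<bar> powr p * (1 + (v x)\<^sup>2) powr (\<beta> * p)))" .
      qed
    qed measurable
  qed
  have it: "integrable lborel (\<lambda>x. (v x)\<^sup>2 * (1 + (v x)\<^sup>2) powr (2 * (real n * e)))" for n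
  proof (induction n)
    case 0
    have "(1 + (v x)\<^sup>2) powr 0 = 1" for x by (simp add: add_nonneg_eq_0_iff)
    then show ?case using sqint_integrable[OF vs] by simp
  next
    case (Suc n)
    have "real n * e \<ge> 0" using e by simp
    from step[OF this Suc] show ?case by (simp add: algebra_simps)
  qed
  obtain n :: nat where n: "\<gamma> \<le> 2 * (real n * e)"
  proof -
    obtain n :: nat where "\<gamma> / (2 * e) \<le> real n" using real_arch_simple by blast
    then have "\<gamma> \<le> 2 * (real n * e)" using e by (simp add: field_simps)
    then show ?thesis by (rule that)
  qed
  show ?thesis
  proof (rule Bochner_Integration.integrable_bound[OF it[of n]])
    show "AE x in lborel. norm ((v x)\<^sup>2 * (1 + (v x)\<^sup>2) powr \<gamma>) \<le> norm ((v x)\<^sup>2 * (1 + (v x)\<^sup>2) powr (2 * (real n * e)))"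
    proof (rule AE_I2)
      fix x
      have "(1 + (v x)\<^sup>2) powr \<gamma> \<le> (1 + (v x)\<^sup>2) powr (2 * (real n * e))" by (rule powr_mono[OF n]) simp
      then have "(v x)\<^sup>2 * (1 + (v x)\<^sup>2) powr \<gamma> \<le> (v x)\<^sup>2 * (1 + (v x)\<^sup>2) powr (2 * (real n * e))"
        by (rule mult_left_mono) simp
      then show "norm ((v x)\<^sup>2 * (1 + (v x)\<^sup>2) powr \<gamma>) \<le> norm ((v x)\<^sup>2 * (1 + (v x)\<^sup>2) powr (2 * (real n * e)))"
        by simp
    qed
  qed measurable
qed

subsection \<open>Unique continuation by a linear Carleman weight\<close>

text \<open>The exponential is unbounded on the whole space but bounded by exp(\<tau> |R|) on the
  ball, and all functions in question vanish outside; hence the pointwise vanishing among the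
  hypotheses. The radius is left free because both the solution and its translates are
  weighted.\<close>

lemma H10_exp_weight:
  fixes z :: "'a::euclidean_space \<Rightarrow> real" and e :: 'a
  assumes z: "H10 (ball 0 R) z Z" and out: "\<And>x. x \<notin> ball 0 R \<Longrightarrow> z x = 0" "\<And>x. x \<notin> ball 0 R \<Longrightarrow> Z x = 0"
    and e: "norm e = 1" and \<tau>: "\<tau> > 0"
  shows "H10 (ball 0 R) (\<lambda>x. exp (\<tau> * (x \<bullet> e)) * z x) (\<lambda>x. exp (\<tau> * (x \<bullet> e)) *\<^sub>R (Z x + (\<tau> * z x) *\<^sub>R e))"
proof -
  obtain f where f: "\<And>k::nat. C1c (ball 0 R) (f k)" "(\<lambda>k. sqn (\<lambda>x. f k x - z x)) \<longlonglongrightarrow> 0"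
    "(\<lambda>k. sqn (\<lambda>x. egrad (f k) x - Z x)) \<longlonglongrightarrow> 0" using H10_approx[OF z] by blast
  define E where "E x = exp (\<tau> * (x \<bullet> e))" for x
  have [measurable]: "E \<in> borel_measurable borel" unfolding E_def by measurable
  have [measurable]: "z \<in> borel_measurable borel" "Z \<in> borel_measurable borel" using H10D[OF z] by auto
  have dE: "(E has_derivative (\<lambda>h. (E x *\<^sub>R (\<tau> *\<^sub>R e)) \<bullet> h)) (at x)" for x
    unfolding E_def[abs_def]
    by (rule has_derivative_eq_rhs, (rule derivative_intros)+) (auto simp: inner_commute)
  have cE: "continuous_on UNIV E" unfolding E_def by (intro continuous_intros)
  have c: "continuous_on (ball 0 R) (\<lambda>x. E x *\<^sub>R (\<tau> *\<^sub>R e))"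
    by (intro continuous_intros continuous_on_subset[OF cE]) auto
  have Ef: "C1c (ball 0 R) (\<lambda>x. E x * k x)" "egrad (\<lambda>x. E x * k x) x = E x *\<^sub>R (egrad k x + (\<tau> * k x) *\<^sub>R e)"
    if k: "C1c (ball 0 R) k" for k x
    using C1c_mult_local[OF k open_ball dE c] by (auto simp: scaleR_add_right mult_ac)
  define M where "M = exp (\<tau> * \<bar>R\<bar>)"
  have EM: "E x \<le> M" if "x \<in> ball 0 R" for x
  proof -
    have "x \<bullet> e \<le> norm x * norm e" by (rule norm_cauchy_schwarz)
    then have "x \<bullet> e \<le> \<bar>R\<bar>" using that e by simp
    then show ?thesis unfolding E_def M_def using \<tau> by simp
  qed
  have E0: "E x \<ge> 0" for x by (simp add: E_def)
  have bd1: "norm (E x * y) \<le> M * norm y" if "x \<in> ball 0 R \<or> y = 0" for x and y :: real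
    using that EM[of x] E0[of x] by (cases "y = 0") (auto simp: abs_mult intro!: mult_right_mono)
  have bd2: "norm (E x *\<^sub>R y) \<le> M * norm y" if "x \<in> ball 0 R \<or> y = 0" for x and y :: 'a
    using that EM[of x] E0[of x] by (cases "y = 0") (auto intro!: mult_right_mono)
  have zs: "sqint z" and Zs: "sqint Z" using H10D[OF z] by auto
  have Zt: "sqint (\<lambda>x. Z x + (\<tau> * z x) *\<^sub>R e)"
  proof (rule sqint_add(1)[OF Zs])
    show "sqint (\<lambda>x. (\<tau> * z x) *\<^sub>R e)"
      by (rule sqint_bound(1)[OF zs, of _ "\<bar>\<tau>\<bar>"]) (use e in \<open>auto simp: abs_mult\<close>)
  qed
  have s1: "sqint (\<lambda>x. E x * z x)"
    by (rule sqint_bound(1)[OF zs, of _ M], measurable, rule bd1) (use out in auto)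
  have s2: "sqint (\<lambda>x. E x *\<^sub>R (Z x + (\<tau> * z x) *\<^sub>R e))"
  proof (rule sqint_bound(1)[OF Zt, of _ M])
    show "norm (E x *\<^sub>R (Z x + (\<tau> * z x) *\<^sub>R e)) \<le> M * norm (Z x + (\<tau> * z x) *\<^sub>R e)" for x
      by (rule bd2) (cases "x \<in> ball 0 R"; simp add: out)
  qed measurable
  have d1: "sqint (\<lambda>x. f k x - z x)" and d2: "sqint (\<lambda>x. egrad (f k) x - Z x)" for k
    using sqint_diff(1)[OF C1c_sqint[OF f(1)] zs] sqint_diff(1)[OF C1c_sqint_egrad[OF f(1)] Zs] by auto
  have fo: "f k x = 0" "egrad (f k) x = 0" if "x \<notin> ball 0 R" for k x
    using C1c_outside[OF f(1) that] by auto
  have l1: "(\<lambda>k. sqn (\<lambda>x. E x * f k x - E x * z x)) \<longlonglongrightarrow> 0"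
  proof (rule tendsto_sandwich[of "\<lambda>k. 0"])
    show "eventually (\<lambda>k. sqn (\<lambda>x. E x * f k x - E x * z x) \<le> M\<^sup>2 * sqn (\<lambda>x. f k x - z x)) sequentially"
    proof (rule always_eventually, rule allI)
      fix k
      note [measurable] = C1c_measurable[OF f(1)[of k]]
      show "sqn (\<lambda>x. E x * f k x - E x * z x) \<le> M\<^sup>2 * sqn (\<lambda>x. f k x - z x)"
        unfolding right_diff_distrib[symmetric]
      proof (rule sqint_bound(2)[OF d1])
        show "norm (E x * (f k x - z x)) \<le> M * norm (f k x - z x)" for x
          by (rule bd1) (cases "x \<in> ball 0 R"; simp add: out fo)
      qed measurable
    qed
    show "(\<lambda>k. M\<^sup>2 * sqn (\<lambda>x. f k x - z x)) \<longlonglongrightarrow> 0" using tendsto_mult[OF tendsto_const f(2), of "M\<^sup>2"] by simp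
  qed auto
  have l2: "(\<lambda>k. sqn (\<lambda>x. egrad (\<lambda>x. E x * f k x) x - E x *\<^sub>R (Z x + (\<tau> * z x) *\<^sub>R e))) \<longlonglongrightarrow> 0"
  proof (rule tendsto_sandwich[of "\<lambda>k. 0"])
    show "eventually (\<lambda>k. sqn (\<lambda>x. egrad (\<lambda>x. E x * f k x) x - E x *\<^sub>R (Z x + (\<tau> * z x) *\<^sub>R e))
        \<le> M\<^sup>2 * (2 * sqn (\<lambda>x. egrad (f k) x - Z x) + 2 * (\<tau>\<^sup>2 * sqn (\<lambda>x. f k x - z x)))) sequentially"
    proof (rule always_eventually, rule allI)
      fix k
      note [measurable] = C1c_measurable[OF f(1)[of k]]
      let ?D = "\<lambda>x. (egrad (f k) x - Z x) + (\<tau> * (f k x - z x)) *\<^sub>R e"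
      have t: "sqint (\<lambda>x. (\<tau> * (f k x - z x)) *\<^sub>R e)" "sqn (\<lambda>x. (\<tau> * (f k x - z x)) *\<^sub>R e) \<le> \<bar>\<tau>\<bar>\<^sup>2 * sqn (\<lambda>x. f k x - z x)"
        using sqint_bound[OF d1[of k], of "\<lambda>x. (\<tau> * (f k x - z x)) *\<^sub>R e" "\<bar>\<tau>\<bar>"] e by (auto simp: abs_mult)
      have D: "sqint ?D" "sqn ?D \<le> 2 * sqn (\<lambda>x. egrad (f k) x - Z x) + 2 * (\<tau>\<^sup>2 * sqn (\<lambda>x. f k x - z x))"
        using sqint_add[OF d2[of k] t(1)] t(2) by auto
      have eq: "egrad (\<lambda>x. E x * f k x) x - E x *\<^sub>R (Z x + (\<tau> * z x) *\<^sub>R e) = E x *\<^sub>R ?D x" for x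
        unfolding Ef(2)[OF f(1)] by (simp add: algebra_simps)
      have "sqn (\<lambda>x. E x *\<^sub>R ?D x) \<le> M\<^sup>2 * sqn ?D"
      proof (rule sqint_bound(2)[OF D(1)])
        show "norm (E x *\<^sub>R ?D x) \<le> M * norm (?D x)" for x
          by (rule bd2) (cases "x \<in> ball 0 R"; simp add: out fo)
      qed measurable
      also have "\<dots> \<le> M\<^sup>2 * (2 * sqn (\<lambda>x. egrad (f k) x - Z x) + 2 * (\<tau>\<^sup>2 * sqn (\<lambda>x. f k x - z x)))"
        by (rule mult_left_mono[OF D(2)]) simp
      finally show "sqn (\<lambda>x. egrad (\<lambda>x. E x * f k x) x - E x *\<^sub>R (Z x + (\<tau> * z x) *\<^sub>R e))
        \<le> M\<^sup>2 * (2 * sqn (\<lambda>x. egrad (f k) x - Z x) + 2 * (\<tau>\<^sup>2 * sqn (\<lambda>x. f k x - z x)))" unfolding eq .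
    qed
    have "(\<lambda>k. M\<^sup>2 * (2 * sqn (\<lambda>x. egrad (f k) x - Z x) + 2 * (\<tau>\<^sup>2 * sqn (\<lambda>x. f k x - z x)))) \<longlonglongrightarrow> M\<^sup>2 * (2 * 0 + 2 * (\<tau>\<^sup>2 * 0))"
      by (intro tendsto_intros f)
    then show "(\<lambda>k. M\<^sup>2 * (2 * sqn (\<lambda>x. egrad (f k) x - Z x) + 2 * (\<tau>\<^sup>2 * sqn (\<lambda>x. f k x - z x)))) \<longlonglongrightarrow> 0" by simp
  qed auto
  show ?thesis
    unfolding H10_def E_def[symmetric]
    by (intro conjI exI[of _ "\<lambda>k x. E x * f k x"] allI s1 s2 l1 l2 Ef(1)[OF f(1)])
qed

text \<open>Integrating by parts with the multiplier (x \<bullet> e) f expresses the squared norm of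
  f as -2 times the pairing of (x \<bullet> e) f with the derivative along e, and |x \<bullet> e|
  \<le> 1 on the ball. Only the derivative in one direction is used, which is the one the Carleman
  weight controls.\<close>

lemma Poincare_C1c:
  fixes f :: "'a::euclidean_space \<Rightarrow> real" and e :: 'a
  assumes f: "C1c (ball 0 1) f" and e: "norm e = 1"
  shows "sqn f \<le> 4 * sqn (\<lambda>x. egrad f x \<bullet> e)"
proof -
  note [measurable] = C1c_measurable[OF f]
  have x: "C1c (ball 0 1) (\<lambda>x. (x \<bullet> e) * f x)" "egrad (\<lambda>x. (x \<bullet> e) * f x) x = (x \<bullet> e) *\<^sub>R egrad f x + f x *\<^sub>R e" for x
    using C1c_mult_local[OF f open_ball has_derivative_inner_self_const[of e]] by auto
  have ee: "e \<bullet> e = 1" using e by (simp add: norm_eq_sqrt_inner)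
  let ?d = "\<lambda>x. egrad f x \<bullet> e"
  have ds: "sqint ?d" by (rule sqint_inner_const(1)[OF C1c_sqint_egrad[OF f]])
  have k: "sqint (\<lambda>x. (x \<bullet> e) * f x)" "sqn (\<lambda>x. (x \<bullet> e) * f x) \<le> 1\<^sup>2 * sqn f"
  proof -
    have b: "norm ((x \<bullet> e) * f x) \<le> 1 * norm (f x)" for x
    proof (cases "x \<in> ball 0 1")
      case True
      have "\<bar>x \<bullet> e\<bar> \<le> 1" using Cauchy_Schwarz_ineq2[of x e] e True by simp
      then have "\<bar>x \<bullet> e\<bar> * \<bar>f x\<bar> \<le> 1 * \<bar>f x\<bar>" by (rule mult_right_mono) simp
      then show ?thesis by (simp add: abs_mult)
    qed (use C1c_outside[OF f] in simp)
    show "sqint (\<lambda>x. (x \<bullet> e) * f x)" "sqn (\<lambda>x. (x \<bullet> e) * f x) \<le> 1\<^sup>2 * sqn f"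
      using sqint_bound[OF C1c_sqint[OF f] _ b] by auto
  qed
  have "(\<integral>x. ((x \<bullet> e) * f x) * ?d x \<partial>lborel) = - (\<integral>x. (egrad (\<lambda>x. (x \<bullet> e) * f x) x \<bullet> e) * f x \<partial>lborel)"
    by (rule C1c_integral_by_parts[OF x(1) f open_ball])
  also have "(\<integral>x. (egrad (\<lambda>x. (x \<bullet> e) * f x) x \<bullet> e) * f x \<partial>lborel) = (\<integral>x. ((x \<bullet> e) * f x) * ?d x + f x * f x \<partial>lborel)"
    unfolding x(2) by (rule Bochner_Integration.integral_cong) (auto simp: inner_add_left ee algebra_simps)
  also have "\<dots> = (\<integral>x. ((x \<bullet> e) * f x) * ?d x \<partial>lborel) + (\<integral>x. f x * f x \<partial>lborel)"
    by (rule Bochner_Integration.integral_add[OF sqint_mult[OF k(1) ds] sqint_mult[OF C1c_sqint[OF f] C1c_sqint[OF f]]])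
  also have "(\<integral>x. f x * f x \<partial>lborel) = sqn f" by (simp add: sqn_inner)
  finally have "sqn f = - 2 * (\<integral>x. ((x \<bullet> e) * f x) \<bullet> ?d x \<partial>lborel)" by simp
  also have "\<dots> \<le> 2 * (sqrt (sqn (\<lambda>x. (x \<bullet> e) * f x)) * sqrt (sqn ?d))"
    using integral_inner_le[OF k(1) ds] by linarith
  also have "\<dots> \<le> 2 * (sqrt (sqn f) * sqrt (sqn ?d))"
    using k(2) by (intro mult_left_mono mult_right_mono) auto
  finally have b: "sqn f \<le> 2 * (sqrt (sqn f) * sqrt (sqn ?d))" .
  have "sqrt (sqn f) \<le> 2 * sqrt (sqn ?d)"
  proof (cases "sqrt (sqn f) = 0")
    case False
    then have p: "sqrt (sqn f) > 0" using sqn_nonneg[of f] by (simp add: less_le)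
    have "sqrt (sqn f) * sqrt (sqn f) \<le> sqrt (sqn f) * (2 * sqrt (sqn ?d))" using b by simp
    from mult_left_le_imp_le[OF this p] show ?thesis .
  qed simp
  then have "(sqrt (sqn f))\<^sup>2 \<le> (2 * sqrt (sqn ?d))\<^sup>2" by (rule power_mono) simp
  then show ?thesis by (simp add: power_mult_distrib)
qed

lemma H10_Poincare:
  assumes z: "H10 (ball 0 1) z Z" and e: "norm e = 1"
  shows "sqn z \<le> 4 * sqn (\<lambda>x. Z x \<bullet> e)"
proof -
  obtain f where f: "\<And>k::nat. C1c (ball 0 1) (f k)" "(\<lambda>k. sqn (\<lambda>x. f k x - z x)) \<longlonglongrightarrow> 0"
    "(\<lambda>k. sqn (\<lambda>x. egrad (f k) x - Z x)) \<longlonglongrightarrow> 0" using H10_approx[OF z] by blast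
  have "(\<lambda>k. sqn (f k)) \<longlonglongrightarrow> sqn z" by (rule tendsto_sqn[OF H10D(1)[OF z] C1c_sqint[OF f(1)] f(2)])
  moreover have "(\<lambda>k. sqn (\<lambda>x. egrad (f k) x \<bullet> e)) \<longlonglongrightarrow> sqn (\<lambda>x. Z x \<bullet> e)"
    by (rule tendsto_sqn[OF sqint_inner_const(1)[OF H10D(2)[OF z]] sqint_inner_const(1)[OF C1c_sqint_egrad[OF f(1)]]
        tendsto_sqn_inner_const[OF C1c_sqint_egrad[OF f(1)] H10D(2)[OF z] f(3)]])
  then have "(\<lambda>k. 4 * sqn (\<lambda>x. egrad (f k) x \<bullet> e)) \<longlonglongrightarrow> 4 * sqn (\<lambda>x. Z x \<bullet> e)" by (intro tendsto_mult tendsto_const)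
  ultimately show ?thesis by (rule LIMSEQ_le) (use Poincare_C1c[OF f(1) e] in auto)
qed

section \<open>Symmetric difference quotients\<close>

definition diff_quot :: "'a::euclidean_space \<Rightarrow> real \<Rightarrow> ('a \<Rightarrow> real) \<Rightarrow> 'a \<Rightarrow> real" where
  "diff_quot e t f x = (f (x + t *\<^sub>R e) - f (x - t *\<^sub>R e)) / (2 * t)"

lemma sqint_translate:
  fixes f :: "'a::euclidean_space \<Rightarrow> 'b::euclidean_space"
  assumes "sqint f"
  shows "sqint (\<lambda>x. f (x + y))" "sqn (\<lambda>x. f (x + y)) = sqn f"
  using sqint_affine[OF assms, of 1 y] by (simp_all add: add.commute)

lemma sqint_diff_quot:
  assumes f: "sqint f" and t: "t > 0"
  shows "sqint (diff_quot e t f)" "sqn (diff_quot e t f) \<le> sqn f / t\<^sup>2"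
proof -
  have d: "sqint (\<lambda>x. f (x + t *\<^sub>R e) - f (x - t *\<^sub>R e))" "sqn (\<lambda>x. f (x + t *\<^sub>R e) - f (x - t *\<^sub>R e)) \<le> 4 * sqn f"
    using sqint_diff[OF sqint_translate(1)[OF f, of "t *\<^sub>R e"] sqint_translate(1)[OF f, of "- (t *\<^sub>R e)"]]
      sqint_translate(2)[OF f, of "t *\<^sub>R e"] sqint_translate(2)[OF f, of "- (t *\<^sub>R e)"] by auto
  have eq: "diff_quot e t f = (\<lambda>x. (1 / (2 * t)) * (f (x + t *\<^sub>R e) - f (x - t *\<^sub>R e)))"
    by (auto simp: diff_quot_def)
  show "sqint (diff_quot e t f)" unfolding eq by (rule sqint_cmult[OF d(1)])
  have "sqn (diff_quot e t f) = (1 / (2 * t))\<^sup>2 * sqn (\<lambda>x. f (x + t *\<^sub>R e) - f (x - t *\<^sub>R e))"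
    unfolding eq by (rule sqn_cmult)
  also have "\<dots> \<le> (1 / (2 * t))\<^sup>2 * (4 * sqn f)" by (rule mult_left_mono[OF d(2)]) simp
  also have "\<dots> = sqn f / t\<^sup>2" using t by (simp add: power_mult_distrib power_divide)
  finally show "sqn (diff_quot e t f) \<le> sqn f / t\<^sup>2" .
qed

lemma diff_quot_diff: "diff_quot e t (\<lambda>x. f x - g x) = (\<lambda>x. diff_quot e t f x - diff_quot e t g x)"
  by (auto simp: diff_quot_def diff_divide_distrib)

lemma C1c_diff_quot_bound:
  fixes f :: "'a::euclidean_space \<Rightarrow> real"
  assumes f: "C1c U f" and e: "norm e = 1" and t: "t > 0"
  shows "sqn (diff_quot e t f) \<le> sqn (egrad f)"
proof -
  have d: "sqint (\<lambda>x. f (x + t *\<^sub>R e) - f (x - t *\<^sub>R e))"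
    using sqint_diff(1)[OF sqint_translate(1)[OF C1c_sqint[OF f], of "t *\<^sub>R e"] sqint_translate(1)[OF C1c_sqint[OF f], of "- (t *\<^sub>R e)"]] by simp
  have "(\<integral>\<^sup>+x. ennreal ((f (- (t *\<^sub>R e) + 1 *\<^sub>R x + ((2 * t) *\<^sub>R e + 0 *\<^sub>R x)) - f (- (t *\<^sub>R e) + 1 *\<^sub>R x))\<^sup>2) * indicator UNIV x \<partial>lborel)
     \<le> ennreal ((2 * t)\<^sup>2 * sqn (egrad f) / 1 ^ DIM('a))"
    by (rule C1c_displacement_sq[OF f]) (use t e in auto)
  note disp = this
  have eq1: "- (t *\<^sub>R e) + 1 *\<^sub>R x + ((2 * t) *\<^sub>R e + 0 *\<^sub>R x) = x + t *\<^sub>R e" "- (t *\<^sub>R e) + 1 *\<^sub>R x = x - t *\<^sub>R e" for x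
    by (auto simp: algebra_simps scaleR_left_distrib[symmetric])
  have "(\<integral>\<^sup>+x. ennreal ((f (x + t *\<^sub>R e) - f (x - t *\<^sub>R e))\<^sup>2) \<partial>lborel) \<le> ennreal ((2 * t)\<^sup>2 * sqn (egrad f))"
    using disp[unfolded eq1(1)] by (simp only: eq1(2) indicator_UNIV mult_1_right power_one div_by_1)
  then have "ennreal (sqn (\<lambda>x. f (x + t *\<^sub>R e) - f (x - t *\<^sub>R e))) \<le> ennreal ((2 * t)\<^sup>2 * sqn (egrad f))"
    using nn_integral_sq[OF d] by simp
  then have b: "sqn (\<lambda>x. f (x + t *\<^sub>R e) - f (x - t *\<^sub>R e)) \<le> (2 * t)\<^sup>2 * sqn (egrad f)" by simp
  have eq: "diff_quot e t f = (\<lambda>x. (1 / (2 * t)) * (f (x + t *\<^sub>R e) - f (x - t *\<^sub>R e)))"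
    by (auto simp: diff_quot_def)
  have "sqn (diff_quot e t f) = (1 / (2 * t))\<^sup>2 * sqn (\<lambda>x. f (x + t *\<^sub>R e) - f (x - t *\<^sub>R e))"
    unfolding eq by (rule sqn_cmult)
  also have "\<dots> \<le> (1 / (2 * t))\<^sup>2 * ((2 * t)\<^sup>2 * sqn (egrad f))" by (rule mult_left_mono[OF b]) simp
  also have "\<dots> = sqn (egrad f)" using t by (simp add: power_divide)
  finally show ?thesis .
qed

text \<open>The bound is independent of t. Moving to the limit in the approximating sequence is
  possible for fixed t, where the difference quotient is a bounded operator on L^2.\<close>

lemma H10_diff_quot_bound:
  assumes z: "H10 U z Z" and e: "norm e = 1" and t: "t > 0"
  shows "sqn (diff_quot e t z) \<le> sqn Z"
proof -
  obtain f where f: "\<And>k::nat. C1c U (f k)" "(\<lambda>k. sqn (\<lambda>x. f k x - z x)) \<longlonglongrightarrow> 0"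
    "(\<lambda>k. sqn (\<lambda>x. egrad (f k) x - Z x)) \<longlonglongrightarrow> 0" using H10_approx[OF z] by blast
  have lim: "(\<lambda>k. sqn (\<lambda>x. diff_quot e t (f k) x - diff_quot e t z x)) \<longlonglongrightarrow> 0"
  proof (rule tendsto_sandwich[of "\<lambda>k. 0"])
    show "eventually (\<lambda>k. sqn (\<lambda>x. diff_quot e t (f k) x - diff_quot e t z x) \<le> sqn (\<lambda>x. f k x - z x) / t\<^sup>2) sequentially"
      unfolding diff_quot_diff[symmetric]
      by (intro always_eventually allI sqint_diff_quot(2) t sqint_diff(1)[OF C1c_sqint[OF f(1)] H10D(1)[OF z]])
    show "(\<lambda>k. sqn (\<lambda>x. f k x - z x) / t\<^sup>2) \<longlonglongrightarrow> 0" using tendsto_divide[OF f(2) tendsto_const[of "t\<^sup>2"]] t by simp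
  qed auto
  have "(\<lambda>k. sqn (diff_quot e t (f k))) \<longlonglongrightarrow> sqn (diff_quot e t z)"
    by (rule tendsto_sqn[OF sqint_diff_quot(1)[OF H10D(1)[OF z] t] sqint_diff_quot(1)[OF C1c_sqint[OF f(1)] t] lim])
  moreover have "(\<lambda>k. sqn (egrad (f k))) \<longlonglongrightarrow> sqn Z" by (rule tendsto_sqn[OF H10D(2)[OF z] C1c_sqint_egrad[OF f(1)] f(3)])
  ultimately show ?thesis by (rule LIMSEQ_le) (use C1c_diff_quot_bound[OF f(1) e t] in auto)
qed

lemma C1c_diff_quot_tendsto:
  fixes f :: "'a::euclidean_space \<Rightarrow> real"
  assumes f: "C1c U f" and e: "norm e = 1" and t: "\<And>n. 0 < t n" "\<And>n. t n \<le> 1" "t \<longlonglongrightarrow> 0"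
  shows "(\<lambda>n. sqn (\<lambda>x. diff_quot e (t n) f x - egrad f x \<bullet> e)) \<longlonglongrightarrow> 0"
proof -
  note [measurable] = C1c_measurable[OF f]
  obtain K where K: "compact K" "\<And>x. x \<notin> K \<Longrightarrow> f x = 0" "\<And>x. x \<notin> K \<Longrightarrow> egrad f x = 0" using C1c_support[OF f] by metis
  obtain B where B: "B \<ge> 0" "\<And>x. norm (egrad f x) \<le> B" using C1c_bounded_egrad[OF f] by blast
  obtain r where r: "r > 0" "K \<subseteq> ball 0 r" using compact_imp_bounded[OF K(1)] bounded_subset_ballD by blast
  define d where "d n x = diff_quot e (t n) f x - egrad f x \<bullet> e" for n x
  have [measurable]: "d n \<in> borel_measurable borel" for n unfolding d_def diff_quot_def by measurable
  have "(\<lambda>n. \<integral>x. (norm (d n x))\<^sup>2 \<partial>lborel) \<longlonglongrightarrow> (\<integral>x. 0 \<partial>(lborel :: 'a measure))"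
  proof (rule integral_dominated_convergence[where w = "\<lambda>x. indicator (ball 0 (r + 1)) x * (2 * B)\<^sup>2"])
    show "integrable lborel (\<lambda>x::'a. indicator (ball 0 (r + 1)) x * (2 * B)\<^sup>2)"
      using emeasure_lborel_ball_finite[of "0::'a" "r + 1"] by (intro integrable_mult_left integrable_real_indicator) auto
    show "AE x in lborel. (\<lambda>n. (norm (d n x))\<^sup>2) \<longlonglongrightarrow> 0"
    proof (rule AE_I2)
      fix x
      have dv: "((\<lambda>s. f (x + s *\<^sub>R e)) has_real_derivative (egrad f x \<bullet> e)) (at 0)"
      proof -
        have "((\<lambda>s. x + s *\<^sub>R e) has_derivative (\<lambda>s. s *\<^sub>R e)) (at 0)" by (auto intro!: derivative_eq_intros)
        from has_derivative_compose[OF this, of f "\<lambda>h. egrad f x \<bullet> h"] C1c_derivative[OF f, of x]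
        have "((\<lambda>s. f (x + s *\<^sub>R e)) has_derivative (\<lambda>s. (egrad f x \<bullet> e) * s)) (at 0)" by (simp add: mult.commute)
        then show ?thesis by (simp add: has_field_derivative_def)
      qed
      have l: "((\<lambda>s. (f (x + s *\<^sub>R e) - f x) / s) \<longlongrightarrow> egrad f x \<bullet> e) (at 0)"
        using dv by (simp add: has_field_derivative_iff)
      have nz: "t n \<noteq> 0" "- t n \<noteq> 0" for n using t(1)[of n] by auto
      have "filterlim t (at 0) sequentially" using t(3) nz by (auto simp: filterlim_at)
      from filterlim_compose[OF l this] have l1: "(\<lambda>n. (f (x + t n *\<^sub>R e) - f x) / t n) \<longlonglongrightarrow> egrad f x \<bullet> e" .
      have "filterlim (\<lambda>n. - t n) (at 0) sequentially" using tendsto_minus[OF t(3)] nz by (auto simp: filterlim_at)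
      from filterlim_compose[OF l this] have l2: "(\<lambda>n. (f (x + (- t n) *\<^sub>R e) - f x) / (- t n)) \<longlonglongrightarrow> egrad f x \<bullet> e" .
      have eq: "d n x = (1 / 2) * ((f (x + t n *\<^sub>R e) - f x) / t n) + (1 / 2) * ((f (x + (- t n) *\<^sub>R e) - f x) / (- t n)) - egrad f x \<bullet> e" for n
        using nz(1)[of n] by (simp add: d_def diff_quot_def field_simps)
      have "(\<lambda>n. d n x) \<longlonglongrightarrow> (1 / 2) * (egrad f x \<bullet> e) + (1 / 2) * (egrad f x \<bullet> e) - egrad f x \<bullet> e"
        unfolding eq by (intro tendsto_diff tendsto_add tendsto_mult tendsto_const l1 l2)
      then have "(\<lambda>n. d n x) \<longlonglongrightarrow> 0" by simp
      then have "(\<lambda>n. (norm (d n x))\<^sup>2) \<longlonglongrightarrow> (norm (0::real))\<^sup>2" by (intro tendsto_power tendsto_norm)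
      then show "(\<lambda>n. (norm (d n x))\<^sup>2) \<longlonglongrightarrow> 0" by simp
    qed
    show "AE x in lborel. norm ((norm (d n x))\<^sup>2) \<le> indicator (ball 0 (r + 1)) x * (2 * B)\<^sup>2" for n
    proof (rule AE_I2)
      fix x
      show "norm ((norm (d n x))\<^sup>2) \<le> indicator (ball 0 (r + 1)) x * (2 * B)\<^sup>2"
      proof (cases "x \<in> ball 0 (r + 1)")
        case True
        have "\<bar>f (x + t n *\<^sub>R e) - f (x - t n *\<^sub>R e)\<bar> \<le> B * norm ((x + t n *\<^sub>R e) - (x - t n *\<^sub>R e))"
          by (rule C1c_Lipschitz[OF f B(2)])
        also have "(x + t n *\<^sub>R e) - (x - t n *\<^sub>R e) = (2 * t n) *\<^sub>R e"
        proof -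
          have "(x + y) - (x - y) = y + y" for y by simp
          then show ?thesis by (simp only: mult_2 scaleR_left_distrib)
        qed
        finally have "\<bar>diff_quot e (t n) f x\<bar> \<le> B" using t(1)[of n] e by (simp add: diff_quot_def field_simps)
        moreover have "\<bar>egrad f x \<bullet> e\<bar> \<le> B" using Cauchy_Schwarz_ineq2[of "egrad f x" e] B(2)[of x] e by simp
        ultimately have "\<bar>d n x\<bar> \<le> 2 * B" unfolding d_def by linarith
        then have "\<bar>d n x\<bar>\<^sup>2 \<le> (2 * B)\<^sup>2" by (rule power_mono) simp
        then show ?thesis using True by simp
      next
        case False
        have nt: "norm (t n *\<^sub>R e) \<le> 1" using t(1,2)[of n] e by simp
        have "norm x \<le> norm (x + t n *\<^sub>R e) + norm (t n *\<^sub>R e)" "norm x \<le> norm (x - t n *\<^sub>R e) + norm (t n *\<^sub>R e)"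
          using norm_triangle_ineq4[of "x + t n *\<^sub>R e" "t n *\<^sub>R e"] norm_triangle_ineq[of "x - t n *\<^sub>R e" "t n *\<^sub>R e"] by auto
        moreover have "norm x \<ge> r + 1" using False by simp
        ultimately have "r \<le> norm (x + t n *\<^sub>R e)" "r \<le> norm (x - t n *\<^sub>R e)" "r \<le> norm x" using nt by linarith+
        then have "x + t n *\<^sub>R e \<notin> K" "x - t n *\<^sub>R e \<notin> K" "x \<notin> K" using r(2) by (auto simp: subset_iff)
        then have "d n x = 0" using K(2,3) by (simp add: d_def diff_quot_def)
        then show ?thesis by simp
      qed
    qed
  qed measurable
  then show ?thesis unfolding sqn_def d_def by simp
qed

text \<open>By the uniform bound \<open>H10_diff_quot_bound\<close> for z minus an approximant, the
  approximant can be fixed before t is made small; for it the convergence is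
  \<open>C1c_diff_quot_tendsto\<close>.\<close>

lemma H10_diff_quot_tendsto:
  fixes z :: "'a::euclidean_space \<Rightarrow> real"
  assumes z: "H10 U z Z" and e: "norm e = 1" and t: "\<And>n. 0 < t n" "\<And>n. t n \<le> 1" "t \<longlonglongrightarrow> 0"
  shows "(\<lambda>n. sqn (\<lambda>x. diff_quot e (t n) z x - Z x \<bullet> e)) \<longlonglongrightarrow> 0"
proof (rule LIMSEQ_I)
  fix r :: real assume r: "r > 0"
  obtain f where f: "\<And>k::nat. C1c U (f k)" "(\<lambda>k. sqn (\<lambda>x. f k x - z x)) \<longlonglongrightarrow> 0"
    "(\<lambda>k. sqn (\<lambda>x. egrad (f k) x - Z x)) \<longlonglongrightarrow> 0" using H10_approx[OF z] by blast
  have "eventually (\<lambda>k. sqn (\<lambda>x. egrad (f k) x - Z x) < r / 16) sequentially"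
    using r by (intro order_tendstoD(2)[OF f(3)]) simp
  then obtain k where k: "sqn (\<lambda>x. egrad (f k) x - Z x) < r / 16" using eventually_happens by force
  have fz: "H10 U (\<lambda>x. z x - f k x) (\<lambda>x. Z x - egrad (f k) x)" by (rule H10_diff[OF z H10_C1c[OF f(1)]])
  have "eventually (\<lambda>n. sqn (\<lambda>x. diff_quot e (t n) (f k) x - egrad (f k) x \<bullet> e) < r / 16) sequentially"
    using r by (intro order_tendstoD(2)[OF C1c_diff_quot_tendsto[OF f(1) e t]]) simp
  then obtain M where M: "\<And>n. n \<ge> M \<Longrightarrow> sqn (\<lambda>x. diff_quot e (t n) (f k) x - egrad (f k) x \<bullet> e) < r / 16"
    by (auto simp: eventually_sequentially)
  show "\<exists>no. \<forall>n\<ge>no. norm (sqn (\<lambda>x. diff_quot e (t n) z x - Z x \<bullet> e) - 0) < r"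
  proof (intro exI[of _ M] allI impI)
    fix n assume n: "n \<ge> M"
    define A where "A = diff_quot e (t n) (\<lambda>x. z x - f k x)"
    define B where "B x = diff_quot e (t n) (f k) x - egrad (f k) x \<bullet> e" for x
    define C where "C x = (egrad (f k) x - Z x) \<bullet> e" for x
    have sA: "sqint A" "sqn A \<le> sqn (\<lambda>x. Z x - egrad (f k) x)"
      unfolding A_def using sqint_diff_quot(1)[OF H10D(1)[OF fz] t(1)] H10_diff_quot_bound[OF fz e t(1)] by auto
    have sB: "sqint B"
      unfolding B_def by (rule sqint_diff(1)[OF sqint_diff_quot(1)[OF C1c_sqint[OF f(1)] t(1)] sqint_inner_const(1)[OF C1c_sqint_egrad[OF f(1)]]])
    have sC: "sqint C" "sqn C \<le> sqn (\<lambda>x. egrad (f k) x - Z x)"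
      unfolding C_def using sqint_inner_const[OF sqint_diff(1)[OF C1c_sqint_egrad[OF f(1)] H10D(2)[OF z]], of k e] e by auto
    have eq: "diff_quot e (t n) z x - Z x \<bullet> e = A x + (B x + C x)" for x
      unfolding A_def B_def C_def diff_quot_diff by (simp add: inner_diff_left)
    have "sqn (\<lambda>x. diff_quot e (t n) z x - Z x \<bullet> e) \<le> 2 * sqn A + 2 * sqn (\<lambda>x. B x + C x)"
      unfolding eq by (rule sqint_add(2)[OF sA(1) sqint_add(1)[OF sB sC(1)]])
    also have "\<dots> \<le> 2 * sqn A + 2 * (2 * sqn B + 2 * sqn C)" using sqint_add(2)[OF sB sC(1)] by simp
    also have "\<dots> < r"
    proof -
      have "sqn B < r / 16" using M[OF n] by (simp add: B_def[abs_def])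
      moreover have "sqn A \<le> sqn (\<lambda>x. egrad (f k) x - Z x)" using sA(2) by (simp only: sqn_commute[of Z "egrad (f k)"])
      ultimately show ?thesis using sC(2) k r by argo
    qed
    finally show "norm (sqn (\<lambda>x. diff_quot e (t n) z x - Z x \<bullet> e) - 0) < r" by simp
  qed
qed

text \<open>Translation by -y carries one integral into the other. It makes the symmetric difference
  quotient skew-adjoint, so that a function paired with its own quotient integrates to zero: the
  discrete form of the vanishing integral of w times its derivative along e.\<close>

lemma integral_translate_inner:
  fixes f :: "'a::euclidean_space \<Rightarrow> 'b::euclidean_space"
  assumes "sqint f"
  shows "(\<integral>x. f x \<bullet> f (x + y) \<partial>lborel) = (\<integral>x. f x \<bullet> f (x - y) \<partial>lborel)"
proof -
  have i: "integrable lborel (\<lambda>x. f x \<bullet> f (x + y))" by (rule sqint_inner[OF assms sqint_translate(1)[OF assms]])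
  from integral_affine[OF i, of 1 "- y"] show ?thesis by (simp add: inner_commute)
qed

text \<open>For w = exp(\<tau> x \<bullet> e) v the equation becomes -\<Delta>w + 2 \<tau>
  \<partial>w - \<tau>^2 w = h, where \<partial> is the derivative along e and h is the weighted
  nonlinearity. Multiplying by \<partial>w kills the two symmetric terms, so 4 \<tau>^2
  \<parallel>\<partial>w\<parallel>^2 is at most X = \<parallel>h\<parallel>^2. The Poincare
  inequality gives \<tau>^2 \<parallel>w\<parallel>^2 \<le> X, and multiplying by w bounds the
  Dirichlet norm squared by 2 X. Since h^2 = Q w^2, absorption of the potential Q for large \<tau>
  gives X \<le> X / 2.\<close>

lemma conf_sol_zero_mass:
  fixes v :: "'a::euclidean_space \<Rightarrow> real"
  assumes N: "DIM('a) \<ge> 3" and sol: "conf_sol 0 v F"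
  shows "AE x in lborel. v x = 0"
proof -
  define p where "p = crit_exp DIM('a)"
  have p2: "p > 2" using N by (simp add: p_def crit_exp_def field_simps)
  have vF: "H10 (ball 0 1) v F" and out: "\<And>x. x \<notin> ball 0 1 \<Longrightarrow> v x = 0" "\<And>x. x \<notin> ball 0 1 \<Longrightarrow> F x = 0"
    using sol unfolding conf_sol_def by auto
  have [measurable]: "v \<in> borel_measurable borel" "F \<in> borel_measurable borel" using H10D[OF vF] by auto
  obtain S where S: "S > 0" "\<And>U (z :: 'a \<Rightarrow> real) Z. H10 U z Z \<Longrightarrow> Lpint p z"
    "\<And>U (z :: 'a \<Rightarrow> real) Z. H10 U z Z \<Longrightarrow> Lpn p z powr (2 / p) \<le> S * sqn Z"
    unfolding p_def by (rule H10_Sobolev[where 'a='a, OF N]) blast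
  obtain e :: 'a where "e \<in> Basis" using nonempty_Basis by blast
  then have e: "norm e = 1" and ee: "e \<bullet> e = 1" by (simp_all add: inner_same_Basis)
  have hi: "integrable lborel (\<lambda>x. \<bar>v x\<bar> powr r)" if "r \<ge> 2" for r
  proof (rule Bochner_Integration.integrable_bound[OF conf_sol_higher_integrability[OF N sol, of "(r - 2) / 2"]])
    show "AE x in lborel. norm (\<bar>v x\<bar> powr r) \<le> norm ((v x)\<^sup>2 * (1 + (v x)\<^sup>2) powr ((r - 2) / 2))"
    proof (rule AE_I2)
      fix x
      show "norm (\<bar>v x\<bar> powr r) \<le> norm ((v x)\<^sup>2 * (1 + (v x)\<^sup>2) powr ((r - 2) / 2))"
      proof (cases "v x = 0")
        case False
        have sq: "\<bar>v x\<bar> powr 2 = (v x)\<^sup>2" using False by (simp add: powr_numeral)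
        have "\<bar>v x\<bar> powr r = \<bar>v x\<bar> powr 2 * \<bar>v x\<bar> powr (2 * ((r - 2) / 2))"
        proof -
          have "2 + 2 * ((r - 2) / 2) = r" by (simp add: field_simps)
          then show ?thesis by (simp only: powr_add[symmetric])
        qed
        also have "\<dots> = (v x)\<^sup>2 * ((v x)\<^sup>2) powr ((r - 2) / 2)" unfolding powr_powr[symmetric] sq ..
        also have "\<dots> \<le> (v x)\<^sup>2 * (1 + (v x)\<^sup>2) powr ((r - 2) / 2)"
          using that by (intro mult_left_mono powr_mono2) auto
        finally show ?thesis by simp
      qed simp
    qed
  qed measurable
  define \<phi> where "\<phi> x = crit_nl p (v x)" for x
  have [measurable]: "\<phi> \<in> borel_measurable borel" unfolding \<phi>_def by measurable
  have \<phi>s: "sqint \<phi>"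
  proof -
    have "(norm (\<phi> x))\<^sup>2 = \<bar>v x\<bar> powr (2 * (p - 1))" for x
    proof -
      have "(norm (\<phi> x))\<^sup>2 = (\<bar>v x\<bar> powr (p - 1))\<^sup>2" by (simp add: \<phi>_def abs_crit_nl[OF p2])
      then show ?thesis by (simp only: power2_eq_square powr_add[symmetric] mult_2)
    qed
    then show ?thesis unfolding sqint_def using hi[of "2 * (p - 1)"] p2 by simp
  qed
  \<comment> \<open>As \<phi> is square-integrable, L^2 convergence of the test functions suffices.
    \<open>U\<close> is arbitrary thanks to \<open>conf_sol_extension\<close>, which admits
    translates that leave the unit ball.\<close>
  have eq: "(\<integral>x. F x \<bullet> Z x \<partial>lborel) = (\<integral>x. \<phi> x * z x \<partial>lborel)" if z: "H10 U z Z" for U z Z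
  proof -
    obtain f where f: "\<And>k::nat. C1c U (f k)" "(\<lambda>k. sqn (\<lambda>x. f k x - z x)) \<longlonglongrightarrow> 0"
      "(\<lambda>k. sqn (\<lambda>x. egrad (f k) x - Z x)) \<longlonglongrightarrow> 0" using H10_approx[OF z] by blast
    have c0: "(\<lambda>k. sqn (\<lambda>x. F x - F x)) \<longlonglongrightarrow> 0" "(\<lambda>k. sqn (\<lambda>x. \<phi> x - \<phi> x)) \<longlonglongrightarrow> 0" by (simp_all add: sqn_def)
    have "(\<lambda>k. \<integral>x. F x \<bullet> egrad (f k) x \<partial>lborel) \<longlonglongrightarrow> (\<integral>x. F x \<bullet> Z x \<partial>lborel)"
      by (rule tendsto_integral_inner[OF H10D(2)[OF vF] H10D(2)[OF z] H10D(2)[OF vF] C1c_sqint_egrad[OF f(1)] c0(1) f(3)])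
    moreover have "(\<lambda>k. \<integral>x. \<phi> x \<bullet> f k x \<partial>lborel) \<longlonglongrightarrow> (\<integral>x. \<phi> x \<bullet> z x \<partial>lborel)"
      by (rule tendsto_integral_inner[OF \<phi>s H10D(1)[OF z] \<phi>s C1c_sqint[OF f(1)] c0(2) f(2)])
    moreover have "(\<integral>x. F x \<bullet> egrad (f k) x \<partial>lborel) = (\<integral>x. \<phi> x \<bullet> f k x \<partial>lborel)" for k
      using conf_sol_extension[OF N sol C1c_mono[OF f(1) subset_UNIV]] by (simp add: \<phi>_def p_def)
    ultimately show ?thesis using LIMSEQ_unique by fastforce
  qed
  \<comment> \<open>The square of the potential |v|^(p - 2). Its power N / 2 is |v|^(2 p), so
    integrability beyond the critical exponent is essential here.\<close>
  define Q where "Q x = \<bar>v x\<bar> powr (2 * (p - 2))" for x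
  have [measurable]: "Q \<in> borel_measurable borel" unfolding Q_def by measurable
  have Qi: "integrable lborel (\<lambda>x. Q x powr (real DIM('a) / 2))"
  proof -
    have "2 * (p - 2) * (real DIM('a) / 2) = 2 * p" using N by (simp add: p_def crit_exp_def field_simps)
    then show ?thesis using hi[of "2 * p"] p2 by (simp add: Q_def powr_powr)
  qed
  \<comment> \<open>With the Dirichlet norm squared at most 2 X, the critical part of the absorption
    costs X / 4.\<close>
  define \<eta> where "\<eta> = 1 / (8 * S)"
  have \<eta>: "\<eta> > 0" using S(1) by (simp add: \<eta>_def)
  obtain K where K: "K \<ge> 0" "\<And>z. sqint z \<Longrightarrow> Lpint p z \<Longrightarrow> (\<integral>x. Q x * (z x)\<^sup>2 \<partial>lborel) \<le> K * sqn z + \<eta> * Lpn p z powr (2 / p)"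
    unfolding p_def by (rule potential_absorption[OF N _ _ Qi \<eta>]) (auto simp: Q_def)
  \<comment> \<open>K depends on v only, so \<tau> may be chosen after it. Then 4 K \<le> \<tau>^2
    makes the other part of the absorption cost X / 4 as well, and \<tau> \<ge> 1 serves the energy
    bound.\<close>
  define \<tau> where "\<tau> = 1 + 2 * sqrt K"
  have \<tau>1: "\<tau> \<ge> 1" using K(1) by (simp add: \<tau>_def)
  then have \<tau>: "\<tau> > 0" by simp
  have \<tau>K: "4 * K \<le> \<tau>\<^sup>2"
  proof -
    have "(2 * sqrt K)\<^sup>2 \<le> \<tau>\<^sup>2" unfolding \<tau>_def using K(1) by (intro power_mono) auto
    then show ?thesis using K(1) by (simp add: power_mult_distrib)
  qed
  define E where "E x = exp (\<tau> * (x \<bullet> e))" for x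
  have [measurable]: "E \<in> borel_measurable borel" unfolding E_def by measurable
  define w where "w x = E x * v x" for x
  define W where "W x = E x *\<^sub>R (F x + (\<tau> * v x) *\<^sub>R e)" for x
  define h where "h x = E x * \<phi> x" for x
  have wW: "H10 (ball 0 1) w W"
    unfolding w_def W_def E_def by (rule H10_exp_weight[OF vF out e \<tau>])
  have wout: "w x = 0" "W x = 0" if "x \<notin> ball 0 1" for x using out[OF that] by (simp_all add: w_def W_def)
  note ws = H10D(1)[OF wW] and Ws = H10D(2)[OF wW]
  have [measurable]: "w \<in> borel_measurable borel" "W \<in> borel_measurable borel" using ws Ws by auto
  have hs: "sqint h"
  proof (rule sqint_bound(1)[OF \<phi>s, of _ "exp \<tau>"])
    show "norm (h x) \<le> exp \<tau> * norm (\<phi> x)" for x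
    proof (cases "x \<in> ball 0 1")
      case True
      have "x \<bullet> e \<le> norm x * norm e" by (rule norm_cauchy_schwarz)
      then have "x \<bullet> e \<le> 1" using True e by simp
      then have "\<tau> * (x \<bullet> e) \<le> \<tau> * 1" using \<tau> by (intro mult_left_mono) auto
      then have "E x \<le> exp \<tau>" by (simp add: E_def)
      then show ?thesis by (simp add: h_def abs_mult mult_right_mono E_def)
    qed (simp add: h_def \<phi>_def crit_nl_def out)
  qed (unfold h_def, measurable)
  \<comment> \<open>The weak form of the conjugated equation: the original one tested with the
    weight times g, after one integration by parts of the first-order term. Radius 2 leaves room for
    translates of w.\<close>
  have star: "(\<integral>x. W x \<bullet> G x \<partial>lborel) + 2 * \<tau> * (\<integral>x. (W x \<bullet> e) * g x \<partial>lborel) - \<tau>\<^sup>2 * (\<integral>x. w x * g x \<partial>lborel)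
      = (\<integral>x. h x * g x \<partial>lborel)"
    if g: "H10 (ball 0 2) g G" and go: "\<And>x. x \<notin> ball 0 2 \<Longrightarrow> g x = 0" "\<And>x. x \<notin> ball 0 2 \<Longrightarrow> G x = 0" for g G
  proof -
    note gs = H10D(1)[OF g] and Gs = H10D(2)[OF g]
    have gE: "H10 (ball 0 2) (\<lambda>x. E x * g x) (\<lambda>x. E x *\<^sub>R (G x + (\<tau> * g x) *\<^sub>R e))"
      unfolding E_def by (rule H10_exp_weight[OF g go e \<tau>])
    have i1: "integrable lborel (\<lambda>x. W x \<bullet> G x)" by (rule sqint_inner[OF Ws Gs])
    have i2: "integrable lborel (\<lambda>x. (W x \<bullet> e) * g x)" by (rule sqint_mult[OF sqint_inner_const(1)[OF Ws] gs])
    have i3: "integrable lborel (\<lambda>x. w x * (G x \<bullet> e))" by (rule sqint_mult[OF ws sqint_inner_const(1)[OF Gs]])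
    have i4: "integrable lborel (\<lambda>x. w x * g x)" by (rule sqint_mult[OF ws gs])
    have pt: "F x \<bullet> (E x *\<^sub>R (G x + (\<tau> * g x) *\<^sub>R e))
        = W x \<bullet> G x + \<tau> * ((W x \<bullet> e) * g x) - \<tau> * (w x * (G x \<bullet> e)) - \<tau>\<^sup>2 * (w x * g x)" for x
    proof -
      have "E x *\<^sub>R F x = W x - (\<tau> * w x) *\<^sub>R e" by (simp add: W_def w_def algebra_simps)
      then have "F x \<bullet> (E x *\<^sub>R (G x + (\<tau> * g x) *\<^sub>R e)) = (W x - (\<tau> * w x) *\<^sub>R e) \<bullet> (G x + (\<tau> * g x) *\<^sub>R e)"
        by (metis inner_scaleR_left inner_scaleR_right)
      then show ?thesis
        by (simp add: inner_diff_left inner_add_right ee inner_commute[of e "G x"] power2_eq_square algebra_simps)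
    qed
    have "(\<integral>x. h x * g x \<partial>lborel) = (\<integral>x. F x \<bullet> (E x *\<^sub>R (G x + (\<tau> * g x) *\<^sub>R e)) \<partial>lborel)"
      using eq[OF gE] by (simp add: h_def mult_ac)
    also have "\<dots> = (\<integral>x. W x \<bullet> G x \<partial>lborel) + \<tau> * (\<integral>x. (W x \<bullet> e) * g x \<partial>lborel)
        - \<tau> * (\<integral>x. w x * (G x \<bullet> e) \<partial>lborel) - \<tau>\<^sup>2 * (\<integral>x. w x * g x \<partial>lborel)"
      unfolding pt
      by (simp only: Bochner_Integration.integral_add Bochner_Integration.integral_diff Bochner_Integration.integrable_diff
          Bochner_Integration.integrable_add integrable_mult_right i1 i2 i3 i4 integral_mult_right_zero)
    also have "(\<integral>x. w x * (G x \<bullet> e) \<partial>lborel) = - (\<integral>x. (W x \<bullet> e) * g x \<partial>lborel)"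
      by (rule H10_by_parts[OF wW g open_ball])
    finally show ?thesis by (simp add: algebra_simps)
  qed
  define X where "X = sqn h"
  have X0: "X \<ge> 0" by (simp add: X_def)
  have energy: "sqn W = \<tau>\<^sup>2 * sqn w + (\<integral>x. h x * w x \<partial>lborel)"
  proof -
    have w2: "H10 (ball 0 2) w W" by (rule H10_mono[OF wW]) auto
    have "(\<integral>x. w x * (W x \<bullet> e) \<partial>lborel) = - (\<integral>x. (W x \<bullet> e) * w x \<partial>lborel)"
      by (rule H10_by_parts[OF wW wW open_ball])
    then have z: "(\<integral>x. (W x \<bullet> e) * w x \<partial>lborel) = 0" by (simp add: mult.commute)
    have "(\<integral>x. W x \<bullet> W x \<partial>lborel) + 2 * \<tau> * (\<integral>x. (W x \<bullet> e) * w x \<partial>lborel) - \<tau>\<^sup>2 * (\<integral>x. w x * w x \<partial>lborel)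
      = (\<integral>x. h x * w x \<partial>lborel)"
      by (rule star[OF w2]) (use wout in auto)
    then show ?thesis unfolding z by (simp add: sqn_inner)
  qed
  have We: "sqint (\<lambda>x. W x \<bullet> e)" by (rule sqint_inner_const(1)[OF Ws])
  \<comment> \<open>The derivative of w along e need not be an admissible test function, so its
    symmetric difference quotients are used. Constant coefficients make the second-order and
    zeroth-order terms vanish exactly for every step size.\<close>
  have mult: "2 * \<tau> * sqn (\<lambda>x. W x \<bullet> e) = (\<integral>x. h x * (W x \<bullet> e) \<partial>lborel)"
  proof -
    \<comment> \<open>Starting at 1 / 2 keeps all steps strictly below one, so that the translated
      supports stay in the ball of radius 2.\<close>
    define t where "t n = 1 / real (Suc (Suc n))" for n
    have t: "0 < t n" "t n < 1" for n by (auto simp: t_def)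
    have t1: "t n \<le> 1" for n using t(2)[of n] by simp
    have t0: "t \<longlonglongrightarrow> 0" unfolding t_def[abs_def] using LIMSEQ_Suc[OF LIMSEQ_Suc[OF lim_1_over_n]] by simp
    note lim = H10_diff_quot_tendsto[OF wW e t(1) t1 t0]
    have ds: "sqint (diff_quot e (t n) w)" for n by (rule sqint_diff_quot(1)[OF ws t(1)])
    have c0: "(\<lambda>k. sqn (\<lambda>x. W x \<bullet> e - W x \<bullet> e)) \<longlonglongrightarrow> 0" "(\<lambda>k. sqn (\<lambda>x. h x - h x)) \<longlonglongrightarrow> 0" by (simp_all add: sqn_def)
    have l1: "(\<lambda>n. \<integral>x. (W x \<bullet> e) \<bullet> diff_quot e (t n) w x \<partial>lborel) \<longlonglongrightarrow> (\<integral>x. (W x \<bullet> e) \<bullet> (W x \<bullet> e) \<partial>lborel)"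
      by (rule tendsto_integral_inner[OF We We We ds c0(1) lim])
    have l2: "(\<lambda>n. \<integral>x. h x \<bullet> diff_quot e (t n) w x \<partial>lborel) \<longlonglongrightarrow> (\<integral>x. h x \<bullet> (W x \<bullet> e) \<partial>lborel)"
      by (rule tendsto_integral_inner[OF hs We hs ds c0(2) lim])
    have "2 * \<tau> * (\<integral>x. (W x \<bullet> e) \<bullet> diff_quot e (t n) w x \<partial>lborel) = (\<integral>x. h x \<bullet> diff_quot e (t n) w x \<partial>lborel)" for n
    proof -
      let ?y = "t n *\<^sub>R e"
      have ny: "norm ?y < 1" using t[of n] e by simp
      have tr: "H10 (ball 0 2) (\<lambda>x. w (x + y)) (\<lambda>x. W (x + y))" if "norm y < 1" for y
      proof -
        have "H10 (ball 0 2) (\<lambda>x. w (y + 1 *\<^sub>R x)) (\<lambda>x. 1 *\<^sub>R W (y + 1 *\<^sub>R x))"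
        proof (rule H10_affine[OF wW])
          fix x :: 'a assume "x \<in> ball 0 1"
          then show "(1 / 1) *\<^sub>R (x - y) \<in> ball 0 2" using norm_triangle_ineq4[of x y] that by simp
        qed simp
        then show ?thesis by (simp add: add.commute)
      qed
      have to: "w (x + y) = 0" "W (x + y) = 0" if "norm y < 1" "x \<notin> ball 0 2" for x y
      proof -
        have "norm x \<le> norm (x + y) + norm y" using norm_triangle_ineq4[of "x + y" y] by simp
        then have "x + y \<notin> ball 0 1" using that by simp
        then show "w (x + y) = 0" "W (x + y) = 0" using wout by blast+
      qed
      define g where "g x = (1 / (2 * t n)) * w (x + ?y) + (- (1 / (2 * t n))) * w (x + (- ?y))" for x
      define G where "G x = (1 / (2 * t n)) *\<^sub>R W (x + ?y) + (- (1 / (2 * t n))) *\<^sub>R W (x + (- ?y))" for x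
      have g: "H10 (ball 0 2) g G"
        unfolding g_def G_def by (rule H10_lincomb[OF tr tr]) (use ny in auto)
      have gd: "g x = diff_quot e (t n) w x" for x
        by (simp add: g_def diff_quot_def diff_divide_distrib)
      have go: "g x = 0" "G x = 0" if "x \<notin> ball 0 2" for x
        using to[OF _ that, of ?y] to[OF _ that, of "- ?y"] ny by (simp_all add: g_def G_def)
      have s1: "sqint (\<lambda>x. w (x + ?y))" "sqint (\<lambda>x. w (x - ?y))" "sqint (\<lambda>x. W (x + ?y))" "sqint (\<lambda>x. W (x - ?y))"
        using sqint_translate(1)[OF ws, of ?y] sqint_translate(1)[OF ws, of "- ?y"]
          sqint_translate(1)[OF Ws, of ?y] sqint_translate(1)[OF Ws, of "- ?y"] by simp_all
      have z1: "(\<integral>x. W x \<bullet> G x \<partial>lborel) = 0"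
      proof -
        have "(\<integral>x. W x \<bullet> G x \<partial>lborel) = (\<integral>x. (1 / (2 * t n)) * (W x \<bullet> W (x + ?y)) - (1 / (2 * t n)) * (W x \<bullet> W (x - ?y)) \<partial>lborel)"
          by (simp add: G_def inner_diff_right)
        also have "\<dots> = (1 / (2 * t n)) * (\<integral>x. W x \<bullet> W (x + ?y) \<partial>lborel) - (1 / (2 * t n)) * (\<integral>x. W x \<bullet> W (x - ?y) \<partial>lborel)"
          by (simp only: Bochner_Integration.integral_diff integrable_mult_right sqint_inner[OF Ws s1(3)] sqint_inner[OF Ws s1(4)] integral_mult_right_zero)
        finally show ?thesis using integral_translate_inner[OF Ws, of ?y] by simp
      qed
      have z2: "(\<integral>x. w x * g x \<partial>lborel) = 0"
      proof -
        have "(\<integral>x. w x * g x \<partial>lborel) = (\<integral>x. (1 / (2 * t n)) * (w x \<bullet> w (x + ?y)) - (1 / (2 * t n)) * (w x \<bullet> w (x - ?y)) \<partial>lborel)"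
          by (rule Bochner_Integration.integral_cong) (auto simp: g_def right_diff_distrib)
        also have "\<dots> = (1 / (2 * t n)) * (\<integral>x. w x \<bullet> w (x + ?y) \<partial>lborel) - (1 / (2 * t n)) * (\<integral>x. w x \<bullet> w (x - ?y) \<partial>lborel)"
          by (simp only: Bochner_Integration.integral_diff integrable_mult_right sqint_inner[OF ws s1(1)] sqint_inner[OF ws s1(2)] integral_mult_right_zero)
        finally show ?thesis using integral_translate_inner[OF ws, of ?y] by simp
      qed
      have "2 * \<tau> * (\<integral>x. (W x \<bullet> e) * g x \<partial>lborel) = (\<integral>x. h x * g x \<partial>lborel)"
        using star[OF g go] unfolding z1 z2 by simp
      then show ?thesis unfolding gd by simp
    qed
    then have "(\<lambda>n. \<integral>x. h x \<bullet> diff_quot e (t n) w x \<partial>lborel) \<longlonglongrightarrow> 2 * \<tau> * (\<integral>x. (W x \<bullet> e) \<bullet> (W x \<bullet> e) \<partial>lborel)"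
      using tendsto_mult[OF tendsto_const[of "2 * \<tau>"] l1] by simp
    from LIMSEQ_unique[OF this l2] show ?thesis by (simp add: sqn_inner)
  qed
  have Wb: "4 * \<tau>\<^sup>2 * sqn (\<lambda>x. W x \<bullet> e) \<le> X"
  proof (cases "sqn (\<lambda>x. W x \<bullet> e) = 0")
    case False
    define Y where "Y = sqn (\<lambda>x. W x \<bullet> e)"
    have Y: "Y > 0" using False sqn_nonneg[of "\<lambda>x. W x \<bullet> e"] by (simp add: Y_def less_le)
    have "(2 * \<tau> * Y)\<^sup>2 \<le> X * Y"
      unfolding Y_def mult X_def using integral_inner_sq_le[OF hs We] by simp
    then have "Y * (4 * \<tau>\<^sup>2 * Y) \<le> Y * X" by (simp add: power2_eq_square mult_ac)
    then show ?thesis using Y unfolding Y_def by (rule mult_left_le_imp_le)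
  qed (simp add: X0)
  have wb: "\<tau>\<^sup>2 * sqn w \<le> X"
  proof -
    have "\<tau>\<^sup>2 * sqn w \<le> \<tau>\<^sup>2 * (4 * sqn (\<lambda>x. W x \<bullet> e))" by (intro mult_left_mono H10_Poincare[OF wW e]) simp
    then show ?thesis using Wb by linarith
  qed
  have WX: "sqn W \<le> 2 * X"
  proof -
    have "(\<integral>x. h x * w x \<partial>lborel) \<le> sqrt X * sqrt (sqn w)"
      using integral_inner_le[OF hs ws] by (simp add: X_def)
    also have "\<dots> \<le> sqrt X * sqrt X"
    proof (intro mult_left_mono real_sqrt_le_mono)
      have "1 * sqn w \<le> \<tau>\<^sup>2 * sqn w" using \<tau>1 by (intro mult_right_mono) (auto simp: one_le_power)
      then show "sqn w \<le> X" using wb by linarith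
    qed (use X0 in simp)
    also have "\<dots> = X" using X0 by simp
    finally show ?thesis using energy wb by linarith
  qed
  have "X = (\<integral>x. Q x * (w x)\<^sup>2 \<partial>lborel)"
    unfolding X_def sqn_def
  proof (rule Bochner_Integration.integral_cong)
    fix x
    have "Q x = (\<bar>v x\<bar> powr (p - 2))\<^sup>2" unfolding Q_def by (simp only: power2_eq_square powr_add[symmetric] mult_2)
    then show "(norm (h x))\<^sup>2 = Q x * (w x)\<^sup>2"
      by (simp add: h_def w_def \<phi>_def crit_nl_def power_mult_distrib mult_ac)
  qed simp
  also have "\<dots> \<le> K * sqn w + \<eta> * Lpn p w powr (2 / p)" by (rule K(2)[OF ws S(2)[OF wW]])
  also have "\<dots> \<le> X / 4 + \<eta> * (S * (2 * X))"
  proof (rule add_mono)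
    have "4 * K * sqn w \<le> \<tau>\<^sup>2 * sqn w" by (rule mult_right_mono[OF \<tau>K]) simp
    then show "K * sqn w \<le> X / 4" using wb by simp
    have "S * sqn W \<le> S * (2 * X)" using WX S(1) by (intro mult_left_mono) auto
    then show "\<eta> * Lpn p w powr (2 / p) \<le> \<eta> * (S * (2 * X))"
      using S(3)[OF wW] \<eta> by (intro mult_left_mono) auto
  qed
  also have "\<dots> = X / 2" unfolding \<eta>_def using S(1) by simp
  finally have "X = 0" using X0 by simp
  then have "\<tau>\<^sup>2 * sqn w \<le> 0" using wb by simp
  then have "sqn w = 0" using \<tau> sqn_nonneg[of w] by (simp add: mult_le_0_iff)
  then have "AE x in lborel. w x = 0" by (rule sqn_eq_0_AE[OF ws])
  then show ?thesis by eventually_elim (simp add: w_def E_def)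
qed

subsection \<open>From hyperbolic space to the Euclidean ball\<close>

lemma hyp_vol_weight: "x \<in> ball 0 1 \<Longrightarrow> (2 / (1 - (norm x)\<^sup>2)) ^ DIM('a) = conf (x::'a::euclidean_space) powr (- real DIM('a))"
proof -
  assume x: "x \<in> ball 0 1"
  have "(2 / (1 - (norm x)\<^sup>2)) ^ DIM('a) = (1 / conf x) ^ DIM('a)" by (simp add: conf_def)
  also have "\<dots> = conf x powr (- real DIM('a))"
    using conf_pos[OF x] by (simp add: powr_minus_divide powr_realpow power_one_over)
  finally show ?thesis .
qed

lemma AE_hyp_vol:
  fixes P :: "'a::euclidean_space \<Rightarrow> bool"
  assumes "AE x in lborel. x \<in> ball 0 1 \<longrightarrow> P x"
  shows "AE x in hyp_vol. P x"
proof -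
  have "AE x in lebesgue. x \<in> ball 0 1 \<longrightarrow> P x" using assms by (rule AE_completion)
  then have "AE x in restrict_space lebesgue (ball 0 1). P x" by (subst AE_restrict_space_iff) auto
  then have "AE x in restrict_space lebesgue (ball 0 1). 0 < ennreal ((2 / (1 - (norm x)\<^sup>2)) ^ DIM('a)) \<longrightarrow> P x"
    by eventually_elim simp
  moreover have m: "(\<lambda>x::'a. ennreal ((2 / (1 - (norm x)\<^sup>2)) ^ DIM('a))) \<in> borel_measurable (restrict_space lebesgue (ball 0 1))"
    by (intro measurable_restrict_space1 measurable_completion) measurable
  ultimately show ?thesis unfolding hyp_vol_def by (subst AE_density[OF m])
qed

lemma measurable_hyp_vol: "f \<in> borel_measurable lebesgue \<Longrightarrow> f \<in> borel_measurable hyp_vol"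
  unfolding hyp_vol_def by (simp add: measurable_restrict_space1)

lemma hyp_vol_nn_integral:
  fixes f g :: "'a::euclidean_space \<Rightarrow> ennreal"
  assumes g [measurable]: "g \<in> borel_measurable borel" and eq: "AE x in lborel. f x = g x"
  shows "(\<integral>\<^sup>+x. f x \<partial>hyp_vol) = (\<integral>\<^sup>+x. ennreal (conf x powr (- real DIM('a))) * g x * indicator (ball 0 1) x \<partial>lborel)"
proof -
  let ?\<rho> = "\<lambda>x::'a. ennreal ((2 / (1 - (norm x)\<^sup>2)) ^ DIM('a))"
  have "?\<rho> \<in> borel_measurable borel" by measurable
  then have m: "?\<rho> \<in> borel_measurable (restrict_space lebesgue (ball 0 1))"
    by (intro measurable_restrict_space1 measurable_completion) simp
  have gm: "g \<in> borel_measurable (restrict_space lebesgue (ball 0 1))"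
    by (intro measurable_restrict_space1 measurable_completion) simp
  have "AE x in lborel. x \<in> ball 0 1 \<longrightarrow> f x = g x" using eq by eventually_elim simp
  then have "AE x in hyp_vol. f x = g x" by (rule AE_hyp_vol)
  then have "(\<integral>\<^sup>+x. f x \<partial>hyp_vol) = (\<integral>\<^sup>+x. g x \<partial>hyp_vol)" by (rule nn_integral_cong_AE)
  also have "\<dots> = (\<integral>\<^sup>+x. ?\<rho> x * g x \<partial>restrict_space lebesgue (ball 0 1))"
    unfolding hyp_vol_def by (rule nn_integral_density[OF m gm])
  also have "\<dots> = (\<integral>\<^sup>+x. ?\<rho> x * g x * indicator (ball 0 1) x \<partial>lebesgue)"
    by (rule nn_integral_restrict_space) simp
  also have "\<dots> = (\<integral>\<^sup>+x. ?\<rho> x * g x * indicator (ball 0 1) x \<partial>lborel)" by (rule nn_integral_completion)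
  also have "\<dots> = (\<integral>\<^sup>+x. ennreal (conf x powr (- real DIM('a))) * g x * indicator (ball 0 1) x \<partial>lborel)"
    by (intro nn_integral_cong) (auto simp: hyp_vol_weight indicator_def)
  finally show ?thesis .
qed

lemma hyp_vol_integral:
  fixes f g :: "'a::euclidean_space \<Rightarrow> real"
  assumes f: "f \<in> borel_measurable lebesgue" and g [measurable]: "g \<in> borel_measurable borel"
    and eq: "AE x in lborel. f x = g x"
  shows "(\<integral>x. f x \<partial>hyp_vol) = (\<integral>x. indicator (ball 0 1) x * (conf x powr (- real DIM('a)) * g x) \<partial>lborel)"
proof -
  let ?\<rho> = "\<lambda>x::'a. (2 / (1 - (norm x)\<^sup>2)) ^ DIM('a)"
  have \<rho>m: "?\<rho> \<in> borel_measurable borel" by measurable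
  then have m: "?\<rho> \<in> borel_measurable (restrict_space lebesgue (ball 0 1))"
    by (intro measurable_restrict_space1 measurable_completion) simp
  have gm: "g \<in> borel_measurable lebesgue" by (intro measurable_completion) simp
  have \<rho>0: "AE x in restrict_space lebesgue (ball 0 1). 0 \<le> ?\<rho> x"
    by (rule AE_I2) (simp add: space_restrict_space hyp_vol_weight)
  have "AE x in lborel. x \<in> ball 0 1 \<longrightarrow> f x = g x" using eq by eventually_elim simp
  then have "AE x in hyp_vol. f x = g x" by (rule AE_hyp_vol)
  then have "(\<integral>x. f x \<partial>hyp_vol) = (\<integral>x. g x \<partial>hyp_vol)"
    by (intro integral_cong_AE measurable_hyp_vol f gm)
  also have "\<dots> = (\<integral>x. ?\<rho> x *\<^sub>R g x \<partial>restrict_space lebesgue (ball 0 1))"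
    unfolding hyp_vol_def by (rule integral_density[OF measurable_restrict_space1[OF gm] m \<rho>0])
  also have "\<dots> = (\<integral>x. indicator (ball 0 1) x *\<^sub>R (?\<rho> x *\<^sub>R g x) \<partial>lebesgue)"
    by (rule integral_restrict_space) simp
  also have "\<dots> = (\<integral>x. indicator (ball 0 1) x *\<^sub>R (?\<rho> x *\<^sub>R g x) \<partial>lborel)"
    using borel_measurable_scaleR[OF borel_measurable_indicator[of "ball 0 1"] borel_measurable_scaleR[OF \<rho>m g]]
    by (intro integral_completion) simp
  also have "\<dots> = (\<integral>x. indicator (ball 0 1) x * (conf x powr (- real DIM('a)) * g x) \<partial>lborel)"
    by (intro Bochner_Integration.integral_cong) (auto simp: hyp_vol_weight indicator_def)
  finally show ?thesis .
qed

text \<open>Solutions are only Lebesgue measurable, whereas Fubini and the changes of variables are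
  carried out for Borel functions. The Borel representative is chosen coordinate by
  coordinate.\<close>

lemma lebesgue_borel_version:
  fixes G :: "'a::euclidean_space \<Rightarrow> 'b::euclidean_space"
  assumes "G \<in> borel_measurable lebesgue"
  obtains G' where "G' \<in> borel_measurable borel" "AE x in lborel. G x = G' x"
proof -
  have "\<exists>g\<in>borel_measurable lborel. AE x in lborel. G x \<bullet> b = g x" for b
    by (rule completion_ex_borel_measurable_real) (use assms in measurable)
  then have "\<exists>g. \<forall>b. g b \<in> borel_measurable lborel \<and> (AE x in lborel. G x \<bullet> b = g b x)"
    by (intro choice allI) blast
  then obtain g where g: "\<And>b. g b \<in> borel_measurable lborel" "\<And>b. AE x in lborel. G x \<bullet> b = g b x" by blast
  have [measurable]: "g b \<in> borel_measurable borel" for b using g(1) by simp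
  show ?thesis
  proof (rule that[of "\<lambda>x. \<Sum>b\<in>Basis. g b x *\<^sub>R b"])
    show "(\<lambda>x. \<Sum>b\<in>Basis. g b x *\<^sub>R b) \<in> borel_measurable borel" by measurable
    have "AE x in lborel. \<forall>b\<in>Basis. G x \<bullet> b = g b x" using g(2) by (intro AE_finite_allI) auto
    then show "AE x in lborel. G x = (\<Sum>b\<in>Basis. g b x *\<^sub>R b)"
    proof eventually_elim
      case (elim x)
      have "G x = (\<Sum>b\<in>Basis. (G x \<bullet> b) *\<^sub>R b)" by (simp add: euclidean_representation)
      also have "\<dots> = (\<Sum>b\<in>Basis. g b x *\<^sub>R b)" using elim by (intro sum.cong) auto
      finally show ?case .
    qed
  qed
qed

text \<open>The difference of the two sides is a linear functional of the test pair that is bounded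
  in the Dirichlet norm: Cauchy-Schwarz for the gradient term, Hardy for the mass term, Hoelder and
  Sobolev for the nonlinearity. It therefore vanishes on the closure as soon as it vanishes on the
  products of \<open>conf powr (- a)\<close> with test functions, which are dense.\<close>

lemma conf_solI:
  fixes v :: "'a::euclidean_space \<Rightarrow> real"
  assumes N: "DIM('a) \<ge> 3" and vF: "H10 (ball 0 1) v F"
    and out: "\<And>x. x \<notin> ball 0 1 \<Longrightarrow> v x = 0" "\<And>x. x \<notin> ball 0 1 \<Longrightarrow> F x = 0"
    and test: "\<And>\<phi>. test_fun \<phi> \<Longrightarrow>
       (\<integral>x. F x \<bullet> egrad (\<lambda>x. conf x powr (- a) * \<phi> x) x \<partial>lborel)
         + m * (\<integral>x. (hyp_wt x * v x) * (hyp_wt x * (conf x powr (- a) * \<phi> x)) \<partial>lborel)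
       = (\<integral>x. crit_nl (crit_exp DIM('a)) (v x) * (conf x powr (- a) * \<phi> x) \<partial>lborel)"
  shows "conf_sol m v F"
proof -
  define p where "p = crit_exp DIM('a)"
  have p2: "p > 2" using N by (simp add: p_def crit_exp_def field_simps)
  have N2: "DIM('a) \<ge> 2" using N by simp
  obtain S where S: "S > 0" "\<And>U (z :: 'a \<Rightarrow> real) Z. H10 U z Z \<Longrightarrow> Lpint p z"
    "\<And>U (z :: 'a \<Rightarrow> real) Z. H10 U z Z \<Longrightarrow> Lpn p z powr (2 / p) \<le> S * sqn Z"
    unfolding p_def by (rule H10_Sobolev[where 'a='a, OF N]) blast
  have vp: "Lpint p v" by (rule S(2)[OF vF])
  note Fs = H10D(2)[OF vF] and hv = H10_Hardy(1)[OF vF N2]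
  define Lf where "Lf z Z = (\<integral>x. F x \<bullet> Z x \<partial>lborel) + m * (\<integral>x. (hyp_wt x * v x) * (hyp_wt x * z x) \<partial>lborel)
       - (\<integral>x. crit_nl p (v x) * z x \<partial>lborel)" for z Z
  define C where "C = sqrt (sqn F) + \<bar>m\<bar> * (sqrt (sqn (\<lambda>x. hyp_wt x * v x)) * 2) + Lpn p v powr (1 - 1 / p) * sqrt S"
  have bound: "\<bar>Lf z Z\<bar> \<le> C * sqrt (sqn Z)" if z: "H10 (ball 0 1) z Z" for z Z
  proof -
    have b1: "\<bar>\<integral>x. F x \<bullet> Z x \<partial>lborel\<bar> \<le> sqrt (sqn F) * sqrt (sqn Z)" by (rule integral_inner_le[OF Fs H10D(2)[OF z]])
    have b2: "\<bar>m * (\<integral>x. (hyp_wt x * v x) * (hyp_wt x * z x) \<partial>lborel)\<bar> \<le> \<bar>m\<bar> * (sqrt (sqn (\<lambda>x. hyp_wt x * v x)) * (2 * sqrt (sqn Z)))"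
    proof -
      have "\<bar>\<integral>x. (hyp_wt x * v x) * (hyp_wt x * z x) \<partial>lborel\<bar> \<le> sqrt (sqn (\<lambda>x. hyp_wt x * v x)) * sqrt (sqn (\<lambda>x. hyp_wt x * z x))"
        using integral_inner_le[OF hv H10_Hardy(1)[OF z N2]] by simp
      also have "\<dots> \<le> sqrt (sqn (\<lambda>x. hyp_wt x * v x)) * sqrt (4 * sqn Z)"
        by (intro mult_left_mono real_sqrt_le_mono H10_Hardy(2)[OF z N2]) simp
      also have "sqrt (4 * sqn Z) = 2 * sqrt (sqn Z)" by (simp add: real_sqrt_mult)
      finally show ?thesis by (simp add: abs_mult mult_left_mono)
    qed
    have b3: "\<bar>\<integral>x. crit_nl p (v x) * z x \<partial>lborel\<bar> \<le> Lpn p v powr (1 - 1 / p) * (sqrt S * sqrt (sqn Z))"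
    proof -
      have "Lpn p z powr (1 / p) = sqrt (Lpn p z powr (2 / p))" by (simp add: powr_half_sqrt[symmetric] powr_powr)
      also have "\<dots> \<le> sqrt (S * sqn Z)" by (intro real_sqrt_le_mono S(3)[OF z])
      finally have "Lpn p z powr (1 / p) \<le> sqrt S * sqrt (sqn Z)" by (simp add: real_sqrt_mult)
      then have "Lpn p v powr (1 - 1 / p) * Lpn p z powr (1 / p) \<le> Lpn p v powr (1 - 1 / p) * (sqrt S * sqrt (sqn Z))"
        by (rule mult_left_mono) simp
      with crit_nl_pairing(2)[OF p2 vp S(2)[OF z]] show ?thesis by linarith
    qed
    have "\<bar>Lf z Z\<bar> \<le> sqrt (sqn F) * sqrt (sqn Z) + \<bar>m\<bar> * (sqrt (sqn (\<lambda>x. hyp_wt x * v x)) * (2 * sqrt (sqn Z)))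
        + Lpn p v powr (1 - 1 / p) * (sqrt S * sqrt (sqn Z))"
      unfolding Lf_def using b1 b2 b3 by linarith
    also have "\<dots> = C * sqrt (sqn Z)" unfolding C_def by (simp add: algebra_simps)
    finally show ?thesis .
  qed
  have Ldiff: "Lf (\<lambda>x. z x - y x) (\<lambda>x. Z x - Y x) = Lf z Z - Lf y Y"
    if z: "H10 (ball 0 1) z Z" and y: "H10 (ball 0 1) y Y" for z Z y Y
  proof -
    have "(\<integral>x. F x \<bullet> (Z x - Y x) \<partial>lborel) = (\<integral>x. F x \<bullet> Z x \<partial>lborel) - (\<integral>x. F x \<bullet> Y x \<partial>lborel)"
      unfolding inner_diff_right
      by (rule Bochner_Integration.integral_diff[OF sqint_inner[OF Fs H10D(2)[OF z]] sqint_inner[OF Fs H10D(2)[OF y]]])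
    moreover have "(\<integral>x. (hyp_wt x * v x) * (hyp_wt x * (z x - y x)) \<partial>lborel)
        = (\<integral>x. (hyp_wt x * v x) * (hyp_wt x * z x) \<partial>lborel) - (\<integral>x. (hyp_wt x * v x) * (hyp_wt x * y x) \<partial>lborel)"
      unfolding right_diff_distrib
      by (rule Bochner_Integration.integral_diff[OF sqint_mult[OF hv H10_Hardy(1)[OF z N2]] sqint_mult[OF hv H10_Hardy(1)[OF y N2]]])
    moreover have "(\<integral>x. crit_nl p (v x) * (z x - y x) \<partial>lborel) = (\<integral>x. crit_nl p (v x) * z x \<partial>lborel) - (\<integral>x. crit_nl p (v x) * y x \<partial>lborel)"
      unfolding right_diff_distrib
      by (rule Bochner_Integration.integral_diff[OF crit_nl_pairing(1)[OF p2 vp S(2)[OF z]] crit_nl_pairing(1)[OF p2 vp S(2)[OF y]]])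
    ultimately show ?thesis unfolding Lf_def by (simp add: right_diff_distrib)
  qed
  \<comment> \<open>Convergence of the gradients alone is enough, as the bound on the functional
    involves nothing else.\<close>
  have limit: "Lf z Z = 0"
    if z: "H10 (ball 0 1) z Z" and y: "\<And>k::nat. H10 (ball 0 1) (y k) (Y k)" "\<And>k. Lf (y k) (Y k) = 0"
      and c: "(\<lambda>k. sqn (\<lambda>x. Y k x - Z x)) \<longlonglongrightarrow> 0" for z Z y Y
  proof -
    have "\<bar>Lf z Z\<bar> \<le> C * sqrt (sqn (\<lambda>x. Y k x - Z x))" for k
      using bound[OF H10_diff[OF y(1)[of k] z]] Ldiff[OF y(1)[of k] z] y(2)[of k] by simp
    moreover have "(\<lambda>k. C * sqrt (sqn (\<lambda>x. Y k x - Z x))) \<longlonglongrightarrow> C * sqrt 0" by (intro tendsto_intros c)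
    ultimately have "\<bar>Lf z Z\<bar> \<le> C * sqrt 0" by (intro LIMSEQ_le_const) auto
    then show ?thesis by simp
  qed
  have C1: "Lf g (egrad g) = 0" if g: "C1c (ball 0 1) g" for g
  proof -
    \<comment> \<open>Not g but this multiple of it is mollified, so that multiplying back by
      \<open>conf powr (- a)\<close> gives functions of exactly the tested form.\<close>
    define \<phi> where "\<phi> x = conf x powr a * g x" for x
    have \<phi>: "C1c (ball 0 1) \<phi>" unfolding \<phi>_def by (rule C1c_conf_powr(1)[OF g])
    have geq: "g = (\<lambda>x. conf x powr (- a) * \<phi> x)"
    proof
      fix x
      show "g x = conf x powr (- a) * \<phi> x"
      proof (cases "x \<in> ball 0 1")
        case True
        then have "conf x powr (- a) * conf x powr a = 1" using conf_pos[OF True] by (simp add: powr_add[symmetric])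
        then show ?thesis by (simp add: \<phi>_def mult.assoc[symmetric])
      qed (use C1c_outside[OF g] in \<open>simp add: \<phi>_def\<close>)
    qed
    obtain gs K B where gs: "\<And>n. test_fun (gs n)" "compact K" "K \<subseteq> ball 0 1"
      "\<And>n x. x \<notin> K \<Longrightarrow> gs n x = 0" "\<And>n x. x \<notin> K \<Longrightarrow> egrad (gs n) x = 0" "B \<ge> 0"
      "\<And>n x. \<bar>gs n x\<bar> \<le> B" "\<And>n x. norm (egrad (gs n) x) \<le> B"
      "\<And>x. (\<lambda>n. gs n x) \<longlonglongrightarrow> \<phi> x" "\<And>x. (\<lambda>n. egrad (gs n) x) \<longlonglongrightarrow> egrad \<phi> x"
      by (rule C1c_approx_test_fun[OF \<phi>]) blast
    define y where "y n x = conf x powr (- a) * gs n x" for n x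
    have y: "C1c (ball 0 1) (y n)" for n unfolding y_def by (rule C1c_conf_powr(1)[OF test_fun_C1c[OF gs(1)]])
    have ey: "egrad (y n) x = conf x powr (- a) *\<^sub>R egrad (gs n) x + (a * conf x powr (- a - 1) * gs n x) *\<^sub>R x" for n x
      unfolding y_def C1c_conf_powr(2)[OF test_fun_C1c[OF gs(1)]] by simp
    have eg: "egrad g x = conf x powr (- a) *\<^sub>R egrad \<phi> x + (a * conf x powr (- a - 1) * \<phi> x) *\<^sub>R x" for x
      by (subst geq) (simp add: C1c_conf_powr(2)[OF \<phi>])
    have cc: "continuous_on K (\<lambda>x. conf x powr r)" for r
    proof -
      have "continuous_on (ball 0 1) (\<lambda>x::'a. conf x powr r)"
        by (intro continuous_at_imp_continuous_on ballI has_derivative_continuous[OF conf_powr_derivative])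
      then show ?thesis by (rule continuous_on_subset[OF _ gs(3)])
    qed
    obtain A where A: "\<And>x. x \<in> K \<Longrightarrow> conf x powr (- a) \<le> A" "\<And>x. x \<in> K \<Longrightarrow> conf x powr (- a - 1) \<le> A"
    proof -
      have "bounded ((\<lambda>x. conf x powr (- a)) ` K)" "bounded ((\<lambda>x. conf x powr (- a - 1)) ` K)"
        using compact_imp_bounded[OF compact_continuous_image[OF cc gs(2)]] by auto
      then obtain A1 A2 where "\<And>x. x \<in> K \<Longrightarrow> \<bar>conf x powr (- a)\<bar> \<le> A1" "\<And>x. x \<in> K \<Longrightarrow> \<bar>conf x powr (- a - 1)\<bar> \<le> A2"
        by (auto simp: bounded_iff)
      then show ?thesis by (intro that[of "max A1 A2"]) (force simp: le_max_iff_disj)+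
    qed
    have ny: "norm (egrad (y n) x) \<le> (A * B + \<bar>a\<bar> * A * B) * indicator K x" for n x
    proof (cases "x \<in> K")
      case True
      have x1: "norm x \<le> 1" using True gs(3) by auto
      have A0: "0 \<le> A" using A(1)[OF True] powr_ge_zero[of "conf x" "-a"] by linarith
      have "norm (egrad (y n) x) \<le> norm (conf x powr (- a) *\<^sub>R egrad (gs n) x) + norm ((a * conf x powr (- a - 1) * gs n x) *\<^sub>R x)"
        unfolding ey by (rule norm_triangle_ineq)
      also have "\<dots> = conf x powr (- a) * norm (egrad (gs n) x) + \<bar>a\<bar> * conf x powr (- a - 1) * \<bar>gs n x\<bar> * norm x"
        by (simp add: abs_mult)
      also have "\<dots> \<le> A * B + \<bar>a\<bar> * A * B * 1"
        using A[OF True] A0 gs(6,7,8) x1 by (intro add_mono mult_mono) auto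
      finally show ?thesis using True by simp
    next
      case False
      then show ?thesis using gs(4,5) unfolding ey by simp
    qed
    have lim: "(\<lambda>n. sqn (\<lambda>x. egrad (y n) x - egrad g x)) \<longlonglongrightarrow> 0"
    proof -
      define c where "c = A * B + \<bar>a\<bar> * A * B"
      have ly: "(\<lambda>n. egrad (y n) x) \<longlonglongrightarrow> egrad g x" for x
        unfolding ey eg by (intro tendsto_intros gs(9,10))
      have ng: "norm (egrad g x) \<le> c * indicator K x" for x
        by (rule tendsto_upperbound[OF tendsto_norm[OF ly]]) (use ny in \<open>auto simp: c_def\<close>)
      have [measurable]: "egrad (y n) \<in> borel_measurable borel" "egrad g \<in> borel_measurable borel" for n
        using C1c_measurable(2)[OF y] C1c_measurable(2)[OF g] by auto
      have [measurable]: "K \<in> sets borel" using gs(2) by (rule borel_compact)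
      have Kf: "emeasure lborel K < \<infinity>" by (rule emeasure_compact_finite[OF gs(2)])
      have "(\<lambda>n. \<integral>x. (norm (egrad (y n) x - egrad g x))\<^sup>2 \<partial>lborel) \<longlonglongrightarrow> (\<integral>x. 0 \<partial>(lborel :: 'a measure))"
      proof (rule integral_dominated_convergence[where w = "\<lambda>x. (2 * c)\<^sup>2 * indicator K x"])
        show "integrable lborel (\<lambda>x. (2 * c)\<^sup>2 * indicator K x :: real)"
          using Kf by (intro integrable_mult_right integrable_real_indicator) auto
        show "AE x in lborel. (\<lambda>n. (norm (egrad (y n) x - egrad g x))\<^sup>2) \<longlonglongrightarrow> 0"
        proof (rule AE_I2)
          fix x
          have "(\<lambda>n. (norm (egrad (y n) x - egrad g x))\<^sup>2) \<longlonglongrightarrow> (norm (egrad g x - egrad g x))\<^sup>2"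
            by (intro tendsto_intros ly)
          then show "(\<lambda>n. (norm (egrad (y n) x - egrad g x))\<^sup>2) \<longlonglongrightarrow> 0" by simp
        qed
        show "AE x in lborel. norm ((norm (egrad (y n) x - egrad g x))\<^sup>2) \<le> (2 * c)\<^sup>2 * indicator K x" for n
        proof (rule AE_I2)
          fix x
          have "norm (egrad (y n) x - egrad g x) \<le> 2 * c * indicator K x"
            using norm_triangle_ineq4[of "egrad (y n) x" "egrad g x"] ny[of n x, folded c_def] ng[of x] by linarith
          then have "(norm (egrad (y n) x - egrad g x))\<^sup>2 \<le> (2 * c * indicator K x)\<^sup>2" by (rule power_mono) simp
          also have "\<dots> = (2 * c)\<^sup>2 * indicator K x" by (auto simp: indicator_def)
          finally show "norm ((norm (egrad (y n) x - egrad g x))\<^sup>2) \<le> (2 * c)\<^sup>2 * indicator K x" by simp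
        qed
      qed measurable
      then show ?thesis by (simp add: sqn_def)
    qed
    have "Lf (y n) (egrad (y n)) = 0" for n
      using test[OF gs(1)[of n]] unfolding Lf_def y_def p_def by simp
    then show ?thesis by (rule limit[OF H10_C1c[OF g] H10_C1c[OF y] _ lim])
  qed
  have "Lf z Z = 0" if z: "H10 (ball 0 1) z Z" for z Z
  proof -
    obtain f where f: "\<And>k::nat. C1c (ball 0 1) (f k)" "(\<lambda>k. sqn (\<lambda>x. f k x - z x)) \<longlonglongrightarrow> 0"
      "(\<lambda>k. sqn (\<lambda>x. egrad (f k) x - Z x)) \<longlonglongrightarrow> 0" using H10_approx[OF z] by blast
    show ?thesis by (rule limit[OF z H10_C1c[OF f(1)] C1[OF f(1)] f(3)])
  qed
  then show ?thesis unfolding conf_sol_def Lf_def p_def using vF out by simp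
qed

text \<open>The volume weight splits as conf^(-N) = conf^(-2 a) conf^(-2), so the hyperbolic norm of
  a difference controls conf^(-a) times its gradient and conf^(-a - 1) times its value in L^2. These
  are the two ingredients of the gradient of conf^(-a) u, whence the transformed test functions
  converge in the Dirichlet norm.\<close>

lemma weak_solution_conf_sol:
  fixes u :: "'a::euclidean_space \<Rightarrow> real"
  assumes N: "DIM('a) \<ge> 3" and sol: "weak_solution lam u G"
  obtains v F where "conf_sol (real DIM('a) * (real DIM('a) - 2) / 4 - lam) v F"
    "AE x in lborel. x \<in> ball 0 1 \<longrightarrow> v x = 0 \<longrightarrow> u x = 0"
proof -
  define a where "a = (real DIM('a) - 2) / 2"
  define p where "p = crit_exp DIM('a)"
  define M0 where "M0 = real DIM('a) * (real DIM('a) - 2) / 4"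
  have n: "real DIM('a) > 2" using N by simp
  have N2: "DIM('a) \<ge> 2" using N by simp
  have Na: "real DIM('a) = 2 * a + 2" by (simp add: a_def field_simps)
  have ap: "a * (p - 2) = 2" using n by (simp add: p_def crit_exp_def a_def field_simps)
  have um: "u \<in> borel_measurable lebesgue" and Gm: "G \<in> borel_measurable lebesgue"
    using sol unfolding weak_solution_def H1_with_grad_def by auto
  obtain \<phi> where \<phi>: "\<And>k::nat. test_fun (\<phi> k)"
    "(\<lambda>k. \<integral>\<^sup>+ x. ennreal ((conf x)\<^sup>2 * (norm (egrad (\<phi> k) x - G x))\<^sup>2 + (\<phi> k x - u x)\<^sup>2) \<partial>hyp_vol) \<longlonglongrightarrow> 0"
    using sol unfolding weak_solution_def H1_with_grad_def by blast
  have weak: "(\<integral>x. (conf x)\<^sup>2 * (G x \<bullet> egrad \<psi> x) \<partial>hyp_vol) - lam * (\<integral>x. u x * \<psi> x \<partial>hyp_vol)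
        = (\<integral>x. \<bar>u x\<bar> powr (p - 2) * u x * \<psi> x \<partial>hyp_vol)" if "test_fun \<psi>" for \<psi>
    using sol that unfolding weak_solution_def p_def by blast
  obtain u' where u' [measurable]: "u' \<in> borel_measurable borel" and uu: "AE x in lborel. u x = u' x"
    by (rule lebesgue_borel_version[OF um])
  obtain G' where G' [measurable]: "G' \<in> borel_measurable borel" and GG: "AE x in lborel. G x = G' x"
    by (rule lebesgue_borel_version[OF Gm])
  have \<phi>C: "C1c (ball 0 1) (\<phi> k)" for k by (rule test_fun_C1c[OF \<phi>(1)])
  note [measurable] = C1c_measurable[OF \<phi>C]
  define I where "I k = (\<integral>\<^sup>+x. ennreal (conf x powr (- real DIM('a))) * ennreal ((conf x)\<^sup>2 * (norm (egrad (\<phi> k) x - G' x))\<^sup>2 + (\<phi> k x - u' x)\<^sup>2) * indicator (ball 0 1) x \<partial>lborel)" for k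
  have I0: "I \<longlonglongrightarrow> 0"
  proof -
    have "(\<integral>\<^sup>+ x. ennreal ((conf x)\<^sup>2 * (norm (egrad (\<phi> k) x - G x))\<^sup>2 + (\<phi> k x - u x)\<^sup>2) \<partial>hyp_vol) = I k" for k
      unfolding I_def
    proof (rule hyp_vol_nn_integral)
      show "(\<lambda>x. ennreal ((conf x)\<^sup>2 * (norm (egrad (\<phi> k) x - G' x))\<^sup>2 + (\<phi> k x - u' x)\<^sup>2)) \<in> borel_measurable borel"
        by measurable
      show "AE x in lborel. ennreal ((conf x)\<^sup>2 * (norm (egrad (\<phi> k) x - G x))\<^sup>2 + (\<phi> k x - u x)\<^sup>2)
          = ennreal ((conf x)\<^sup>2 * (norm (egrad (\<phi> k) x - G' x))\<^sup>2 + (\<phi> k x - u' x)\<^sup>2)"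
        using uu GG by eventually_elim simp
    qed
    with \<phi>(2) show ?thesis by simp
  qed
  define v where "v x = (if x \<in> ball 0 1 then conf x powr (- a) * u' x else 0)" for x
  define F where "F x = (if x \<in> ball 0 1 then conf x powr (- a) *\<^sub>R (G' x + (a / conf x * u' x) *\<^sub>R x) else 0)" for x
  \<comment> \<open>The vector field that occurs in the weak formulation; F differs from it by the
    derivative of the conformal factor.\<close>
  define P where "P x = (if x \<in> ball 0 1 then conf x powr (- a) *\<^sub>R G' x else 0)" for x
  have bm: "Measurable.pred borel (\<lambda>x::'a. x \<in> ball 0 1)" by simp
  have [measurable]: "v \<in> borel_measurable borel" unfolding v_def using bm by measurable
  have [measurable]: "F \<in> borel_measurable borel" unfolding F_def using bm by measurable
  have [measurable]: "P \<in> borel_measurable borel" unfolding P_def using bm by measurable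
  define f where "f k x = conf x powr (- a) * \<phi> k x" for k x
  have fC: "C1c (ball 0 1) (f k)" for k unfolding f_def by (rule C1c_conf_powr(1)[OF \<phi>C])
  have fg: "egrad (f k) x = conf x powr (- a) *\<^sub>R egrad (\<phi> k) x + (a * conf x powr (- a - 1) * \<phi> k x) *\<^sub>R x" for k x
    unfolding f_def C1c_conf_powr(2)[OF \<phi>C] by simp
  define Pk where "Pk k x = conf x powr (- a) *\<^sub>R egrad (\<phi> k) x" for k x
  note [measurable] = C1c_measurable[OF fC]
  have [measurable]: "Pk k \<in> borel_measurable borel" for k unfolding Pk_def by measurable
  have cpow: "conf x powr (- real DIM('a)) * (conf x)\<^sup>2 = (conf x powr (- a))\<^sup>2"
    "conf x powr (- real DIM('a)) = (conf x powr (- a))\<^sup>2 * (1 / conf x)\<^sup>2"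
    "1 \<le> (1 / conf x)\<^sup>2" "conf x powr (- a - 1) = conf x powr (- a) / conf x"
    if "x \<in> ball 0 1" for x :: 'a
  proof -
    define c where "c = conf x"
    have c: "c > 0" using conf_pos[OF that] by (simp add: c_def)
    have e: "c powr (- real DIM('a)) = (c powr (- a))\<^sup>2 * (1 / c)\<^sup>2"
    proof -
      have "c powr (- real DIM('a)) = c powr ((- a) + (- a) + (- 2))" unfolding Na by (rule arg_cong[where f = "(powr) c"]) simp
      also have "\<dots> = c powr (- a) * c powr (- a) * c powr (- 2)" by (simp only: powr_add)
      also have "c powr (- 2) = (1 / c)\<^sup>2" using c by (simp add: powr_minus_divide powr_numeral power_divide)
      finally show ?thesis by (simp add: power2_eq_square)
    qed
    then show "conf x powr (- real DIM('a)) = (conf x powr (- a))\<^sup>2 * (1 / conf x)\<^sup>2" by (simp add: c_def)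
    show "conf x powr (- real DIM('a)) * (conf x)\<^sup>2 = (conf x powr (- a))\<^sup>2"
      unfolding c_def[symmetric] e using c by (simp add: power_divide)
    have "1 \<le> 1 / c" using c conf_le_half[of x] by (simp add: c_def)
    then show "1 \<le> (1 / conf x)\<^sup>2" unfolding c_def[symmetric] by (rule one_le_power)
    show "conf x powr (- a - 1) = conf x powr (- a) / conf x" using c by (simp add: c_def powr_diff)
  qed
  define D where "D k x = (conf x powr (- a))\<^sup>2 * (norm (egrad (\<phi> k) x - G' x))\<^sup>2" for k x
  define E where "E k x = (conf x powr (- a))\<^sup>2 * (1 / conf x)\<^sup>2 * (\<phi> k x - u' x)\<^sup>2" for k x
  have Ieq: "I k = (\<integral>\<^sup>+x. ennreal (D k x + E k x) * indicator (ball 0 1) x \<partial>lborel)" for k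
    unfolding I_def
  proof (rule nn_integral_cong)
    fix x
    show "ennreal (conf x powr (- real DIM('a))) * ennreal ((conf x)\<^sup>2 * (norm (egrad (\<phi> k) x - G' x))\<^sup>2 + (\<phi> k x - u' x)\<^sup>2) * indicator (ball 0 1) x
       = ennreal (D k x + E k x) * indicator (ball 0 1) x"
    proof (cases "x \<in> ball 0 1")
      case True
      have "conf x powr (- real DIM('a)) * ((conf x)\<^sup>2 * (norm (egrad (\<phi> k) x - G' x))\<^sup>2 + (\<phi> k x - u' x)\<^sup>2) = D k x + E k x"
        unfolding distrib_left mult.assoc[symmetric] cpow(1)[OF True] D_def E_def by (simp add: cpow(2)[OF True])
      moreover have "ennreal (conf x powr (- real DIM('a))) * ennreal ((conf x)\<^sup>2 * (norm (egrad (\<phi> k) x - G' x))\<^sup>2 + (\<phi> k x - u' x)\<^sup>2)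
         = ennreal (conf x powr (- real DIM('a)) * ((conf x)\<^sup>2 * (norm (egrad (\<phi> k) x - G' x))\<^sup>2 + (\<phi> k x - u' x)\<^sup>2))"
        by (rule ennreal_mult[symmetric]) auto
      ultimately show ?thesis by simp
    qed simp
  qed
  have DE0: "0 \<le> D k x" "0 \<le> E k x" for k x by (simp_all add: D_def E_def)
  have bnd: "(\<integral>\<^sup>+x. ennreal ((norm (g x))\<^sup>2) \<partial>lborel) \<le> ennreal c * I k"
    if g: "\<And>x. x \<in> ball 0 1 \<Longrightarrow> (norm (g x))\<^sup>2 \<le> c * (D k x + E k x)" "\<And>x. x \<notin> ball 0 1 \<Longrightarrow> g x = 0" and c: "c \<ge> 0"
    for g :: "'a \<Rightarrow> 'b::euclidean_space" and c k
  proof -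
    have "(\<integral>\<^sup>+x. ennreal ((norm (g x))\<^sup>2) \<partial>lborel) \<le> (\<integral>\<^sup>+x. ennreal c * (ennreal (D k x + E k x) * indicator (ball 0 1) x) \<partial>lborel)"
    proof (rule nn_integral_mono)
      fix x
      show "ennreal ((norm (g x))\<^sup>2) \<le> ennreal c * (ennreal (D k x + E k x) * indicator (ball 0 1) x)"
      proof (cases "x \<in> ball 0 1")
        case True
        have "ennreal ((norm (g x))\<^sup>2) \<le> ennreal (c * (D k x + E k x))" by (rule ennreal_leI[OF g(1)[OF True]])
        also have "\<dots> = ennreal c * ennreal (D k x + E k x)" using DE0[of k x] c by (intro ennreal_mult) auto
        finally show ?thesis using True by simp
      qed (use g(2) in simp)
    qed
    also have "\<dots> = ennreal c * I k"
      unfolding Ieq D_def E_def by (rule nn_integral_cmult) measurable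
    finally show ?thesis .
  qed
  have bP: "(\<integral>\<^sup>+x. ennreal ((norm (Pk k x - P x))\<^sup>2) \<partial>lborel) \<le> ennreal 1 * I k" for k
  proof (rule bnd)
    fix x :: 'a
    show "(norm (Pk k x - P x))\<^sup>2 \<le> 1 * (D k x + E k x)" if "x \<in> ball 0 1"
    proof -
      have "Pk k x - P x = conf x powr (- a) *\<^sub>R (egrad (\<phi> k) x - G' x)" using that by (simp add: Pk_def P_def scaleR_diff_right)
      then show ?thesis using DE0[of k x] by (simp add: D_def power_mult_distrib)
    qed
    show "Pk k x - P x = 0" if "x \<notin> ball 0 1" using C1c_outside[OF \<phi>C that] that by (simp add: Pk_def P_def)
  qed simp
  have bv: "(\<integral>\<^sup>+x. ennreal ((norm (f k x - v x))\<^sup>2) \<partial>lborel) \<le> ennreal 1 * I k" for k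
  proof (rule bnd)
    fix x :: 'a
    show "(norm (f k x - v x))\<^sup>2 \<le> 1 * (D k x + E k x)" if "x \<in> ball 0 1"
    proof -
      have "f k x - v x = conf x powr (- a) * (\<phi> k x - u' x)" using that by (simp add: f_def v_def right_diff_distrib)
      then have "(norm (f k x - v x))\<^sup>2 = 1 * ((conf x powr (- a))\<^sup>2 * (\<phi> k x - u' x)\<^sup>2)" by (simp add: power_mult_distrib)
      also have "\<dots> \<le> (1 / conf x)\<^sup>2 * ((conf x powr (- a))\<^sup>2 * (\<phi> k x - u' x)\<^sup>2)"
        by (rule mult_right_mono[OF cpow(3)[OF that]]) simp
      also have "\<dots> = E k x" by (simp add: E_def)
      finally show ?thesis using DE0[of k x] by simp
    qed
    show "f k x - v x = 0" if "x \<notin> ball 0 1" using C1c_outside[OF fC that] that by (simp add: v_def)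
  qed simp
  \<comment> \<open>From \<open>norm_add_sq_le\<close> for the two parts of the gradient difference;
    a^2 comes from differentiating the conformal factor, with |x| \<le> 1.\<close>
  define c where "c = 2 + 2 * a\<^sup>2"
  have c0: "c \<ge> 0" by (simp add: c_def)
  have bF: "(\<integral>\<^sup>+x. ennreal ((norm (egrad (f k) x - F x))\<^sup>2) \<partial>lborel) \<le> ennreal c * I k" for k
  proof (rule bnd[OF _ _ c0])
    fix x :: 'a
    show "(norm (egrad (f k) x - F x))\<^sup>2 \<le> c * (D k x + E k x)" if "x \<in> ball 0 1"
    proof -
      define d where "d = egrad (\<phi> k) x - G' x"
      define y where "y = (a / conf x * (\<phi> k x - u' x)) *\<^sub>R x"
      have "egrad (f k) x - F x = conf x powr (- a) *\<^sub>R (d + y)"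
        unfolding fg d_def y_def using that by (simp add: F_def cpow(4)[OF that] algebra_simps)
      then have "(norm (egrad (f k) x - F x))\<^sup>2 = (conf x powr (- a))\<^sup>2 * (norm (d + y))\<^sup>2" by (simp add: power_mult_distrib)
      also have "\<dots> \<le> (conf x powr (- a))\<^sup>2 * (2 * (norm d)\<^sup>2 + 2 * (norm y)\<^sup>2)"
        by (intro mult_left_mono norm_add_sq_le) simp
      also have "(norm y)\<^sup>2 \<le> a\<^sup>2 * ((1 / conf x)\<^sup>2 * (\<phi> k x - u' x)\<^sup>2)"
      proof -
        have "(norm y)\<^sup>2 = (a\<^sup>2 * ((1 / conf x)\<^sup>2 * (\<phi> k x - u' x)\<^sup>2)) * (norm x)\<^sup>2"
          by (simp add: y_def power_mult_distrib power_divide)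
        also have "\<dots> \<le> (a\<^sup>2 * ((1 / conf x)\<^sup>2 * (\<phi> k x - u' x)\<^sup>2)) * 1"
          using that by (intro mult_left_mono) (auto simp: power_le_one)
        finally show ?thesis by simp
      qed
      also have "(conf x powr (- a))\<^sup>2 * (2 * (norm d)\<^sup>2 + 2 * (a\<^sup>2 * ((1 / conf x)\<^sup>2 * (\<phi> k x - u' x)\<^sup>2))) = 2 * D k x + 2 * a\<^sup>2 * E k x"
        by (simp add: D_def E_def d_def algebra_simps)
      also have "\<dots> \<le> c * D k x + c * E k x"
        using DE0[of k x] by (intro add_mono mult_right_mono) (auto simp: c_def)
      finally show ?thesis by (simp add: distrib_left mult_left_mono)
    qed
    show "egrad (f k) x - F x = 0" if "x \<notin> ball 0 1" using C1c_outside[OF fC that] that by (simp add: F_def)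
  qed
  have Pks: "sqint (Pk k)" for k
  proof -
    define y where "y x = conf x powr (- a - 1) * \<phi> k x" for x
    have y: "C1c (ball 0 1) y" unfolding y_def by (rule C1c_conf_powr(1)[OF \<phi>C])
    have "sqint (\<lambda>x. (a * y x) *\<^sub>R x)"
    proof (rule sqint_bound(1)[OF C1c_sqint[OF y], of _ "\<bar>a\<bar>"])
      show "(\<lambda>x. (a * y x) *\<^sub>R x) \<in> borel_measurable borel" using C1c_measurable(1)[OF y] by measurable
      show "norm ((a * y x) *\<^sub>R x) \<le> \<bar>a\<bar> * norm (y x)" for x
      proof (cases "x \<in> ball 0 1")
        case True
        then have "\<bar>a\<bar> * \<bar>y x\<bar> * norm x \<le> \<bar>a\<bar> * \<bar>y x\<bar> * 1" by (intro mult_left_mono) auto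
        then show ?thesis by (simp add: abs_mult)
      qed (use C1c_outside[OF y] in simp)
    qed
    from sqint_diff(1)[OF C1c_sqint_egrad[OF fC[of k]] this] show ?thesis
      unfolding fg y_def Pk_def by (simp add: mult.assoc)
  qed
  \<comment> \<open>The early integrals may be infinite, and then give no square integrability of
    the limit; shifting the sequence by \<open>k0\<close> removes them.\<close>
  have "eventually (\<lambda>k. I k < 1) sequentially" using order_tendstoD(2)[OF I0, of 1] by simp
  then obtain k0 where k0: "\<And>k. k \<ge> k0 \<Longrightarrow> I k < 1" by (auto simp: eventually_sequentially)
  have fin: "ennreal r * I (k + k0) < \<infinity>" for r k
    using k0[of "k + k0"] by (auto simp: ennreal_mult_less_top intro: less_trans)
  have I1: "(\<lambda>k. I (k + k0)) \<longlonglongrightarrow> 0" by (rule LIMSEQ_ignore_initial_segment[OF I0])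
  have conv: "sqint g \<and> (\<lambda>k. sqn (\<lambda>x. gs (k + k0) x - g x)) \<longlonglongrightarrow> 0"
    if gs: "\<And>k. sqint (gs k)" and g: "g \<in> borel_measurable borel"
      and b: "\<And>k. (\<integral>\<^sup>+x. ennreal ((norm (gs k x - g x))\<^sup>2) \<partial>lborel) \<le> ennreal r * I k"
    for gs :: "nat \<Rightarrow> 'a \<Rightarrow> 'b::euclidean_space" and g r
  proof -
    have d: "sqint (\<lambda>x. gs (k + k0) x - g x)" for k
    proof (rule sqintI_nn)
      show "(\<lambda>x. gs (k + k0) x - g x) \<in> borel_measurable borel"
        using sqint_measurable[OF gs] g by measurable
      show "(\<integral>\<^sup>+x. ennreal ((norm (gs (k + k0) x - g x))\<^sup>2) \<partial>lborel) < \<infinity>"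
        using b[of "k + k0"] fin[of r k] by (rule le_less_trans)
    qed
    have "sqint g" using sqint_diff(1)[OF gs[of "0 + k0"] d[of 0]] by simp
    moreover have "(\<lambda>k. ennreal (sqn (\<lambda>x. gs (k + k0) x - g x))) \<longlonglongrightarrow> 0"
    proof (rule tendsto_sandwich[of "\<lambda>k. 0"])
      show "eventually (\<lambda>k. ennreal (sqn (\<lambda>x. gs (k + k0) x - g x)) \<le> ennreal r * I (k + k0)) sequentially"
        unfolding nn_integral_sq[OF d, symmetric] by (intro always_eventually allI b)
      have "(\<lambda>k. ennreal r * I (k + k0)) \<longlonglongrightarrow> ennreal r * 0" by (intro ennreal_tendsto_cmult I1) simp
      then show "(\<lambda>k. ennreal r * I (k + k0)) \<longlonglongrightarrow> 0" by simp
    qed auto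
    ultimately show ?thesis by (simp add: ennreal_tendsto_0_iff)
  qed
  have cv: "sqint v" "(\<lambda>k. sqn (\<lambda>x. f (k + k0) x - v x)) \<longlonglongrightarrow> 0"
    using conv[of f v 1] C1c_sqint[OF fC] bv by auto
  have cF: "sqint F" "(\<lambda>k. sqn (\<lambda>x. egrad (f (k + k0)) x - F x)) \<longlonglongrightarrow> 0"
    using conv[of "\<lambda>k. egrad (f k)" F c] C1c_sqint_egrad[OF fC] bF by auto
  have cP: "sqint P" "(\<lambda>k. sqn (\<lambda>x. Pk (k + k0) x - P x)) \<longlonglongrightarrow> 0"
    using conv[of Pk P 1] Pks bP by auto
  have vF: "H10 (ball 0 1) v F"
    unfolding H10_def using cv cF fC by (intro conjI exI[of _ "\<lambda>k. f (k + k0)"]) auto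
  have outv: "v x = 0" and outF: "F x = 0" if "x \<notin> ball 0 1" for x using that by (auto simp: v_def F_def)
  have test: "(\<integral>x. F x \<bullet> egrad (\<lambda>x. conf x powr (- a) * \<psi> x) x \<partial>lborel)
         + (M0 - lam) * (\<integral>x. (hyp_wt x * v x) * (hyp_wt x * (conf x powr (- a) * \<psi> x)) \<partial>lborel)
       = (\<integral>x. crit_nl p (v x) * (conf x powr (- a) * \<psi> x) \<partial>lborel)" if t: "test_fun \<psi>" for \<psi>
  proof -
    have \<psi>: "C1c (ball 0 1) \<psi>" by (rule test_fun_C1c[OF t])
    define g where "g x = conf x powr (- a) * \<psi> x" for x
    have gC: "C1c (ball 0 1) g" unfolding g_def by (rule C1c_conf_powr(1)[OF \<psi>])
    have inv: "conf x powr a * (conf x powr (- a) * k x) = k x" if "C1c (ball 0 1) k" for k x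
    proof (cases "x \<in> ball 0 1")
      case True
      then have "conf x powr a * conf x powr (- a) = 1" using conf_pos[OF True] by (simp add: powr_add[symmetric])
      then show ?thesis by (simp add: mult.assoc[symmetric])
    qed (use C1c_outside[OF that] in simp)
    note [measurable] = C1c_measurable[OF \<psi>] C1c_measurable[OF gC]
    define R where "R x = conf x powr (- a) *\<^sub>R egrad \<psi> x" for x
    have Rs: "sqint R"
    proof -
      have "continuous_on UNIV R"
      proof -
        obtain K where K: "compact K" "K \<subseteq> ball 0 1" "\<And>x. x \<notin> K \<Longrightarrow> egrad \<psi> x = 0" using C1c_support[OF \<psi>] by metis
        have op: "open (- K)" using K(1) by (simp add: compact_imp_closed open_Compl)
        have "continuous_on (ball 0 1) (\<lambda>x::'a. conf x powr (- a))"
          by (intro continuous_at_imp_continuous_on ballI has_derivative_continuous[OF conf_powr_derivative])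
        then have c1: "continuous_on (ball 0 1) R"
          unfolding R_def by (intro continuous_on_scaleR continuous_on_subset[OF C1c_cont_egrad[OF \<psi>]]) auto
        have c2: "continuous_on (- K) R"
          by (rule continuous_on_eq[of _ "\<lambda>x. 0"]) (use K in \<open>auto simp: R_def\<close>)
        have "ball 0 1 \<union> - K = UNIV" using K(2) by auto
        then show ?thesis using continuous_on_open_Un[OF open_ball op c1 c2] by simp
      qed
      moreover obtain K where "compact K" "\<And>x. x \<notin> K \<Longrightarrow> egrad \<psi> x = 0" using C1c_support[OF \<psi>] by metis
      ultimately show ?thesis by (intro continuous_compact_support(2)[of R K]) (auto simp: R_def)
    qed
    have wts: "sqint (\<lambda>x. hyp_wt x * f k x)" "sqint (\<lambda>x. hyp_wt x * g x)" "sqint (\<lambda>x. hyp_wt x * v x)" for k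
      using H10_Hardy(1)[OF H10_C1c[OF fC] N2] H10_Hardy(1)[OF H10_C1c[OF gC] N2] H10_Hardy(1)[OF vF N2] by auto
    \<comment> \<open>The conformal identity for the approximants, passed to the limit: the gradient
      terms converge by construction and the weighted term by Hardy's inequality. The constant
      \<open>M0\<close> created here joins -\<lambda> to form the mass.\<close>
    have T1: "(\<integral>x. P x \<bullet> R x \<partial>lborel) = (\<integral>x. F x \<bullet> egrad g x \<partial>lborel) + M0 * (\<integral>x. (hyp_wt x * v x) * (hyp_wt x * g x) \<partial>lborel)"
    proof -
      have zero: "(\<lambda>k. sqn (\<lambda>x. R x - R x)) \<longlonglongrightarrow> 0" "(\<lambda>k. sqn (\<lambda>x. egrad g x - egrad g x)) \<longlonglongrightarrow> 0"
        "(\<lambda>k. sqn (\<lambda>x. hyp_wt x * g x - hyp_wt x * g x)) \<longlonglongrightarrow> 0" by (simp_all add: sqn_def)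
      have idk: "(\<integral>x. Pk k x \<bullet> R x \<partial>lborel) = (\<integral>x. egrad (f k) x \<bullet> egrad g x \<partial>lborel) + M0 * (\<integral>x. (hyp_wt x * f k x) \<bullet> (hyp_wt x * g x) \<partial>lborel)" for k
      proof -
        have "(\<lambda>x. conf x powr a * f k x) = \<phi> k" "(\<lambda>x. conf x powr a * g x) = \<psi>"
          using inv[OF \<phi>C[of k]] inv[OF \<psi>] by (auto simp: f_def g_def)
        then show ?thesis using conformal_identity[OF fC[of k] gC] unfolding a_def[symmetric] M0_def[symmetric]
          by (simp add: Pk_def R_def)
      qed
      have l1: "(\<lambda>k. \<integral>x. Pk (k + k0) x \<bullet> R x \<partial>lborel) \<longlonglongrightarrow> (\<integral>x. P x \<bullet> R x \<partial>lborel)"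
        by (rule tendsto_integral_inner[OF cP(1) Rs Pks Rs cP(2) zero(1)])
      have l2: "(\<lambda>k. \<integral>x. egrad (f (k + k0)) x \<bullet> egrad g x \<partial>lborel) \<longlonglongrightarrow> (\<integral>x. F x \<bullet> egrad g x \<partial>lborel)"
        by (rule tendsto_integral_inner[OF cF(1) C1c_sqint_egrad[OF gC] C1c_sqint_egrad[OF fC] C1c_sqint_egrad[OF gC] cF(2) zero(2)])
      have "(\<lambda>k. sqn (\<lambda>x. hyp_wt x * f (k + k0) x - hyp_wt x * v x)) \<longlonglongrightarrow> 0"
      proof (rule tendsto_sandwich[of "\<lambda>k. 0"])
        show "eventually (\<lambda>k. sqn (\<lambda>x. hyp_wt x * f (k + k0) x - hyp_wt x * v x) \<le> 4 * sqn (\<lambda>x. egrad (f (k + k0)) x - F x)) sequentially"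
          unfolding right_diff_distrib[symmetric]
          by (intro always_eventually allI H10_Hardy(2)[OF H10_diff[OF H10_C1c[OF fC] vF] N2])
        show "(\<lambda>k. 4 * sqn (\<lambda>x. egrad (f (k + k0)) x - F x)) \<longlonglongrightarrow> 0"
          using tendsto_mult[OF tendsto_const cF(2), of 4] by simp
      qed auto
      then have l3: "(\<lambda>k. \<integral>x. (hyp_wt x * f (k + k0) x) \<bullet> (hyp_wt x * g x) \<partial>lborel) \<longlonglongrightarrow> (\<integral>x. (hyp_wt x * v x) \<bullet> (hyp_wt x * g x) \<partial>lborel)"
        by (rule tendsto_integral_inner[OF wts(3,2,1,2) _ zero(3)])
      have "(\<lambda>k. \<integral>x. Pk (k + k0) x \<bullet> R x \<partial>lborel) \<longlonglongrightarrow> (\<integral>x. F x \<bullet> egrad g x \<partial>lborel) + M0 * (\<integral>x. (hyp_wt x * v x) \<bullet> (hyp_wt x * g x) \<partial>lborel)"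
        unfolding idk by (intro tendsto_add tendsto_mult tendsto_const l2 l3)
      from LIMSEQ_unique[OF l1 this] show ?thesis by simp
    qed
    have H1: "(\<integral>x. (conf x)\<^sup>2 * (G x \<bullet> egrad \<psi> x) \<partial>hyp_vol) = (\<integral>x. P x \<bullet> R x \<partial>lborel)"
    proof -
      have "(\<lambda>x. (conf x)\<^sup>2 * (G x \<bullet> egrad \<psi> x)) \<in> borel_measurable lebesgue"
      proof -
        have m1: "(\<lambda>x. (conf x)\<^sup>2) \<in> borel_measurable (lebesgue :: 'a measure)" "egrad \<psi> \<in> borel_measurable lebesgue"
          by (intro measurable_completion; simp; measurable)+
        show ?thesis by (intro borel_measurable_times borel_measurable_inner m1 Gm)
      qed
      then have "(\<integral>x. (conf x)\<^sup>2 * (G x \<bullet> egrad \<psi> x) \<partial>hyp_vol)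
          = (\<integral>x. indicator (ball 0 1) x * (conf x powr (- real DIM('a)) * ((conf x)\<^sup>2 * (G' x \<bullet> egrad \<psi> x))) \<partial>lborel)"
        by (rule hyp_vol_integral) (measurable, use GG in \<open>eventually_elim, simp\<close>)
      also have "\<dots> = (\<integral>x. P x \<bullet> R x \<partial>lborel)"
      proof (rule Bochner_Integration.integral_cong)
        fix x :: 'a
        show "indicator (ball 0 1) x * (conf x powr (- real DIM('a)) * ((conf x)\<^sup>2 * (G' x \<bullet> egrad \<psi> x))) = P x \<bullet> R x"
          using cpow(1)[of x] by (cases "x \<in> ball 0 1") (auto simp: P_def R_def mult.assoc[symmetric] power2_eq_square)
      qed simp
      finally show ?thesis .
    qed
    have H2: "(\<integral>x. u x * \<psi> x \<partial>hyp_vol) = (\<integral>x. (hyp_wt x * v x) * (hyp_wt x * g x) \<partial>lborel)"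
    proof -
      have "(\<lambda>x. u x * \<psi> x) \<in> borel_measurable lebesgue"
      proof -
        have m1: "\<psi> \<in> borel_measurable lebesgue" by (intro measurable_completion) simp
        show ?thesis by (intro borel_measurable_times m1 um)
      qed
      then have "(\<integral>x. u x * \<psi> x \<partial>hyp_vol) = (\<integral>x. indicator (ball 0 1) x * (conf x powr (- real DIM('a)) * (u' x * \<psi> x)) \<partial>lborel)"
        by (rule hyp_vol_integral) (measurable, use uu in \<open>eventually_elim, simp\<close>)
      also have "\<dots> = (\<integral>x. (hyp_wt x * v x) * (hyp_wt x * g x) \<partial>lborel)"
      proof (rule Bochner_Integration.integral_cong)
        fix x :: 'a
        show "indicator (ball 0 1) x * (conf x powr (- real DIM('a)) * (u' x * \<psi> x)) = (hyp_wt x * v x) * (hyp_wt x * g x)"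
        proof (cases "x \<in> ball 0 1")
          case True
          then have w: "hyp_wt x = 1 / conf x" by (simp add: hyp_wt_def)
          show ?thesis unfolding cpow(2)[OF True] w using True by (simp add: v_def g_def power2_eq_square)
        qed (simp add: v_def)
      qed simp
      finally show ?thesis .
    qed
    have H3: "(\<integral>x. \<bar>u x\<bar> powr (p - 2) * u x * \<psi> x \<partial>hyp_vol) = (\<integral>x. crit_nl p (v x) * g x \<partial>lborel)"
    proof -
      have "(\<lambda>x. \<bar>u x\<bar> powr (p - 2) * u x * \<psi> x) \<in> borel_measurable lebesgue"
      proof -
        have m1: "\<psi> \<in> borel_measurable lebesgue" by (intro measurable_completion) simp
        show ?thesis using um m1 by measurable
      qed
      then have "(\<integral>x. \<bar>u x\<bar> powr (p - 2) * u x * \<psi> x \<partial>hyp_vol)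
          = (\<integral>x. indicator (ball 0 1) x * (conf x powr (- real DIM('a)) * (\<bar>u' x\<bar> powr (p - 2) * u' x * \<psi> x)) \<partial>lborel)"
        by (rule hyp_vol_integral) (measurable, use uu in \<open>eventually_elim, simp\<close>)
      also have "\<dots> = (\<integral>x. crit_nl p (v x) * g x \<partial>lborel)"
      proof (rule Bochner_Integration.integral_cong)
        fix x :: 'a
        show "indicator (ball 0 1) x * (conf x powr (- real DIM('a)) * (\<bar>u' x\<bar> powr (p - 2) * u' x * \<psi> x)) = crit_nl p (v x) * g x"
        proof (cases "x \<in> ball 0 1")
          case True
          have c: "conf x > 0" by (rule conf_pos[OF True])
          \<comment> \<open>Since a (p - 2) = 2, this power supplies the factor conf^(-2); the other
            factors conf^(-a) go to v and to the test function, so the nonlinear term carries no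
            weight.\<close>
          have "\<bar>v x\<bar> powr (p - 2) = conf x powr (- a * (p - 2)) * \<bar>u' x\<bar> powr (p - 2)"
            using True by (simp add: v_def abs_mult powr_mult powr_powr)
          also have "- a * (p - 2) = - 2" using ap by simp
          also have "conf x powr (- 2) = (1 / conf x)\<^sup>2" using c by (simp add: powr_minus_divide powr_numeral power_divide)
          finally have e: "\<bar>v x\<bar> powr (p - 2) = (1 / conf x)\<^sup>2 * \<bar>u' x\<bar> powr (p - 2)" .
          show ?thesis unfolding cpow(2)[OF True] crit_nl_def e using True by (simp add: v_def g_def power2_eq_square mult_ac)
        qed (simp add: v_def crit_nl_def)
      qed simp
      finally show ?thesis .
    qed
    have "(\<integral>x. F x \<bullet> egrad g x \<partial>lborel) + (M0 - lam) * (\<integral>x. (hyp_wt x * v x) * (hyp_wt x * g x) \<partial>lborel)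
       = (\<integral>x. crit_nl p (v x) * g x \<partial>lborel)"
      using weak[OF t] unfolding H1 H2 H3 T1 by (simp add: left_diff_distrib)
    then show ?thesis unfolding g_def .
  qed
  have "conf_sol (M0 - lam) v F"
    by (rule conf_solI[OF N vF outv outF test[unfolded p_def]])
  moreover have "AE x in lborel. x \<in> ball 0 1 \<longrightarrow> v x = 0 \<longrightarrow> u x = 0"
    using uu
  proof eventually_elim
    case (elim x)
    then show ?case using conf_pos[of x] by (auto simp: v_def)
  qed
  ultimately show ?thesis unfolding M0_def by (rule that)
qed

theorem theorem1p1:
  fixes lam :: real and u :: "'a::euclidean_space \<Rightarrow> real" and G :: "'a \<Rightarrow> 'a"
  assumes "DIM('a) \<ge> 3"
    and "lam \<le> real (DIM('a)) * (real (DIM('a)) - 2) / 4"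
    and "weak_solution lam u G"
  shows "AE x in hyp_vol. u x = 0"
proof -
  obtain v F where vF: "conf_sol (real DIM('a) * (real DIM('a) - 2) / 4 - lam) v F"
    and vu: "AE x in lborel. x \<in> ball 0 1 \<longrightarrow> v x = 0 \<longrightarrow> u x = 0"
    by (rule weak_solution_conf_sol[OF assms(1,3)])
  have "AE x in lborel. v x = 0"
  proof (cases "lam = real DIM('a) * (real DIM('a) - 2) / 4")
    case True
    then have "real DIM('a) * (real DIM('a) - 2) / 4 - lam = 0" by simp
    with vF have "conf_sol 0 v F" by metis
    then show ?thesis by (rule conf_sol_zero_mass[OF assms(1)])
  next
    case False
    then show ?thesis using assms(2) by (intro conf_sol_positive_mass[OF assms(1) vF]) simp
  qed
  with vu have "AE x in lborel. x \<in> ball 0 1 \<longrightarrow> u x = 0" by eventually_elim simp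
  then show ?thesis by (rule AE_hyp_vol)
qed

end
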